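(* Let $\Sigma$ be a closed orientable surface of genus at least $2$. There is a left order on $\pi_1(\Sigma)$ whose orbit under the natural conjugation action of $\pi_1(\Sigma)$ is dense in $\mathcal{LO}(\pi_1(\Sigma))$.
   Context: A left order on a group $G$ is a total order $\preceq$ on $G$ such that $f\preceq h$ implies $gf\preceq gh$ for all $f,g,h\in G$. $\mathcal{LO}(G)$ is the set of all left orders on $G$, with the topology in which a local base at $\preceq$ is given by the sets $V_{g_1,\dots,g_k}=\{\preceq'\in\mathcal{LO}(G)\mid \mathrm{id}\prec' g_i \text{ for } i=1,\dots,k\}$, where $\{g_1,\dots,g_k\}$ runs over finite subsets of $\preceq$-positive elements of $G$ (elements $g$ with $\mathrm{id}\prec g$). The group $G$ acts on $\mathcal{LO}(G)$ by conjugation: $g\in G$ sends $\prec$ to the left order $\prec_g$ defined by $h\prec_g k \Leftrightarrow ghg^{-1}\prec gkg^{-1}$. The orbit of $\prec$ is $\{\prec_g : g\in G\}$. *)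

theory Defs
  imports "HOL-Analysis.Analysis" "HOL-Algebra.Group"
begin

definition loops_at :: "'a topology \<Rightarrow> 'a \<Rightarrow> (real \<Rightarrow> 'a) set" where
  "loops_at X p = {f. pathin X f \<and> f 0 = p \<and> f 1 = p}"

(* Homotopy of loops relative to the endpoints.  For spaces coming from the type class,
   the library's homotopic_paths is the same instance of homotopic_with. *)
definition loop_homotopic :: "'a topology \<Rightarrow> 'a \<Rightarrow> (real \<Rightarrow> 'a) \<Rightarrow> (real \<Rightarrow> 'a) \<Rightarrow> bool" where
  "loop_homotopic X p = homotopic_with (\<lambda>r. r 0 = p \<and> r 1 = p) (top_of_set {0..1}) X"

(* Same formula as the library's +++, which is restricted to the class topological_space. *)
definition loop_join :: "(real \<Rightarrow> 'a) \<Rightarrow> (real \<Rightarrow> 'a) \<Rightarrow> real \<Rightarrow> 'a" where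
  "loop_join f g = (\<lambda>x. if x \<le> 1/2 then f (2 * x) else g (2 * x - 1))"

definition loop_class :: "'a topology \<Rightarrow> 'a \<Rightarrow> (real \<Rightarrow> 'a) \<Rightarrow> (real \<Rightarrow> 'a) set" where
  "loop_class X p f = {g. loop_homotopic X p f g}"

(* All joins of representatives are homotopic, so the union in the multiplication
   is the single class [f][g] = [f * g]. *)
definition fundamental_group :: "'a topology \<Rightarrow> 'a \<Rightarrow> (real \<Rightarrow> 'a) set monoid" where
  "fundamental_group X p =
     \<lparr> carrier = loop_class X p ` loops_at X p,
       mult = (\<lambda>A B. \<Union>f\<in>A. \<Union>g\<in>B. loop_class X p (loop_join f g)),
       one = loop_class X p (\<lambda>_. p) \<rparr>"

(* The boundary circle of the closed unit disc is cut into 4n arcs, regarded as the sides of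
   a 4n-gon; polygon_side n k t is the point with parameter t (0 \<le> t \<le> 1) on the k-th side,
   traversed counterclockwise. *)
definition polygon_side :: "nat \<Rightarrow> nat \<Rightarrow> real \<Rightarrow> complex" where
  "polygon_side n k t = cis (2 * pi * (real k + t) / (4 * real n))"

(* Side pairing according to the word a_1 b_1 a_1^-1 b_1^-1 ... a_n b_n a_n^-1 b_n^-1:
   sides 4j and 4j+2 carry a_(j+1), sides 4j+1 and 4j+3 carry b_(j+1), and the two sides
   of a pair are identified with opposite orientations. *)
definition side_pairing :: "nat \<Rightarrow> complex \<Rightarrow> complex \<Rightarrow> bool" where
  "side_pairing n x y \<longleftrightarrow>
     (\<exists>k t. k < 4 * n \<and> k mod 4 < 2 \<and> 0 \<le> t \<and> t \<le> 1 \<and>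
        x = polygon_side n k t \<and> y = polygon_side n (k + 2) (1 - t))"

(* X is a closed orientable surface of genus n \<ge> 1: it is homeomorphic to the space obtained
   from the 4n-gon by the above side pairing (the connected sum of n tori).  Being
   homeomorphic to that quotient is expressed by a quotient map from the disc onto X whose
   fibres are exactly the classes of the equivalence relation generated by the pairing. *)
definition closed_orientable_surface :: "nat \<Rightarrow> 'a topology \<Rightarrow> bool" where
  "closed_orientable_surface n X \<longleftrightarrow> n \<ge> 1 \<and>
     (\<exists>q. quotient_map (top_of_set (cball (0::complex) 1)) X q \<and>
        (\<forall>x\<in>cball 0 1. \<forall>y\<in>cball 0 1. q x = q y \<longleftrightarrow> equivclp (side_pairing n) x y))"

definition left_orders :: "('a, 'b) monoid_scheme \<Rightarrow> 'a rel set" where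
  "left_orders G =
     {r. linear_order_on (carrier G) r \<and>
         (\<forall>f\<in>carrier G. \<forall>h\<in>carrier G. \<forall>g\<in>carrier G.
            (f, h) \<in> r \<longrightarrow> (g \<otimes>\<^bsub>G\<^esub> f, g \<otimes>\<^bsub>G\<^esub> h) \<in> r)}"

definition positive_elements :: "('a, 'b) monoid_scheme \<Rightarrow> 'a rel \<Rightarrow> 'a set" where
  "positive_elements G r = {g \<in> carrier G. (\<one>\<^bsub>G\<^esub>, g) \<in> r \<and> g \<noteq> \<one>\<^bsub>G\<^esub>}"

definition basic_nbhd :: "('a, 'b) monoid_scheme \<Rightarrow> 'a set \<Rightarrow> 'a rel set" where
  "basic_nbhd G F = {r \<in> left_orders G. F \<subseteq> positive_elements G r}"

definition left_order_topology :: "('a, 'b) monoid_scheme \<Rightarrow> 'a rel topology" where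
  "left_order_topology G =
     topology (\<lambda>U. U \<subseteq> left_orders G \<and>
       (\<forall>r\<in>U. \<exists>F. finite F \<and> F \<subseteq> positive_elements G r \<and> basic_nbhd G F \<subseteq> U))"

lemma openin_left_order_topology:
  "openin (left_order_topology G) U \<longleftrightarrow> U \<subseteq> left_orders G \<and>
     (\<forall>r\<in>U. \<exists>F. finite F \<and> F \<subseteq> positive_elements G r \<and> basic_nbhd G F \<subseteq> U)"
proof -
  define P where "P U \<longleftrightarrow> U \<subseteq> left_orders G \<and>
    (\<forall>r\<in>U. \<exists>F. finite F \<and> F \<subseteq> positive_elements G r \<and> basic_nbhd G F \<subseteq> U)" for U
  have "P (S \<inter> T)" if S: "P S" and T: "P T" for S T
    unfolding P_def
  proof (intro conjI ballI)
    show "S \<inter> T \<subseteq> left_orders G" using S by (auto simp: P_def)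
    fix r assume r: "r \<in> S \<inter> T"
    obtain F where F: "finite F" "F \<subseteq> positive_elements G r" "basic_nbhd G F \<subseteq> S"
      using S r unfolding P_def by blast
    obtain F' where F': "finite F'" "F' \<subseteq> positive_elements G r" "basic_nbhd G F' \<subseteq> T"
      using T r unfolding P_def by blast
    have "basic_nbhd G (F \<union> F') \<subseteq> S \<inter> T"
      using F F' unfolding basic_nbhd_def by blast
    then show "\<exists>F. finite F \<and> F \<subseteq> positive_elements G r \<and> basic_nbhd G F \<subseteq> S \<inter> T"
      using F F' by (intro exI[of _ "F \<union> F'"]) auto
  qed
  moreover have "P (\<Union>K)" if "\<forall>S\<in>K. P S" for K
    unfolding P_def
  proof (intro conjI ballI)
    show "\<Union>K \<subseteq> left_orders G" using that by (intro Union_least) (simp add: P_def)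
    fix r assume "r \<in> \<Union>K"
    then obtain S where S: "S \<in> K" "r \<in> S" by blast
    then have "P S" using that by blast
    then obtain F where F: "finite F" "F \<subseteq> positive_elements G r" "basic_nbhd G F \<subseteq> S"
      using S(2) unfolding P_def by blast
    have "basic_nbhd G F \<subseteq> \<Union>K" using F(3) S(1) by (meson Union_upper subset_trans)
    then show "\<exists>F. finite F \<and> F \<subseteq> positive_elements G r \<and> basic_nbhd G F \<subseteq> \<Union>K"
      using F by (intro exI[of _ F] conjI)
  qed
  ultimately have "istopology P" by (simp add: istopology_def)
  moreover have "left_order_topology G = topology P"
    unfolding left_order_topology_def P_def ..
  ultimately show ?thesis by (simp add: topology_inverse' P_def)
qed

lemma topspace_left_order_topology: "topspace (left_order_topology G) = left_orders G"
proof -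
  have "openin (left_order_topology G) (left_orders G)"
    unfolding openin_left_order_topology
  proof (intro conjI ballI exI[of _ "{}"])
    show "basic_nbhd G {} \<subseteq> left_orders G" by (auto simp: basic_nbhd_def)
  qed auto
  then have "left_orders G \<subseteq> topspace (left_order_topology G)"
    by (rule openin_subset)
  moreover have "topspace (left_order_topology G) \<subseteq> left_orders G"
    using openin_topspace[of "left_order_topology G"]
    unfolding openin_left_order_topology by (rule conjunct1)
  ultimately show ?thesis by (rule subset_antisym[rotated])
qed

lemma openin_basic_nbhd:
  assumes "finite F"
  shows "openin (left_order_topology G) (basic_nbhd G F)"
  unfolding openin_left_order_topology
proof (intro conjI ballI exI[of _ F])
  fix r assume "r \<in> basic_nbhd G F"
  then show "F \<subseteq> positive_elements G r" by (simp add: basic_nbhd_def)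
qed (use assms in \<open>simp_all add: basic_nbhd_def\<close>)

(* The conjugate of a left order, for the reflexive relation; since conjugation is injective,
   its strict part is the conjugate of the strict part of r. *)
definition conj_order :: "('a, 'b) monoid_scheme \<Rightarrow> 'a rel \<Rightarrow> 'a \<Rightarrow> 'a rel" where
  "conj_order G r g =
     {(h, k). h \<in> carrier G \<and> k \<in> carrier G \<and>
        (g \<otimes>\<^bsub>G\<^esub> h \<otimes>\<^bsub>G\<^esub> inv\<^bsub>G\<^esub> g, g \<otimes>\<^bsub>G\<^esub> k \<otimes>\<^bsub>G\<^esub> inv\<^bsub>G\<^esub> g) \<in> r}"

definition conj_orbit :: "('a, 'b) monoid_scheme \<Rightarrow> 'a rel \<Rightarrow> 'a rel set" where
  "conj_orbit G r = conj_order G r ` carrier G"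

end

theory Submission
  imports Defs "HOL-Algebra.Generated_Groups"
begin

text \<open>
  Write \<open>G\<close> for the fundamental group, with generators \<open>A\<^sub>j, B\<^sub>j\<close> (\<open>j \<le> m\<close>, where \<open>m \<ge> 1\<close> because the
  genus is at least 2) and the single relation that the product of the commutators \<open>[A\<^sub>j, B\<^sub>j]\<close> is
  trivial.  \<open>G\<close> is countable, so a left order with dense orbit can be built from finite
  approximations as soon as the conjugation action is topologically transitive: given two
  nonempty basic open sets of left orders, some left order in the first has a conjugate in the
  second.  The union of suitably chosen finite sets of elements, each positive in some left order,
  is the positive cone of the required order.

  Transitivity is a statement about actions on the rational line.  A left order of a countable
  group comes from a free action by order automorphisms of the rationals, an element being positive
  iff it moves a base point up; conversely any action and any point define such signs, and moving
  the base point within its orbit conjugates the order.  Membership in a basic open set depends on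
  finitely many signs, hence on the action near a finite set of points.  So take the actions
  for the two given orders, keep the first one to the left of some point \<open>K\<close>, keep the second
  one to the right of some point, and put the first to the left of the second.  It must then be
  possible to get from the base point of the first to that of the second.

  The essential step is to modify an action beyond \<open>K\<close> (\<open>cut_right\<close>).  All handles but the last are
  changed so that they become trivial far to the right.  The product of their commutators is a new
  automorphism \<open>W\<close>, equal to the old one where this matters.  The last handle has to solve
  \<open>[a, b] = W\<^sup>-\<^sup>1\<close>, with \<open>a\<close> and \<open>b\<close> prescribed to the left of \<open>K\<close>.  Read this as a conjugacy: \<open>a\<close>
  conjugates \<open>b\<close> to \<open>W\<^sup>-\<^sup>1 b\<close>.  If \<open>b\<close> is continued so steeply that both \<open>b\<close> and \<open>W\<^sup>-\<^sup>1 b\<close> push every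
  point off to infinity, then \<open>a\<close> is determined and exists (\<open>conjugacy_extension\<close>); other positions
  of \<open>a K\<close> and \<open>b K\<close> are dealt with by exchanging the roles of \<open>a\<close>, \<open>b\<close> and their inverses.  As a bonus
  the point \<open>K\<close> can now be moved arbitrarily far to the right.  After cutting both actions and placing them side by
  side, handle 0 acts trivially on an interval between them, and \<open>A\<^sub>0\<close> may be composed with any
  automorphism supported there without disturbing the relation.  One that carries a point of the first orbit
  to a point of the second completes the argument; this is where genus at least 2 is used.

  Two things are needed about \<open>G\<close> itself.  It has a left order at all: the kernel of the map that
  counts \<open>A\<^sub>m\<close> is generated by \<open>B\<^sub>m\<close> and the conjugates of the other generators by powers of \<open>A\<^sub>m\<close>,
  and letting \<open>A\<^sub>m\<close> act as a translation by 1 one can prescribe the action of all these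
  elements on the unit interval freely, so that every nontrivial element acts nontrivially
  somewhere (\<open>residual\<close>); a countable group with this property is left-orderable.

  And \<open>G\<close> has the presentation used above, of which two halves are needed: the side elements of the
  polygon generate, and automorphisms satisfying the relation define an action.  The surface is
  covered by the images of the open polygon, of a neighbourhood of its vertices, and of a neighbourhood of each pair of sides.
  Each of these contracts, within the surface, to a single point; a loop cut into short pieces is
  therefore a product of passages between points of the polygon that are identified, which are
  products of the generators.  For the other half, locally constant labels on the patches of this
  cover define a flat connection with values in a given group, and its holonomy is the homomorphism
  sought.
\<close>

section \<open>Paths and the fundamental group of a topology\<close>

abbreviation unit_square :: "(real \<times> real) set" where
  "unit_square \<equiv> {0..1} \<times> {0..1}"

definition path_between :: "'a topology \<Rightarrow> 'a \<Rightarrow> 'a \<Rightarrow> (real \<Rightarrow> 'a) \<Rightarrow> bool" where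
  "path_between X a b f \<longleftrightarrow> pathin X f \<and> f 0 = a \<and> f 1 = b"

definition path_homotopic :: "'a topology \<Rightarrow> 'a \<Rightarrow> 'a \<Rightarrow> (real \<Rightarrow> 'a) \<Rightarrow> (real \<Rightarrow> 'a) \<Rightarrow> bool" where
  "path_homotopic X a b = homotopic_with (\<lambda>r. r 0 = a \<and> r 1 = b) (top_of_set {0..1}) X"

definition path_rev :: "(real \<Rightarrow> 'a) \<Rightarrow> real \<Rightarrow> 'a" where
  "path_rev f = (\<lambda>t. f (1 - t))"

lemma loops_at_eq: "loops_at X p = {f. path_between X p p f}"
  by (simp add: loops_at_def path_between_def)

lemma loop_homotopic_eq: "loop_homotopic X p = path_homotopic X p p"
  by (simp add: loop_homotopic_def path_homotopic_def)

lemma continuous_map_compose_on: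
  assumes "continuous_map (top_of_set S) X F" "continuous_on T g" "g ` T \<subseteq> S"
  shows "continuous_map (top_of_set T) X (\<lambda>x. F (g x))"
proof -
  have "continuous_map (top_of_set T) (top_of_set S) g"
    using assms by (auto simp: continuous_map_in_subtopology)
  from continuous_map_compose[OF this assms(1)] show ?thesis by (simp add: o_def)
qed

lemma path_homotopicI:
  assumes h: "continuous_map (top_of_set unit_square) X h"
    and "\<And>t. t \<in> {0..1} \<Longrightarrow> h (0, t) = f t" "\<And>t. t \<in> {0..1} \<Longrightarrow> h (1, t) = g t"
    and "\<And>s. s \<in> {0..1} \<Longrightarrow> h (s, 0) = a" "\<And>s. s \<in> {0..1} \<Longrightarrow> h (s, 1) = b"
  shows "path_homotopic X a b f g"
proof -
  define k where "k = (\<lambda>(s, t). if t \<in> {0..1} then h (s, t) else if s = (0::real) then f t else g t)"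
  have "continuous_map (prod_topology (top_of_set {0..1}) (top_of_set {0..1})) X k"
    unfolding prod_topology_subtopology_eu euclidean_product_topology[symmetric]
    by (rule continuous_map_eq[OF h]) (auto simp: k_def)
  moreover have "k (0, t) = f t" "k (1, t) = g t" for t
    using assms by (auto simp: k_def)
  moreover have "k (s, 0) = a \<and> k (s, 1) = b" if "s \<in> {0..1}" for s
    using assms that by (auto simp: k_def)
  ultimately show ?thesis
    unfolding path_homotopic_def homotopic_with_def by blast
qed

lemma path_homotopicE:
  assumes "path_homotopic X a b f g"
  obtains h :: "real \<times> real \<Rightarrow> 'a" where "continuous_map (top_of_set unit_square) X h"
    "\<And>t. h (0, t) = f t" "\<And>t. h (1, t) = g t"
    "\<And>s. s \<in> {0..1} \<Longrightarrow> h (s, 0) = a" "\<And>s. s \<in> {0..1} \<Longrightarrow> h (s, 1) = b"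
proof -
  obtain h :: "real \<times> real \<Rightarrow> 'a" where h: "continuous_map (prod_topology (top_of_set {0..1}) (top_of_set {0..1})) X h"
    "\<forall>t. h (0, t) = f t" "\<forall>t. h (1, t) = g t" "\<forall>s\<in>{0..1}. h (s, 0) = a \<and> h (s, 1) = b"
    using assms unfolding path_homotopic_def homotopic_with_def by blast
  then show ?thesis using that[of h] by simp
qed

lemma path_homotopic_refl: "path_homotopic X a b f f \<longleftrightarrow> path_between X a b f"
  by (auto simp: path_homotopic_def path_between_def pathin_def)

lemma path_homotopic_sym: "path_homotopic X a b f g \<Longrightarrow> path_homotopic X a b g f"
  by (simp add: path_homotopic_def homotopic_with_sym)

lemma path_homotopic_trans [trans]:
  "path_homotopic X a b f g \<Longrightarrow> path_homotopic X a b g h \<Longrightarrow> path_homotopic X a b f h"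
  unfolding path_homotopic_def by (rule homotopic_with_trans)

lemma path_homotopic_imp_path_between:
  assumes "path_homotopic X a b f g" shows "path_between X a b f" "path_between X a b g"
  using path_homotopic_trans[OF assms path_homotopic_sym[OF assms]]
    path_homotopic_trans[OF path_homotopic_sym[OF assms] assms]
  by (simp_all add: path_homotopic_refl)

text \<open>Two paths in a convex set with common endpoints are joined by the straight-line homotopy,
  and a continuous map carries that homotopy along.  All reparametrisations below, and hence the
  group laws, are instances of this.\<close>

lemma path_homotopic_convex:
  fixes S :: "'b::real_normed_vector set"
  assumes F: "continuous_map (top_of_set S) X F" and S: "convex S"
    and al: "continuous_on {0..1} \<alpha>" "\<alpha> ` {0..1} \<subseteq> S"
    and be: "continuous_on {0..1} \<beta>" "\<beta> ` {0..1} \<subseteq> S"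
    and "\<alpha> 0 = \<beta> 0" "\<alpha> 1 = \<beta> 1"
    and "\<And>t. t \<in> {0..1} \<Longrightarrow> f t = F (\<alpha> t)" "\<And>t. t \<in> {0..1} \<Longrightarrow> g t = F (\<beta> t)"
    and "f 0 = a" "f 1 = b"
  shows "path_homotopic X a b f g"
proof -
  define h where "h = (\<lambda>x::real \<times> real. (1 - fst x) *\<^sub>R \<alpha> (snd x) + fst x *\<^sub>R \<beta> (snd x))"
  have "continuous_on unit_square (\<lambda>x. \<alpha> (snd x))" "continuous_on unit_square (\<lambda>x. \<beta> (snd x))"
    by (rule continuous_on_compose2[OF al(1)] continuous_on_compose2[OF be(1)]; auto intro!: continuous_intros)+
  then have "continuous_on unit_square h" unfolding h_def
    by (intro continuous_intros)
  moreover have "h ` unit_square \<subseteq> S"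
  proof clarify
    fix s t :: real assume "s \<in> {0..1}" "t \<in> {0..1}"
    then have "\<alpha> t \<in> S" "\<beta> t \<in> S" "0 \<le> 1 - s" "0 \<le> s" using al(2) be(2) by auto
    then show "h (s, t) \<in> S" unfolding h_def fst_conv snd_conv
      by (intro convexD[OF S]) simp_all
  qed
  ultimately have *: "continuous_map (top_of_set unit_square) X (\<lambda>x. F (h x))"
    by (intro continuous_map_compose_on[OF F])
  show ?thesis
  proof (rule path_homotopicI[OF *])
    fix s :: real assume "s \<in> {0..1}"
    have "h (s, 0) = \<alpha> 0" "h (s, 1) = \<alpha> 1"
      using assms(7,8) by (simp_all add: h_def scaleR_left_distrib[symmetric])
    then show "F (h (s, 0)) = a" "F (h (s, 1)) = b"
      using assms(9)[of 0] assms(9)[of 1] assms(11,12) by simp_all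
  next
    fix t :: real assume "t \<in> {0..1}"
    then show "F (h (0, t)) = f t" "F (h (1, t)) = g t" using assms(9,10) by (simp_all add: h_def)
  qed
qed

lemma path_between_eq:
  assumes "path_between X a b f" "\<And>t. t \<in> {0..1} \<Longrightarrow> f t = g t"
  shows "path_homotopic X a b f g"
proof -
  have "continuous_map (top_of_set {0..1}) X f" using assms by (simp add: path_between_def pathin_def)
  then show ?thesis
    by (rule path_homotopic_convex[where \<alpha> = "\<lambda>x. x" and \<beta> = "\<lambda>x. x"])
      (use assms in \<open>auto simp: path_between_def\<close>)
qed

lemma continuous_map_join:
  assumes f: "continuous_map (top_of_set (A \<times> {0..1})) X f"
    and g: "continuous_map (top_of_set (A \<times> {0..1})) X g"
    and "\<And>s. s \<in> A \<Longrightarrow> f (s, 1) = g (s, 0)"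
  shows "continuous_map (top_of_set (A \<times> {0..1::real})) X
    (\<lambda>x. if snd x \<le> 1/2 then f (fst x, 2 * snd x) else g (fst x, 2 * snd x - 1))"
proof (rule continuous_map_cases_le)
  show "continuous_map (top_of_set (A \<times> {0..1})) euclideanreal snd"
    "continuous_map (top_of_set (A \<times> {0..1})) euclideanreal (\<lambda>x. 1/2)"
    by (auto intro!: continuous_intros)
  show "continuous_map (subtopology (top_of_set (A \<times> {0..1}))
     {x \<in> topspace (top_of_set (A \<times> {0..1})). snd x \<le> 1 / 2}) X (\<lambda>x. f (fst x, 2 * snd x))"
    unfolding subtopology_subtopology
    by (rule continuous_map_compose_on[OF f]) (auto intro!: continuous_intros)
  show "continuous_map (subtopology (top_of_set (A \<times> {0..1}))
     {x \<in> topspace (top_of_set (A \<times> {0..1})). 1 / 2 \<le> snd x}) X (\<lambda>x. g (fst x, 2 * snd x - 1))"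
    unfolding subtopology_subtopology
    by (rule continuous_map_compose_on[OF g]) (auto intro!: continuous_intros)
  fix x assume "x \<in> topspace (top_of_set (A \<times> {0..1::real}))" "snd x = 1/2"
  then have "fst x \<in> A" "2 * snd x = 1" "2 * snd x - 1 = 0" by auto
  then show "f (fst x, 2 * snd x) = g (fst x, 2 * snd x - 1)" using assms(3) by metis
qed

lemma path_homotopic_join:
  assumes f: "path_homotopic X a b f f'" and g: "path_homotopic X b c g g'"
  shows "path_homotopic X a c (loop_join f g) (loop_join f' g')"
proof -
  obtain h where h: "continuous_map (top_of_set unit_square) X h"
    "\<And>t. h (0, t) = f t" "\<And>t. h (1, t) = f' t"
    "\<And>s. s \<in> {0..1} \<Longrightarrow> h (s, 0) = a" "\<And>s. s \<in> {0..1} \<Longrightarrow> h (s, 1) = b"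
    using path_homotopicE[OF f] by metis
  obtain k where k: "continuous_map (top_of_set unit_square) X k"
    "\<And>t. k (0, t) = g t" "\<And>t. k (1, t) = g' t"
    "\<And>s. s \<in> {0..1} \<Longrightarrow> k (s, 0) = b" "\<And>s. s \<in> {0..1} \<Longrightarrow> k (s, 1) = c"
    using path_homotopicE[OF g] by metis
  show ?thesis
    by (rule path_homotopicI[OF continuous_map_join[OF h(1) k(1)]])
      (use h k in \<open>auto simp: loop_join_def\<close>)
qed

lemma path_between_join:
  assumes "path_between X a b f" "path_between X b c g"
  shows "path_between X a c (loop_join f g)"
  using path_homotopic_join[of X a b f f c g g] assms by (simp add: path_homotopic_refl)

lemma path_between_rev: "path_between X a b f \<Longrightarrow> path_between X b a (path_rev f)"
  unfolding path_between_def pathin_def path_rev_def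
  by (auto intro!: continuous_map_compose_on[of "{0..1}" X f] continuous_intros)

lemma path_between_const: "a \<in> topspace X \<Longrightarrow> path_between X a a (\<lambda>_. a)"
  by (auto simp: path_between_def pathin_def)

lemma path_between_compose:
  assumes "continuous_map (top_of_set S) X F" "continuous_on {0..1} \<delta>" "\<delta> ` {0..1} \<subseteq> S"
  shows "path_between X (F (\<delta> 0)) (F (\<delta> 1)) (\<lambda>t. F (\<delta> t))"
  using continuous_map_compose_on[OF assms] by (simp add: path_between_def pathin_def)

lemma continuous_on_unit_cases:
  fixes f g :: "real \<Rightarrow> 'b::topological_space"
  assumes "continuous_on {0..1} f" "continuous_on {0..1} g" "f 1 = g 0"
  shows "continuous_on {0..1} (\<lambda>x. if x \<le> 1/2 then f (2 * x) else g (2 * x - 1))"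
  using path_join_imp[of f g] assms
  by (simp add: path_def pathstart_def pathfinish_def joinpaths_def)

lemma path_homotopic_assoc:
  assumes f: "path_between X a b f" and g: "path_between X b c g" and h: "path_between X c d h"
  shows "path_homotopic X a d (loop_join (loop_join f g) h) (loop_join f (loop_join g h))"
proof -
  define F where "F = loop_join (loop_join f g) h"
  have F: "path_between X a d F" unfolding F_def
    by (rule path_between_join[OF path_between_join[OF f g] h])
  let ?\<beta> = "\<lambda>x::real. if x \<le> 1/2 then x / 2 else max (x - 1/4) (2 * x - 1)"
  have "path_homotopic X a d F (\<lambda>t. F (?\<beta> t))"
  proof (rule path_homotopic_convex[where F = F and \<alpha> = "\<lambda>x. x" and \<beta> = ?\<beta>])
    have "continuous_on {0..1} (\<lambda>x::real. if x \<le> 1/2 then (\<lambda>y. y/4) (2 * x) else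
       (\<lambda>y. max ((y+1)/2 - 1/4) y) (2 * x - 1))"
      by (rule continuous_on_unit_cases) (auto intro!: continuous_intros)
    then show "continuous_on {0..1} ?\<beta>"
      by (rule continuous_on_eq) (auto simp: field_simps)
  qed (use F in \<open>auto simp: path_between_def pathin_def max_def\<close>)
  also have "path_homotopic X a d (\<lambda>t. F (?\<beta> t)) (loop_join f (loop_join g h))"
  proof (rule path_between_eq)
    show "path_between X a d (\<lambda>t. F (?\<beta> t))" using calculation by (rule path_homotopic_imp_path_between)
    fix t :: real assume t: "t \<in> {0..1}"
    consider "t \<le> 1/2" | "1/2 < t" "t \<le> 3/4" | "3/4 < t" by linarith
    then show "F (?\<beta> t) = loop_join f (loop_join g h) t"
    proof cases
      case 1 then show ?thesis by (simp add: F_def loop_join_def)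
    next
      case 2
      then have "max (t - 1/4) (2 * t - 1) = t - 1/4" by (simp add: max_def)
      then show ?thesis using 2 by (simp add: F_def loop_join_def algebra_simps)
    next
      case 3
      then have "max (t - 1/4) (2 * t - 1) = 2 * t - 1" by (simp add: max_def)
      then show ?thesis using 3 by (simp add: F_def loop_join_def algebra_simps)
    qed
  qed
  finally show ?thesis by (simp add: F_def)
qed

lemma path_homotopic_const_right:
  assumes f: "path_between X a b f"
  shows "path_homotopic X a b (loop_join f (\<lambda>_. b)) f"
proof (rule path_homotopic_convex[where S = "{0..1}" and F = f and \<alpha> = "\<lambda>x. min (2 * x) 1" and \<beta> = "\<lambda>x. x"])
  show "continuous_on {0..1} (\<lambda>x::real. min (2 * x) 1)" by (intro continuous_intros)
qed (use f in \<open>auto simp: path_between_def pathin_def loop_join_def min_def max_def\<close>)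

lemma path_homotopic_const_left:
  assumes f: "path_between X a b f"
  shows "path_homotopic X a b (loop_join (\<lambda>_. a) f) f"
proof (rule path_homotopic_convex[where S = "{0..1}" and F = f and \<alpha> = "\<lambda>x. max (2 * x - 1) 0" and \<beta> = "\<lambda>x. x"])
  show "continuous_on {0..1} (\<lambda>x::real. max (2 * x - 1) 0)" by (intro continuous_intros)
qed (use f in \<open>auto simp: path_between_def pathin_def loop_join_def min_def max_def\<close>)

lemma path_homotopic_join_rev:
  assumes f: "path_between X a b f"
  shows "path_homotopic X a a (loop_join f (path_rev f)) (\<lambda>_. a)"
  by (rule path_homotopic_convex[where S = "{0..1}" and F = f and \<alpha> = "\<lambda>x. 1 - \<bar>2 * x - 1\<bar>" and \<beta> = "\<lambda>x. 0"])
    (use f in \<open>auto simp: path_between_def pathin_def loop_join_def path_rev_def algebra_simps intro!: continuous_intros\<close>)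

lemma path_homotopic_rev_join:
  assumes f: "path_between X a b f"
  shows "path_homotopic X b b (loop_join (path_rev f) f) (\<lambda>_. b)"
  using path_homotopic_join_rev[OF path_between_rev[OF f]] by (simp add: path_rev_def)

lemma path_homotopic_cancel:
  assumes f: "path_between X a b f" and s: "path_between X c b s" and g: "path_between X b d g"
  shows "path_homotopic X a d (loop_join (loop_join f (path_rev s)) (loop_join s g)) (loop_join f g)"
proof -
  note s' = path_between_rev[OF s]
  have "path_homotopic X a d (loop_join (loop_join f (path_rev s)) (loop_join s g))
      (loop_join f (loop_join (path_rev s) (loop_join s g)))"
    by (intro path_homotopic_assoc[OF f s' path_between_join[OF s g]])
  also have "path_homotopic X a d (loop_join f (loop_join (path_rev s) (loop_join s g)))
     (loop_join f g)"
  proof (rule path_homotopic_join)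
    show "path_homotopic X a b f f" using f by (simp add: path_homotopic_refl)
    have "path_homotopic X b d (loop_join (path_rev s) (loop_join s g)) (loop_join (loop_join (path_rev s) s) g)"
      by (intro path_homotopic_sym[OF path_homotopic_assoc[OF s' s g]])
    also have "path_homotopic X b d (loop_join (loop_join (path_rev s) s) g) (loop_join (\<lambda>_. b) g)"
      by (rule path_homotopic_join[OF path_homotopic_rev_join[OF s]]) (simp add: path_homotopic_refl g)
    also have "path_homotopic X b d (loop_join (\<lambda>_. b) g) g"
      by (rule path_homotopic_const_left[OF g])
    finally show "path_homotopic X b d (loop_join (path_rev s) (loop_join s g)) g" .
  qed
  finally show ?thesis .
qed

lemma loop_class_eq_iff:
  assumes "f \<in> loops_at X p"
  shows "loop_class X p f = loop_class X p g \<longleftrightarrow> path_homotopic X p p f g"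
proof -
  have f: "path_homotopic X p p f f" using assms by (simp add: loops_at_eq path_homotopic_refl)
  show ?thesis
  proof
    assume "loop_class X p f = loop_class X p g"
    then have "f \<in> loop_class X p g" using f by (auto simp: loop_class_def loop_homotopic_eq)
    then show "path_homotopic X p p f g"
      by (simp add: loop_class_def loop_homotopic_eq path_homotopic_sym)
  next
    assume fg: "path_homotopic X p p f g"
    have "path_homotopic X p p f h \<longleftrightarrow> path_homotopic X p p g h" for h
      using path_homotopic_trans[OF fg] path_homotopic_trans[OF path_homotopic_sym[OF fg]] by blast
    then show "loop_class X p f = loop_class X p g"
      by (simp add: loop_class_def loop_homotopic_eq)
  qed
qed

lemma fundamental_group_mult:
  assumes "f \<in> loops_at X p" "g \<in> loops_at X p"
  shows "loop_class X p f \<otimes>\<^bsub>fundamental_group X p\<^esub> loop_class X p g = loop_class X p (loop_join f g)"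
proof -
  have "loop_class X p (loop_join f' g') = loop_class X p (loop_join f g)"
    if "f' \<in> loop_class X p f" "g' \<in> loop_class X p g" for f' g'
  proof -
    have "path_homotopic X p p f f'" "path_homotopic X p p g g'"
      using that by (auto simp: loop_class_def loop_homotopic_eq)
    then have "path_homotopic X p p (loop_join f g) (loop_join f' g')" by (rule path_homotopic_join)
    moreover have "loop_join f g \<in> loops_at X p"
      using path_between_join[of X p p f p g] assms by (simp add: loops_at_eq)
    ultimately have "loop_class X p (loop_join f g) = loop_class X p (loop_join f' g')"
      by (simp only: loop_class_eq_iff)
    then show ?thesis by (rule sym)
  qed
  then have "(\<Union>f'\<in>loop_class X p f. \<Union>g'\<in>loop_class X p g. loop_class X p (loop_join f' g'))
      = (\<Union>f'\<in>loop_class X p f. \<Union>g'\<in>loop_class X p g. loop_class X p (loop_join f g))"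
    by (intro SUP_cong refl) simp
  moreover have "f \<in> loop_class X p f" "g \<in> loop_class X p g"
    using assms by (simp_all add: loop_class_def loop_homotopic_eq path_homotopic_refl loops_at_eq)
  then have "loop_class X p f \<noteq> {}" "loop_class X p g \<noteq> {}" by (simp_all only: ex_in_conv[symmetric]) iprover+
  ultimately show ?thesis by (simp add: fundamental_group_def)
qed

lemma fundamental_group_carrier:
  "carrier (fundamental_group X p) = loop_class X p ` loops_at X p"
  by (simp add: fundamental_group_def)

lemma fundamental_group_one: "\<one>\<^bsub>fundamental_group X p\<^esub> = loop_class X p (\<lambda>_. p)"
  by (simp add: fundamental_group_def)

lemma group_fundamental_group:
  assumes "p \<in> topspace X"
  shows "group (fundamental_group X p)"
proof (rule groupI)
  let ?G = "fundamental_group X p"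
  have const: "(\<lambda>_. p) \<in> loops_at X p" using assms by (simp add: loops_at_eq path_between_const)
  then show "\<one>\<^bsub>?G\<^esub> \<in> carrier ?G" by (auto simp: fundamental_group_carrier fundamental_group_one)
  fix x y z assume "x \<in> carrier ?G" "y \<in> carrier ?G"
  then obtain f g where fg: "x = loop_class X p f" "f \<in> loops_at X p" "y = loop_class X p g" "g \<in> loops_at X p"
    by (auto simp: fundamental_group_carrier)
  have fg': "path_between X p p f" "path_between X p p g" using fg by (auto simp: loops_at_eq)
  show "x \<otimes>\<^bsub>?G\<^esub> y \<in> carrier ?G" 
    using path_between_join[OF fg'] fg
    by (simp add: fundamental_group_mult fundamental_group_carrier loops_at_eq)
  show "\<one>\<^bsub>?G\<^esub> \<otimes>\<^bsub>?G\<^esub> x = x"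
  proof -
    have "loop_join (\<lambda>_. p) f \<in> loops_at X p"
      using path_between_join[OF path_between_const[OF assms] fg'(1)] by (simp add: loops_at_eq)
    then show ?thesis using fg const path_homotopic_const_left[OF fg'(1)]
      by (simp only: fundamental_group_one fundamental_group_mult loop_class_eq_iff)
  qed
  have "loop_class X p (path_rev f) \<in> carrier ?G"
    using path_between_rev[OF fg'(1)] by (simp add: fundamental_group_carrier loops_at_eq)
  moreover have "loop_class X p (path_rev f) \<otimes>\<^bsub>?G\<^esub> x = \<one>\<^bsub>?G\<^esub>"
  proof -
    have "path_rev f \<in> loops_at X p" using path_between_rev[OF fg'(1)] by (simp add: loops_at_eq)
    moreover have "loop_join (path_rev f) f \<in> loops_at X p"
      using path_between_join[OF path_between_rev[OF fg'(1)] fg'(1)] by (simp add: loops_at_eq)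
    ultimately show ?thesis using fg path_homotopic_rev_join[OF fg'(1)]
      by (simp only: fundamental_group_one fundamental_group_mult loop_class_eq_iff)
  qed
  ultimately show "\<exists>y\<in>carrier ?G. y \<otimes>\<^bsub>?G\<^esub> x = \<one>\<^bsub>?G\<^esub>" by blast
  assume "z \<in> carrier ?G"
  then obtain h where h: "z = loop_class X p h" "path_between X p p h"
    by (auto simp: fundamental_group_carrier loops_at_eq)
  have "h \<in> loops_at X p" "loop_join f g \<in> loops_at X p" "loop_join g h \<in> loops_at X p"
    "loop_join (loop_join f g) h \<in> loops_at X p"
    using path_between_join[OF fg'] path_between_join[OF fg'(2) h(2)]
      path_between_join[OF path_between_join[OF fg'] h(2)] h(2) by (simp_all add: loops_at_eq)
  then show "x \<otimes>\<^bsub>?G\<^esub> y \<otimes>\<^bsub>?G\<^esub> z = x \<otimes>\<^bsub>?G\<^esub> (y \<otimes>\<^bsub>?G\<^esub> z)"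
    using path_homotopic_assoc[OF fg' h(2)] fg h(1)
    by (simp only: fundamental_group_mult loop_class_eq_iff)
qed

section \<open>Order automorphisms of the rationals\<close>

abbreviation finv :: "('a \<Rightarrow> 'b) \<Rightarrow> 'b \<Rightarrow> 'a" where
  "finv f \<equiv> inv_into UNIV f"

text \<open>The rationals, rather than the reals, are the line acted upon: every countable dense order
  without ends is a copy of them, which lets a countable left-ordered group act without further
  completion.\<close>

definition order_aut :: "(rat \<Rightarrow> rat) set" where
  "order_aut = {f. strict_mono f \<and> surj f}"

lemma order_aut_less [simp]: "f \<in> order_aut \<Longrightarrow> f x < f y \<longleftrightarrow> x < y"
  by (simp add: order_aut_def strict_mono_less)

lemma order_aut_le [simp]: "f \<in> order_aut \<Longrightarrow> f x \<le> f y \<longleftrightarrow> x \<le> y"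
  by (simp add: order_aut_def strict_mono_less_eq)

lemma order_aut_eq [simp]: "f \<in> order_aut \<Longrightarrow> f x = f y \<longleftrightarrow> x = y"
  by (simp add: order_aut_def strict_mono_eq)

lemma order_aut_inv_right [simp]: "f \<in> order_aut \<Longrightarrow> f (finv f x) = x"
  by (simp add: order_aut_def surj_f_inv_f)

lemma order_aut_inv_left [simp]: "f \<in> order_aut \<Longrightarrow> finv f (f x) = x"
  by (simp add: order_aut_def inv_f_f strict_mono_imp_inj_on)

lemma order_autI:
  assumes "\<And>x y. x < y \<Longrightarrow> f x < f y" "\<And>z. \<exists>x. f x = z"
  shows "f \<in> order_aut"
proof -
  have "strict_mono f" using assms(1) by (rule strict_monoI)
  moreover have "surj f" unfolding surj_def using assms(2) by (intro allI) (metis (full_types))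
  ultimately show ?thesis by (simp add: order_aut_def)
qed

lemma order_aut_inv [simp]: "f \<in> order_aut \<Longrightarrow> finv f \<in> order_aut"
proof (rule order_autI)
  assume f: "f \<in> order_aut"
  show "finv f x < finv f y" if "x < y" for x y
    using order_aut_less[OF f, of "finv f x" "finv f y"] that f by simp
  show "\<exists>x. finv f x = z" for z
    using order_aut_inv_left[OF f] by blast
qed

lemma order_aut_inv_less [simp]: "f \<in> order_aut \<Longrightarrow> finv f x < y \<longleftrightarrow> x < f y"
  using order_aut_less[of f "finv f x" y] by simp

lemma order_aut_less_inv [simp]: "f \<in> order_aut \<Longrightarrow> y < finv f x \<longleftrightarrow> f y < x"
  using order_aut_less[of f y "finv f x"] by simp

lemma order_aut_inv_le [simp]: "f \<in> order_aut \<Longrightarrow> finv f x \<le> y \<longleftrightarrow> x \<le> f y"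
  using order_aut_le[of f "finv f x" y] by simp

lemma order_aut_le_inv [simp]: "f \<in> order_aut \<Longrightarrow> y \<le> finv f x \<longleftrightarrow> f y \<le> x"
  using order_aut_le[of f y "finv f x"] by simp

lemma order_aut_inv_eq: "f \<in> order_aut \<Longrightarrow> finv f x = y \<longleftrightarrow> x = f y"
  by (metis order_aut_inv_left order_aut_inv_right)

lemma order_aut_inv_inv: "f \<in> order_aut \<Longrightarrow> finv (finv f) = f"
  by (rule ext) (simp add: order_aut_inv_eq)

lemma order_aut_id [simp]: "id \<in> order_aut" "(\<lambda>x. x) \<in> order_aut"
  by (auto intro: order_autI)

lemma order_aut_comp [simp]:
  assumes f: "f \<in> order_aut" and g: "g \<in> order_aut" shows "f \<circ> g \<in> order_aut"
proof (rule order_autI)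
  show "\<exists>x. (f \<circ> g) x = z" for z
    using f g by (intro exI[of _ "finv g (finv f z)"]) simp
qed (use f g in simp)

lemma order_aut_comp' [simp]: "f \<in> order_aut \<Longrightarrow> g \<in> order_aut \<Longrightarrow> (\<lambda>x. f (g x)) \<in> order_aut"
  using order_aut_comp[of f g] by (simp add: o_def)

lemma order_aut_affine:
  assumes "0 < k" shows "(\<lambda>x. k * x + d) \<in> order_aut"
proof (rule order_autI)
  show "\<exists>x. k * x + d = z" for z using assms by (intro exI[of _ "(z - d) / k"]) simp
qed (use assms in simp)

lemma order_aut_add [simp]: "(\<lambda>x. x + d) \<in> order_aut"
  using order_aut_affine[of 1 d] by simp

lemma order_aut_funpow: "f \<in> order_aut \<Longrightarrow> f ^^ k \<in> order_aut"
  by (induction k) simp_all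

lemma order_aut_paste:
  assumes f: "f \<in> order_aut" and g: "g \<in> order_aut" and u: "f u = g u"
  shows "(\<lambda>x. if x \<le> u then f x else g x) \<in> order_aut"
proof (rule order_autI)
  fix x y :: rat assume xy: "x < y"
  show "(if x \<le> u then f x else g x) < (if y \<le> u then f y else g y)"
  proof (cases "x \<le> u \<and> \<not> y \<le> u")
    case True
    then have "f x \<le> f u" "g u < g y" using f g by simp_all
    then show ?thesis using True u by simp
  qed (use xy f g in auto)
next
  fix z
  show "\<exists>x. (if x \<le> u then f x else g x) = z"
  proof (cases "z \<le> f u")
    case True
    then show ?thesis using f by (intro exI[of _ "finv f z"]) simp
  next
    case False
    then show ?thesis using g u by (intro exI[of _ "finv g z"]) simp
  qed
qed

lemma order_aut_max:
  assumes f: "f \<in> order_aut" and g: "g \<in> order_aut"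
  shows "(\<lambda>x. max (f x) (g x)) \<in> order_aut"
proof (rule order_autI)
  show "max (f x) (g x) < max (f y) (g y)" if "x < y" for x y
  proof -
    have "f x < f y" "g x < g y" using that f g by simp_all
    then show ?thesis by (auto simp: max_def)
  qed
  fix z
  show "\<exists>x. max (f x) (g x) = z"
  proof (cases "finv f z \<le> finv g z")
    case True
    then have "g (finv f z) \<le> z" using f g order_aut_le[OF g, of "finv f z" "finv g z"] by simp
    then show ?thesis using f by (intro exI[of _ "finv f z"]) (simp add: max_def)
  next
    case False
    then have "finv g z \<le> finv f z" by linarith
    then have "f (finv g z) \<le> z" by (simp only: order_aut_le_inv[OF f])
    then show ?thesis using g by (intro exI[of _ "finv g z"]) (simp add: max_def)
  qed
qed

text \<open>The maximum of finitely many automorphisms is an automorphism, so beyond a point a map may be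
  replaced by one that dominates any prescribed ones.\<close>

lemma steep_extension:
  assumes p: "p \<in> order_aut" and m: "m1 \<in> order_aut" "m2 \<in> order_aut" "m1 u \<le> p u" "m2 u \<le> p u"
  obtains q where "q \<in> order_aut" "\<And>x. x \<le> u \<Longrightarrow> q x = p x" "\<And>x. u \<le> x \<Longrightarrow> m1 x \<le> q x" "\<And>x. u \<le> x \<Longrightarrow> m2 x \<le> q x"
proof -
  define h where "h = (\<lambda>x. max (max (m1 x) (m2 x)) (x + (p u - u)))"
  have h: "h \<in> order_aut" unfolding h_def by (intro order_aut_max m order_aut_add)
  have hu: "p u = h u" using m by (simp add: h_def)
  define q where "q = (\<lambda>x. if x \<le> u then p x else h x)"
  have q: "q x = h x" if "u \<le> x" for x using that hu by (cases "x = u") (simp_all add: q_def)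
  have "m1 x \<le> h x" "m2 x \<le> h x" for x by (simp_all add: h_def)
  moreover have "q \<in> order_aut" unfolding q_def by (rule order_aut_paste[OF p h hu])
  moreover have "q x = p x" if "x \<le> u" for x using that by (simp add: q_def)
  ultimately show ?thesis using that[of q] q by simp
qed

lemma funpow_unbounded:
  fixes p :: "rat \<Rightarrow> rat"
  assumes "u \<le> p e" "0 < d" "\<And>y. u \<le> y \<Longrightarrow> y + d \<le> p y"
  shows "\<exists>k. z \<le> (p ^^ k) e"
proof -
  have *: "u + of_nat k * d \<le> (p ^^ Suc k) e" for k
  proof (induction k)
    case (Suc k)
    have "u \<le> u + of_nat k * d" using assms(2) by simp
    then have "(p ^^ Suc k) e + d \<le> p ((p ^^ Suc k) e)" using Suc by (intro assms(3)) linarith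
    then show ?case using Suc by (simp add: algebra_simps)
  qed (use assms in simp)
  obtain k where "(z - u) / d \<le> of_nat k" using real_arch_simple by blast
  then have "z - u \<le> of_nat k * d" using assms(2) by (simp add: pos_divide_le_eq)
  then have "z \<le> (p ^^ Suc k) e" using *[of k] by linarith
  then show ?thesis by blast
qed

lemma funpow_finv: "f \<in> order_aut \<Longrightarrow> (f ^^ k) ((finv f ^^ k) x) = x"
proof (induction k)
  case (Suc k)
  have "(f ^^ Suc k) ((finv f ^^ Suc k) x) = (f ^^ k) (f (finv f ((finv f ^^ k) x)))"
    by (simp only: funpow_Suc_right[of k f] funpow.simps(2)[of k "finv f"] o_apply)
  then show ?case using Suc by simp
qed simp

text \<open>Every point is carried below \<open>e\<close> by a power of \<open>p\<^sup>-\<^sup>1\<close>.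
  Hence the conjugating map is forced to be \<open>p'\<^sup>k f p\<^sup>-\<^sup>k\<close> for
  large \<open>k\<close>, and the value does not depend on \<open>k\<close> because
  \<open>f\<close> already conjugates \<open>p\<close> to \<open>p'\<close> below
  \<open>e\<close>.\<close>

lemma conjugacy_extension:
  assumes p: "p \<in> order_aut" and p': "p' \<in> order_aut" and f: "f \<in> order_aut"
    and e: "e < p e" and up: "\<And>z. \<exists>k. z \<le> (p ^^ k) e" and up': "\<And>z. \<exists>k. z \<le> (p' ^^ k) (f e)"
    and conj: "\<And>x. x \<le> e \<Longrightarrow> f (p x) = p' (f x)"
  obtains g where "g \<in> order_aut" "\<And>x. x \<le> p e \<Longrightarrow> g x = f x" "\<And>x. g (p x) = p' (g x)"
proof -
  have pk: "p ^^ k \<in> order_aut" "p' ^^ k \<in> order_aut" "finv p ^^ k \<in> order_aut" "finv p' ^^ k \<in> order_aut" for k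
    using p p' by (simp_all add: order_aut_funpow)
  note canc = funpow_finv[OF p] funpow_finv[OF p']
  define v where "v k x = (p' ^^ k) (f ((finv p ^^ k) x))" for k x
  have below: "(finv p ^^ k) x \<le> e \<longleftrightarrow> x \<le> (p ^^ k) e" for k x
    using order_aut_le[OF pk(1)[of k], of "(finv p ^^ k) x" e] canc(1)[of k x] by simp
  have vSuc: "v (Suc k) x = v k x \<and> x \<le> (p ^^ Suc k) e" if "x \<le> (p ^^ k) e" for k x
  proof -
    let ?y = "(finv p ^^ k) x"
    have y: "?y \<le> e" using that below by simp
    then have "finv p ?y \<le> e" using p e by simp
    then have "p' (f (finv p ?y)) = f ?y" using conj[of "finv p ?y"] p by simp
    then have "v (Suc k) x = v k x" by (simp add: v_def funpow_swap1[of p'])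
    moreover have "finv p ?y \<le> e" by fact
    then have "(finv p ^^ Suc k) x \<le> e" by simp
    then have "x \<le> (p ^^ Suc k) e" using below by blast
    ultimately show ?thesis ..
  qed
  have vmono: "v (k + i) x = v k x \<and> x \<le> (p ^^ (k + i)) e" if "x \<le> (p ^^ k) e" for k i x
    by (induction i) (use that vSuc in auto)
  define g where "g x = v (SOME k. x \<le> (p ^^ k) e) x" for x
  have g: "g x = v k x" if "x \<le> (p ^^ k) e" for k x
  proof -
    have "x \<le> (p ^^ (SOME k. x \<le> (p ^^ k) e)) e" using up by (rule someI_ex)
    then have "v ((SOME k. x \<le> (p ^^ k) e) + k) x = g x" using vmono unfolding g_def by blast
    then show ?thesis using vmono[OF that] by (simp add: add.commute)
  qed
  have vaut: "v k \<in> order_aut" for k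
  proof -
    have "v k = (p' ^^ k) \<circ> (f \<circ> (finv p ^^ k))" by (simp add: fun_eq_iff v_def)
    then show ?thesis using order_aut_comp[OF pk(2) order_aut_comp[OF f pk(3)]] by simp
  qed
  show ?thesis
  proof
    show "g \<in> order_aut"
    proof (rule order_autI)
      fix x y :: rat assume "x < y"
      obtain k where k: "y \<le> (p ^^ k) e" using up by blast
      then have "g x = v k x" "g y = v k y" using \<open>x < y\<close> by (simp_all add: g)
      then show "g x < g y" using \<open>x < y\<close> vaut by simp
    next
      fix z
      obtain k where k: "z \<le> (p' ^^ k) (f e)" using up' by blast
      let ?x = "(p ^^ k) (finv f ((finv p' ^^ k) z))"
      have "(finv p' ^^ k) z \<le> f e"
        using order_aut_le[OF pk(2)[of k], of "(finv p' ^^ k) z" "f e"] canc(2)[of k z] k by simp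
      then have "?x \<le> (p ^^ k) e" using pk f by simp
      then have "g ?x = v k ?x" by (rule g)
      moreover have "(finv p ^^ k) ?x = finv f ((finv p' ^^ k) z)"
        using order_aut_eq[OF pk(1)[of k]] canc(1)[of k ?x] by blast
      ultimately have "g ?x = z" using f canc by (simp add: v_def)
      then show "\<exists>x. g x = z" ..
    qed
    show "g x = f x" if "x \<le> p e" for x
    proof -
      have "g x = v 1 x" using that by (intro g) simp
      also have "\<dots> = p' (f (finv p x))" by (simp add: v_def)
      also have "\<dots> = f (p (finv p x))" using that p by (intro conj[symmetric]) simp
      finally show ?thesis using p by simp
    qed
    show "g (p x) = p' (g x)" for x
    proof -
      obtain k where k: "x \<le> (p ^^ k) e" using up by blast
      then have "p x \<le> (p ^^ Suc k) e" using p by simp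
      then have "g (p x) = v (Suc k) (p x)" by (rule g)
      also have "\<dots> = p' (v k x)" using p by (simp add: v_def funpow_swap1[of "finv p"])
      finally show ?thesis using g[OF k] by simp
    qed
  qed
qed

section \<open>Prolonging a commutator equation\<close>

text \<open>Being in the orbit of \<open>x\<close> under the group generated by \<open>S\<close>.\<close>

inductive reach :: "(rat \<Rightarrow> rat) set \<Rightarrow> rat \<Rightarrow> rat \<Rightarrow> bool" for S x where
  refl: "reach S x x"
| fwd: "reach S x y \<Longrightarrow> f \<in> S \<Longrightarrow> reach S x (f y)"
| bwd: "reach S x y \<Longrightarrow> f \<in> S \<Longrightarrow> reach S x (finv f y)"

lemma reach_funpow:
  assumes "reach S x e" "p \<in> S \<or> (\<exists>f\<in>S. p = finv f)"
  shows "reach S x ((p ^^ k) e)"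
  by (induction k) (use assms in \<open>auto intro: reach.intros\<close>)

text \<open>The equation \<open>A B = c B A\<close> says that \<open>c\<close> is the commutator of
  \<open>A\<close> and \<open>B\<close>. The last clause makes the base point movable
  arbitrarily far to the right; without it two actions placed side by side could not be linked.\<close>

definition commutator_extends ::
  "(rat \<Rightarrow> rat) \<Rightarrow> (rat \<Rightarrow> rat) \<Rightarrow> (rat \<Rightarrow> rat) \<Rightarrow> rat \<Rightarrow> bool" where
  "commutator_extends a b c x0 \<longleftrightarrow> (\<exists>A\<in>order_aut. \<exists>B\<in>order_aut.
     (\<forall>x\<le>x0. A x = a x \<and> B x = b x) \<and> (\<forall>x. A (B x) = c (B (A x))) \<and>
     (\<forall>z. \<exists>y\<ge>z. reach {A, B} x0 y))"

text \<open>The commutator equation is symmetric under exchanging the two maps and inverting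
  \<open>c\<close>, which halves the number of cases below.\<close>

lemma commutator_extends_swap:
  assumes "commutator_extends b a (finv c) x0" "c \<in> order_aut"
  shows "commutator_extends a b c x0"
proof -
  obtain A B where AB: "A \<in> order_aut" "B \<in> order_aut" "\<forall>x\<le>x0. B x = b x \<and> A x = a x"
    "\<forall>x. B (A x) = finv c (A (B x))" "\<forall>z. \<exists>y\<ge>z. reach {B, A} x0 y"
    using assms(1) unfolding commutator_extends_def by blast
  have "A (B x) = c (B (A x))" for x using AB(4) assms(2) by simp
  moreover have "{B, A} = {A, B}" by blast
  ultimately show ?thesis unfolding commutator_extends_def using AB
    by (intro bexI[of _ A] bexI[of _ B]) auto
qed

text \<open>Here \<open>b\<close> moves \<open>x0\<close> up. Keep it up to \<open>max x0 (a x0)\<close>, as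
  far as the relation below \<open>x0\<close> involves its values, and continue it steeply from
  there on: then \<open>B\<close> and \<open>c B\<close> both push points to infinity, and the
  equation \<open>A B A\<^sup>-\<^sup>1 = c B\<close> determines \<open>A\<close> by conjugacy
  extension.\<close>

lemma commutator_extends_push_b:
  assumes a: "a \<in> order_aut" and b: "b \<in> order_aut" and c': "c' \<in> order_aut"
    and rel: "\<And>x. x \<le> x0 \<Longrightarrow> a (b x) = c' (b (a x))"
    and neq: "a x0 \<noteq> x0" and q: "x0 < b x0" "a x0 \<le> b x0" and r: "x0 \<le> a (b x0)"
  shows "commutator_extends a b c' x0"
proof -
  define u where "u = max x0 (a x0)"
  have r': "c' (b (a x0)) = a (b x0)" using rel[of x0] by simp
  have r'p: "a x0 < a (b x0)" using a q by simp
  have u1: "u \<le> b x0" "u \<le> a (b x0)" using q r r'p by (simp_all add: u_def)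
  have u2: "u < b u \<and> u < c' (b u)"
  proof (cases "a x0 < x0")
    case True
    then have "c' (b (a x0)) < c' (b x0)" using b c' by simp
    then show ?thesis using True q r r' by (simp add: u_def max_def)
  next
    case False
    then have p: "x0 < a x0" using neq by simp
    then have "b x0 < b (a x0)" using b by simp
    then show ?thesis using p q r'p r' by (simp add: u_def max_def)
  qed
  \<comment> \<open>a definite amount by which both maps move \<open>u\<close>, to be kept from there on\<close>
  define d where "d = min (b u - u) (c' (b u) - u)"
  have d: "0 < d" "u + d \<le> b u" "u + d \<le> c' (b u)" using u2 by (auto simp: d_def)
  have m: "(\<lambda>x. x + d) \<in> order_aut" "(\<lambda>x. finv c' (x + d)) \<in> order_aut"
    using order_aut_comp'[of "finv c'" "\<lambda>x. x + d"] c' by simp_all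
  have mu: "u + d \<le> b u" "finv c' (u + d) \<le> b u" using d c' by simp_all
  obtain B where B: "B \<in> order_aut" "\<And>x. x \<le> u \<Longrightarrow> B x = b x" "\<And>x. u \<le> x \<Longrightarrow> x + d \<le> B x"
    "\<And>x. u \<le> x \<Longrightarrow> finv c' (x + d) \<le> B x"
    using steep_extension[OF b m mu] by blast
  have B4: "x + d \<le> c' (B x)" if "u \<le> x" for x using B(4)[OF that] c' by simp
  have Bx0: "B x0 = b x0" "B (a x0) = b (a x0)" by (intro B(2); simp add: u_def)+
  have up: "\<exists>k. z \<le> (B ^^ k) x0" for z
    by (rule funpow_unbounded[where u = u and d = d]) (use B d u1 Bx0 in auto)
  have up': "\<exists>k. z \<le> ((\<lambda>x. c' (B x)) ^^ k) (a x0)" for z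
    by (rule funpow_unbounded[where u = u and d = d]) (use B4 d u1 Bx0 r' in auto)
  have conj: "a (B x) = c' (B (a x))" if "x \<le> x0" for x
  proof -
    have "a x \<le> a x0" using a that by simp
    then have "B x = b x" "B (a x) = b (a x)" using that by (intro B(2); simp add: u_def)+
    then show ?thesis using rel[OF that] by simp
  qed
  have lt: "x0 < B x0" using Bx0 q by simp
  obtain A where A: "A \<in> order_aut" "\<And>x. x \<le> B x0 \<Longrightarrow> A x = a x" "\<And>x. A (B x) = c' (B (A x))"
    using conjugacy_extension[OF B(1) order_aut_comp'[OF c' B(1)] a lt up up' conj] by blast
  have "A x = a x \<and> B x = b x" if "x \<le> x0" for x
    using that lt by (auto intro!: A(2) B(2) simp: u_def)
  moreover have "\<exists>y\<ge>z. reach {A, B} x0 y" for z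
    using up[of z] reach_funpow[OF reach.refl, of B "{A, B}"] by blast
  ultimately show ?thesis
    unfolding commutator_extends_def using A(1,3) B(1) by blast
qed

text \<open>When \<open>a\<close> moves \<open>x0\<close> down, its inverse moves points up. The equation is
  \<open>B A\<^sup>-\<^sup>1 B\<^sup>-\<^sup>1 = A\<^sup>-\<^sup>1 c\<close>, so that now
  \<open>E = A\<^sup>-\<^sup>1\<close> is continued steeply and \<open>B\<close> is the
  conjugating map. The last hypothesis ensures that \<open>b (a x0)\<close>, after one step of
  \<open>A\<^sup>-\<^sup>1 c\<close>, lies where the steep part of that map has begun.\<close>

lemma commutator_extends_pull_a:
  assumes a: "a \<in> order_aut" and b: "b \<in> order_aut" and c': "c' \<in> order_aut"
    and rel: "\<And>x. x \<le> x0 \<Longrightarrow> a (b x) = c' (b (a x))"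
    and neq: "b x0 \<noteq> x0" and p: "a x0 < x0" and r: "a (b x0) < x0"
    and q: "finv c' (max (a x0) (a (b x0))) \<le> b x0"
  shows "commutator_extends a b c' x0"
proof -
  define u where "u = max (a x0) (a (b x0))"
  define al where "al = finv a"
  have al: "al \<in> order_aut" "\<And>x. al (a x) = x" "\<And>x. a (al x) = x" using a by (simp_all add: al_def)
  have r': "c' (b (a x0)) = a (b x0)" using rel[of x0] by simp
  have ux: "u < x0" using p r by (simp add: u_def)
  have "x0 = al (a x0)" using al by simp
  also have "\<dots> \<le> al u" by (subst order_aut_le[OF al(1)]) (simp add: u_def)
  finally have u1: "x0 \<le> al u" .
  have u2: "finv c' u < al u"
  proof (cases "a (b x0) \<le> a x0")
    case True
    then have "b x0 < x0" using a neq by simp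
    then show ?thesis using u1 q by (simp add: u_def)
  next
    case False
    then have u: "u = a (b x0)" by (simp add: u_def)
    then have "finv c' u = b (a x0)" using r' c' by (simp add: order_aut_inv_eq)
    also have "\<dots> < b x0" using b p by simp
    also have "\<dots> = al u" using u al by simp
    finally show ?thesis .
  qed
  define d where "d = min (al u - u) (al u - finv c' u)"
  have d: "0 < d" "u + d \<le> al u" "finv c' u + d \<le> al u" using u1 u2 ux by (auto simp: d_def)
  have m: "(\<lambda>x. x + d) \<in> order_aut" "(\<lambda>x. finv c' x + d) \<in> order_aut"
    using c' order_aut_comp'[OF order_aut_add[of d], of "finv c'"] by simp_all
  obtain E where E: "E \<in> order_aut" "\<And>x. x \<le> u \<Longrightarrow> E x = al x" "\<And>x. u \<le> x \<Longrightarrow> x + d \<le> E x"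
    "\<And>x. u \<le> x \<Longrightarrow> finv c' x + d \<le> E x"
    using steep_extension[OF al(1) m d(2,3)] by blast
  have E4: "x + d \<le> E (c' x)" if "finv c' u \<le> x" for x using E(4)[of "c' x"] that c' by simp
  have Eu: "E (a x0) = x0" "E (a (b x0)) = b x0" using E(2) al by (simp_all add: u_def)
  have up: "\<exists>k. z \<le> (E ^^ k) (a x0)" for z
    by (rule funpow_unbounded[where u = u and d = d]) (use E d ux Eu in auto)
  have up': "\<exists>k. z \<le> ((\<lambda>x. E (c' x)) ^^ k) (b (a x0))" for z
    by (rule funpow_unbounded[where u = "finv c' u" and d = d]) (use E4 d q Eu r' in \<open>auto simp: u_def\<close>)
  have conj: "b (E x) = E (c' (b x))" if "x \<le> a x0" for x
  proof -
    have x: "al x \<le> x0" using that a by (simp add: al_def)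
    then have *: "a (b (al x)) = c' (b x)" using rel[of "al x"] al by simp
    have "a (b (al x)) \<le> a (b x0)" using x a b by simp
    then have "c' (b x) \<le> u" using * by (simp add: u_def)
    then have "E (c' (b x)) = al (a (b (al x)))" using E(2) * by simp
    moreover have "E x = al x" using that E(2) by (simp add: u_def)
    ultimately show ?thesis using al by simp
  qed
  have lt: "a x0 < E (a x0)" using Eu p by simp
  obtain B where B: "B \<in> order_aut" "\<And>x. x \<le> E (a x0) \<Longrightarrow> B x = b x" "\<And>x. B (E x) = E (c' (B x))"
    using conjugacy_extension[OF E(1) order_aut_comp'[OF E(1) c'] b lt up up' conj] by blast
  define A where "A = finv E"
  have A: "A \<in> order_aut" "finv A = E" using E by (simp_all add: A_def order_aut_inv_inv)
  have Ax: "A x = a x" if "x \<le> x0" for x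
  proof -
    have "a x \<le> a x0" using that a by simp
    then have "E (a x) = x" using E(2)[of "a x"] al by (simp add: u_def)
    then show ?thesis using E(1) by (simp add: A_def order_aut_inv_eq)
  qed
  have "A (B x) = c' (B (A x))" for x
    using B(3)[of "A x"] E(1) by (simp add: A_def order_aut_inv_eq)
  moreover have "A x = a x \<and> B x = b x" if "x \<le> x0" for x
    using that Ax B(2) Eu by simp
  moreover have "reach {A, B} x0 (a x0)"
    using reach.fwd[OF reach.refl[of "{A, B}" x0], of A] Ax[of x0] by simp
  then have "reach {A, B} x0 ((E ^^ k) (a x0))" for k
    by (rule reach_funpow) (use A in auto)
  then have "\<exists>y\<ge>z. reach {A, B} x0 y" for z
    using up[of z] by blast
  ultimately show ?thesis
    unfolding commutator_extends_def using A(1) B(1) by blast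
qed

text \<open>One of the four maps \<open>a\<close>, \<open>b\<close>, \<open>a\<^sup>-\<^sup>1\<close>,
  \<open>b\<^sup>-\<^sup>1\<close> can always serve as the one that is continued steeply; which
  one depends on the signs of \<open>a x0 - x0\<close> and \<open>b x0 - x0\<close> and on the
  position of the products.\<close>

lemma commutator_extension:
  assumes a: "a \<in> order_aut" and b: "b \<in> order_aut" and c': "c' \<in> order_aut"
    and rel: "\<And>x. x \<le> x0 \<Longrightarrow> a (b x) = c' (b (a x))"
    and neq: "a x0 \<noteq> x0" "b x0 \<noteq> x0"
  shows "commutator_extends a b c' x0"
proof -
  have ci: "finv c' \<in> order_aut" using c' by simp
  have rel': "b (a x) = finv c' (a (b x))" if "x \<le> x0" for x using rel[OF that] c' by simp
  note push_b = commutator_extends_push_b[OF a b c' rel neq(1)]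
  note pull_a = commutator_extends_pull_a[OF a b c' rel neq(2)]
  note push_a = commutator_extends_swap[OF commutator_extends_push_b[OF b a ci rel' neq(2)] c']
  note pull_b = commutator_extends_swap[OF commutator_extends_pull_a[OF b a ci rel' neq(1)] c']
  have r: "c' (b (a x0)) = a (b x0)" using rel[of x0] by simp
  have ab: "a (b x0) < a x0 \<longleftrightarrow> b x0 < x0" "a x0 < a (b x0) \<longleftrightarrow> x0 < b x0"
    "b (a x0) < b x0 \<longleftrightarrow> a x0 < x0" "b x0 < b (a x0) \<longleftrightarrow> x0 < a x0" using a b by simp_all
  consider "x0 < a x0" "x0 < b x0" | "a x0 < x0" "x0 < b x0" | "x0 < a x0" "b x0 < x0"
    | "a x0 < x0" "b x0 < x0" using neq by linarith
  then show ?thesis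
  proof cases
    case 1
    then show ?thesis using push_a push_b ab by (cases "a x0 \<le> b x0") auto
  next
    case 2
    show ?thesis
    proof (cases "x0 \<le> a (b x0)")
      case True then show ?thesis using push_b 2 by auto
    next
      case False
      have "max (a x0) (a (b x0)) = c' (b (a x0))" using 2 ab r by simp
      then have "finv c' (max (a x0) (a (b x0))) = b (a x0)" using c' by simp
      then show ?thesis using pull_a False 2 ab by simp
    qed
  next
    case 3
    show ?thesis
    proof (cases "x0 \<le> b (a x0)")
      case True then show ?thesis using push_a 3 by auto
    next
      case False
      have "max (b x0) (b (a x0)) = finv c' (a (b x0))" using 3 ab rel'[of x0] by simp
      then have "finv (finv c') (max (b x0) (b (a x0))) = a (b x0)" using c' ci by simp
      then show ?thesis using pull_b False 3 ab by simp
    qed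
  next
    case 4
    have m: "max (a x0) (a (b x0)) = a x0" "max (b x0) (b (a x0)) = b x0" using 4 ab by simp_all
    have l: "a (b x0) < x0" "b (a x0) < x0" using 4 ab by linarith+
    show ?thesis
    proof (cases "a x0 \<le> c' (b x0)")
      case True
      then have "finv c' (a x0) \<le> b x0" using c' by simp
      then show ?thesis using pull_a l 4 m by simp
    next
      case False
      then have "finv (finv c') (b x0) \<le> a x0" using c' ci by (simp only: order_aut_inv_inv)
      then show ?thesis using pull_b l 4 m by simp
    qed
  qed
qed

section \<open>Cutting and linking actions of a surface group\<close>

lemma order_aut_paste_ex:
  assumes "f \<in> order_aut" "g \<in> order_aut" "f u = g u"
  obtains h where "h \<in> order_aut" "\<And>x. x \<le> u \<Longrightarrow> h x = f x" "\<And>x. u \<le> x \<Longrightarrow> h x = g x"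
proof -
  have "(if x \<le> u then f x else g x) = g x" if "u \<le> x" for x
    using that assms(3) by (cases "x = u") simp_all
  then show ?thesis using that[OF order_aut_paste[OF assms]] by simp
qed

lemma order_aut_segment:
  fixes x1 x2 y1 y2 :: rat
  assumes "x1 < x2" "y1 < y2"
  obtains h where "h \<in> order_aut" "h x1 = y1" "h x2 = y2"
proof
  let ?k = "(y2 - y1) / (x2 - x1)"
  have "0 < ?k" using assms by simp
  then show "(\<lambda>x. ?k * x + (y1 - ?k * x1)) \<in> order_aut" by (rule order_aut_affine)
  show "?k * x1 + (y1 - ?k * x1) = y1" by simp
  have "?k * (x2 - x1) = y2 - y1" using assms by simp
  then show "?k * x2 + (y1 - ?k * x1) = y2" by (simp add: right_diff_distrib)
qed

lemma extend_by_identity: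
  assumes f: "f \<in> order_aut"
  obtains g M where "g \<in> order_aut" "\<And>x. x \<le> N \<Longrightarrow> g x = f x" "\<And>x. M \<le> x \<Longrightarrow> g x = x"
proof -
  define M where "M = max N (f N) + 1"
  have M: "N < M" "f N < M" by (simp_all add: M_def)
  obtain h where h: "h \<in> order_aut" "h N = f N" "h M = M" using order_aut_segment[OF M] by blast
  obtain k where k: "k \<in> order_aut" "\<And>x. x \<le> M \<Longrightarrow> k x = h x" "\<And>x. M \<le> x \<Longrightarrow> k x = id x"
    using order_aut_paste_ex[OF h(1) order_aut_id(1), of M] h(3) by auto
  have "f N = k N" using k(2)[of N] M h by simp
  then obtain g where g: "g \<in> order_aut" "\<And>x. x \<le> N \<Longrightarrow> g x = f x" "\<And>x. N \<le> x \<Longrightarrow> g x = k x"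
    using order_aut_paste_ex[OF f k(1)] by blast
  have "g x = x" if "M \<le> x" for x using that g(3)[of x] k(3)[of x] M by simp
  then show ?thesis using that g by blast
qed

lemma order_aut_bump:
  assumes "l < s" "s < r" "l < t" "t < r"
  obtains g where "g \<in> order_aut" "g s = t" "\<And>x. x \<le> l \<Longrightarrow> g x = x" "\<And>x. r \<le> x \<Longrightarrow> g x = x"
proof -
  obtain h1 where h1: "h1 \<in> order_aut" "h1 l = l" "h1 s = t" using order_aut_segment[OF assms(1,3)] by blast
  obtain h2 where h2: "h2 \<in> order_aut" "h2 s = t" "h2 r = r" using order_aut_segment[OF assms(2,4)] by blast
  have "h1 s = h2 s" using h1 h2 by simp
  then obtain k where k: "k \<in> order_aut" "\<And>x. x \<le> s \<Longrightarrow> k x = h1 x" "\<And>x. s \<le> x \<Longrightarrow> k x = h2 x"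
    using order_aut_paste_ex[OF h1(1) h2(1)] by blast
  have "id l = k l" using k(2)[of l] assms h1 by simp
  then obtain k1 where k1: "k1 \<in> order_aut" "\<And>x. x \<le> l \<Longrightarrow> k1 x = id x" "\<And>x. l \<le> x \<Longrightarrow> k1 x = k x"
    using order_aut_paste_ex[OF order_aut_id(1) k(1)] by blast
  have "k1 r = id r" using k1(3)[of r] k(3)[of r] assms h2 by simp
  then obtain g where g: "g \<in> order_aut" "\<And>x. x \<le> r \<Longrightarrow> g x = k1 x" "\<And>x. r \<le> x \<Longrightarrow> g x = id x"
    using order_aut_paste_ex[OF k1(1) order_aut_id(1)] by blast
  show ?thesis
  proof (rule that[OF g(1)])
    show "g s = t" using g(2)[of s] k1(3)[of s] k(2)[of s] h1 assms by simp
    show "g x = x" if "x \<le> l" for x using that g(2)[of x] k1(2)[of x] assms by simp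
    show "g x = x" if "r \<le> x" for x using that g(3)[of x] by simp
  qed
qed

definition commutator :: "(rat \<Rightarrow> rat) \<Rightarrow> (rat \<Rightarrow> rat) \<Rightarrow> rat \<Rightarrow> rat" where
  "commutator a b = a \<circ> b \<circ> finv a \<circ> finv b"

fun cword :: "(nat \<Rightarrow> rat \<Rightarrow> rat) \<Rightarrow> (nat \<Rightarrow> rat \<Rightarrow> rat) \<Rightarrow> nat \<Rightarrow> rat \<Rightarrow> rat" where
  "cword a b 0 = id"
| "cword a b (Suc j) = cword a b j \<circ> commutator (a j) (b j)"

lemma commutator_aut [simp]: "a \<in> order_aut \<Longrightarrow> b \<in> order_aut \<Longrightarrow> commutator a b \<in> order_aut"
  unfolding commutator_def by (intro order_aut_comp order_aut_inv)

lemma cword_aut: "(\<And>j. j < m \<Longrightarrow> a j \<in> order_aut \<and> b j \<in> order_aut) \<Longrightarrow> cword a b m \<in> order_aut"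
  by (induction m) simp_all

lemma cword_cong:
  "(\<And>j. j < m \<Longrightarrow> commutator (a j) (b j) = commutator (a' j) (b' j)) \<Longrightarrow> cword a b m = cword a' b' m"
  by (induction m) simp_all

text \<open>The value of a word at a point depends on its letters only along the finite trajectory of the
  point, and monotonicity bounds these trajectories for all points up to \<open>K\<close> at
  once.\<close>

lemma cword_local:
  assumes "\<And>j. j < m \<Longrightarrow> a j \<in> order_aut \<and> b j \<in> order_aut"
  shows "\<exists>N. \<forall>a' b'. (\<forall>j<m. a' j \<in> order_aut \<and> b' j \<in> order_aut \<and> (\<forall>x\<le>N. a' j x = a j x \<and> b' j x = b j x))
     \<longrightarrow> (\<forall>x\<le>K. cword a' b' m x = cword a b m x)"
  using assms
proof (induction m arbitrary: K)
  case (Suc m)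
  have ab: "a m \<in> order_aut" "b m \<in> order_aut" using Suc.prems by auto
  define K1 where "K1 = finv (b m) K"
  define K2 where "K2 = finv (a m) K1"
  define K3 where "K3 = b m K2"
  have IH: "\<exists>N. \<forall>a' b'. (\<forall>j<m. a' j \<in> order_aut \<and> b' j \<in> order_aut \<and> (\<forall>x\<le>N. a' j x = a j x \<and> b' j x = b j x))
     \<longrightarrow> (\<forall>x\<le>a m K3. cword a' b' m x = cword a b m x)"
    by (rule Suc.IH) (simp add: Suc.prems)
  then obtain N where N: "\<forall>a' b'. (\<forall>j<m. a' j \<in> order_aut \<and> b' j \<in> order_aut \<and> (\<forall>x\<le>N. a' j x = a j x \<and> b' j x = b j x))
     \<longrightarrow> (\<forall>x\<le>a m K3. cword a' b' m x = cword a b m x)" by (rule exE)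
  show ?case
  proof (intro exI[of _ "Max {N, K1, K2, K3}"] allI impI)
    fix a' b' x
    assume H: "\<forall>j<Suc m. a' j \<in> order_aut \<and> b' j \<in> order_aut \<and>
      (\<forall>x\<le>Max {N, K1, K2, K3}. a' j x = a j x \<and> b' j x = b j x)" and x: "x \<le> K"
    have eq: "a' m y = a m y \<and> b' m y = b m y" if "y \<le> N \<or> y \<le> K1 \<or> y \<le> K2 \<or> y \<le> K3" for y
    proof -
      have "y \<le> Max {N, K1, K2, K3}" using that by auto
      then show ?thesis using H by blast
    qed
    have ab': "a' m \<in> order_aut" "b' m \<in> order_aut" using H by auto
    define x1 where "x1 = finv (b m) x"
    define x2 where "x2 = finv (a m) x1"
    have le: "x1 \<le> K1" unfolding x1_def K1_def using ab x by simp
    have le2: "x2 \<le> K2" unfolding x2_def K2_def using ab le by simp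
    have le3: "b m x2 \<le> K3" unfolding K3_def using ab le2 by simp
    have le4: "a m (b m x2) \<le> a m K3" using ab le3 by simp
    have "b' m x1 = x" using eq[of x1] le ab by (simp add: x1_def)
    then have e1: "finv (b' m) x = x1" using ab' by (simp add: order_aut_inv_eq)
    have "a' m x2 = x1" using eq[of x2] le2 ab by (simp add: x2_def)
    then have e2: "finv (a' m) x1 = x2" using ab' by (simp add: order_aut_inv_eq)
    have "commutator (a' m) (b' m) x = commutator (a m) (b m) x"
      using e1 e2 eq[of x2] eq[of "b m x2"] le2 le3 by (simp add: commutator_def x1_def[symmetric] x2_def[symmetric])
    moreover have "commutator (a m) (b m) x \<le> a m K3"
      using le4 by (simp add: commutator_def x1_def x2_def)
    moreover have "\<forall>j<m. a' j \<in> order_aut \<and> b' j \<in> order_aut \<and> (\<forall>x\<le>N. a' j x = a j x \<and> b' j x = b j x)"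
      using H by (simp add: le_max_iff_disj)
    moreover from this have "\<forall>x\<le>a m K3. cword a' b' m x = cword a b m x" by (rule N[THEN spec, THEN spec, THEN mp])
    ultimately show "cword a' b' (Suc m) x = cword a b (Suc m) x" by simp
  qed
qed simp

text \<open>The first \<open>m\<close> handles are continued by the identity, beyond a point chosen so far
  out that their product of commutators keeps its values up to \<open>a m (b m K)\<close>. These
  are the only values which enter the equation for the last handle below \<open>K\<close>, so
  \<open>commutator_extension\<close> applies to it.\<close>

lemma cut_right:
  assumes aut: "\<And>j. j < Suc m \<Longrightarrow> a j \<in> order_aut \<and> b j \<in> order_aut"
    and rel: "cword a b (Suc m) = id" and K: "a m K \<noteq> K" "b m K \<noteq> K"
  obtains a' b' M where "\<And>j. j < Suc m \<Longrightarrow> a' j \<in> order_aut \<and> b' j \<in> order_aut"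
    "cword a' b' (Suc m) = id" "\<And>j x. j < Suc m \<Longrightarrow> x \<le> K \<Longrightarrow> a' j x = a j x \<and> b' j x = b j x"
    "K \<le> M" "\<And>j x. j < m \<Longrightarrow> M \<le> x \<Longrightarrow> a' j x = x \<and> b' j x = x"
    "\<And>z. \<exists>y\<ge>z. reach {a' m, b' m} K y"
proof -
  have am: "a m \<in> order_aut" "b m \<in> order_aut" using aut by auto
  define W where "W = cword a b m"
  have W: "W \<in> order_aut" unfolding W_def using aut by (intro cword_aut) simp
  have "\<exists>N. \<forall>a' b'. (\<forall>j<m. a' j \<in> order_aut \<and> b' j \<in> order_aut \<and> (\<forall>x\<le>N. a' j x = a j x \<and> b' j x = b j x))
     \<longrightarrow> (\<forall>x\<le>a m (b m K). cword a' b' m x = W x)"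
    unfolding W_def by (rule cword_local) (simp add: aut)
  then obtain N0 where N0: "\<forall>a' b'. (\<forall>j<m. a' j \<in> order_aut \<and> b' j \<in> order_aut \<and> (\<forall>x\<le>N0. a' j x = a j x \<and> b' j x = b j x))
     \<longrightarrow> (\<forall>x\<le>a m (b m K). cword a' b' m x = W x)" by (rule exE)
  \<comment> \<open>beyond \<open>N\<close> the first \<open>m\<close> handles may be changed freely\<close>
  define N where "N = max N0 K"
  define P where "P f p \<longleftrightarrow> fst p \<in> order_aut \<and> (\<forall>x\<le>N. fst p x = f x) \<and> (\<forall>x\<ge>snd p. fst p x = x)"
    for f and p :: "(rat \<Rightarrow> rat) \<times> rat"
  have ex: "\<exists>p. P f p" if f: "f \<in> order_aut" for f
  proof -
    obtain g M where "g \<in> order_aut" "\<And>x. x \<le> N \<Longrightarrow> g x = f x" "\<And>x. M \<le> x \<Longrightarrow> g x = x"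
      using extend_by_identity[OF f, of N] by blast
    then have "P f (g, M)" by (simp add: P_def)
    then show ?thesis ..
  qed
  have "\<forall>j\<in>{..<m}. \<exists>p. P (a j) p" "\<forall>j\<in>{..<m}. \<exists>p. P (b j) p" using ex aut by simp_all
  then obtain pa pb where pab: "\<forall>j\<in>{..<m}. P (a j) (pa j)" "\<forall>j\<in>{..<m}. P (b j) (pb j)"
    using bchoice[of "{..<m}" "\<lambda>j. P (a j)"] bchoice[of "{..<m}" "\<lambda>j. P (b j)"] by blast
  define a1 Ma b1 Mb where "a1 j = fst (pa j)" and "Ma j = snd (pa j)" and "b1 j = fst (pb j)" and "Mb j = snd (pb j)" for j
  have a1: "a1 j \<in> order_aut \<and> (\<forall>x\<le>N. a1 j x = a j x) \<and> (\<forall>x\<ge>Ma j. a1 j x = x)" if "j < m" for j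
    using pab(1) that by (simp add: P_def a1_def Ma_def)
  have b1: "b1 j \<in> order_aut \<and> (\<forall>x\<le>N. b1 j x = b j x) \<and> (\<forall>x\<ge>Mb j. b1 j x = x)" if "j < m" for j
    using pab(2) that by (simp add: P_def b1_def Mb_def)
  define M where "M = Max (insert K (Ma ` {..<m} \<union> Mb ` {..<m}))"
  have M: "K \<le> M" "\<And>j. j < m \<Longrightarrow> Ma j \<le> M" "\<And>j. j < m \<Longrightarrow> Mb j \<le> M"
    by (auto simp: M_def intro!: Max_ge)
  define W' where "W' = cword a1 b1 m"
  have W': "W' \<in> order_aut" unfolding W'_def using a1 b1 by (intro cword_aut) simp
  have W'W: "W' x = W x" if "x \<le> a m (b m K)" for x
  proof -
    have "\<forall>j<m. a1 j \<in> order_aut \<and> b1 j \<in> order_aut \<and> (\<forall>x\<le>N0. a1 j x = a j x \<and> b1 j x = b j x)"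
      using a1 b1 by (simp add: N_def)
    then have "\<forall>x\<le>a m (b m K). cword a1 b1 m x = W x" by (rule N0[THEN spec, THEN spec, THEN mp])
    then show ?thesis using that by (simp add: W'_def)
  qed
  have rel': "W (commutator (a m) (b m) x) = x" for x
    using fun_cong[OF rel, of x] by (simp add: W_def)
  have "a m (b m x) = finv W' (b m (a m x))" if "x \<le> K" for x
  proof -
    have "a m (b m x) \<le> a m (b m K)" using that am by simp
    then have "W' (a m (b m x)) = W (a m (b m x))" by (rule W'W)
    also have "\<dots> = b m (a m x)" using rel'[of "b m (a m x)"] am by (simp add: commutator_def)
    finally show ?thesis using order_aut_inv_left[OF W', of "a m (b m x)"] by simp
  qed
  then have "commutator_extends (a m) (b m) (finv W') K"
    using W' K am by (intro commutator_extension) simp_all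
  then obtain A B where AB: "A \<in> order_aut" "B \<in> order_aut" "\<forall>x\<le>K. A x = a m x \<and> B x = b m x"
    "\<forall>x. A (B x) = finv W' (B (A x))" "\<forall>z. \<exists>y\<ge>z. reach {A, B} K y"
    unfolding commutator_extends_def by blast
  have comm: "W' (commutator A B x) = x" for x
    using AB(1,2) W' AB(4)[rule_format, of "finv A (finv B x)"] by (simp add: commutator_def)
  define a' where "a' = a1(m := A)"
  define b' where "b' = b1(m := B)"
  have ab': "a' j = a1 j" "b' j = b1 j" if "j < m" for j using that by (simp_all add: a'_def b'_def)
  have abm: "a' m = A" "b' m = B" by (simp_all add: a'_def b'_def)
  have "cword a' b' m = W'" unfolding W'_def by (rule cword_cong) (simp add: ab')
  then have "cword a' b' (Suc m) = id" using comm by (simp add: abm fun_eq_iff)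
  moreover have "a' j \<in> order_aut \<and> b' j \<in> order_aut" if "j < Suc m" for j
  proof (cases "j = m")
    case False
    then have "j < m" using that by simp
    then show ?thesis using a1[of j] b1[of j] ab'[of j] by simp
  qed (simp add: abm AB(1,2))
  moreover have "a' j x = a j x \<and> b' j x = b j x" if "j < Suc m" "x \<le> K" for j x
  proof (cases "j = m")
    case False
    then have "j < m" using that by simp
    then show ?thesis using a1[of j] b1[of j] ab'[of j] that(2) by (simp add: N_def)
  qed (use that(2) AB(3) in \<open>simp add: abm\<close>)
  moreover have "a' j x = x \<and> b' j x = x" if "j < m" "M \<le> x" for j x
    using that a1[of j] b1[of j] M(2,3)[of j] ab'[of j] by simp
  ultimately show ?thesis using that[of a' b' M] M(1) AB(5) abm by simp
qed

text \<open>Turning the line around exchanges the two ends, so that statements about the right end carry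
  over to the left one.\<close>

definition reflect :: "(rat \<Rightarrow> rat) \<Rightarrow> rat \<Rightarrow> rat" where
  "reflect f = (\<lambda>x. - f (- x))"

lemma reflect_aut [simp]: "f \<in> order_aut \<Longrightarrow> reflect f \<in> order_aut"
proof (rule order_autI)
  assume f: "f \<in> order_aut"
  show "reflect f x < reflect f y" if "x < y" for x y using that f by (simp add: reflect_def)
  show "\<exists>x. reflect f x = z" for z using f by (intro exI[of _ "- finv f (- z)"]) (simp add: reflect_def)
qed

lemma reflect_reflect [simp]: "reflect (reflect f) = f"
  by (simp add: reflect_def)

lemma reflect_comp: "reflect (f \<circ> g) = reflect f \<circ> reflect g"
  by (simp add: reflect_def fun_eq_iff)

lemma reflect_finv: "f \<in> order_aut \<Longrightarrow> finv (reflect f) = reflect (finv f)"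
proof (rule ext)
  fix x assume f: "f \<in> order_aut"
  have "x = reflect f (reflect (finv f) x)" using f by (simp add: reflect_def)
  then show "finv (reflect f) x = reflect (finv f) x"
    using f reflect_aut[OF f] by (simp only: order_aut_inv_eq)
qed

lemma reflect_id: "reflect id = id"
  by (simp add: reflect_def fun_eq_iff)

lemma reflect_commutator:
  "a \<in> order_aut \<Longrightarrow> b \<in> order_aut \<Longrightarrow> reflect (commutator a b) = commutator (reflect a) (reflect b)"
  by (simp only: commutator_def reflect_comp reflect_finv)

lemma reflect_cword:
  assumes "\<And>j. j < m \<Longrightarrow> a j \<in> order_aut \<and> b j \<in> order_aut"
  shows "cword (\<lambda>j. reflect (a j)) (\<lambda>j. reflect (b j)) m = reflect (cword a b m)"
  using assms
proof (induction m)
  case (Suc m)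
  have "a m \<in> order_aut" "b m \<in> order_aut" using Suc.prems[of m] by simp_all
  moreover have "cword (\<lambda>j. reflect (a j)) (\<lambda>j. reflect (b j)) m = reflect (cword a b m)"
    by (rule Suc.IH) (simp add: Suc.prems)
  ultimately show ?case by (simp only: cword.simps reflect_comp reflect_commutator)
qed (simp add: reflect_id)

lemma reach_reflect:
  assumes "reach S x y" "S \<subseteq> order_aut"
  shows "reach (reflect ` S) (- x) (- y)"
  using assms(1)
proof induction
  case (fwd y f)
  have "reach (reflect ` S) (- x) (reflect f (- y))" using fwd reach.fwd[of "reflect ` S" "- x" "- y" "reflect f"] by simp
  then show ?case by (simp add: reflect_def)
next
  case (bwd y f)
  have "reach (reflect ` S) (- x) (finv (reflect f) (- y))" using bwd reach.bwd[of "reflect ` S" "- x" "- y" "reflect f"] by simp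
  moreover have "finv (reflect f) = reflect (finv f)" using bwd assms(2) by (intro reflect_finv) blast
  ultimately show ?case by (simp add: reflect_def)
qed (rule reach.refl)

lemma cut_left:
  assumes aut: "\<And>j. j < Suc m \<Longrightarrow> a j \<in> order_aut \<and> b j \<in> order_aut"
    and rel: "cword a b (Suc m) = id" and K: "a m K \<noteq> K" "b m K \<noteq> K"
  obtains a' b' M where "\<And>j. j < Suc m \<Longrightarrow> a' j \<in> order_aut \<and> b' j \<in> order_aut"
    "cword a' b' (Suc m) = id" "\<And>j x. j < Suc m \<Longrightarrow> K \<le> x \<Longrightarrow> a' j x = a j x \<and> b' j x = b j x"
    "M \<le> K" "\<And>j x. j < m \<Longrightarrow> x \<le> M \<Longrightarrow> a' j x = x \<and> b' j x = x"
    "\<And>z. \<exists>y\<le>z. reach {a' m, b' m} K y"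
proof -
  let ?a = "\<lambda>j. reflect (a j)" and ?b = "\<lambda>j. reflect (b j)"
  have 1: "?a j \<in> order_aut \<and> ?b j \<in> order_aut" if "j < Suc m" for j using aut[OF that] by simp
  have 2: "cword ?a ?b (Suc m) = id" using reflect_cword[of "Suc m" a b] aut rel reflect_id by simp
  have 3: "?a m (- K) \<noteq> - K" "?b m (- K) \<noteq> - K" using K by (simp_all add: reflect_def)
  show ?thesis
  proof (rule cut_right[OF 1 2 3])
    fix a' b' M
    assume *: "\<And>j. j < Suc m \<Longrightarrow> a' j \<in> order_aut \<and> b' j \<in> order_aut"
      "cword a' b' (Suc m) = id" "\<And>j x. j < Suc m \<Longrightarrow> x \<le> - K \<Longrightarrow> a' j x = ?a j x \<and> b' j x = ?b j x"
      "- K \<le> M" "\<And>j x. j < m \<Longrightarrow> M \<le> x \<Longrightarrow> a' j x = x \<and> b' j x = x"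
      "\<And>z. \<exists>y\<ge>z. reach {a' m, b' m} (- K) y"
    let ?a' = "\<lambda>j. reflect (a' j)" and ?b' = "\<lambda>j. reflect (b' j)"
    show ?thesis
    proof (rule that[of ?a' ?b' "- M"])
      show "?a' j \<in> order_aut \<and> ?b' j \<in> order_aut" if "j < Suc m" for j using *(1)[OF that] by simp
      show "cword ?a' ?b' (Suc m) = id" using reflect_cword[of "Suc m" a' b'] *(1,2) reflect_id by simp
      show "?a' j x = a j x \<and> ?b' j x = b j x" if "j < Suc m" "K \<le> x" for j x
        using *(3)[OF that(1), of "- x"] that(2) by (simp add: reflect_def)
      show "- M \<le> K" using *(4) by linarith
      show "?a' j x = x \<and> ?b' j x = x" if "j < m" "x \<le> - M" for j x
        using *(5)[OF that(1), of "- x"] that(2) by (simp add: reflect_def)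
      show "\<exists>y\<le>z. reach {?a' m, ?b' m} K y" for z
      proof -
        obtain y where y: "- z \<le> y" "reach {a' m, b' m} (- K) y" using *(6) by blast
        have "{a' m, b' m} \<subseteq> order_aut" using *(1)[of m] by simp
        from reach_reflect[OF y(2) this] have "reach {?a' m, ?b' m} K (- y)" by simp
        then show ?thesis using y(1) by (intro exI[of _ "- y"]) simp
      qed
    qed
  qed
qed

text \<open>The order isomorphism from all rationals to the negative ones, used to place two actions
  side by side.\<close>

definition to_neg :: "rat \<Rightarrow> rat" where
  "to_neg x = (if x \<le> 0 then x - 1 else - 1 / (x + 1))"

definition to_pos :: "rat \<Rightarrow> rat" where
  "to_pos x = - to_neg (- x)"

lemma to_neg_less [simp]: "to_neg x < to_neg y \<longleftrightarrow> x < y"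
proof -
  have mono: "to_neg x < to_neg y" if "x < y" for x y
  proof -
    consider "y \<le> 0" | "x \<le> 0" "0 < y" | "0 < x" using that by linarith
    then show ?thesis
    proof cases
      case 2
      then have "1 / (y + 1) < 1" by simp
      moreover have "to_neg x \<le> - 1" "to_neg y = - (1 / (y + 1))" using 2 by (simp_all add: to_neg_def)
      ultimately show ?thesis by linarith
    next
      case 3
      then show ?thesis using that by (simp add: to_neg_def divide_simps)
    qed (use that in \<open>simp add: to_neg_def\<close>)
  qed
  show ?thesis using mono[of x y] mono[of y x] by (cases x y rule: linorder_cases) auto
qed

lemma to_neg_eq [simp]: "to_neg x = to_neg y \<longleftrightarrow> x = y"
  using to_neg_less[of x y] to_neg_less[of y x] by (metis less_irrefl linorder_less_linear)

lemma to_neg_neg [simp]: "to_neg x < 0"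
  by (simp add: to_neg_def divide_simps)

lemma to_neg_surj: "z < 0 \<Longrightarrow> \<exists>x. z = to_neg x"
proof (cases "z \<le> - 1")
  case True
  then show ?thesis by (intro exI[of _ "z + 1"]) (simp add: to_neg_def)
next
  case False
  assume "z < 0"
  then have "1 < - 1 / z" using False by (simp add: divide_simps)
  then show ?thesis using \<open>z < 0\<close> by (intro exI[of _ "- 1 / z - 1"]) (simp add: to_neg_def)
qed

lemma to_pos_less [simp]: "to_pos x < to_pos y \<longleftrightarrow> x < y"
  by (simp add: to_pos_def)

lemma to_pos_eq [simp]: "to_pos x = to_pos y \<longleftrightarrow> x = y"
  by (simp add: to_pos_def)

lemma to_pos_pos [simp]: "0 < to_pos x"
  by (simp add: to_pos_def)

lemma to_neg_to_pos [simp]: "to_neg x < to_pos y"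
  by (rule less_trans[of _ 0]) simp_all

lemma rat_sides: obtains (neg) x where "z = to_neg x" | (zero) "z = 0" | (pos) x where "z = to_pos x"
proof -
  consider "z < 0" | "z = 0" | "- z < 0" by linarith
  then show ?thesis
  proof cases
    case 1 then show ?thesis using to_neg_surj neg by blast
  next
    case 2 then show ?thesis using zero by blast
  next
    case 3
    then obtain x where "- z = to_neg x" using to_neg_surj by blast
    then have "z = to_pos (- x)" by (simp add: to_pos_def)
    then show ?thesis using pos by blast
  qed
qed

definition side_by_side :: "(rat \<Rightarrow> rat) \<Rightarrow> (rat \<Rightarrow> rat) \<Rightarrow> rat \<Rightarrow> rat" where
  "side_by_side f g z = (if z < 0 then to_neg (f (finv to_neg z))
     else if z = 0 then 0 else to_pos (g (finv to_pos z)))"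

lemma side_by_side_simps [simp]:
  "side_by_side f g (to_neg x) = to_neg (f x)" "side_by_side f g 0 = 0"
  "side_by_side f g (to_pos x) = to_pos (g x)"
proof -
  have "inj to_neg" "inj to_pos" by (simp_all add: inj_def)
  then have "finv to_neg (to_neg x) = x" "finv to_pos (to_pos x) = x" by (simp_all add: inv_f_f)
  moreover have "\<not> to_pos x < 0" "to_pos x \<noteq> 0" using to_pos_pos[of x] by linarith+
  ultimately show "side_by_side f g (to_neg x) = to_neg (f x)" "side_by_side f g 0 = 0"
    "side_by_side f g (to_pos x) = to_pos (g x)" by (simp_all add: side_by_side_def)
qed

lemma side_by_side_aut [simp]:
  assumes f: "f \<in> order_aut" and g: "g \<in> order_aut"
  shows "side_by_side f g \<in> order_aut"
proof (rule order_autI)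
  fix x y :: rat assume "x < y"
  have no: "\<not> to_pos u < to_neg v" "\<not> 0 < to_neg v" "\<not> to_pos u < 0" for u v
    using to_neg_neg[of v] to_pos_pos[of u] by linarith+
  show "side_by_side f g x < side_by_side f g y"
    by (cases x rule: rat_sides; cases y rule: rat_sides) (use \<open>x < y\<close> no f g in simp_all)
next
  fix z
  show "\<exists>x. side_by_side f g x = z"
  proof (cases z rule: rat_sides)
    case (neg x) then show ?thesis using f by (intro exI[of _ "to_neg (finv f x)"]) simp
  next
    case zero then show ?thesis by (intro exI[of _ 0]) simp
  next
    case (pos x) then show ?thesis using g by (intro exI[of _ "to_pos (finv g x)"]) simp
  qed
qed

lemma side_by_side_comp:
  "side_by_side (f \<circ> f') (g \<circ> g') = side_by_side f g \<circ> side_by_side f' g'"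
proof (rule ext)
  fix z show "side_by_side (f \<circ> f') (g \<circ> g') z = (side_by_side f g \<circ> side_by_side f' g') z"
    by (cases z rule: rat_sides) simp_all
qed

lemma side_by_side_finv:
  assumes f: "f \<in> order_aut" and g: "g \<in> order_aut"
  shows "finv (side_by_side f g) = side_by_side (finv f) (finv g)"
proof (rule ext)
  fix z
  have "z = side_by_side f g (side_by_side (finv f) (finv g) z)"
    by (cases z rule: rat_sides) (use f g in simp_all)
  then show "finv (side_by_side f g) z = side_by_side (finv f) (finv g) z"
    using side_by_side_aut[OF f g] by (simp only: order_aut_inv_eq)
qed

lemma side_by_side_commutator:
  assumes "a \<in> order_aut" "a' \<in> order_aut" "b \<in> order_aut" "b' \<in> order_aut"
  shows "commutator (side_by_side a a') (side_by_side b b') = side_by_side (commutator a b) (commutator a' b')"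
  using assms by (simp only: commutator_def side_by_side_comp side_by_side_finv)

lemma side_by_side_cword:
  assumes "\<And>j. j < m \<Longrightarrow> a j \<in> order_aut \<and> b j \<in> order_aut \<and> a' j \<in> order_aut \<and> b' j \<in> order_aut"
  shows "cword (\<lambda>j. side_by_side (a j) (a' j)) (\<lambda>j. side_by_side (b j) (b' j)) m
     = side_by_side (cword a b m) (cword a' b' m)"
  using assms
proof (induction m)
  case 0
  show ?case
  proof (rule ext)
    fix z show "cword (\<lambda>j. side_by_side (a j) (a' j)) (\<lambda>j. side_by_side (b j) (b' j)) 0 z
      = side_by_side (cword a b 0) (cword a' b' 0) z" by (cases z rule: rat_sides) simp_all
  qed
next
  case (Suc m)
  have "a m \<in> order_aut" "b m \<in> order_aut" "a' m \<in> order_aut" "b' m \<in> order_aut"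
    using Suc.prems[of m] by simp_all
  moreover have "cword (\<lambda>j. side_by_side (a j) (a' j)) (\<lambda>j. side_by_side (b j) (b' j)) m
     = side_by_side (cword a b m) (cword a' b' m)"
    by (rule Suc.IH) (simp add: Suc.prems)
  ultimately show ?case by (simp only: cword.simps side_by_side_comp side_by_side_commutator)
qed

text \<open>On the interval between \<open>to_neg M1\<close> and \<open>to_pos M2\<close> both maps of
  handle 0 are the identity. A map supported there commutes with \<open>b 0\<close>, and
  composing \<open>a 0\<close> with it does not change the commutator.\<close>

lemma link_actions:
  assumes aut1: "\<And>j. j < Suc m \<Longrightarrow> a1 j \<in> order_aut \<and> b1 j \<in> order_aut" and rel1: "cword a1 b1 (Suc m) = id"
    and aut2: "\<And>j. j < Suc m \<Longrightarrow> a2 j \<in> order_aut \<and> b2 j \<in> order_aut" and rel2: "cword a2 b2 (Suc m) = id"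
    and m: "0 < m"
    and id1: "\<And>x. M1 \<le> x \<Longrightarrow> a1 0 x = x \<and> b1 0 x = x"
    and id2: "\<And>x. x \<le> M2 \<Longrightarrow> a2 0 x = x \<and> b2 0 x = x"
    and u: "M1 < u" and v: "v < M2"
  obtains a b where "\<And>j. j < Suc m \<Longrightarrow> a j \<in> order_aut \<and> b j \<in> order_aut" "cword a b (Suc m) = id"
    "\<And>j x. j \<noteq> 0 \<or> x \<le> M1 \<Longrightarrow> a j (to_neg x) = to_neg (a1 j x)" "\<And>j x. b j (to_neg x) = to_neg (b1 j x)"
    "\<And>j x. j \<noteq> 0 \<or> M2 \<le> x \<Longrightarrow> a j (to_pos x) = to_pos (a2 j x)" "\<And>j x. b j (to_pos x) = to_pos (b2 j x)"
    "a 0 (to_neg u) = to_pos v"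
proof -
  define a0 where "a0 = (\<lambda>j. side_by_side (a1 j) (a2 j))"
  define b where "b = (\<lambda>j. side_by_side (b1 j) (b2 j))"
  have aut0: "a0 j \<in> order_aut" "b j \<in> order_aut" if "j < Suc m" for j
    using aut1[OF that] aut2[OF that] by (simp_all add: a0_def b_def)
  have "side_by_side id id = id"
  proof (rule ext)
    fix z show "side_by_side id id z = id z" by (cases z rule: rat_sides) simp_all
  qed
  then have rel0: "cword a0 b (Suc m) = id"
    using side_by_side_cword[of "Suc m" a1 b1 a2 b2] aut1 aut2 rel1 rel2 unfolding a0_def b_def by simp
  obtain g where g: "g \<in> order_aut" "g (to_neg u) = to_pos v"
    "\<And>x. x \<le> to_neg M1 \<Longrightarrow> g x = x" "\<And>x. to_pos M2 \<le> x \<Longrightarrow> g x = x"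
    using order_aut_bump[of "to_neg M1" "to_neg u" "to_pos M2" "to_pos v"] u v by auto
  have fix0: "a0 0 x = x \<and> b 0 x = x" if x: "to_neg M1 \<le> x" "x \<le> to_pos M2" for x
  proof (cases x rule: rat_sides)
    case (neg y)
    then have "M1 \<le> y" using x to_neg_less[of y M1] by (simp add: not_less[symmetric])
    then show ?thesis using id1 neg by (simp add: a0_def b_def)
  next
    case (pos y)
    then have "y \<le> M2" using x to_pos_less[of M2 y] by (simp add: not_less[symmetric])
    then show ?thesis using id2 pos by (simp add: a0_def b_def)
  qed (simp add: a0_def b_def)
  have b0: "b 0 \<in> order_aut" and a00: "a0 0 \<in> order_aut" using aut0 by simp_all
  have mid: "to_neg M1 \<le> to_pos M2" by (intro less_imp_le) simp
  have gmid: "g (to_neg M1) = to_neg M1" "g (to_pos M2) = to_pos M2" using g by simp_all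
  have bmid: "b 0 (to_neg M1) = to_neg M1" "b 0 (to_pos M2) = to_pos M2" using fix0 mid by simp_all
  have comm: "g (b 0 x) = b 0 (g x)" for x
  proof -
    consider "x \<le> to_neg M1" | "to_neg M1 \<le> x" "x \<le> to_pos M2" | "to_pos M2 \<le> x" by linarith
    then show ?thesis
    proof cases
      case 1
      then have "b 0 x \<le> b 0 (to_neg M1)" using b0 by simp
      then show ?thesis using 1 g(3) bmid by simp
    next
      case 2
      then have "g (to_neg M1) \<le> g x" "g x \<le> g (to_pos M2)" using g(1) by simp_all
      then show ?thesis using 2 fix0 gmid by simp
    next
      case 3
      then have "b 0 (to_pos M2) \<le> b 0 x" using b0 by simp
      then show ?thesis using 3 g(4) bmid by simp
    qed
  qed
  define a where "a = a0(0 := a0 0 \<circ> g)"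
  have fin: "finv (a0 0 \<circ> g) x = finv g (finv (a0 0) x)" for x
    using g(1) a00 order_aut_comp[OF a00 g(1)] by (simp add: order_aut_inv_eq)
  have "commutator (a0 0 \<circ> g) (b 0) = commutator (a0 0) (b 0)"
    using g(1) by (simp add: commutator_def fun_eq_iff fin comm)
  then have "cword a b (Suc m) = cword a0 b (Suc m)" by (intro cword_cong) (simp add: a_def)
  then have "cword a b (Suc m) = id" using rel0 by simp
  moreover have "a j \<in> order_aut \<and> b j \<in> order_aut" if "j < Suc m" for j
    using aut0[OF that] a00 g(1) by (simp add: a_def)
  moreover have "a j (to_neg x) = to_neg (a1 j x)" if "j \<noteq> 0 \<or> x \<le> M1" for j x
  proof (cases "j = 0")
    case True
    then have "to_neg x \<le> to_neg M1" using that to_neg_less[of M1 x] by (simp add: not_less[symmetric])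
    then show ?thesis using True g(3) by (simp add: a_def a0_def)
  qed (simp add: a_def a0_def)
  moreover have "a j (to_pos x) = to_pos (a2 j x)" if "j \<noteq> 0 \<or> M2 \<le> x" for j x
  proof (cases "j = 0")
    case True
    then have "to_pos M2 \<le> to_pos x" using that to_pos_less[of x M2] by (simp add: not_less[symmetric])
    then show ?thesis using True g(4) by (simp add: a_def a0_def)
  qed (simp add: a_def a0_def)
  moreover have "a 0 (to_neg u) = to_pos v" using g(2) id2[of v] v by (simp add: a_def a0_def)
  ultimately show ?thesis using that[of a b] by (simp add: b_def)
qed

section \<open>Countable dense orders\<close>

definition dense_order :: "'a set \<Rightarrow> ('a \<Rightarrow> 'a \<Rightarrow> bool) \<Rightarrow> bool" where
  "dense_order A lt \<longleftrightarrow> A \<noteq> {} \<and> (\<forall>x\<in>A. \<not> lt x x) \<and>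
     (\<forall>x\<in>A. \<forall>y\<in>A. \<forall>z\<in>A. lt x y \<longrightarrow> lt y z \<longrightarrow> lt x z) \<and>
     (\<forall>x\<in>A. \<forall>y\<in>A. x = y \<or> lt x y \<or> lt y x) \<and>
     (\<forall>x\<in>A. \<forall>y\<in>A. lt x y \<longrightarrow> (\<exists>z\<in>A. lt x z \<and> lt z y)) \<and>
     (\<forall>x\<in>A. (\<exists>y\<in>A. lt x y) \<and> (\<exists>y\<in>A. lt y x))"

lemma dense_orderD:
  assumes "dense_order A lt"
  shows "A \<noteq> {}" "\<And>x. x \<in> A \<Longrightarrow> \<not> lt x x"
    "\<And>x y z. x \<in> A \<Longrightarrow> y \<in> A \<Longrightarrow> z \<in> A \<Longrightarrow> lt x y \<Longrightarrow> lt y z \<Longrightarrow> lt x z"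
    "\<And>x y. x \<in> A \<Longrightarrow> y \<in> A \<Longrightarrow> x = y \<or> lt x y \<or> lt y x"
    "\<And>x y. x \<in> A \<Longrightarrow> y \<in> A \<Longrightarrow> lt x y \<Longrightarrow> \<exists>z\<in>A. lt x z \<and> lt z y"
    "\<And>x. x \<in> A \<Longrightarrow> \<exists>y\<in>A. lt x y" "\<And>x. x \<in> A \<Longrightarrow> \<exists>y\<in>A. lt y x"
proof -
  note d = assms[unfolded dense_order_def]
  note d2 = d[THEN conjunct2] note d3 = d2[THEN conjunct2] note d4 = d3[THEN conjunct2]
  note d5 = d4[THEN conjunct2] note d6 = d5[THEN conjunct2]
  show "A \<noteq> {}" using d[THEN conjunct1] .
  show "\<not> lt x x" if "x \<in> A" for x using d2[THEN conjunct1] that by (rule bspec)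
  show "lt x z" if "x \<in> A" "y \<in> A" "z \<in> A" "lt x y" "lt y z" for x y z
    using d3[THEN conjunct1, THEN bspec, THEN bspec, THEN bspec, THEN mp, THEN mp] that .
  show "x = y \<or> lt x y \<or> lt y x" if "x \<in> A" "y \<in> A" for x y
    using d4[THEN conjunct1, THEN bspec, THEN bspec] that .
  show "\<exists>z\<in>A. lt x z \<and> lt z y" if "x \<in> A" "y \<in> A" "lt x y" for x y
    using d5[THEN conjunct1, THEN bspec, THEN bspec, THEN mp] that .
  show "\<exists>y\<in>A. lt x y" "\<exists>y\<in>A. lt y x" if "x \<in> A" for x
    using d6[THEN bspec, OF that, THEN conjunct1] d6[THEN bspec, OF that, THEN conjunct2] .
qed

lemma dense_order_trans:
  assumes "dense_order A lt" "x \<in> A" "y \<in> A" "z \<in> A"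
  shows "x = y \<or> lt x y \<Longrightarrow> lt y z \<Longrightarrow> lt x z" "lt x y \<Longrightarrow> z = y \<or> lt y z \<Longrightarrow> lt x z"
  using dense_orderD(3)[OF assms] by (elim disjE; simp)+

lemma dense_order_rat: "dense_order (UNIV :: rat set) (<)"
  unfolding dense_order_def
proof (intro conjI ballI impI)
  fix x y :: rat
  show "\<exists>y\<in>UNIV. x < y" by (rule bexI[of _ "x + 1"]) simp_all
  show "\<exists>y\<in>UNIV. y < x" by (rule bexI[of _ "x - 1"]) simp_all
  assume "x < y" then show "\<exists>z\<in>UNIV. x < z \<and> z < y" using dense by blast
qed auto

lemma finite_has_greatest:
  assumes "finite L" "L \<noteq> {}" "L \<subseteq> A" "dense_order A lt"
  shows "\<exists>m\<in>L. \<forall>x\<in>L. x = m \<or> lt x m"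
  using assms(1-3)
proof (induction rule: finite_ne_induct)
  case (insert x F)
  then obtain m where m: "m \<in> F" "\<forall>y\<in>F. y = m \<or> lt y m" by blast
  have A: "x \<in> A" "m \<in> A" "F \<subseteq> A" using m insert by blast+
  show ?case
  proof (cases "lt m x")
    case True
    have "y = x \<or> lt y x" if "y \<in> insert x F" for y
    proof (cases "y = x")
      case False
      then have "y \<in> F" using that by simp
      then show ?thesis using dense_order_trans(1)[OF assms(4), of y m x] A True m(2) by auto
    qed simp
    then show ?thesis by blast
  next
    case False
    then have "x = m \<or> lt x m" using dense_orderD(4)[OF assms(4) A(1,2)] by blast
    then show ?thesis using m by blast
  qed
qed blast

lemma dense_order_converse:
  assumes d: "dense_order A lt" shows "dense_order A (\<lambda>x y. lt y x)"
  unfolding dense_order_def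
proof (intro conjI ballI impI)
  fix x y z assume x: "x \<in> A" and y: "y \<in> A"
  show "\<not> lt x x" "x = y \<or> lt y x \<or> lt x y" using dense_orderD(2,4)[OF d] x y by auto
  show "\<exists>z\<in>A. lt z x" "\<exists>z\<in>A. lt x z" using dense_orderD(6,7)[OF d x] by auto
  show "\<exists>z\<in>A. lt z x \<and> lt y z" if "lt y x" using dense_orderD(5)[OF d y x that] by auto
  show "lt z x" if "z \<in> A" "lt y x" "lt z y" using dense_orderD(3)[OF d that(1) y x that(3,2)] .
qed (rule dense_orderD(1)[OF d])

lemma dense_order_separate:
  assumes d: "dense_order A lt" and "finite L" "finite U" "L \<subseteq> A" "U \<subseteq> A"
    and LU: "\<And>l u. l \<in> L \<Longrightarrow> u \<in> U \<Longrightarrow> lt l u"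
  shows "\<exists>x\<in>A. (\<forall>l\<in>L. lt l x) \<and> (\<forall>u\<in>U. lt x u)"
proof -
  have "\<exists>x\<in>A. (\<forall>l\<in>L. lt l x) \<and> (\<forall>u\<in>U. lt x u)" if "L = {}" "U = {}"
    using that dense_orderD(1)[OF d] by blast
  moreover have "\<exists>x\<in>A. (\<forall>l\<in>L. lt l x) \<and> (\<forall>u\<in>U. lt x u)" if ne: "L \<noteq> {}" "U = {}"
  proof -
    obtain m where m: "m \<in> L" "\<forall>x\<in>L. x = m \<or> lt x m"
      using finite_has_greatest[OF assms(2) ne(1) assms(4) d] by blast
    then have mA: "m \<in> A" using assms by blast
    obtain x where x: "x \<in> A" "lt m x" using dense_orderD(6)[OF d mA] by blast
    have "lt l x" if "l \<in> L" for l
      using that m x mA dense_order_trans(1)[OF d, of l m x] assms(4) by auto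
    then show ?thesis using x ne by blast
  qed
  moreover have "\<exists>x\<in>A. (\<forall>l\<in>L. lt l x) \<and> (\<forall>u\<in>U. lt x u)" if ne: "U \<noteq> {}"
  proof -
    obtain w where w: "w \<in> U" "\<forall>x\<in>U. x = w \<or> lt w x"
      using finite_has_greatest[OF assms(3) ne assms(5) dense_order_converse[OF d]] by blast
    then have wA: "w \<in> A" using assms by blast
    show ?thesis
    proof (cases "L = {}")
      case True
      obtain x where x: "x \<in> A" "lt x w" using dense_orderD(7)[OF d wA] by blast
      have "lt x u" if "u \<in> U" for u
        using that w x wA dense_order_trans(2)[OF d, of x w u] assms(5) by auto
      then show ?thesis using x True by blast
    next
      case False
      obtain m where m: "m \<in> L" "\<forall>x\<in>L. x = m \<or> lt x m"
        using finite_has_greatest[OF assms(2) False assms(4) d] by blast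
      then have mA: "m \<in> A" using assms by blast
      obtain x where x: "x \<in> A" "lt m x" "lt x w"
        using dense_orderD(5)[OF d mA wA LU[OF m(1) w(1)]] by blast
      have "lt l x" if "l \<in> L" for l
        using that m x mA dense_order_trans(1)[OF d, of l m x] assms(4) by auto
      moreover have "lt x u" if "u \<in> U" for u
        using that w x wA dense_order_trans(2)[OF d, of x w u] assms(5) by auto
      ultimately show ?thesis using x by blast
    qed
  qed
  ultimately show ?thesis by blast
qed

definition partial_iso :: "'a set \<Rightarrow> ('a \<Rightarrow> 'a \<Rightarrow> bool) \<Rightarrow> 'b set \<Rightarrow> ('b \<Rightarrow> 'b \<Rightarrow> bool) \<Rightarrow> ('a \<times> 'b) set \<Rightarrow> bool" where
  "partial_iso A lt B lt' S \<longleftrightarrow> finite S \<and> S \<subseteq> A \<times> B \<and>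
     (\<forall>(x, q)\<in>S. \<forall>(y, p)\<in>S. lt x y \<longleftrightarrow> lt' q p)"

lemma partial_isoD:
  assumes "partial_iso A lt B lt' S"
  shows "finite S" "S \<subseteq> A \<times> B" "\<And>x q y p. (x, q) \<in> S \<Longrightarrow> (y, p) \<in> S \<Longrightarrow> lt x y \<longleftrightarrow> lt' q p"
  using assms unfolding partial_iso_def by auto

lemma partial_iso_converse:
  assumes "partial_iso A lt B lt' S" shows "partial_iso B lt' A lt (S\<inverse>)"
  unfolding partial_iso_def using partial_isoD[OF assms] by auto

lemma partial_iso_functional:
  assumes "partial_iso A lt B lt' S" "dense_order A lt" "dense_order B lt'" "(x, q) \<in> S" "(y, p) \<in> S"
  shows "x = y \<longleftrightarrow> q = p"
proof -
  have "lt x y \<longleftrightarrow> lt' q p" "lt y x \<longleftrightarrow> lt' p q"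
    using partial_isoD(3)[OF assms(1)] assms(4,5) by auto
  moreover have "x \<in> A" "y \<in> A" "q \<in> B" "p \<in> B" using partial_isoD(2)[OF assms(1)] assms(4,5) by auto
  ultimately show ?thesis
    using dense_orderD(2)[OF assms(2), of x] dense_orderD(4)[OF assms(2), of x y]
      dense_orderD(2)[OF assms(3), of q] dense_orderD(4)[OF assms(3), of q p] by auto
qed

lemma partial_iso_extend:
  assumes S: "partial_iso A lt B lt' S" and A: "dense_order A lt" and B: "dense_order B lt'" and x: "x \<in> A"
  shows "\<exists>q. partial_iso A lt B lt' (insert (x, q) S)"
proof (cases "x \<in> Domain S")
  case True
  then obtain q where "(x, q) \<in> S" by blast
  then have "insert (x, q) S = S" by blast
  then show ?thesis using S by (intro exI[of _ q]) simp
next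
  case False
  note S' = partial_isoD[OF S]
  let ?L = "snd ` {z \<in> S. lt (fst z) x}" and ?U = "snd ` {z \<in> S. lt x (fst z)}"
  have "\<exists>q\<in>B. (\<forall>l\<in>?L. lt' l q) \<and> (\<forall>u\<in>?U. lt' q u)"
  proof (rule dense_order_separate[OF B])
    show "finite ?L" "finite ?U" "?L \<subseteq> B" "?U \<subseteq> B" using S' by auto
    fix l u assume "l \<in> ?L" "u \<in> ?U"
    then obtain y z where yz: "(y, l) \<in> S" "lt y x" "(z, u) \<in> S" "lt x z" by auto
    then have "y \<in> A" "z \<in> A" using S'(2) by auto
    then have "lt y z" using dense_orderD(3)[OF A _ x] yz by simp
    then show "lt' l u" using S'(3)[OF yz(1,3)] by simp
  qed
  then obtain q where q0: "q \<in> B" "\<forall>l\<in>?L. lt' l q" "\<forall>u\<in>?U. lt' q u" by blast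
  have q: "q \<in> B" "\<And>y p. (y, p) \<in> S \<Longrightarrow> lt y x \<Longrightarrow> lt' p q" "\<And>y p. (y, p) \<in> S \<Longrightarrow> lt x y \<Longrightarrow> lt' q p"
    using q0 by (simp_all add: ball_conj_distrib)
  have new: "(lt x y \<longleftrightarrow> lt' q p) \<and> (lt y x \<longleftrightarrow> lt' p q)" if yp: "(y, p) \<in> S" for y p
  proof -
    have "y \<in> A" "p \<in> B" "y \<noteq> x" using yp S'(2) False by auto
    then show ?thesis
      using dense_orderD(4)[OF A x, of y] q(2,3)[OF yp] dense_orderD(2)[OF A x] dense_orderD(2)[OF B q(1)]
        dense_orderD(3)[OF A x _ x, of y] dense_orderD(3)[OF B q(1) _ q(1), of p] by blast
  qed
  have "partial_iso A lt B lt' (insert (x, q) S)"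
    unfolding partial_iso_def
    using S' q(1) x new dense_orderD(2)[OF A x] dense_orderD(2)[OF B q(1)] by auto
  then show ?thesis ..
qed

text \<open>Back and forth: enlarging the given finite partial isomorphism step by step, each element of
  either order is eventually matched.\<close>

theorem countable_dense_order_iso:
  assumes S0: "partial_iso A lt B lt' S0" and A: "dense_order A lt" "countable A" and B: "dense_order B lt'" "countable B"
  obtains f where "bij_betw f A B" "\<And>x y. x \<in> A \<Longrightarrow> y \<in> A \<Longrightarrow> lt x y \<longleftrightarrow> lt' (f x) (f y)"
    "\<And>x q. (x, q) \<in> S0 \<Longrightarrow> f x = q"
proof -
  let ?a = "from_nat_into A" and ?b = "from_nat_into B"
  have ne: "A \<noteq> {}" "B \<noteq> {}" using dense_orderD(1) A B by blast+
  have step: "\<exists>T. partial_iso A lt B lt' T \<and> S \<subseteq> T \<and> ?a k \<in> Domain T \<and> ?b k \<in> Range T"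
    if S: "partial_iso A lt B lt' S" for S k
  proof -
    obtain q where q: "partial_iso A lt B lt' (insert (?a k, q) S)"
      using partial_iso_extend[OF S A(1) B(1) from_nat_into[OF ne(1)]] by blast
    then have "partial_iso B lt' A lt ((insert (?a k, q) S)\<inverse>)" by (rule partial_iso_converse)
    then obtain x where "partial_iso B lt' A lt (insert (?b k, x) ((insert (?a k, q) S)\<inverse>))"
      using partial_iso_extend[OF _ B(1) A(1) from_nat_into[OF ne(2)]] by blast
    then have "partial_iso A lt B lt' ((insert (?b k, x) ((insert (?a k, q) S)\<inverse>))\<inverse>)"
      by (rule partial_iso_converse)
    then show ?thesis by (intro exI[of _ "(insert (?b k, x) ((insert (?a k, q) S)\<inverse>))\<inverse>"]) auto
  qed
  have "\<exists>T. \<forall>k. (partial_iso A lt B lt' (T k) \<and> S0 \<subseteq> T k) \<and>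
    (T k \<subseteq> T (Suc k) \<and> ?a k \<in> Domain (T (Suc k)) \<and> ?b k \<in> Range (T (Suc k)))"
  proof (rule dependent_nat_choice)
    fix S k assume "partial_iso A lt B lt' S \<and> S0 \<subseteq> S"
    then show "\<exists>T. (partial_iso A lt B lt' T \<and> S0 \<subseteq> T) \<and> S \<subseteq> T \<and> ?a k \<in> Domain T \<and> ?b k \<in> Range T"
      using step[of S k] by blast
  qed (use S0 in blast)
  then obtain T where T: "\<And>k. partial_iso A lt B lt' (T k)" "\<And>k. S0 \<subseteq> T k" "\<And>k. T k \<subseteq> T (Suc k)"
    "\<And>k. ?a k \<in> Domain (T (Suc k))" "\<And>k. ?b k \<in> Range (T (Suc k))" by blast
  have mono: "T k \<subseteq> T l" if "k \<le> l" for k l using lift_Suc_mono_le[of T k l] T(3) that by simp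
  define R where "R = (\<Union>k. T k)"
  have R: "(lt x y \<longleftrightarrow> lt' q p) \<and> (x = y \<longleftrightarrow> q = p) \<and> x \<in> A \<and> q \<in> B" if xy: "(x, q) \<in> R" "(y, p) \<in> R" for x q y p
  proof -
    obtain k l where "(x, q) \<in> T k" "(y, p) \<in> T l" using xy unfolding R_def by blast
    then have xT: "(x, q) \<in> T (max k l)" "(y, p) \<in> T (max k l)" using mono[of k "max k l"] mono[of l "max k l"] by auto
    then have "lt x y \<longleftrightarrow> lt' q p" "x \<in> A" "q \<in> B" using partial_isoD(2,3)[OF T(1)[of "max k l"]] by auto
    then show ?thesis using partial_iso_functional[OF T(1) A(1) B(1) xT] by blast
  qed
  have dom: "\<exists>q. (x, q) \<in> R" if x: "x \<in> A" for x
  proof -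
    obtain k where "x = ?a k" using from_nat_into_surj[OF A(2) x] by auto
    then show ?thesis using T(4)[of k] unfolding R_def by blast
  qed
  have ran: "\<exists>x. (x, q) \<in> R" if q: "q \<in> B" for q
  proof -
    obtain k where "q = ?b k" using from_nat_into_surj[OF B(2) q] by auto
    then show ?thesis using T(5)[of k] unfolding R_def by blast
  qed
  define f where "f x = (SOME q. (x, q) \<in> R)" for x
  have f: "(x, f x) \<in> R" if "x \<in> A" for x unfolding f_def using dom[OF that] by (rule someI_ex)
  have fR: "f x = q" if "(x, q) \<in> R" for x q
  proof -
    have "x \<in> A" using R[OF that that] by simp
    from R[OF f[OF this] that] show ?thesis by simp
  qed
  show ?thesis
  proof (rule that)
    show "bij_betw f A B"
    proof (rule bij_betw_imageI)
      show "inj_on f A"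
      proof (rule inj_onI)
        fix x y assume "x \<in> A" "y \<in> A" "f x = f y"
        then show "x = y" using R[OF f f, of x y] by simp
      qed
      show "f ` A = B"
      proof (intro equalityI subsetI)
        fix q assume "q \<in> B"
        then obtain x where "(x, q) \<in> R" using ran by auto
        then show "q \<in> f ` A" using fR R by (intro image_eqI[of _ _ x]) auto
      next
        fix q assume "q \<in> f ` A"
        then show "q \<in> B" using R[OF f f] by auto
      qed
    qed
    show "lt x y \<longleftrightarrow> lt' (f x) (f y)" if "x \<in> A" "y \<in> A" for x y using R[OF f[OF that(1)] f[OF that(2)]] by blast
    show "f x = q" if "(x, q) \<in> S0" for x q using that T(2)[of 0] fR unfolding R_def by blast
  qed
qed

lemma order_aut_extending:
  fixes S :: "(rat \<times> rat) set"
  assumes "finite S" "\<And>x q y p. (x, q) \<in> S \<Longrightarrow> (y, p) \<in> S \<Longrightarrow> x < y \<longleftrightarrow> q < p"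
  obtains f where "f \<in> order_aut" "\<And>x q. (x, q) \<in> S \<Longrightarrow> f x = q"
proof -
  have "partial_iso UNIV (<) UNIV (<) S" unfolding partial_iso_def using assms by auto
  then show ?thesis
  proof (rule countable_dense_order_iso[OF _ dense_order_rat countableI_type dense_order_rat countableI_type])
    fix f :: "rat \<Rightarrow> rat"
    assume f: "bij_betw f UNIV UNIV" "\<And>x y. x \<in> UNIV \<Longrightarrow> y \<in> UNIV \<Longrightarrow> x < y \<longleftrightarrow> f x < f y"
      "\<And>x q. (x, q) \<in> S \<Longrightarrow> f x = q"
    have "f \<in> order_aut"
    proof (rule order_autI)
      show "\<exists>x. f x = z" for z
        using surjD[OF bij_betw_imp_surj_on[OF f(1)], of z] by auto
      show "f x < f y" if "x < y" for x y using f(2)[OF UNIV_I UNIV_I, of x y] that by (rule iffD1)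
    qed
    then show ?thesis using that f(3) by simp
  qed
qed

section \<open>Groups acting on the rational line\<close>

definition Aut_rat :: "(rat \<Rightarrow> rat) monoid" where
  "Aut_rat = \<lparr>carrier = order_aut, mult = (\<circ>), one = id\<rparr>"

lemma group_Aut_rat: "group Aut_rat"
proof (rule groupI)
  fix f assume "f \<in> carrier Aut_rat"
  then show "\<exists>g\<in>carrier Aut_rat. g \<otimes>\<^bsub>Aut_rat\<^esub> f = \<one>\<^bsub>Aut_rat\<^esub>"
    by (intro bexI[of _ "finv f"]) (simp_all add: Aut_rat_def fun_eq_iff)
qed (simp_all add: Aut_rat_def o_assoc)

lemma inv_Aut_rat: "f \<in> order_aut \<Longrightarrow> inv\<^bsub>Aut_rat\<^esub> f = finv f"
  by (rule group.inv_equality[OF group_Aut_rat]) (simp_all add: Aut_rat_def fun_eq_iff)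

lemma finv_translation: "finv (\<lambda>x::rat. x + d) = (\<lambda>x. x - d)"
  by (rule ext) (simp add: order_aut_inv_eq[OF order_aut_add])

fun surface_word :: "('a, 'b) monoid_scheme \<Rightarrow> (nat \<Rightarrow> 'a) \<Rightarrow> (nat \<Rightarrow> 'a) \<Rightarrow> nat \<Rightarrow> 'a" where
  "surface_word G A B 0 = \<one>\<^bsub>G\<^esub>"
| "surface_word G A B (Suc j) =
     surface_word G A B j \<otimes>\<^bsub>G\<^esub> (A j \<otimes>\<^bsub>G\<^esub> B j \<otimes>\<^bsub>G\<^esub> inv\<^bsub>G\<^esub> A j \<otimes>\<^bsub>G\<^esub> inv\<^bsub>G\<^esub> B j)"

lemma surface_word_Aut_rat:
  "(\<And>j. j < n \<Longrightarrow> a j \<in> order_aut \<and> b j \<in> order_aut) \<Longrightarrow> surface_word Aut_rat a b n = cword a b n"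
proof (induction n)
  case (Suc n)
  then have "surface_word Aut_rat a b n = cword a b n" "a n \<in> order_aut" "b n \<in> order_aut" by simp_all
  then show ?case by (simp add: inv_Aut_rat) (simp add: Aut_rat_def commutator_def o_assoc)
qed (simp add: Aut_rat_def)

text \<open>Letters are indices together with a flag which is false for the inverse.\<close>

fun word_value :: "('a, 'b) monoid_scheme \<Rightarrow> ('i \<Rightarrow> 'a) \<Rightarrow> ('i \<times> bool) list \<Rightarrow> 'a" where
  "word_value G e [] = \<one>\<^bsub>G\<^esub>"
| "word_value G e (x # l) = (if snd x then e (fst x) else inv\<^bsub>G\<^esub> e (fst x)) \<otimes>\<^bsub>G\<^esub> word_value G e l"

definition reduced :: "('i \<times> bool) list \<Rightarrow> bool" where
  "reduced l \<longleftrightarrow> (\<forall>r. Suc r < length l \<longrightarrow> fst (l ! r) = fst (l ! Suc r) \<longrightarrow> snd (l ! r) = snd (l ! Suc r))"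

lemma reduced_Cons:
  "reduced (x # l) \<longleftrightarrow> reduced l \<and> (l = [] \<or> (fst x = fst (hd l) \<longrightarrow> snd x = snd (hd l)))"
proof (cases l)
  case (Cons y k)
  show ?thesis
  proof
    assume R: "reduced (x # l)"
    have "reduced l" unfolding reduced_def
    proof (intro allI impI)
      fix r assume "Suc r < length l" "fst (l ! r) = fst (l ! Suc r)"
      then show "snd (l ! r) = snd (l ! Suc r)"
        using R[unfolded reduced_def, THEN spec, of "Suc r"] by simp
    qed
    moreover have "fst x = fst y \<longrightarrow> snd x = snd y"
      using R[unfolded reduced_def, THEN spec, of 0] Cons by simp
    ultimately show "reduced l \<and> (l = [] \<or> (fst x = fst (hd l) \<longrightarrow> snd x = snd (hd l)))" using Cons by simp
  next
    assume R: "reduced l \<and> (l = [] \<or> (fst x = fst (hd l) \<longrightarrow> snd x = snd (hd l)))"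
    show "reduced (x # l)" unfolding reduced_def
    proof (intro allI impI)
      fix r assume r: "Suc r < length (x # l)" "fst ((x # l) ! r) = fst ((x # l) ! Suc r)"
      show "snd ((x # l) ! r) = snd ((x # l) ! Suc r)"
      proof (cases r)
        case 0 then show ?thesis using r R Cons by simp
      next
        case (Suc r') then show ?thesis using r R[THEN conjunct1, unfolded reduced_def, THEN spec, of r'] by simp
      qed
    qed
  qed
qed (simp add: reduced_def)

context group begin

lemma word_value_closed: "(\<And>i. i \<in> V \<Longrightarrow> e i \<in> carrier G) \<Longrightarrow> set l \<subseteq> V \<times> UNIV \<Longrightarrow> word_value G e l \<in> carrier G"
  by (induction l) auto

lemma word_value_append:
  assumes e: "\<And>i. i \<in> V \<Longrightarrow> e i \<in> carrier G" and "set l \<subseteq> V \<times> UNIV" "set k \<subseteq> V \<times> UNIV"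
  shows "word_value G e (l @ k) = word_value G e l \<otimes> word_value G e k"
  using assms(2)
proof (induction l)
  case Nil then show ?case using word_value_closed[of V e k] e assms(3) by simp
next
  case (Cons x l)
  then have "e (fst x) \<in> carrier G" "word_value G e l \<in> carrier G" using e word_value_closed[of V e l] by auto
  then show ?case using Cons word_value_closed[of V e k] e assms(3) by (simp add: m_assoc)
qed

lemma generate_word:
  assumes e: "\<And>i. i \<in> V \<Longrightarrow> e i \<in> carrier G" and "g \<in> generate G (e ` V)"
  shows "\<exists>l. set l \<subseteq> V \<times> UNIV \<and> g = word_value G e l"
  using assms(2)
proof induction
  case one
  show ?case by (rule exI[of _ "[]"]) simp
next
  case (incl h)
  then obtain i where "i \<in> V" "h = e i" by blast
  then show ?case using e by (intro exI[of _ "[(i, True)]"]) simp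
next
  case (inv h)
  then obtain i where "i \<in> V" "h = e i" by blast
  then show ?case using e by (intro exI[of _ "[(i, False)]"]) simp
next
  case (eng h1 h2)
  then obtain l k where "set l \<subseteq> V \<times> UNIV" "h1 = word_value G e l" "set k \<subseteq> V \<times> UNIV" "h2 = word_value G e k"
    by blast
  then show ?case using word_value_append[of V e l k] e by (intro exI[of _ "l @ k"]) simp
qed

lemma countable_generate:
  assumes "S \<subseteq> carrier G" "countable S" shows "countable (generate G S)"
proof -
  have "generate G S \<subseteq> word_value G (\<lambda>x. x) ` lists (S \<times> UNIV)"
  proof
    fix g assume g: "g \<in> generate G S"
    have "\<exists>l. set l \<subseteq> S \<times> UNIV \<and> g = word_value G (\<lambda>x. x) l"
      by (rule generate_word) (use assms(1) g in auto)
    then show "g \<in> word_value G (\<lambda>x. x) ` lists (S \<times> UNIV)" by auto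
  qed
  moreover have "countable (lists (S \<times> (UNIV :: bool set)))" using assms(2) by (intro countable_lists) simp
  ultimately show ?thesis by (rule countable_subset[OF _ countable_image])
qed

lemma reduced_word_exists:
  assumes e: "\<And>i. i \<in> V \<Longrightarrow> e i \<in> carrier G" and "set l \<subseteq> V \<times> UNIV"
  shows "\<exists>k. set k \<subseteq> V \<times> UNIV \<and> reduced k \<and> word_value G e k = word_value G e l"
  using assms(2)
proof (induction l)
  case Nil
  show ?case by (rule exI[of _ "[]"]) (simp add: reduced_def)
next
  case (Cons x l)
  then obtain k where k: "set k \<subseteq> V \<times> UNIV" "reduced k" "word_value G e k = word_value G e l" by auto
  have x: "e (fst x) \<in> carrier G" using Cons.prems e by auto
  show ?case
  proof (cases "reduced (x # k)")
    case True
    then show ?thesis using k Cons.prems by (intro exI[of _ "x # k"]) simp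
  next
    case False
    then obtain y k' where k': "k = y # k'" "fst x = fst y" "snd x \<noteq> snd y"
      using k(2) reduced_Cons[of x k] by (cases k) auto
    have "set k' \<subseteq> V \<times> UNIV" using k k' by simp
    then have c: "word_value G e k' \<in> carrier G" using word_value_closed[of V e k'] e by simp
    have "word_value G e (x # l) = word_value G e k'"
      using k(3)[symmetric] k' x c by (cases "snd x") (simp_all add: m_assoc[symmetric])
    then show ?thesis using k k' reduced_Cons[of y k'] by (intro exI[of _ k']) simp
  qed
qed

lemma conj_generate:
  assumes x: "x \<in> carrier G" and S: "S \<subseteq> carrier G" and K: "subgroup K G"
    and conj: "\<And>s. s \<in> S \<Longrightarrow> x \<otimes> s \<otimes> inv x \<in> K" and g: "g \<in> generate G S"
  shows "x \<otimes> g \<otimes> inv x \<in> K"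
  using g
proof induction
  case one then show ?case using x subgroup.one_closed[OF K] by simp
next
  case (incl h) then show ?case using conj by simp
next
  case (inv h)
  then have h: "h \<in> carrier G" using S by blast
  have "x \<otimes> inv h \<otimes> inv x = inv (x \<otimes> h \<otimes> inv x)" using x h by (simp add: inv_mult_group m_assoc)
  then show ?case using subgroup.m_inv_closed[OF K conj[OF inv]] by simp
next
  case (eng h1 h2)
  have h: "h1 \<in> carrier G" "h2 \<in> carrier G" using eng generate_in_carrier[OF S] by auto
  have "inv x \<otimes> (x \<otimes> (h2 \<otimes> inv x)) = h2 \<otimes> inv x" using x h by (simp add: m_assoc[symmetric])
  then have "x \<otimes> (h1 \<otimes> h2) \<otimes> inv x = (x \<otimes> h1 \<otimes> inv x) \<otimes> (x \<otimes> h2 \<otimes> inv x)" using x h by (simp add: m_assoc)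
  then show ?case using subgroup.m_closed[OF K eng.IH] by simp
qed

lemma hom_Aut_rat:
  assumes \<rho>: "\<rho> \<in> hom G Aut_rat"
  shows "g \<in> carrier G \<Longrightarrow> \<rho> g \<in> order_aut"
    and "g \<in> carrier G \<Longrightarrow> h \<in> carrier G \<Longrightarrow> \<rho> (g \<otimes> h) x = \<rho> g (\<rho> h x)"
    and "\<rho> \<one> x = x"
    and "g \<in> carrier G \<Longrightarrow> \<rho> (inv g) = finv (\<rho> g)"
proof -
  interpret group_hom G Aut_rat \<rho>
    using \<rho> group_Aut_rat by (intro group_hom.intro group_hom_axioms.intro) (simp_all add: is_group)
  show 1: "\<rho> g \<in> order_aut" if "g \<in> carrier G" for g using hom_closed[OF that] by (simp add: Aut_rat_def)
  show "\<rho> (g \<otimes> h) x = \<rho> g (\<rho> h x)" if "g \<in> carrier G" "h \<in> carrier G"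
    using hom_mult[OF that] by (simp add: Aut_rat_def)
  show "\<rho> \<one> x = x" using hom_one by (simp add: Aut_rat_def)
  show "\<rho> (inv g) = finv (\<rho> g)" if "g \<in> carrier G" using hom_inv[OF that] inv_Aut_rat[OF 1[OF that]] by simp
qed

text \<open>Enumerate the group and choose for each element an action and a point that it moves. Comparing
  two elements by the first of these points at which they differ is a left order.\<close>

lemma left_orders_nonempty:
  assumes "countable (carrier G)"
    and res: "\<And>g. g \<in> carrier G \<Longrightarrow> g \<noteq> \<one> \<Longrightarrow> \<exists>\<rho>\<in>hom G Aut_rat. \<rho> g \<noteq> id"
  shows "left_orders G \<noteq> {}"
proof -
  define e where "e = from_nat_into (carrier G)"
  have e: "e i \<in> carrier G" for i unfolding e_def by (rule from_nat_into) blast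
  have e_surj: "\<exists>i. e i = g" if "g \<in> carrier G" for g
    unfolding e_def using from_nat_into_surj[OF assms(1) that] .
  have "\<forall>i. \<exists>p. fst p \<in> hom G Aut_rat \<and> (e i \<noteq> \<one> \<longrightarrow> fst p (e i) (snd p) \<noteq> snd p)"
  proof
    fix i
    show "\<exists>p. fst p \<in> hom G Aut_rat \<and> (e i \<noteq> \<one> \<longrightarrow> fst p (e i) (snd p) \<noteq> snd p)"
    proof (cases "e i = \<one>")
      case True
      have "(\<lambda>_. id) \<in> hom G Aut_rat" by (simp add: hom_def Aut_rat_def)
      then show ?thesis using True by (intro exI[of _ "(\<lambda>_. id, 0)"]) simp
    next
      case False
      then obtain \<rho> where \<rho>: "\<rho> \<in> hom G Aut_rat" "\<rho> (e i) \<noteq> id" using res[OF e] by blast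
      then obtain y where "\<rho> (e i) y \<noteq> y" by (auto simp: fun_eq_iff)
      then show ?thesis using \<rho>(1) by (intro exI[of _ "(\<rho>, y)"]) simp
    qed
  qed
  from choice[OF this] obtain P where P: "\<And>i. fst (P i) \<in> hom G Aut_rat"
    "\<And>i. e i \<noteq> \<one> \<Longrightarrow> fst (P i) (e i) (snd (P i)) \<noteq> snd (P i)" by blast
  define v where "v g i = fst (P i) g (snd (P i))" for g i
  note hm = hom_Aut_rat[OF P(1)]
  have vl: "v (g \<otimes> f) i < v (g \<otimes> h) i \<longleftrightarrow> v f i < v h i" "v (g \<otimes> f) i = v (g \<otimes> h) i \<longleftrightarrow> v f i = v h i"
    if "g \<in> carrier G" "f \<in> carrier G" "h \<in> carrier G" for g f h i
    using that hm(1)[of g i] by (simp_all add: v_def hm(2))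
  have sep: "\<exists>i. v f i \<noteq> v h i" if f: "f \<in> carrier G" and h: "h \<in> carrier G" and ne: "f \<noteq> h" for f h
  proof -
    obtain i where i: "e i = inv f \<otimes> h" using e_surj[of "inv f \<otimes> h"] f h by auto
    have "e i \<noteq> \<one>"
    proof
      assume "e i = \<one>"
      then have "inv f \<otimes> h = \<one>" using i by simp
      then have "f \<otimes> (inv f \<otimes> h) = f" using f by simp
      then show False using f h ne by (simp add: m_assoc[symmetric])
    qed
    then have "v (inv f \<otimes> h) i \<noteq> v (inv f \<otimes> f) i" using P(2)[of i] i f hm(3) by (simp add: v_def)
    then have "v h i \<noteq> v f i" using vl(2)[of "inv f" h f] f h by simp
    then show ?thesis by (intro exI[of _ i]) simp
  qed
  define lt where "lt f h \<longleftrightarrow> (\<exists>i. v f i < v h i \<and> (\<forall>j<i. v f j = v h j))" for f h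
  have lt_trans: "lt f k" if fh: "lt f h" and hk: "lt h k" for f h k
  proof -
    obtain i where i: "v f i < v h i" "\<forall>j<i. v f j = v h j" using fh unfolding lt_def by blast
    obtain l where l: "v h l < v k l" "\<forall>j<l. v h j = v k j" using hk unfolding lt_def by blast
    have "v f (min i l) < v k (min i l) \<and> (\<forall>j<min i l. v f j = v k j)"
      using i l by (cases i l rule: linorder_cases) (auto simp: min_def)
    then show ?thesis unfolding lt_def by blast
  qed
  have lt_irr: "\<not> lt f f" for f by (simp add: lt_def)
  have lt_total: "lt f h \<or> lt h f" if "f \<in> carrier G" "h \<in> carrier G" "f \<noteq> h" for f h
  proof -
    let ?i = "LEAST i. v f i \<noteq> v h i"
    have 1: "v f ?i \<noteq> v h ?i" using LeastI_ex[OF sep[OF that]] .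
    have 2: "\<forall>j<?i. v f j = v h j" using not_less_Least by blast
    show ?thesis
    proof (cases "v f ?i < v h ?i")
      case True then show ?thesis using 2 unfolding lt_def by blast
    next
      case False
      then have "v h ?i < v f ?i" using 1 by linarith
      then show ?thesis using 2 unfolding lt_def by metis
    qed
  qed
  define r where "r = {(f, h). f \<in> carrier G \<and> h \<in> carrier G \<and> (f = h \<or> lt f h)}"
  have "linear_order_on (carrier G) r"
    unfolding linear_order_on_def partial_order_on_def preorder_on_def
  proof (intro conjI)
    show "r \<subseteq> carrier G \<times> carrier G" by (auto simp: r_def)
    show "refl_on (carrier G) r" by (auto simp: refl_on_def r_def)
    show "trans r"
    proof (rule transI)
      fix x y z assume "(x, y) \<in> r" "(y, z) \<in> r"
      then show "(x, z) \<in> r" using lt_trans[of x y z] by (auto simp: r_def)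
    qed
    show "antisym r"
    proof (rule antisymI)
      fix x y assume "(x, y) \<in> r" "(y, x) \<in> r"
      then show "x = y" using lt_trans[of x y x] lt_irr[of x] by (auto simp: r_def)
    qed
    show "total_on (carrier G) r"
      using lt_total by (auto simp: total_on_def r_def)
  qed
  moreover have "(g \<otimes> f, g \<otimes> h) \<in> r" if "f \<in> carrier G" "h \<in> carrier G" "g \<in> carrier G" "(f, h) \<in> r" for f g h
    using that vl[OF that(3,1,2)] by (auto simp: r_def lt_def)
  ultimately have "r \<in> left_orders G" by (simp add: left_orders_def)
  then show ?thesis by blast
qed

end

definition unit_aut :: "(rat \<Rightarrow> rat) set" where
  "unit_aut = {f \<in> order_aut. f 0 = 0 \<and> f 1 = 1}"

text \<open>On different unit intervals such a map can be chosen independently, and conjugation by an integer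
  translation only shifts the index.\<close>

definition fibrewise :: "(int \<Rightarrow> rat \<Rightarrow> rat) \<Rightarrow> rat \<Rightarrow> rat" where
  "fibrewise F x = of_int \<lfloor>x\<rfloor> + F \<lfloor>x\<rfloor> (x - of_int \<lfloor>x\<rfloor>)"

lemma unit_autD: "f \<in> unit_aut \<Longrightarrow> f \<in> order_aut" "f \<in> unit_aut \<Longrightarrow> f 0 = 0" "f \<in> unit_aut \<Longrightarrow> f 1 = 1"
  by (simp_all add: unit_aut_def)

lemma unit_aut_range:
  assumes "f \<in> unit_aut" "0 \<le> y" "y < 1" shows "0 \<le> f y" "f y < 1"
  using assms order_aut_le[OF unit_autD(1), of f 0 y] order_aut_less[OF unit_autD(1), of f y 1]
  by (simp_all add: unit_autD)

lemma unit_aut_comp: "f \<in> unit_aut \<Longrightarrow> g \<in> unit_aut \<Longrightarrow> f \<circ> g \<in> unit_aut"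
  by (simp add: unit_aut_def)

lemma unit_aut_finv: "f \<in> unit_aut \<Longrightarrow> finv f \<in> unit_aut"
  by (simp add: unit_aut_def order_aut_inv_eq)

lemma unit_aut_id: "id \<in> unit_aut"
  by (simp add: unit_aut_def)

lemma unit_aut_cword: "(\<And>j. j < m \<Longrightarrow> a j \<in> unit_aut \<and> b j \<in> unit_aut) \<Longrightarrow> cword a b m \<in> unit_aut"
proof (induction m)
  case (Suc m)
  then have "a m \<in> unit_aut" "b m \<in> unit_aut" "cword a b m \<in> unit_aut" by simp_all
  then show ?case unfolding cword.simps commutator_def by (intro unit_aut_comp unit_aut_finv)
qed (simp add: unit_aut_id)

lemma fibrewise_parts:
  assumes "\<And>j. F j \<in> unit_aut"
  shows "\<lfloor>fibrewise F x\<rfloor> = \<lfloor>x\<rfloor>" "fibrewise F x - of_int \<lfloor>x\<rfloor> = F \<lfloor>x\<rfloor> (x - of_int \<lfloor>x\<rfloor>)"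
proof -
  have x: "0 \<le> x - of_int \<lfloor>x\<rfloor>" "x - of_int \<lfloor>x\<rfloor> < 1" by linarith+
  have "0 \<le> F \<lfloor>x\<rfloor> (x - of_int \<lfloor>x\<rfloor>)" "F \<lfloor>x\<rfloor> (x - of_int \<lfloor>x\<rfloor>) < 1" 
    using unit_aut_range[OF assms x] .
  then show "\<lfloor>fibrewise F x\<rfloor> = \<lfloor>x\<rfloor>" unfolding fibrewise_def by (intro floor_unique) linarith+
  show "fibrewise F x - of_int \<lfloor>x\<rfloor> = F \<lfloor>x\<rfloor> (x - of_int \<lfloor>x\<rfloor>)" by (simp add: fibrewise_def)
qed

lemma fibrewise_comp:
  assumes "\<And>j. F j \<in> unit_aut" "\<And>j. F' j \<in> unit_aut"
  shows "fibrewise F \<circ> fibrewise F' = fibrewise (\<lambda>j. F j \<circ> F' j)"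
proof (rule ext)
  fix x
  show "(fibrewise F \<circ> fibrewise F') x = fibrewise (\<lambda>j. F j \<circ> F' j) x"
    unfolding o_apply fibrewise_def[of F] fibrewise_parts[OF assms(2)]
    by (simp add: fibrewise_def)
qed

lemma fibrewise_id: "fibrewise (\<lambda>j. id) = id"
  by (simp add: fibrewise_def fun_eq_iff)

lemma fibrewise_inverse:
  assumes "\<And>j. F j \<in> unit_aut"
  shows "fibrewise F (fibrewise (\<lambda>j. finv (F j)) x) = x"
proof -
  have "(\<lambda>j. F j \<circ> finv (F j)) = (\<lambda>j. id)" using unit_autD(1)[OF assms] by (simp add: fun_eq_iff)
  then have "fibrewise F \<circ> fibrewise (\<lambda>j. finv (F j)) = id"
    using fibrewise_comp[of F "\<lambda>j. finv (F j)"] assms unit_aut_finv[OF assms] fibrewise_id by simp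
  then show ?thesis by (simp add: fun_eq_iff)
qed

lemma fibrewise_aut:
  assumes F: "\<And>j. F j \<in> unit_aut"
  shows "fibrewise F \<in> order_aut"
proof (rule order_autI)
  fix x y :: rat assume xy: "x < y"
  show "fibrewise F x < fibrewise F y"
  proof (cases "\<lfloor>x\<rfloor> = \<lfloor>y\<rfloor>")
    case True
    then show ?thesis using xy unit_autD(1)[OF F] by (simp add: fibrewise_def)
  next
    case False
    then have "\<lfloor>x\<rfloor> < \<lfloor>y\<rfloor>" using floor_mono[of x y] xy by linarith
    then have "\<lfloor>fibrewise F x\<rfloor> < \<lfloor>fibrewise F y\<rfloor>" using fibrewise_parts(1)[OF F] by simp
    then show ?thesis by (rule floor_less_cancel)
  qed
next
  show "\<exists>x. fibrewise F x = z" for z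
    using fibrewise_inverse[of F z] F by (intro exI[of _ "fibrewise (\<lambda>j. finv (F j)) z"]) simp
qed

lemma fibrewise_finv:
  assumes F: "\<And>j. F j \<in> unit_aut"
  shows "finv (fibrewise F) = fibrewise (\<lambda>j. finv (F j))"
  by (rule ext) (simp add: order_aut_inv_eq[OF fibrewise_aut[OF F]] fibrewise_inverse[OF F])

lemma fibrewise_commutator:
  assumes "\<And>j. F j \<in> unit_aut" "\<And>j. F' j \<in> unit_aut"
  shows "commutator (fibrewise F) (fibrewise F') = fibrewise (\<lambda>j. commutator (F j) (F' j))"
  unfolding commutator_def fibrewise_finv[OF assms(1)] fibrewise_finv[OF assms(2)]
  using assms by (simp add: fibrewise_comp unit_aut_comp unit_aut_finv)

lemma fibrewise_cword:
  assumes "\<And>j i. j < m \<Longrightarrow> F j i \<in> unit_aut \<and> F' j i \<in> unit_aut"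
  shows "cword (\<lambda>j. fibrewise (F j)) (\<lambda>j. fibrewise (F' j)) m = fibrewise (\<lambda>i. cword (\<lambda>j. F j i) (\<lambda>j. F' j i) m)"
  using assms
proof (induction m)
  case 0 show ?case by (simp only: cword.simps fibrewise_id)
next
  case (Suc m)
  have F: "F m i \<in> unit_aut" "F' m i \<in> unit_aut" for i using Suc.prems[of m i] by simp_all
  have IH: "cword (\<lambda>j. fibrewise (F j)) (\<lambda>j. fibrewise (F' j)) m = fibrewise (\<lambda>i. cword (\<lambda>j. F j i) (\<lambda>j. F' j i) m)"
    by (rule Suc.IH) (simp add: Suc.prems)
  have u: "cword (\<lambda>j. F j i) (\<lambda>j. F' j i) m \<in> unit_aut" for i by (rule unit_aut_cword) (simp add: Suc.prems)
  have u': "commutator (F m i) (F' m i) \<in> unit_aut" for i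
    unfolding commutator_def by (intro unit_aut_comp unit_aut_finv F)
  show ?case by (simp only: cword.simps IH fibrewise_commutator fibrewise_comp F u u')
qed

text \<open>For the last handle, made of the unit translation and a fibrewise map, the commutator compares
  the parts of the map on neighbouring intervals. This turns the surface relation into a
  recursion along the integers.\<close>

lemma translation_fibrewise:
  "commutator (\<lambda>x. x + 1) (fibrewise F) = fibrewise (\<lambda>j. F (j - 1)) \<circ> finv (fibrewise F)"
  by (simp add: commutator_def finv_translation fibrewise_def fun_eq_iff algebra_simps)

text \<open>Cascading: the values on one interval determine those on all others.\<close>

lemma cascade_exists:
  assumes W: "\<And>i. W i \<in> unit_aut" and b: "b \<in> unit_aut"
  shows "\<exists>F :: int \<Rightarrow> rat \<Rightarrow> rat. (\<forall>i. F i \<in> unit_aut) \<and> F 0 = b \<and> (\<forall>i. F i = W i \<circ> F (i - 1))"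
proof -
  define up where "up = rec_nat b (\<lambda>k f. W (int k + 1) \<circ> f)"
  define dn where "dn = rec_nat b (\<lambda>k f. finv (W (- int k)) \<circ> f)"
  define F where "F i = (if 0 \<le> i then up (nat i) else dn (nat (- i)))" for i :: int
  have up: "up 0 = b" "up (Suc k) = W (int k + 1) \<circ> up k" for k by (simp_all add: up_def)
  have dn: "dn 0 = b" "dn (Suc k) = finv (W (- int k)) \<circ> dn k" for k by (simp_all add: dn_def)
  have up_u: "up k \<in> unit_aut" for k by (induction k) (simp_all only: up b W unit_aut_comp)
  have dn_u: "dn k \<in> unit_aut" for k by (induction k) (simp_all only: dn b W unit_aut_comp unit_aut_finv)
  show ?thesis
  proof (intro exI[of _ F] conjI allI)
    show "F i \<in> unit_aut" for i by (simp add: F_def up_u dn_u)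
    show "F 0 = b" by (simp add: F_def up)
    show "F i = W i \<circ> F (i - 1)" for i
    proof (cases "0 < i")
      case True
      then obtain k where "i = int (Suc k)" by (metis gr0_conv_Suc zero_less_imp_eq_int)
      then show ?thesis by (simp add: F_def up nat_add_distrib del: of_nat_Suc) (simp add: up algebra_simps)
    next
      case False
      define k where "k = nat (- i)"
      have i: "i = - int k" "nat (1 - i) = Suc k" using False by (simp_all add: k_def)
      have Fi: "F i = dn k" using False by (cases "i = 0") (simp_all add: F_def k_def up dn)
      have "F (i - 1) = dn (Suc k)" using False i by (simp add: F_def)
      then have "W i \<circ> F (i - 1) = dn k" using unit_autD(1)[OF W, of i] i by (simp add: dn fun_eq_iff)
      then show ?thesis using Fi by simp
    qed
  qed
qed

section \<open>Surface groups are left-orderable\<close>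

text \<open>A presentation by handles with one relation. The universal property concerns actions on the rational
  line, since left orders are studied through these.\<close>

locale surface_presentation = group G for G (structure) +
  fixes A B :: "nat \<Rightarrow> 'a" and m :: nat
  assumes m_pos: "0 < m"
    and A_closed: "\<And>j. j < Suc m \<Longrightarrow> A j \<in> carrier G"
    and B_closed: "\<And>j. j < Suc m \<Longrightarrow> B j \<in> carrier G"
    and generated: "carrier G = generate G (A ` {..<Suc m} \<union> B ` {..<Suc m})"
    and relation: "surface_word G A B (Suc m) = \<one>"
    and universal: "\<And>a b. (\<And>j. j < Suc m \<Longrightarrow> a j \<in> order_aut \<and> b j \<in> order_aut) \<Longrightarrow> cword a b (Suc m) = id
      \<Longrightarrow> \<exists>h\<in>hom G Aut_rat. \<forall>j<Suc m. h (A j) = a j \<and> h (B j) = b j"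
begin

abbreviation t where "t \<equiv> A m"

lemma t_closed [simp]: "t \<in> carrier G"
  using A_closed by simp

lemma countable_carrier: "countable (carrier G)"
  by (subst generated, rule countable_generate) (use A_closed B_closed in auto)

text \<open>Generators of the kernel of the homomorphism that sends \<open>A m\<close> to 1 and all other
  generators to 0. Conjugates of \<open>B m\<close> are not among them, as the relation
  expresses these by the others.\<close>

fun el :: "(bool \<times> nat \<times> int) option \<Rightarrow> 'a" where
  "el None = B m"
| "el (Some (c, j, k)) = t [^] k \<otimes> (if c then A j else B j) \<otimes> inv (t [^] k)"

definition idx :: "(bool \<times> nat \<times> int) option set" where
  "idx = insert None {Some (c, j, k) |c j k. j < m}"

lemma idxE:
  assumes "i \<in> idx"
  obtains "i = None" | c j k where "i = Some (c, j, k)" "j < m"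
  using assms unfolding idx_def by auto

lemma gen_closed: "j < m \<Longrightarrow> (if c then A j else B j) \<in> carrier G"
  using A_closed B_closed by simp

lemma el_closed: "i \<in> idx \<Longrightarrow> el i \<in> carrier G"
  by (erule idxE) (use B_closed gen_closed in auto)

definition N :: "'a set" where "N = generate G (el ` idx)"

lemma subgroup_N: "subgroup N G"
  unfolding N_def by (rule generate_is_subgroup) (use el_closed in auto)

lemma N_closed: "f \<in> N \<Longrightarrow> f \<in> carrier G"
  using subgroup.subset[OF subgroup_N] by auto

lemma el_N: "i \<in> idx \<Longrightarrow> el i \<in> N"
  unfolding N_def by (intro generate.incl) simp

lemma el_conj:
  assumes "j < m"
  shows "t [^] l \<otimes> el (Some (c, j, k)) \<otimes> inv (t [^] (l::int)) = el (Some (c, j, l + k))"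
  using gen_closed[OF assms, of c] by (simp add: int_pow_mult inv_mult_group m_assoc)

lemma gen_eq_el: "j < m \<Longrightarrow> (if c then A j else B j) = el (Some (c, j, 0))"
  using gen_closed[of j c] by simp

lemma gen_N: "j < m \<Longrightarrow> A j \<in> N" "j < m \<Longrightarrow> B j \<in> N"
proof -
  have "el (Some (c, j, 0)) \<in> N" if "j < m" for c by (rule el_N) (use that in \<open>auto simp: idx_def\<close>)
  then show "j < m \<Longrightarrow> A j \<in> N" "j < m \<Longrightarrow> B j \<in> N"
    using gen_eq_el[of j True] gen_eq_el[of j False] by (metis (full_types))+
qed

definition W where "W = surface_word G A B m"

lemma W_generate: "W \<in> generate G ((\<lambda>(c, j). el (Some (c, j, 0))) ` (UNIV \<times> {..<m}))"
proof -
  let ?S = "(\<lambda>(c, j). el (Some (c, j, 0))) ` (UNIV \<times> {..<m})"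
  have S: "A j \<in> ?S" "B j \<in> ?S" if "j < m" for j
  proof -
    have "A j = (\<lambda>(c, j). el (Some (c, j, 0))) (True, j)" "B j = (\<lambda>(c, j). el (Some (c, j, 0))) (False, j)"
      using gen_eq_el[OF that, of True] gen_eq_el[OF that, of False] by simp_all
    then show "A j \<in> ?S" "B j \<in> ?S" using that by blast+
  qed
  have "surface_word G A B n \<in> generate G ?S" if "n \<le> m" for n
    using that
  proof (induction n)
    case (Suc n)
    then have n: "n < m" and IH: "surface_word G A B n \<in> generate G ?S" by auto
    note a = S(1)[OF n] and b = S(2)[OF n]
    show ?case unfolding surface_word.simps
      by (rule generate.eng[OF IH generate.eng[OF generate.eng[OF generate.eng[OF generate.incl[OF a]
        generate.incl[OF b]] generate.inv[OF a]] generate.inv[OF b]]])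
  qed (simp add: generate.one)
  then show ?thesis unfolding W_def by simp
qed

lemma W_N: "W \<in> N"
proof -
  have "generate G ((\<lambda>(c, j). el (Some (c, j, 0))) ` (UNIV \<times> {..<m})) \<subseteq> N"
    by (rule generate_subgroup_incl[OF _ subgroup_N]) (auto intro!: el_N simp: idx_def simp del: el.simps)
  then show ?thesis using W_generate by blast
qed

lemma W_closed [simp]: "W \<in> carrier G"
  using W_N N_closed by blast

lemma b_closed [simp]: "B m \<in> carrier G"
  using B_closed by simp

text \<open>The surface relation, solved for the conjugate of the last generator.\<close>

lemma t_b: "W \<otimes> (t \<otimes> B m \<otimes> inv t) = B m"
proof -
  have "W \<otimes> (t \<otimes> B m \<otimes> inv t \<otimes> inv (B m)) = \<one>" using relation by (simp add: W_def)
  then have "W \<otimes> (t \<otimes> B m \<otimes> inv t) \<otimes> inv (B m) = \<one>" by (simp add: m_assoc)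
  then have "W \<otimes> (t \<otimes> B m \<otimes> inv t) = inv (inv (B m))" by (intro inv_equality[symmetric]) simp_all
  then show ?thesis by simp
qed

lemma conj_N:
  assumes f: "f \<in> N"
  shows "t \<otimes> f \<otimes> inv t \<in> N" "inv t \<otimes> f \<otimes> t \<in> N"
proof -
  have S: "el ` idx \<subseteq> carrier G" using el_closed by blast
  have "t \<otimes> B m \<otimes> inv t = inv W \<otimes> B m"
    using inv_solve_left[of "t \<otimes> B m \<otimes> inv t" W "B m"] t_b by simp
  then have 1: "t \<otimes> B m \<otimes> inv t \<in> N"
    using subgroup.m_closed[OF subgroup_N subgroup.m_inv_closed[OF subgroup_N W_N] el_N[of None]]
    by (simp add: idx_def)
  show "t \<otimes> f \<otimes> inv t \<in> N"
  proof (rule conj_generate[OF t_closed S subgroup_N])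
    show "f \<in> generate G (el ` idx)" using f by (simp add: N_def)
    fix s assume "s \<in> el ` idx"
    then obtain i where i: "s = el i" "i \<in> idx" by blast
    show "t \<otimes> s \<otimes> inv t \<in> N"
      using i(2)
    proof (cases rule: idxE)
      case 1 then show ?thesis using i \<open>t \<otimes> B m \<otimes> inv t \<in> N\<close> by simp
    next
      case (2 c j k)
      then have "t \<otimes> s \<otimes> inv t = el (Some (c, j, 1 + k))" using el_conj[of j 1 c k] i by simp
      then show ?thesis using el_N[of "Some (c, j, 1 + k)"] 2 by (simp add: idx_def)
    qed
  qed
  have c: "inv t \<otimes> el (Some (c, j, k)) \<otimes> t = el (Some (c, j, k - 1))" if "j < m" for c j k
    using el_conj[OF that, of "-1" c k] by (simp add: int_pow_neg)
  have "inv t \<otimes> W \<otimes> inv (inv t) \<in> N"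
  proof (rule conj_generate[OF _ _ subgroup_N _ W_generate])
    fix s assume "s \<in> (\<lambda>(c, j). el (Some (c, j, 0))) ` (UNIV \<times> {..<m})"
    then obtain c' j where s: "s = el (Some (c', j, 0))" "j < m" by (auto simp del: el.simps)
    then have "inv t \<otimes> s \<otimes> inv (inv t) = el (Some (c', j, - 1))" using c[OF s(2), of c' 0] by simp
    then show "inv t \<otimes> s \<otimes> inv (inv t) \<in> N" using el_N[of "Some (c', j, - 1)"] s by (simp add: idx_def)
  qed (use S in \<open>auto simp: idx_def simp del: el.simps intro!: el_closed\<close>)
  then have "inv t \<otimes> W \<otimes> t \<in> N" by simp
  moreover have "inv t \<otimes> B m \<otimes> t = (inv t \<otimes> W \<otimes> t) \<otimes> B m"
  proof -
    have "inv t \<otimes> B m \<otimes> t = inv t \<otimes> (W \<otimes> (t \<otimes> B m \<otimes> inv t)) \<otimes> t" using t_b by simp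
    also have "\<dots> = (inv t \<otimes> W \<otimes> t) \<otimes> B m" by (simp add: m_assoc)
    finally show ?thesis .
  qed
  ultimately have 2: "inv t \<otimes> B m \<otimes> t \<in> N"
    using subgroup.m_closed[OF subgroup_N _ el_N[of None]] by (simp add: idx_def)
  have "inv t \<otimes> f \<otimes> inv (inv t) \<in> N"
  proof (rule conj_generate[OF _ S subgroup_N])
    show "f \<in> generate G (el ` idx)" using f by (simp add: N_def)
    fix s assume "s \<in> el ` idx"
    then obtain i where i: "s = el i" "i \<in> idx" by blast
    show "inv t \<otimes> s \<otimes> inv (inv t) \<in> N"
      using i(2)
    proof (cases rule: idxE)
      case 1 then show ?thesis using i 2 by simp
    next
      case (2 c' j k)
      then have "inv t \<otimes> s \<otimes> inv (inv t) = el (Some (c', j, k - 1))" using c[of j c' k] i by simp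
      then show ?thesis using el_N[of "Some (c', j, k - 1)"] 2 by (simp add: idx_def)
    qed
  qed simp
  then show "inv t \<otimes> f \<otimes> t \<in> N" by simp
qed

lemma generate_left_mult:
  assumes "g \<in> generate G (A ` {..<Suc m} \<union> B ` {..<Suc m})" "f \<in> N"
  shows "\<exists>f'\<in>N. \<exists>k'::int. g \<otimes> (f \<otimes> t [^] (k::int)) = f' \<otimes> t [^] k'"
  using assms
proof (induction arbitrary: f k)
  case one
  then show ?case using N_closed by (intro bexI[of _ f] exI[of _ k]) simp_all
next
  case (incl h)
  have f: "f \<in> carrier G" using N_closed incl by blast
  show ?case
  proof (cases "h = t")
    case True
    have "t \<otimes> (f \<otimes> t [^] k) = (t \<otimes> f \<otimes> inv t) \<otimes> t [^] (1 + k)" using f by (simp add: int_pow_mult m_assoc) (simp add: m_assoc[symmetric])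
    then show ?thesis using True conj_N(1)[OF incl(2)] by blast
  next
    case False
    then have "h \<in> N" using incl(1) gen_N el_N[of None] by (auto simp: less_Suc_eq idx_def)
    then have "h \<otimes> f \<in> N" "h \<in> carrier G" using subgroup.m_closed[OF subgroup_N] incl(2) N_closed by auto
    then show ?thesis using f by (intro bexI[of _ "h \<otimes> f"] exI[of _ k]) (simp_all add: m_assoc)
  qed
next
  case (inv h)
  have f: "f \<in> carrier G" using N_closed inv by blast
  show ?case
  proof (cases "h = t")
    case True
    have "inv t \<otimes> (f \<otimes> t [^] k) = (inv t \<otimes> f \<otimes> t) \<otimes> t [^] (- 1 + k)"
      using f unfolding int_pow_mult[OF t_closed] int_pow_neg[OF t_closed]
      by (simp add: m_assoc) (simp add: m_assoc[symmetric])
    then show ?thesis using True conj_N(2)[OF inv(2)] by blast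
  next
    case False
    then have "h \<in> N" using inv(1) gen_N el_N[of None] by (auto simp: less_Suc_eq idx_def)
    then have "inv h \<in> N" using subgroup.m_inv_closed[OF subgroup_N] by blast
    then have "inv h \<otimes> f \<in> N" "inv h \<in> carrier G" using subgroup.m_closed[OF subgroup_N] inv(2) N_closed by auto
    then show ?thesis using f by (intro bexI[of _ "inv h \<otimes> f"] exI[of _ k]) (simp_all add: m_assoc)
  qed
next
  case (eng h1 h2)
  obtain f' k' where f': "f' \<in> N" "h2 \<otimes> (f \<otimes> t [^] k) = f' \<otimes> t [^] (k' :: int)" using eng.IH(2)[OF eng.prems, of k] by blast
  obtain f'' k'' where f'': "f'' \<in> N" "h1 \<otimes> (f' \<otimes> t [^] k') = f'' \<otimes> t [^] (k'' :: int)" using eng.IH(1)[OF f'(1), of k'] by blast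
  have "h1 \<in> carrier G" "h2 \<in> carrier G" "f \<in> carrier G" using eng generated N_closed by auto
  then have "h1 \<otimes> h2 \<otimes> (f \<otimes> t [^] k) = f'' \<otimes> t [^] k''" using f' f'' by (simp add: m_assoc)
  then show ?case using f'' by blast
qed

text \<open>Since \<open>N\<close> is normalised by \<open>t\<close>, the products of elements of
  \<open>N\<close> with powers of \<open>t\<close> are closed under multiplication by the
  generators.\<close>

lemma decompose:
  assumes "g \<in> carrier G"
  obtains f and k :: int where "f \<in> N" "g = f \<otimes> t [^] k"
proof -
  have "\<one> \<in> N" using subgroup.one_closed[OF subgroup_N] .
  then obtain f' k' where "f' \<in> N" "g \<otimes> (\<one> \<otimes> t [^] (0::int)) = f' \<otimes> t [^] (k' :: int)"
    using generate_left_mult[of g \<one> 0] assms generated by auto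
  then show ?thesis using that[of f' k'] assms by simp
qed

lemma hom_t_pow:
  assumes \<rho>: "\<rho> \<in> hom G Aut_rat" and t: "\<rho> t = (\<lambda>x. x + 1)"
  shows "\<rho> (t [^] (k::int)) x = x + of_int k"
proof (induction k arbitrary: x rule: int_induct[where k = 0])
  case base
  then show ?case using hom_Aut_rat(3)[OF \<rho>] by simp
next
  case (step1 i)
  have "\<rho> (t [^] (i + 1)) x = \<rho> (t [^] i) (\<rho> t x)"
    using hom_Aut_rat(2)[OF \<rho>, of "t [^] i" t] by (simp add: int_pow_mult)
  then show ?case using step1 t by simp
next
  case (step2 i)
  have "\<rho> (t [^] (i - 1)) x = \<rho> (t [^] i) (\<rho> (inv t) x)"
    using hom_Aut_rat(2)[OF \<rho>, of "t [^] i" "inv t"] by (simp add: int_pow_diff)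
  also have "\<rho> (inv t) x = x - 1"
    using hom_Aut_rat(4)[OF \<rho>, of t] t finv_translation[of 1] by simp
  finally show ?case using step2 by simp
qed

text \<open>With \<open>t\<close> acting as the unit translation, the conjugate of a generator by
  \<open>t\<^sup>k\<close> acts on the unit interval as the generator acts on the interval
  starting at \<open>-k\<close>, and these actions may be chosen independently. The parts of
  \<open>B m\<close> on the various intervals are related by the surface relation, but that on
  the unit interval is free and determines the others.\<close>

lemma exists_free_hom:
  assumes \<sigma>: "\<And>i. \<sigma> i \<in> unit_aut"
  obtains \<rho> where "\<rho> \<in> hom G Aut_rat" "\<And>i x. i \<in> idx \<Longrightarrow> 0 \<le> x \<Longrightarrow> x < 1 \<Longrightarrow> \<rho> (el i) x = \<sigma> i x"
proof -
  \<comment> \<open>the sign accounts for conjugation by \<open>t\<^sup>k\<close> moving the interval at \<open>-k\<close> to the unit interval\<close>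
  define FA FB where "FA j i = \<sigma> (Some (True, j, - i))" and "FB j i = \<sigma> (Some (False, j, - i))" for j i
  define V where "V i = cword (\<lambda>j. FA j i) (\<lambda>j. FB j i) m" for i
  have V: "V i \<in> unit_aut" for i unfolding V_def by (rule unit_aut_cword) (simp add: FA_def FB_def \<sigma>)
  have "\<exists>F. (\<forall>i. F i \<in> unit_aut) \<and> F 0 = \<sigma> None \<and> (\<forall>i. F i = V i \<circ> F (i - 1))"
    by (rule cascade_exists[of V, OF V \<sigma>])
  then obtain F where F: "(\<forall>i. F i \<in> unit_aut) \<and> F 0 = \<sigma> None \<and> (\<forall>i. F i = V i \<circ> F (i - 1))" by (rule exE)
  note F = F[THEN conjunct1, THEN spec] F[THEN conjunct2, THEN conjunct1] F[THEN conjunct2, THEN conjunct2, THEN spec]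
  define a where "a j = (if j < m then fibrewise (FA j) else (\<lambda>x. x + 1))" for j
  define b where "b j = (if j < m then fibrewise (FB j) else fibrewise F)" for j
  have FAB: "FA j i \<in> unit_aut" "FB j i \<in> unit_aut" for i j by (simp_all add: FA_def FB_def \<sigma>)
  have aut: "a j \<in> order_aut \<and> b j \<in> order_aut" for j
    using fibrewise_aut[of "FA j", OF FAB(1)] fibrewise_aut[of "FB j", OF FAB(2)] fibrewise_aut[of F, OF F(1)]
    by (simp add: a_def b_def)
  have "cword a b m = cword (\<lambda>j. fibrewise (FA j)) (\<lambda>j. fibrewise (FB j)) m"
    by (rule cword_cong) (simp add: a_def b_def)
  also have "\<dots> = fibrewise (\<lambda>i. cword (\<lambda>j. FA j i) (\<lambda>j. FB j i) m)"
    by (rule fibrewise_cword) (simp only: FAB)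
  also have "\<dots> = fibrewise V" by (simp only: V_def[symmetric])
  finally have w: "cword a b m = fibrewise V" .
  have "fibrewise V \<circ> fibrewise (\<lambda>j. F (j - 1)) = fibrewise (\<lambda>j. V j \<circ> F (j - 1))"
    by (rule fibrewise_comp) (simp_all only: V F(1))
  also have "(\<lambda>j. V j \<circ> F (j - 1)) = F" by (rule ext) (rule F(3)[symmetric])
  finally have vf: "fibrewise V (fibrewise (\<lambda>j. F (j - 1)) x) = fibrewise F x" for x by (simp add: fun_eq_iff)
  have "fibrewise F \<in> order_aut" by (rule fibrewise_aut) (rule F(1))
  then have "cword a b (Suc m) = id"
    using translation_fibrewise[of F] vf by (simp add: w a_def b_def fun_eq_iff)
  then have "\<exists>h\<in>hom G Aut_rat. \<forall>j<Suc m. h (A j) = a j \<and> h (B j) = b j"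
    by (intro universal) (simp_all only: aut)
  then obtain \<rho> where \<rho>: "\<rho> \<in> hom G Aut_rat" "\<And>j. j < Suc m \<Longrightarrow> \<rho> (A j) = a j \<and> \<rho> (B j) = b j"
    by blast
  have t: "\<rho> t = (\<lambda>x. x + 1)" using \<rho>(2)[of m] by (simp add: a_def)
  show ?thesis
  proof (rule that[OF \<rho>(1)])
    fix i and x :: rat assume i: "i \<in> idx" and x: "0 \<le> x" "x < 1"
    have fl: "\<lfloor>x\<rfloor> = 0" using x by (intro floor_unique) simp_all
    show "\<rho> (el i) x = \<sigma> i x"
      using i
    proof (cases rule: idxE)
      case 1
      then show ?thesis using \<rho>(2)[of m] F(2) fl by (simp add: b_def fibrewise_def)
    next
      case (2 c j k)
      let ?s = "if c then A j else B j"
      have s: "?s \<in> carrier G" using gen_closed 2 by blast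
      have "\<rho> ?s = fibrewise (if c then FA j else FB j)" using \<rho>(2)[of j] 2 by (simp add: a_def b_def)
      then have s\<rho>: "\<rho> ?s y = fibrewise (if c then FA j else FB j) y" for y by simp
      have "\<rho> (el i) x = \<rho> (t [^] k) (\<rho> ?s (\<rho> (t [^] (- k)) x))"
        unfolding 2(1) el.simps int_pow_neg[OF t_closed, of k, symmetric]
        by (simp only: hom_Aut_rat(2)[OF \<rho>(1)] s t_closed int_pow_closed m_closed)
      also have "\<dots> = fibrewise (if c then FA j else FB j) (x - of_int k) + of_int k"
        unfolding hom_t_pow[OF \<rho>(1) t] s\<rho> by simp
      also have "\<lfloor>x - of_int k\<rfloor> = - k" using fl by simp
      then have "fibrewise (if c then FA j else FB j) (x - of_int k) = - of_int k + (if c then FA j else FB j) (- k) x"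
        by (simp add: fibrewise_def)
      also have "- of_int k + (if c then FA j else FB j) (- k) x + of_int k = \<sigma> i x"
        using 2(1) by (simp add: FA_def FB_def)
      finally show ?thesis .
    qed
  qed
qed

text \<open>Spell the element by a reduced word. Prescribe for each letter finitely many values in such a
  way that the word moves a point \<open>q L\<close> step by step through \<open>q (L -
  1)\<close>, and so on, to \<open>q 0\<close>. The prescriptions are consistent: since no
  letter is followed by its inverse, those for one letter form a finite order-preserving
  relation.\<close>

lemma residual_N:
  assumes f: "f \<in> N" "f \<noteq> \<one>"
  shows "\<exists>\<rho>\<in>hom G Aut_rat. \<rho> f \<noteq> id"
proof -
  obtain l0 where l0: "set l0 \<subseteq> idx \<times> UNIV" "f = word_value G el l0"
    using generate_word[of idx el f] f(1) el_closed unfolding N_def by blast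
  then obtain l where l: "set l \<subseteq> idx \<times> UNIV" "reduced l" "f = word_value G el l"
    using reduced_word_exists[of idx el l0] el_closed by auto
  define L where "L = length l"
  have L: "0 < L" using l(3) f(2) by (cases l) (simp_all add: L_def)
  \<comment> \<open>any decreasing sequence inside the unit interval would do\<close>
  define q :: "nat \<Rightarrow> rat" where "q r = 1 / (of_nat r + 2)" for r
  have q: "q u < q v \<longleftrightarrow> v < u" "0 < q u" "q u < 1" "q u \<noteq> 0" "q u \<noteq> 1" "\<not> q u < 0" "\<not> 1 < q u" for u v
    by (auto simp: q_def divide_simps)
  have adj: "r' < Suc r \<longleftrightarrow> Suc r' < r" "r < Suc r' \<longleftrightarrow> Suc r < r'"
    if "r < L" "r' < L" "l ! r = (i, True)" "l ! r' = (i, False)" for r r' i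
  proof -
    have "r \<noteq> r'" using that by auto
    moreover have "r \<noteq> Suc r'" using l(2)[unfolded reduced_def, THEN spec, of r'] that by (auto simp: L_def)
    moreover have "r' \<noteq> Suc r" using l(2)[unfolded reduced_def, THEN spec, of r] that by (auto simp: L_def)
    ultimately show "r' < Suc r \<longleftrightarrow> Suc r' < r" "r < Suc r' \<longleftrightarrow> Suc r < r'" by auto
  qed
  define S where "S i = {(0, 0), (1, 1)} \<union> (\<lambda>r. (q (Suc r), q r)) ` {r. r < L \<and> l ! r = (i, True)}
    \<union> (\<lambda>r. (q r, q (Suc r))) ` {r. r < L \<and> l ! r = (i, False)}" for i
  have "\<exists>g. g \<in> unit_aut \<and> (\<forall>x y. (x, y) \<in> S i \<longrightarrow> g x = y)" for i
  proof -
    have mono: "x < y \<longleftrightarrow> x' < y'" if "(x, x') \<in> S i" "(y, y') \<in> S i" for x x' y y'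
      using that unfolding S_def by (auto simp: q adj)
    have "\<exists>g. g \<in> order_aut \<and> (\<forall>x y. (x, y) \<in> S i \<longrightarrow> g x = y)"
    proof (rule order_aut_extending[of "S i"])
      show "finite (S i)" unfolding S_def by simp
      fix g assume "g \<in> order_aut" "\<And>x q. (x, q) \<in> S i \<Longrightarrow> g x = q"
      then show "\<exists>g. g \<in> order_aut \<and> (\<forall>x y. (x, y) \<in> S i \<longrightarrow> g x = y)"
        by (intro exI[of _ g]) simp
    qed (rule mono)
    then obtain g where g: "g \<in> order_aut" "\<And>x y. (x, y) \<in> S i \<Longrightarrow> g x = y" by blast
    have "g 0 = 0" "g 1 = 1" by (intro g(2); simp add: S_def)+
    then show ?thesis using g by (intro exI[of _ g]) (simp add: unit_aut_def)
  qed
  then have "\<exists>\<sigma>. \<forall>i. \<sigma> i \<in> unit_aut \<and> (\<forall>x y. (x, y) \<in> S i \<longrightarrow> \<sigma> i x = y)"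
    by (intro choice allI)
  then obtain \<sigma> where \<sigma>0: "\<forall>i. \<sigma> i \<in> unit_aut \<and> (\<forall>x y. (x, y) \<in> S i \<longrightarrow> \<sigma> i x = y)" by (rule exE)
  have \<sigma>: "\<And>i. \<sigma> i \<in> unit_aut" "\<And>i x y. (x, y) \<in> S i \<Longrightarrow> \<sigma> i x = y"
    using \<sigma>0 by simp_all
  obtain \<rho> where \<rho>: "\<rho> \<in> hom G Aut_rat" "\<And>i x. i \<in> idx \<Longrightarrow> 0 \<le> x \<Longrightarrow> x < 1 \<Longrightarrow> \<rho> (el i) x = \<sigma> i x"
    using exists_free_hom[of \<sigma>] \<sigma>(1) by blast
  have "\<rho> (word_value G el (drop (L - n) l)) (q L) = q (L - n)" if "n \<le> L" for n
    using that
  proof (induction n)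
    case 0
    then show ?case using hom_Aut_rat(3)[OF \<rho>(1)] by (simp add: L_def)
  next
    case (Suc n)
    define r where "r = L - Suc n"
    have r: "r < L" "L - n = Suc r" using Suc.prems by (auto simp: r_def)
    define i s where "i = fst (l ! r)" and "s = snd (l ! r)"
    then have lr: "l ! r = (i, s)" by simp
    have i: "i \<in> idx" using nth_mem[of r l] r(1) l(1) lr by (auto simp: L_def)
    have d: "drop r l = (i, s) # drop (Suc r) l" using Cons_nth_drop_Suc[of r l] r(1) lr by (simp add: L_def)
    have "set (drop (Suc r) l) \<subseteq> idx \<times> UNIV" using l(1) set_drop_subset[of "Suc r" l] by blast
    then have c: "word_value G el (drop (Suc r) l) \<in> carrier G" "el i \<in> carrier G"
      using word_value_closed[of idx el] el_closed i by auto
    have IH: "\<rho> (word_value G el (drop (Suc r) l)) (q L) = q (Suc r)" using Suc r by simp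
    have "\<rho> (word_value G el (drop r l)) (q L) = q r"
    proof (cases s)
      case True
      then have "(q (Suc r), q r) \<in> S i" using lr r by (auto simp: S_def)
      then have "\<rho> (el i) (q (Suc r)) = q r" using \<rho>(2)[OF i, of "q (Suc r)"] q(2,3)[of "Suc r"] \<sigma>(2) by simp
      then show ?thesis using d True IH c hom_Aut_rat(2)[OF \<rho>(1)] by simp
    next
      case False
      then have "(q r, q (Suc r)) \<in> S i" using lr r by (auto simp: S_def)
      then have "\<rho> (el i) (q r) = q (Suc r)" using \<rho>(2)[OF i, of "q r"] q(2,3)[of r] \<sigma>(2) by simp
      then have "finv (\<rho> (el i)) (q (Suc r)) = q r"
        using hom_Aut_rat(1)[OF \<rho>(1) c(2)] by (simp add: order_aut_inv_eq)
      then show ?thesis using d False IH c hom_Aut_rat(2,4)[OF \<rho>(1)] by simp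
    qed
    then show ?case by (simp add: r_def)
  qed
  from this[of L] have "\<rho> f (q L) = q 0" using l(3) by simp
  moreover have "q 0 \<noteq> q L" using q(1)[of L 0] L by auto
  ultimately show ?thesis using \<rho>(1) by (intro bexI[of _ \<rho>]) auto
qed

lemma residual:
  assumes g: "g \<in> carrier G" "g \<noteq> \<one>"
  shows "\<exists>\<rho>\<in>hom G Aut_rat. \<rho> g \<noteq> id"
proof -
  obtain f and k :: int where f: "f \<in> N" "g = f \<otimes> t [^] k" using decompose[OF g(1)] .
  show ?thesis
  proof (cases "k = 0")
    case True
    then have "g = f" using f N_closed by simp
    then show ?thesis using residual_N f g by simp
  next
    case False
    define a where "a j = (if j = m then (\<lambda>x::rat. x + 1) else id)" for j
    have "commutator (a j) id = id" for j
      by (simp add: a_def commutator_def fun_eq_iff finv_translation order_aut_inv_eq)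
    then have "cword a (\<lambda>_. id) n = id" for n by (induction n) simp_all
    moreover have "a j \<in> order_aut \<and> id \<in> order_aut" for j by (simp add: a_def)
    ultimately obtain \<rho> where \<rho>: "\<rho> \<in> hom G Aut_rat" "\<And>j. j < Suc m \<Longrightarrow> \<rho> (A j) = a j \<and> \<rho> (B j) = id"
      using universal[of a "\<lambda>_. id"] by blast
    have t: "\<rho> t = (\<lambda>x. x + 1)" using \<rho>(2)[of m] by (simp add: a_def)
    have "\<rho> h x = x" if "h \<in> N" for h x
      using that unfolding N_def
    proof (induction arbitrary: x)
      case one then show ?case using hom_Aut_rat(3)[OF \<rho>(1)] by simp
    next
      case (incl h)
      then obtain i where i: "h = el i" "i \<in> idx" by blast
      show ?case using i(2)
      proof (cases rule: idxE)
        case 1 then show ?thesis using i \<rho>(2)[of m] by simp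
      next
        case (2 c j k)
        then have "\<rho> (if c then A j else B j) y = y" for y using \<rho>(2)[of j] by (simp add: a_def)
        then show ?thesis
          using 2 i gen_closed[of j c] hom_Aut_rat(2)[OF \<rho>(1)] hom_t_pow[OF \<rho>(1) t] int_pow_neg[OF t_closed, of k, symmetric]
          by simp
      qed
    next
      case (inv h)
      then obtain i where i: "h = el i" "i \<in> idx" by blast
      have h: "h \<in> carrier G" using i el_closed by blast
      have "\<rho> h y = y" for y using i(2)
      proof (cases rule: idxE)
        case 1 then show ?thesis using i \<rho>(2)[of m] by simp
      next
        case (2 c j k)
        then have "\<rho> (if c then A j else B j) y = y" for y using \<rho>(2)[of j] by (simp add: a_def)
        then show ?thesis
          using 2 i gen_closed[of j c] hom_Aut_rat(2)[OF \<rho>(1)] hom_t_pow[OF \<rho>(1) t] int_pow_neg[OF t_closed, of k, symmetric]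
          by simp
      qed
      then show ?case using hom_Aut_rat(1,4)[OF \<rho>(1) h] by (simp add: order_aut_inv_eq)
    next
      case (eng h1 h2)
      then have "h1 \<in> carrier G" "h2 \<in> carrier G" using N_closed unfolding N_def by auto
      then show ?case using eng hom_Aut_rat(2)[OF \<rho>(1)] by simp
    qed
    then have "\<rho> g 0 = of_int k"
      using f N_closed hom_Aut_rat(2)[OF \<rho>(1)] hom_t_pow[OF \<rho>(1) t] by simp
    then show ?thesis using False \<rho>(1) by (intro bexI[of _ \<rho>]) auto
  qed
qed

theorem left_order_exists: "left_orders G \<noteq> {}"
  using left_orders_nonempty[OF countable_carrier residual] .

lemma gen_nontrivial:
  assumes "j < Suc m" shows "A j \<noteq> \<one>" "B j \<noteq> \<one>"
proof -
  let ?s = "\<lambda>x::rat. x + 1"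
  have "commutator ?s ?s = id" by (simp add: commutator_def fun_eq_iff finv_translation)
  then have "cword (\<lambda>_. ?s) (\<lambda>_. ?s) n = id" for n by (induction n) simp_all
  then obtain \<rho> where \<rho>: "\<rho> \<in> hom G Aut_rat" "\<And>j. j < Suc m \<Longrightarrow> \<rho> (A j) = ?s \<and> \<rho> (B j) = ?s"
    using universal[of "\<lambda>_. ?s" "\<lambda>_. ?s"] by auto
  then have "\<rho> (A j) 0 \<noteq> 0" "\<rho> (B j) 0 \<noteq> 0" using assms by simp_all
  then show "A j \<noteq> \<one>" "B j \<noteq> \<one>" using hom_Aut_rat(3)[OF \<rho>(1), of 0] by metis+
qed

end

section \<open>Left orders and actions\<close>

context group begin

lemma left_orderD:
  assumes r: "r \<in> left_orders G"
  shows "(f, h) \<in> r \<Longrightarrow> f \<in> carrier G \<and> h \<in> carrier G"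
    and "f \<in> carrier G \<Longrightarrow> (f, f) \<in> r"
    and "(f, h) \<in> r \<Longrightarrow> (h, k) \<in> r \<Longrightarrow> (f, k) \<in> r"
    and "(f, h) \<in> r \<Longrightarrow> (h, f) \<in> r \<Longrightarrow> f = h"
    and "f \<in> carrier G \<Longrightarrow> h \<in> carrier G \<Longrightarrow> (f, h) \<in> r \<or> (h, f) \<in> r"
    and "g \<in> carrier G \<Longrightarrow> f \<in> carrier G \<Longrightarrow> h \<in> carrier G \<Longrightarrow> (g \<otimes> f, g \<otimes> h) \<in> r \<longleftrightarrow> (f, h) \<in> r"
proof -
  have r1: "r \<subseteq> carrier G \<times> carrier G" "refl_on (carrier G) r" "trans r" "antisym r" "total_on (carrier G) r"
    and r2: "\<And>f h g. f \<in> carrier G \<Longrightarrow> h \<in> carrier G \<Longrightarrow> g \<in> carrier G \<Longrightarrow> (f, h) \<in> r \<Longrightarrow> (g \<otimes> f, g \<otimes> h) \<in> r"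
    using r unfolding left_orders_def linear_order_on_def partial_order_on_def preorder_on_def by auto
  show "(f, h) \<in> r \<Longrightarrow> f \<in> carrier G \<and> h \<in> carrier G" using r1(1) by auto
  show fr: "f \<in> carrier G \<Longrightarrow> (f, f) \<in> r" for f using r1(2) by (simp add: refl_on_def)
  show "(f, h) \<in> r \<Longrightarrow> (h, k) \<in> r \<Longrightarrow> (f, k) \<in> r" using r1(3) by (rule transD)
  show "(f, h) \<in> r \<Longrightarrow> (h, f) \<in> r \<Longrightarrow> f = h" using r1(4) by (rule antisymD)
  show "f \<in> carrier G \<Longrightarrow> h \<in> carrier G \<Longrightarrow> (f, h) \<in> r \<or> (h, f) \<in> r"
    using r1(5) fr unfolding total_on_def by (cases "f = h") auto
  show "(g \<otimes> f, g \<otimes> h) \<in> r \<longleftrightarrow> (f, h) \<in> r" if "g \<in> carrier G" "f \<in> carrier G" "h \<in> carrier G"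
  proof
    assume "(g \<otimes> f, g \<otimes> h) \<in> r"
    then have "(inv g \<otimes> (g \<otimes> f), inv g \<otimes> (g \<otimes> h)) \<in> r" using r2[of "g \<otimes> f" "g \<otimes> h" "inv g"] that by simp
    then show "(f, h) \<in> r" using that by (simp add: m_assoc[symmetric])
  qed (use r2 that in simp)
qed

lemma left_orderI:
  assumes "\<And>f h. R f h \<Longrightarrow> f \<in> carrier G \<and> h \<in> carrier G" "\<And>f. f \<in> carrier G \<Longrightarrow> R f f"
    "\<And>f h k. R f h \<Longrightarrow> R h k \<Longrightarrow> R f k" "\<And>f h. R f h \<Longrightarrow> R h f \<Longrightarrow> f = h"
    "\<And>f h. f \<in> carrier G \<Longrightarrow> h \<in> carrier G \<Longrightarrow> R f h \<or> R h f"
    "\<And>g f h. g \<in> carrier G \<Longrightarrow> R f h \<Longrightarrow> R (g \<otimes> f) (g \<otimes> h)"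
  shows "{(f, h). R f h} \<in> left_orders G"
  unfolding left_orders_def linear_order_on_def partial_order_on_def preorder_on_def mem_Collect_eq
proof (intro conjI)
  show "{(f, h). R f h} \<subseteq> carrier G \<times> carrier G" using assms(1) by auto
  show "refl_on (carrier G) {(f, h). R f h}" using assms(2) by (simp add: refl_on_def)
  show "trans {(f, h). R f h}" by (rule transI) (use assms(3) in auto)
  show "antisym {(f, h). R f h}" by (rule antisymI) (use assms(4) in auto)
  show "total_on (carrier G) {(f, h). R f h}" using assms(5) by (simp add: total_on_def)
qed (use assms(6) in auto)

text \<open>A left order makes the group act on its product with the rationals, ordered
  lexicographically, and by Cantor's theorem that order is the order of the rationals.\<close>

lemma order_realization:
  assumes r: "r \<in> left_orders G" and count: "countable (carrier G)"
  shows "\<exists>\<rho>\<in>hom G Aut_rat. \<exists>y0. (\<forall>g\<in>carrier G. y0 < \<rho> g y0 \<longleftrightarrow> g \<in> positive_elements G r)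
    \<and> (\<forall>g\<in>carrier G. g \<noteq> \<one> \<longrightarrow> (\<forall>y. \<rho> g y \<noteq> y))"
proof -
  note o = left_orderD[OF r]
  define sl where "sl g h \<longleftrightarrow> (g, h) \<in> r \<and> g \<noteq> h" for g h
  have sl_trans: "sl f h \<Longrightarrow> sl h k \<Longrightarrow> sl f k" for f h k
    unfolding sl_def using o(3)[of f h k] o(4)[of f h] by auto
  have sl_irr: "\<not> sl f f" for f by (simp add: sl_def)
  have sl_total: "f \<in> carrier G \<Longrightarrow> h \<in> carrier G \<Longrightarrow> f = h \<or> sl f h \<or> sl h f" for f h
    unfolding sl_def using o(5)[of f h] by auto
  have sl_left: "sl (g \<otimes> f) (g \<otimes> h) \<longleftrightarrow> sl f h" if "g \<in> carrier G" "f \<in> carrier G" "h \<in> carrier G" for g f h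
    unfolding sl_def using o(6)[OF that] that by simp
  \<comment> \<open>the factor of rationals makes the order dense\<close>
  define L where "L = carrier G \<times> (UNIV :: rat set)"
  define lt where "lt z w \<longleftrightarrow> sl (fst z) (fst w) \<or> fst z = fst w \<and> snd z < snd w" for z w :: "'a \<times> rat"
  have d: "dense_order L lt"
    unfolding dense_order_def
  proof (intro conjI ballI impI)
    have "(\<one>, 0) \<in> L" by (simp add: L_def)
    then show "L \<noteq> {}" by blast
    fix x y z assume x: "x \<in> L" and y: "y \<in> L"
    show "\<not> lt x x" by (simp add: lt_def sl_irr)
    show "lt x z" if "lt x y" "lt y z" using that sl_trans[of "fst x" "fst y" "fst z"] by (auto simp: lt_def)
    show "x = y \<or> lt x y \<or> lt y x"
      using sl_total[of "fst x" "fst y"] x y by (auto simp: lt_def L_def prod_eq_iff)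
    show "\<exists>z\<in>L. lt x z"
      by (rule bexI[of _ "(fst x, snd x + 1)"]) (use x in \<open>auto simp: lt_def L_def\<close>)
    show "\<exists>z\<in>L. lt z x"
      by (rule bexI[of _ "(fst x, snd x - 1)"]) (use x in \<open>auto simp: lt_def L_def\<close>)
    show "\<exists>z\<in>L. lt x z \<and> lt z y" if xy: "lt x y"
    proof (cases "sl (fst x) (fst y)")
      case True
      then show ?thesis by (intro bexI[of _ "(fst x, snd x + 1)"]) (use x in \<open>auto simp: lt_def L_def\<close>)
    next
      case False
      then have "fst x = fst y" "snd x < snd y" using xy by (auto simp: lt_def)
      then show ?thesis
        by (intro bexI[of _ "(fst x, (snd x + snd y) / 2)"]) (use x in \<open>auto simp: lt_def L_def\<close>)
    qed
  qed
  have cL: "countable L" unfolding L_def using count by simp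
  have "partial_iso L lt (UNIV :: rat set) (<) {}" by (simp add: partial_iso_def)
  then show ?thesis
  proof (rule countable_dense_order_iso[OF _ d cL dense_order_rat countableI_type])
    fix \<phi> :: "'a \<times> rat \<Rightarrow> rat"
    assume bij: "bij_betw \<phi> L UNIV" and mono: "\<And>x y. x \<in> L \<Longrightarrow> y \<in> L \<Longrightarrow> lt x y \<longleftrightarrow> \<phi> x < \<phi> y"
    define \<psi> where "\<psi> = inv_into L \<phi>"
    have \<psi>: "\<psi> y \<in> L" "\<phi> (\<psi> y) = y" for y
      unfolding \<psi>_def using bij_betw_imp_surj_on[OF bij] by (auto intro: inv_into_into f_inv_into_f)
    have \<psi>\<phi>: "\<psi> (\<phi> z) = z" if "z \<in> L" for z
      unfolding \<psi>_def using bij_betw_imp_inj_on[OF bij] that by simp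
    have f\<psi>: "fst (\<psi> y) \<in> carrier G" for y using \<psi>(1)[of y] by (auto simp: L_def)
    define \<rho> where "\<rho> g y = \<phi> (g \<otimes> fst (\<psi> y), snd (\<psi> y))" for g y
    have inL: "(g \<otimes> fst (\<psi> y), snd (\<psi> y)) \<in> L" if "g \<in> carrier G" for g y
      using that f\<psi> by (simp add: L_def)
    have \<psi>\<rho>: "\<psi> (\<rho> g y) = (g \<otimes> fst (\<psi> y), snd (\<psi> y))" if "g \<in> carrier G" for g y
      unfolding \<rho>_def by (rule \<psi>\<phi>[OF inL[OF that]])
    have comp: "\<rho> (g \<otimes> h) y = \<rho> g (\<rho> h y)" if "g \<in> carrier G" "h \<in> carrier G" for g h y
      unfolding \<rho>_def[of g] \<psi>\<rho>[OF that(2)] unfolding \<rho>_def using that f\<psi> by (simp add: m_assoc)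
    have one: "\<rho> \<one> y = y" for y unfolding \<rho>_def using f\<psi> \<psi>(2) by simp
    have aut: "\<rho> g \<in> order_aut" if g: "g \<in> carrier G" for g
    proof (rule order_autI)
      show "\<rho> g x < \<rho> g y" if "x < y" for x y
      proof -
        have "lt (\<psi> x) (\<psi> y)" using mono[OF \<psi>(1)[of x] \<psi>(1)[of y]] \<psi>(2) that by simp
        then have "lt (g \<otimes> fst (\<psi> x), snd (\<psi> x)) (g \<otimes> fst (\<psi> y), snd (\<psi> y))"
          using sl_left[OF g f\<psi> f\<psi>] by (auto simp: lt_def)
        then show ?thesis unfolding \<rho>_def using mono[OF inL[OF g] inL[OF g]] by (rule iffD1[rotated])
      qed
      show "\<exists>x. \<rho> g x = z" for z
        using comp[of g "inv g" z] one g by (intro exI[of _ "\<rho> (inv g) z"]) simp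
    qed
    have hom: "\<rho> \<in> hom G Aut_rat"
      using aut comp by (simp add: hom_def Aut_rat_def fun_eq_iff)
    define y0 where "y0 = \<phi> (\<one>, 0)"
    have L1: "(\<one>, 0) \<in> L" by (simp add: L_def)
    have y0: "\<rho> g y0 = \<phi> (g, 0)" if "g \<in> carrier G" for g
      unfolding \<rho>_def y0_def \<psi>\<phi>[OF L1] using that by simp
    have "y0 < \<rho> g y0 \<longleftrightarrow> g \<in> positive_elements G r" if g: "g \<in> carrier G" for g
    proof -
      have "y0 < \<rho> g y0 \<longleftrightarrow> lt (\<one>, 0) (g, 0)"
        unfolding y0[OF g] unfolding y0_def by (rule mono[symmetric]) (use g in \<open>simp_all add: L_def\<close>)
      then show ?thesis using g by (auto simp: lt_def sl_def positive_elements_def)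
    qed
    moreover have "\<rho> g y \<noteq> y" if g: "g \<in> carrier G" "g \<noteq> \<one>" for g y
    proof
      assume "\<rho> g y = y"
      then have "g \<otimes> fst (\<psi> y) = fst (\<psi> y)" using \<psi>\<rho>[OF g(1), of y] by (simp add: prod_eq_iff)
      then show False using g f\<psi>[of y] r_cancel_one by blast
    qed
    ultimately show ?thesis using hom by blast
  qed
qed

text \<open>Ties at the point \<open>y0\<close>, that is, elements of its stabiliser, are broken by an
  auxiliary left order.\<close>

lemma order_from_action:
  assumes \<rho>: "\<rho> \<in> hom G Aut_rat" and r0: "r0 \<in> left_orders G"
  shows "\<exists>r\<in>left_orders G. \<forall>g\<in>carrier G. y0 < \<rho> g y0 \<longrightarrow> g \<in> positive_elements G r"
proof -
  note o = left_orderD[OF r0]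
  define R where "R f h \<longleftrightarrow> f \<in> carrier G \<and> h \<in> carrier G \<and>
    (\<rho> f y0 < \<rho> h y0 \<or> \<rho> f y0 = \<rho> h y0 \<and> (f, h) \<in> r0)" for f h
  have "{(f, h). R f h} \<in> left_orders G"
  proof (rule left_orderI)
    fix f h k
    show "R f h \<Longrightarrow> f \<in> carrier G \<and> h \<in> carrier G" by (simp add: R_def)
    show "f \<in> carrier G \<Longrightarrow> R f f" using o(2) by (simp add: R_def)
    show "R f h \<Longrightarrow> R h k \<Longrightarrow> R f k" using o(3)[of f h k] by (auto simp: R_def)
    show "R f h \<Longrightarrow> R h f \<Longrightarrow> f = h" using o(4)[of f h] by (auto simp: R_def)
    show "f \<in> carrier G \<Longrightarrow> h \<in> carrier G \<Longrightarrow> R f h \<or> R h f" using o(5)[of f h] by (auto simp: R_def)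
    show "R (g \<otimes> f) (g \<otimes> h)" if "g \<in> carrier G" "R f h" for g
      using that o(6)[of g f h] hom_Aut_rat(1)[OF \<rho>, of g]
      by (auto simp: R_def hom_Aut_rat(2)[OF \<rho>])
  qed
  moreover have "g \<in> positive_elements G {(f, h). R f h}" if "g \<in> carrier G" "y0 < \<rho> g y0" for g
    using that hom_Aut_rat(3)[OF \<rho>, of y0] by (auto simp: positive_elements_def R_def)
  ultimately show ?thesis by blast
qed

lemma conj_order_left_order:
  assumes r: "r \<in> left_orders G" and g: "g \<in> carrier G"
  shows "conj_order G r g \<in> left_orders G"
proof -
  note o = left_orderD[OF r]
  let ?c = "\<lambda>h. g \<otimes> h \<otimes> inv g"
  have c: "?c h \<in> carrier G" if "h \<in> carrier G" for h using that g by simp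
  have inj: "h = k" if "?c h = ?c k" "h \<in> carrier G" "k \<in> carrier G" for h k
    using that g by simp
  have mult: "?c (k \<otimes> h) = ?c k \<otimes> ?c h" if "h \<in> carrier G" "k \<in> carrier G" for h k
  proof -
    have "inv g \<otimes> (g \<otimes> (h \<otimes> inv g)) = h \<otimes> inv g" using g that by (simp add: m_assoc[symmetric])
    then show ?thesis using g that by (simp add: m_assoc)
  qed
  show ?thesis unfolding conj_order_def
  proof (rule left_orderI)
    fix f h k
    let ?R = "\<lambda>h k. h \<in> carrier G \<and> k \<in> carrier G \<and> (?c h, ?c k) \<in> r"
    show "?R f h \<Longrightarrow> f \<in> carrier G \<and> h \<in> carrier G" by simp
    show "f \<in> carrier G \<Longrightarrow> ?R f f" using o(2)[OF c] by simp
    show "?R f h \<Longrightarrow> ?R h k \<Longrightarrow> ?R f k" using o(3)[of "?c f" "?c h" "?c k"] by simp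
    show "?R f h \<Longrightarrow> ?R h f \<Longrightarrow> f = h" using o(4)[of "?c f" "?c h"] inj[of f h] by simp
    show "f \<in> carrier G \<Longrightarrow> h \<in> carrier G \<Longrightarrow> ?R f h \<or> ?R h f" using o(5)[OF c c] by simp
    show "?R (g' \<otimes> f) (g' \<otimes> h)" if g': "g' \<in> carrier G" and R: "?R f h" for g'
    proof -
      have "(?c g' \<otimes> ?c f, ?c g' \<otimes> ?c h) \<in> r" using o(6)[OF c c c] g' R by blast
      then show ?thesis using g' R mult by simp
    qed
  qed
qed

lemma positive_conj_order:
  assumes "g \<in> carrier G" "f \<in> carrier G"
  shows "f \<in> positive_elements G (conj_order G r g) \<longleftrightarrow> g \<otimes> f \<otimes> inv g \<in> positive_elements G r"
proof -
  have "g \<otimes> f \<otimes> inv g = \<one> \<longleftrightarrow> f = \<one>"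
  proof
    assume "g \<otimes> f \<otimes> inv g = \<one>"
    then have "g \<otimes> f \<otimes> inv g = g \<otimes> \<one> \<otimes> inv g" using assms by simp
    then have "g \<otimes> f = g \<otimes> \<one>" using assms by (simp only: right_cancel m_closed one_closed inv_closed)
    then show "f = \<one>" using assms by simp
  qed (use assms in simp)
  then show ?thesis using assms by (simp add: positive_elements_def conj_order_def)
qed

end

text \<open>The group elements that have a spelling by generators along which the images of the base
  point stay within a prescribed set.\<close>

inductive_set traced :: "('a, 'b) monoid_scheme \<Rightarrow> 'a set \<Rightarrow> ('a \<Rightarrow> rat \<Rightarrow> rat) \<Rightarrow> rat set \<Rightarrow> rat \<Rightarrow> 'a set"
  for G :: "('a, 'b) monoid_scheme" and S \<rho> E y0 where
  one: "\<one>\<^bsub>G\<^esub> \<in> traced G S \<rho> E y0"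
| fwd: "g \<in> traced G S \<rho> E y0 \<Longrightarrow> s \<in> S \<Longrightarrow> \<rho> (s \<otimes>\<^bsub>G\<^esub> g) y0 \<in> E \<Longrightarrow> s \<otimes>\<^bsub>G\<^esub> g \<in> traced G S \<rho> E y0"
| bwd: "g \<in> traced G S \<rho> E y0 \<Longrightarrow> s \<in> S \<Longrightarrow> \<rho> (inv\<^bsub>G\<^esub> s \<otimes>\<^bsub>G\<^esub> g) y0 \<in> E \<Longrightarrow> inv\<^bsub>G\<^esub> s \<otimes>\<^bsub>G\<^esub> g \<in> traced G S \<rho> E y0"

context group begin

lemma traced_closed: "S \<subseteq> carrier G \<Longrightarrow> g \<in> traced G S \<rho> E y0 \<Longrightarrow> g \<in> carrier G"
  by (erule traced.induct) auto

lemma traced_point: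
  assumes "g \<in> traced G S \<rho> E y0" "\<rho> \<in> hom G Aut_rat" "y0 \<in> E"
  shows "\<rho> g y0 \<in> E"
  using assms(1) by cases (use assms(3) hom_Aut_rat(3)[OF assms(2)] in simp_all)

lemma traced_mono:
  assumes "g \<in> traced G S \<rho> E y0" "E \<subseteq> E'"
  shows "g \<in> traced G S \<rho> E' y0"
  using assms(1)
proof induction
  case one show ?case by (rule traced.one)
next
  case (fwd g s) then show ?case using assms(2) by (intro traced.fwd) auto
next
  case (bwd g s) then show ?case using assms(2) by (intro traced.bwd) auto
qed

lemma traced_generate:
  assumes S: "S \<subseteq> carrier G" and "g \<in> generate G S" "finite E" "k \<in> traced G S \<rho> E y0"
  shows "\<exists>E'. finite E' \<and> g \<otimes> k \<in> traced G S \<rho> E' y0"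
  using assms(2-4)
proof (induction arbitrary: E k)
  case one
  then have "k \<in> carrier G" using traced_closed[OF S] by blast
  then show ?case using one by (intro exI[of _ E]) simp
next
  case (incl h)
  then show ?case using traced_mono[OF incl(3), of "insert (\<rho> (h \<otimes> k) y0) E"]
    by (intro exI[of _ "insert (\<rho> (h \<otimes> k) y0) E"] conjI traced.fwd) auto
next
  case (inv h)
  then show ?case using traced_mono[OF inv(3), of "insert (\<rho> (inv h \<otimes> k) y0) E"]
    by (intro exI[of _ "insert (\<rho> (inv h \<otimes> k) y0) E"] conjI traced.bwd) auto
next
  case (eng h1 h2)
  obtain E' where E': "finite E'" "h2 \<otimes> k \<in> traced G S \<rho> E' y0" using eng.IH(2)[OF eng.prems] by blast
  obtain E'' where E'': "finite E''" "h1 \<otimes> (h2 \<otimes> k) \<in> traced G S \<rho> E'' y0" using eng.IH(1)[OF E'] by blast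
  have "h1 \<in> carrier G" "h2 \<in> carrier G" "k \<in> carrier G"
    using eng generate_in_carrier[OF S] traced_closed[OF S] by auto
  then have "h1 \<otimes> h2 \<otimes> k = h1 \<otimes> (h2 \<otimes> k)" by (rule m_assoc)
  then show ?case using E'' by (intro exI[of _ E'']) simp
qed

lemma finite_trace:
  assumes S: "S \<subseteq> carrier G" "carrier G = generate G S" and \<rho>: "\<rho> \<in> hom G Aut_rat" and F: "finite F" "F \<subseteq> carrier G"
  shows "\<exists>E. finite E \<and> y0 \<in> E \<and> F \<subseteq> traced G S \<rho> E y0 \<and> (\<forall>e\<in>E. \<exists>h\<in>traced G S \<rho> E y0. \<rho> h y0 = e)"
proof -
  have "\<exists>E. finite E \<and> F \<subseteq> traced G S \<rho> E y0"
    using F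
  proof (induction rule: finite_induct)
    case empty then show ?case by (intro exI[of _ "{}"]) simp
  next
    case (insert g F)
    then obtain E where E: "finite E" "F \<subseteq> traced G S \<rho> E y0" by auto
    have "g \<in> generate G S" using insert S by auto
    from traced_generate[OF S(1) this, of "{}" \<one> \<rho> y0] obtain E' where E': "finite E'" "g \<otimes> \<one> \<in> traced G S \<rho> E' y0"
      using traced.one by blast
    have "g \<in> traced G S \<rho> (E \<union> E') y0" using traced_mono[OF E'(2), of "E \<union> E'"] insert by simp
    moreover have "F \<subseteq> traced G S \<rho> (E \<union> E') y0" using traced_mono[of _ S \<rho> E y0 "E \<union> E'"] E(2) by blast
    ultimately show ?case using E E' by (intro exI[of _ "E \<union> E'"]) simp
  qed
  then obtain E where E: "finite E" "F \<subseteq> traced G S \<rho> E y0" by blast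
  define E' where "E' = insert y0 (E \<inter> (\<lambda>h. \<rho> h y0) ` traced G S \<rho> E y0)"
  have sub: "g \<in> traced G S \<rho> E' y0" if "g \<in> traced G S \<rho> E y0" for g
    using that
  proof induction
    case one show ?case by (rule traced.one)
  next
    case (fwd g s)
    then have "s \<otimes> g \<in> traced G S \<rho> E y0" by (intro traced.fwd)
    then have "\<rho> (s \<otimes> g) y0 \<in> E'" using fwd by (auto simp: E'_def)
    then show ?case by (rule traced.fwd[OF fwd.IH fwd.hyps(2)])
  next
    case (bwd g s)
    then have "inv s \<otimes> g \<in> traced G S \<rho> E y0" by (intro traced.bwd)
    then have "\<rho> (inv s \<otimes> g) y0 \<in> E'" using bwd by (auto simp: E'_def)
    then show ?case by (rule traced.bwd[OF bwd.IH bwd.hyps(2)])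
  qed
  have "\<exists>h\<in>traced G S \<rho> E' y0. \<rho> h y0 = e" if "e \<in> E'" for e
  proof (cases "e = y0")
    case True
    then show ?thesis using traced.one hom_Aut_rat(3)[OF \<rho>, of y0] by (intro bexI[of _ \<one>]) auto
  next
    case False
    then show ?thesis using that sub by (auto simp: E'_def)
  qed
  then show ?thesis using E sub by (intro exI[of _ E']) (auto simp: E'_def)
qed

text \<open>An action that looks like \<open>\<rho>\<close> on the finite set \<open>E\<close>, generator by
  generator, moves the base point like \<open>\<rho>\<close> for all elements with a trace in
  \<open>E\<close>.\<close>

lemma traced_intertwine:
  assumes S: "S \<subseteq> carrier G" and \<rho>: "\<rho> \<in> hom G Aut_rat" and \<rho>': "\<rho>' \<in> hom G Aut_rat" and y0: "y0 \<in> E"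
    and loc: "\<And>s x. s \<in> S \<Longrightarrow> x \<in> E \<Longrightarrow> \<rho>' s (\<iota> x) = \<iota> (\<rho> s x)"
    and g: "g \<in> traced G S \<rho> E y0"
  shows "\<rho>' g (\<iota> y0) = \<iota> (\<rho> g y0)"
  using g
proof induction
  case one
  show ?case using hom_Aut_rat(3)[OF \<rho>] hom_Aut_rat(3)[OF \<rho>'] by simp
next
  case (fwd g s)
  have c: "g \<in> carrier G" "s \<in> carrier G" using fwd S traced_closed[OF S] by auto
  have "\<rho> g y0 \<in> E" using traced_point[OF fwd(1) \<rho> y0] .
  then show ?case using fwd.IH loc fwd(2) hom_Aut_rat(2)[OF \<rho> c(2,1)] hom_Aut_rat(2)[OF \<rho>' c(2,1)] by simp
next
  case (bwd g s)
  have c: "g \<in> carrier G" "s \<in> carrier G" "inv s \<in> carrier G" using bwd S traced_closed[OF S] by auto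
  let ?w = "\<rho> (inv s \<otimes> g) y0"
  have "\<rho> s ?w = \<rho> (s \<otimes> (inv s \<otimes> g)) y0" using hom_Aut_rat(2)[OF \<rho>, of s "inv s \<otimes> g"] c by simp
  also have "s \<otimes> (inv s \<otimes> g) = g" using c by (simp add: m_assoc[symmetric])
  finally have "\<rho>' s (\<iota> ?w) = \<iota> (\<rho> g y0)" using loc[OF bwd(2,3)] by simp
  then have "finv (\<rho>' s) (\<iota> (\<rho> g y0)) = \<iota> ?w"
    using hom_Aut_rat(1)[OF \<rho>' c(2)] by (simp add: order_aut_inv_eq)
  then show ?case using bwd.IH hom_Aut_rat(2)[OF \<rho>' c(3,1)] hom_Aut_rat(4)[OF \<rho>' c(2)] by simp
qed

end

section \<open>A left order with dense orbit\<close>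

context surface_presentation
begin

abbreviation gens where "gens \<equiv> A ` {..<Suc m} \<union> B ` {..<Suc m}"

lemma gens_closed: "gens \<subseteq> carrier G"
  using A_closed B_closed by auto

definition orbit_rel :: "('a \<Rightarrow> rat \<Rightarrow> rat) \<Rightarrow> rat \<Rightarrow> rat \<Rightarrow> bool" where
  "orbit_rel \<rho> x y \<longleftrightarrow> (\<exists>g\<in>carrier G. y = \<rho> g x)"

lemma orbit_relI: "g \<in> carrier G \<Longrightarrow> \<rho> g x = y \<Longrightarrow> orbit_rel \<rho> x y"
  unfolding orbit_rel_def by auto

lemma orbit_rel_refl: "\<rho> \<in> hom G Aut_rat \<Longrightarrow> orbit_rel \<rho> x x"
  using hom_Aut_rat(3) by (intro orbit_relI[of \<one>]) simp_all

lemma orbit_rel_trans: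
  assumes \<rho>: "\<rho> \<in> hom G Aut_rat" and "orbit_rel \<rho> x y" "orbit_rel \<rho> y z"
  shows "orbit_rel \<rho> x z"
proof -
  obtain g h where "g \<in> carrier G" "y = \<rho> g x" "h \<in> carrier G" "z = \<rho> h y"
    using assms(2,3) unfolding orbit_rel_def by auto
  then show ?thesis using hom_Aut_rat(2)[OF \<rho>, of h g] by (intro orbit_relI[of "h \<otimes> g"]) simp_all
qed

lemma orbit_rel_sym:
  assumes \<rho>: "\<rho> \<in> hom G Aut_rat" and "orbit_rel \<rho> x y"
  shows "orbit_rel \<rho> y x"
proof -
  obtain g where g: "g \<in> carrier G" "y = \<rho> g x" using assms(2) unfolding orbit_rel_def by auto
  then have "\<rho> (inv g) y = x" using hom_Aut_rat(1,4)[OF \<rho> g(1)] by simp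
  then show ?thesis using g by (intro orbit_relI[of "inv g"]) simp_all
qed

lemma orbit_rel_reach:
  assumes \<rho>: "\<rho> \<in> hom G Aut_rat" and R: "reach S x y" and S: "S \<subseteq> order_aut"
    and loc: "\<And>f z. f \<in> S \<Longrightarrow> \<exists>s\<in>carrier G. \<rho> s (\<iota> z) = \<iota> (f z)"
  shows "orbit_rel \<rho> (\<iota> x) (\<iota> y)"
  using R
proof induction
  case refl show ?case by (rule orbit_rel_refl[OF \<rho>])
next
  case (fwd y f)
  obtain s where "s \<in> carrier G" "\<rho> s (\<iota> y) = \<iota> (f y)" using loc[OF fwd(2)] by auto
  then show ?case using orbit_rel_trans[OF \<rho> fwd.IH orbit_relI] by blast
next
  case (bwd y f)
  obtain s where "s \<in> carrier G" "\<rho> s (\<iota> (finv f y)) = \<iota> (f (finv f y))" using loc[OF bwd(2)] by auto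
  moreover have "f \<in> order_aut" using bwd(2) S by auto
  ultimately have "orbit_rel \<rho> (\<iota> (finv f y)) (\<iota> y)" by (intro orbit_relI) simp_all
  then show ?case using orbit_rel_trans[OF \<rho> bwd.IH] orbit_rel_sym[OF \<rho>] by blast
qed

text \<open>The heart of the matter: two actions can be realised, as far as finitely many group
  elements acting on one point each can tell, inside a single action, with the two points on
  the same orbit. Cut the first action to the right and the second one to the left of all points
  that matter; in each, the last handle can still move the base point into the region where
  handle 0 has become trivial, and linking the two there joins the orbits.\<close>

lemma actions_combine:
  assumes \<rho>1: "\<rho>1 \<in> hom G Aut_rat" and fix1: "\<And>y. \<rho>1 (A m) y \<noteq> y" "\<And>y. \<rho>1 (B m) y \<noteq> y"
    and \<rho>2: "\<rho>2 \<in> hom G Aut_rat" and fix2: "\<And>y. \<rho>2 (A m) y \<noteq> y" "\<And>y. \<rho>2 (B m) y \<noteq> y"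
    and F1: "finite F1" "F1 \<subseteq> carrier G" and F2: "finite F2" "F2 \<subseteq> carrier G"
  shows "\<exists>\<rho>\<in>hom G Aut_rat. \<exists>z. \<exists>g\<in>carrier G. (\<forall>f\<in>F1. y1 < \<rho>1 f y1 \<longrightarrow> z < \<rho> f z)
    \<and> (\<forall>f\<in>F2. y2 < \<rho>2 f y2 \<longrightarrow> \<rho> g z < \<rho> f (\<rho> g z))"
proof -
  obtain E1 where E1: "finite E1" "y1 \<in> E1" "F1 \<subseteq> traced G gens \<rho>1 E1 y1"
    "\<forall>e\<in>E1. \<exists>h\<in>traced G gens \<rho>1 E1 y1. \<rho>1 h y1 = e"
    using finite_trace[OF gens_closed generated \<rho>1 F1, of y1] by auto
  obtain E2 where E2: "finite E2" "y2 \<in> E2" "F2 \<subseteq> traced G gens \<rho>2 E2 y2"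
    "\<forall>e\<in>E2. \<exists>h\<in>traced G gens \<rho>2 E2 y2. \<rho>2 h y2 = e"
    using finite_trace[OF gens_closed generated \<rho>2 F2, of y2] by auto
  define K1 where "K1 = Max E1"
  define K2 where "K2 = Min E2"
  have ne: "E1 \<noteq> {}" "E2 \<noteq> {}" using E1(2) E2(2) by blast+
  have K1: "K1 \<in> E1" "\<And>x. x \<in> E1 \<Longrightarrow> x \<le> K1" using Max_in[OF E1(1) ne(1)] E1(1) by (simp_all add: K1_def)
  have K2: "K2 \<in> E2" "\<And>x. x \<in> E2 \<Longrightarrow> K2 \<le> x" using Min_in[OF E2(1) ne(2)] E2(1) by (simp_all add: K2_def)
  obtain h1 where h1: "h1 \<in> traced G gens \<rho>1 E1 y1" "\<rho>1 h1 y1 = K1" using E1(4) K1(1) by auto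
  obtain h2 where h2: "h2 \<in> traced G gens \<rho>2 E2 y2" "\<rho>2 h2 y2 = K2" using E2(4) K2(1) by auto
  have aut: "\<rho> (A j) \<in> order_aut \<and> \<rho> (B j) \<in> order_aut" if "\<rho> \<in> hom G Aut_rat" "j < Suc m" for \<rho> j
    using hom_Aut_rat(1)[OF that(1)] A_closed[OF that(2)] B_closed[OF that(2)] by simp
  have rel: "cword (\<lambda>j. \<rho> (A j)) (\<lambda>j. \<rho> (B j)) (Suc m) = id" if \<rho>: "\<rho> \<in> hom G Aut_rat" for \<rho>
  proof -
    have w: "surface_word G A B n \<in> carrier G \<and> \<rho> (surface_word G A B n) = cword (\<lambda>j. \<rho> (A j)) (\<lambda>j. \<rho> (B j)) n"
      if "n \<le> Suc m" for n
      using that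
    proof (induction n)
      case 0 show ?case using hom_Aut_rat(3)[OF \<rho>] by (simp add: fun_eq_iff)
    next
      case (Suc n)
      then have c: "A n \<in> carrier G" "B n \<in> carrier G" "surface_word G A B n \<in> carrier G"
        using A_closed B_closed by simp_all
      show ?case
      proof
        show "surface_word G A B (Suc n) \<in> carrier G" using c by simp
        show "\<rho> (surface_word G A B (Suc n)) = cword (\<lambda>j. \<rho> (A j)) (\<lambda>j. \<rho> (B j)) (Suc n)"
          using c Suc by (simp add: fun_eq_iff commutator_def hom_Aut_rat(2)[OF \<rho>] hom_Aut_rat(4)[OF \<rho>])
      qed
    qed
    from w[of "Suc m"] have "\<rho> \<one> = cword (\<lambda>j. \<rho> (A j)) (\<lambda>j. \<rho> (B j)) (Suc m)" using relation by simp
    moreover have "\<rho> \<one> = id" using hom_Aut_rat(3)[OF \<rho>] by (simp add: fun_eq_iff)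
    ultimately show ?thesis by simp
  qed
  note c1 = cut_right[of m "\<lambda>j. \<rho>1 (A j)" "\<lambda>j. \<rho>1 (B j)" K1, OF aut[OF \<rho>1] rel[OF \<rho>1] fix1]
  note c2 = cut_left[of m "\<lambda>j. \<rho>2 (A j)" "\<lambda>j. \<rho>2 (B j)" K2, OF aut[OF \<rho>2] rel[OF \<rho>2] fix2]
  show ?thesis
  proof (rule c1)
    fix a1 b1 M1
    assume a1: "\<And>j. j < Suc m \<Longrightarrow> a1 j \<in> order_aut \<and> b1 j \<in> order_aut" "cword a1 b1 (Suc m) = id"
      and l1: "\<And>j x. j < Suc m \<Longrightarrow> x \<le> K1 \<Longrightarrow> a1 j x = \<rho>1 (A j) x \<and> b1 j x = \<rho>1 (B j) x"
      and M1: "K1 \<le> M1" "\<And>j x. j < m \<Longrightarrow> M1 \<le> x \<Longrightarrow> a1 j x = x \<and> b1 j x = x"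
      and r1: "\<And>z. \<exists>y\<ge>z. reach {a1 m, b1 m} K1 y"
    show ?thesis
    proof (rule c2)
      fix a2 b2 M2
      assume a2: "\<And>j. j < Suc m \<Longrightarrow> a2 j \<in> order_aut \<and> b2 j \<in> order_aut" "cword a2 b2 (Suc m) = id"
        and l2: "\<And>j x. j < Suc m \<Longrightarrow> K2 \<le> x \<Longrightarrow> a2 j x = \<rho>2 (A j) x \<and> b2 j x = \<rho>2 (B j) x"
        and M2: "M2 \<le> K2" "\<And>j x. j < m \<Longrightarrow> x \<le> M2 \<Longrightarrow> a2 j x = x \<and> b2 j x = x"
        and r2: "\<And>z. \<exists>y\<le>z. reach {a2 m, b2 m} K2 y"
      obtain u where u: "M1 + 1 \<le> u" "reach {a1 m, b1 m} K1 u" using r1 by auto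
      obtain v where v: "v \<le> M2 - 1" "reach {a2 m, b2 m} K2 v" using r2 by auto
      have uv: "M1 < u" "v < M2" using u v by linarith+
      show ?thesis
      proof (rule link_actions[OF a1 a2 m_pos M1(2)[OF m_pos] M2(2)[OF m_pos] uv])
        fix a b
        assume ab: "\<And>j. j < Suc m \<Longrightarrow> a j \<in> order_aut \<and> b j \<in> order_aut" "cword a b (Suc m) = id"
          and neg: "\<And>j x. j \<noteq> 0 \<or> x \<le> M1 \<Longrightarrow> a j (to_neg x) = to_neg (a1 j x)" "\<And>j x. b j (to_neg x) = to_neg (b1 j x)"
          and pos: "\<And>j x. j \<noteq> 0 \<or> M2 \<le> x \<Longrightarrow> a j (to_pos x) = to_pos (a2 j x)" "\<And>j x. b j (to_pos x) = to_pos (b2 j x)"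
          and link: "a 0 (to_neg u) = to_pos v"
        obtain \<rho> where \<rho>: "\<rho> \<in> hom G Aut_rat" "\<forall>j<Suc m. \<rho> (A j) = a j \<and> \<rho> (B j) = b j"
          using universal[OF ab] by auto
        have loc1: "\<rho> s (to_neg x) = to_neg (\<rho>1 s x)" if s: "s \<in> gens" and xE: "x \<in> E1" for s x
        proof -
          have x: "x \<le> K1" "x \<le> M1" using K1(2)[OF xE] M1(1) by linarith+
          obtain j where j: "j < Suc m" "s = A j \<or> s = B j" using s by auto
          then show ?thesis using \<rho>(2) neg(1)[of j x] neg(2)[of j x] l1[OF j(1) x(1)] x(2) by auto
        qed
        have loc2: "\<rho> s (to_pos x) = to_pos (\<rho>2 s x)" if s: "s \<in> gens" and xE: "x \<in> E2" for s x
        proof -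
          have x: "K2 \<le> x" "M2 \<le> x" using K2(2)[OF xE] M2(1) by linarith+
          obtain j where j: "j < Suc m" "s = A j \<or> s = B j" using s by auto
          then show ?thesis using \<rho>(2) pos(1)[of j x] pos(2)[of j x] l2[OF j(1) x(1)] x(2) by auto
        qed
        have tr1: "\<rho> g (to_neg y1) = to_neg (\<rho>1 g y1)" if "g \<in> traced G gens \<rho>1 E1 y1" for g
          by (rule traced_intertwine[OF gens_closed \<rho>1 \<rho>(1) E1(2) loc1 that])
        have tr2: "\<rho> g (to_pos y2) = to_pos (\<rho>2 g y2)" if "g \<in> traced G gens \<rho>2 E2 y2" for g
          by (rule traced_intertwine[OF gens_closed \<rho>2 \<rho>(1) E2(2) loc2 that])
        have \<rho>m: "\<rho> (A m) = a m" "\<rho> (B m) = b m" "A m \<in> carrier G" "B m \<in> carrier G" using \<rho>(2) by simp_all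
        have o1: "orbit_rel \<rho> (to_neg y1) (to_neg K1)"
          using tr1[OF h1(1)] h1(2) traced_closed[OF gens_closed h1(1)] by (intro orbit_relI[of h1]) simp_all
        have o2: "orbit_rel \<rho> (to_neg K1) (to_neg u)"
        proof (rule orbit_rel_reach[OF \<rho>(1) u(2)])
          show "{a1 m, b1 m} \<subseteq> order_aut" using a1(1)[of m] by simp
          fix f z assume "f \<in> {a1 m, b1 m}"
          then have "\<rho> (A m) (to_neg z) = to_neg (f z) \<or> \<rho> (B m) (to_neg z) = to_neg (f z)"
            using \<rho>m neg(1)[of m z] neg(2)[of m z] m_pos by auto
          then show "\<exists>s\<in>carrier G. \<rho> s (to_neg z) = to_neg (f z)" using \<rho>m(3,4) by blast
        qed
        have o3: "orbit_rel \<rho> (to_neg u) (to_pos v)"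
          using link \<rho>(2) A_closed[of 0] by (intro orbit_relI[of "A 0"]) simp_all
        have o4: "orbit_rel \<rho> (to_pos K2) (to_pos v)"
        proof (rule orbit_rel_reach[OF \<rho>(1) v(2)])
          show "{a2 m, b2 m} \<subseteq> order_aut" using a2(1)[of m] by simp
          fix f z assume "f \<in> {a2 m, b2 m}"
          then have "\<rho> (A m) (to_pos z) = to_pos (f z) \<or> \<rho> (B m) (to_pos z) = to_pos (f z)"
            using \<rho>m pos(1)[of m z] pos(2)[of m z] m_pos by auto
          then show "\<exists>s\<in>carrier G. \<rho> s (to_pos z) = to_pos (f z)" using \<rho>m(3,4) by blast
        qed
        have o5: "orbit_rel \<rho> (to_pos y2) (to_pos K2)"
          using tr2[OF h2(1)] h2(2) traced_closed[OF gens_closed h2(1)] by (intro orbit_relI[of h2]) simp_all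
        have "orbit_rel \<rho> (to_pos v) (to_pos y2)"
          using orbit_rel_sym[OF \<rho>(1) orbit_rel_trans[OF \<rho>(1) o5 o4]] .
        then have "orbit_rel \<rho> (to_neg y1) (to_pos y2)"
          using orbit_rel_trans[OF \<rho>(1) orbit_rel_trans[OF \<rho>(1) orbit_rel_trans[OF \<rho>(1) o1 o2] o3]] by simp
        then obtain g where g: "g \<in> carrier G" "to_pos y2 = \<rho> g (to_neg y1)" unfolding orbit_rel_def by auto
        have "to_neg y1 < \<rho> f (to_neg y1)" if "f \<in> F1" "y1 < \<rho>1 f y1" for f
        proof -
          have "f \<in> traced G gens \<rho>1 E1 y1" using that(1) E1(3) by blast
          then show ?thesis using tr1 that(2) by simp
        qed
        moreover have "\<rho> g (to_neg y1) < \<rho> f (\<rho> g (to_neg y1))" if "f \<in> F2" "y2 < \<rho>2 f y2" for f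
        proof -
          have "f \<in> traced G gens \<rho>2 E2 y2" using that(1) E2(3) by blast
          then show ?thesis using tr2 that(2) g(2)[symmetric] by simp
        qed
        ultimately show ?thesis using \<rho>(1) g(1) by blast
      qed
    qed
  qed
qed

text \<open>Topological transitivity. The action built from those of the two orders defines an order at the
  point \<open>z\<close>; its conjugate is the order which the same action defines at another
  point of the orbit of \<open>z\<close>.\<close>

lemma nbhds_linked:
  assumes F1: "finite F1" "F1 \<subseteq> carrier G" "basic_nbhd G F1 \<noteq> {}"
    and F2: "finite F2" "F2 \<subseteq> carrier G" "basic_nbhd G F2 \<noteq> {}"
  shows "\<exists>r\<in>basic_nbhd G F1. \<exists>g\<in>carrier G. conj_order G r g \<in> basic_nbhd G F2"
proof -
  obtain r1 where r1: "r1 \<in> left_orders G" "F1 \<subseteq> positive_elements G r1" using F1(3) by (auto simp: basic_nbhd_def)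
  obtain r2 where r2: "r2 \<in> left_orders G" "F2 \<subseteq> positive_elements G r2" using F2(3) by (auto simp: basic_nbhd_def)
  obtain \<rho>1 y1 where \<rho>1: "\<rho>1 \<in> hom G Aut_rat" "\<forall>g\<in>carrier G. y1 < \<rho>1 g y1 \<longleftrightarrow> g \<in> positive_elements G r1"
    "\<forall>g\<in>carrier G. g \<noteq> \<one> \<longrightarrow> (\<forall>y. \<rho>1 g y \<noteq> y)"
    using order_realization[OF r1(1) countable_carrier] by blast
  obtain \<rho>2 y2 where \<rho>2: "\<rho>2 \<in> hom G Aut_rat" "\<forall>g\<in>carrier G. y2 < \<rho>2 g y2 \<longleftrightarrow> g \<in> positive_elements G r2"
    "\<forall>g\<in>carrier G. g \<noteq> \<one> \<longrightarrow> (\<forall>y. \<rho>2 g y \<noteq> y)"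
    using order_realization[OF r2(1) countable_carrier] by blast
  have nt: "A m \<noteq> \<one>" "B m \<noteq> \<one>" using gen_nontrivial[of m] by simp_all
  have f: "\<rho>1 (A m) y \<noteq> y" "\<rho>1 (B m) y \<noteq> y" "\<rho>2 (A m) y \<noteq> y" "\<rho>2 (B m) y \<noteq> y" for y
    using \<rho>1(3) \<rho>2(3) nt by simp_all
  obtain \<rho> z g where \<rho>: "\<rho> \<in> hom G Aut_rat" and g: "g \<in> carrier G"
    and 1: "\<forall>f\<in>F1. y1 < \<rho>1 f y1 \<longrightarrow> z < \<rho> f z"
    and 2: "\<forall>f\<in>F2. y2 < \<rho>2 f y2 \<longrightarrow> \<rho> g z < \<rho> f (\<rho> g z)"
    using actions_combine[OF \<rho>1(1) f(1,2) \<rho>2(1) f(3,4) F1(1,2) F2(1,2), of y1 y2] by blast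
  obtain r where r: "r \<in> left_orders G" "\<forall>g\<in>carrier G. z < \<rho> g z \<longrightarrow> g \<in> positive_elements G r"
    using order_from_action[OF \<rho> r1(1), of z] by blast
  have "f \<in> positive_elements G r" if "f \<in> F1" for f
  proof -
    have "f \<in> carrier G" "f \<in> positive_elements G r1" using that F1(2) r1(2) by auto
    then have "z < \<rho> f z" using 1 that \<rho>1(2) by simp
    then show ?thesis using r(2) \<open>f \<in> carrier G\<close> by simp
  qed
  then have "r \<in> basic_nbhd G F1" using r(1) by (auto simp: basic_nbhd_def)
  moreover have "f \<in> positive_elements G (conj_order G r (inv g))" if "f \<in> F2" for f
  proof -
    have fc: "f \<in> carrier G" "f \<in> positive_elements G r2" using that F2(2) r2(2) by auto
    then have "\<rho> g z < \<rho> f (\<rho> g z)" using 2 that \<rho>2(2) by simp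
    then have "z < finv (\<rho> g) (\<rho> f (\<rho> g z))" using hom_Aut_rat(1)[OF \<rho> g] by simp
    then have "z < \<rho> (inv g \<otimes> f \<otimes> g) z" using g fc(1) hom_Aut_rat(2,4)[OF \<rho>] by simp
    then have "inv g \<otimes> f \<otimes> g \<in> positive_elements G r" using r(2) g fc(1) by simp
    then show ?thesis using positive_conj_order[of "inv g" f r] g fc(1) by simp
  qed
  then have "conj_order G r (inv g) \<in> basic_nbhd G F2"
    using conj_order_left_order[OF r(1), of "inv g"] g by (auto simp: basic_nbhd_def)
  ultimately show ?thesis using g by (intro bexI[of _ r] bexI[of _ "inv g"]) simp_all
qed

lemma positive_closed: "F \<subseteq> positive_elements G r \<Longrightarrow> F \<subseteq> carrier G"
  by (auto simp: positive_elements_def)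

text \<open>Enumerate the elements \<open>e k\<close> and the nonempty basic open sets \<open>E k\<close>.
  Enlarge a finite set of elements that are positive in some left order step by step, at stage
  \<open>k\<close> deciding the sign of \<open>e k\<close> and adding a conjugate of \<open>E
  k\<close>. Consistency of each stage is transitivity, and the union is a positive cone.\<close>

theorem dense_orbit_exists:
  "\<exists>r\<in>left_orders G. left_order_topology G closure_of conj_orbit G r = topspace (left_order_topology G)"
proof -
  define \<E> where "\<E> = {F. finite F \<and> F \<subseteq> carrier G \<and> basic_nbhd G F \<noteq> {}}"
  have e0: "{} \<in> \<E>" using left_order_exists by (auto simp: \<E>_def basic_nbhd_def)
  have "countable {F. finite F \<and> F \<subseteq> carrier G}" using countable_Collect_finite_subset[OF countable_carrier]
    by (simp add: conj_commute)
  then have ec: "countable \<E>" by (rule countable_subset[rotated]) (auto simp: \<E>_def)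
  define E where "E = from_nat_into \<E>"
  have E: "E k \<in> \<E>" for k unfolding E_def using e0 by (intro from_nat_into) blast
  define e where "e = from_nat_into (carrier G)"
  have e: "e k \<in> carrier G" for k unfolding e_def by (rule from_nat_into) blast
  have step: "\<exists>F'. F' \<in> \<E> \<and> F \<subseteq> F' \<and> (e k = \<one> \<or> e k \<in> F' \<or> inv (e k) \<in> F') \<and>
      (\<exists>g\<in>carrier G. \<forall>f\<in>E k. g \<otimes> f \<otimes> inv g \<in> F')" if F: "F \<in> \<E>" for F k
  proof -
    obtain r g where r: "r \<in> basic_nbhd G F" and g: "g \<in> carrier G" "conj_order G r g \<in> basic_nbhd G (E k)"
      using nbhds_linked[of F "E k"] F E[of k] by (auto simp: \<E>_def)
    have ro: "r \<in> left_orders G" "F \<subseteq> positive_elements G r" using r by (auto simp: basic_nbhd_def)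
    note o = left_orderD[OF ro(1)]
    have Ek: "finite (E k)" "E k \<subseteq> carrier G" using E[of k] by (auto simp: \<E>_def)
    have "(\<one>, e k) \<in> r \<or> (e k, \<one>) \<in> r" using o(5)[of \<one> "e k"] e by simp
    moreover have "(\<one>, inv (e k)) \<in> r" if "(e k, \<one>) \<in> r"
      using o(6)[of "inv (e k)" "e k" \<one>] that e by simp
    ultimately have sgn: "e k = \<one> \<or> e k \<in> positive_elements G r \<or> inv (e k) \<in> positive_elements G r"
      using e[of k] by (auto simp: positive_elements_def inv_eq_1_iff)
    define F' where "F' = F \<union> (\<lambda>f. g \<otimes> f \<otimes> inv g) ` E k \<union> ({e k, inv (e k)} \<inter> positive_elements G r)"
    have "g \<otimes> f \<otimes> inv g \<in> positive_elements G r" if "f \<in> E k" for f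
      using positive_conj_order[OF g(1), of f r] g(2) that Ek by (auto simp: basic_nbhd_def)
    then have pos: "F' \<subseteq> positive_elements G r" using ro(2) by (auto simp: F'_def)
    then have "r \<in> basic_nbhd G F'" using ro(1) by (simp add: basic_nbhd_def)
    moreover have "finite F'" using F Ek by (simp add: F'_def \<E>_def)
    ultimately have "F' \<in> \<E>" using positive_closed[OF pos] by (auto simp: \<E>_def)
    then show ?thesis using sgn g(1) by (intro exI[of _ F']) (auto simp: F'_def)
  qed
  have "\<exists>T. \<forall>k. T k \<in> \<E> \<and> (T k \<subseteq> T (Suc k) \<and> (e k = \<one> \<or> e k \<in> T (Suc k) \<or> inv (e k) \<in> T (Suc k)) \<and>
      (\<exists>g\<in>carrier G. \<forall>f\<in>E k. g \<otimes> f \<otimes> inv g \<in> T (Suc k)))"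
    by (rule dependent_nat_choice) (use e0 step in blast)+
  then obtain T where T: "\<And>k. T k \<in> \<E>" "\<And>k. T k \<subseteq> T (Suc k)"
    "\<And>k. e k = \<one> \<or> e k \<in> T (Suc k) \<or> inv (e k) \<in> T (Suc k)"
    "\<And>k. \<exists>g\<in>carrier G. \<forall>f\<in>E k. g \<otimes> f \<otimes> inv g \<in> T (Suc k)" by blast
  have mono: "T k \<subseteq> T l" if "k \<le> l" for k l using lift_Suc_mono_le[of T k l] T(2) that by simp
  define P where "P = (\<Union>k. T k)"
  have P_closed: "f \<in> carrier G" if "f \<in> P" for f using that T(1) by (auto simp: P_def \<E>_def)
  have witness: "\<exists>r\<in>left_orders G. F \<subseteq> positive_elements G r" if "finite F" "F \<subseteq> P" for F
  proof -
    have "\<exists>k. F \<subseteq> T k" using that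
    proof (induction rule: finite_induct)
      case (insert x F)
      then obtain k l where "F \<subseteq> T k" "x \<in> T l" by (auto simp: P_def)
      then have "insert x F \<subseteq> T (max k l)" using mono[of k "max k l"] mono[of l "max k l"] by auto
      then show ?case by blast
    qed simp
    then obtain k where k: "F \<subseteq> T k" by blast
    obtain r where "r \<in> basic_nbhd G (T k)" using T(1)[of k] by (auto simp: \<E>_def)
    then show ?thesis using k by (auto simp: basic_nbhd_def)
  qed
  have total: "f = \<one> \<or> f \<in> P \<or> inv f \<in> P" if f: "f \<in> carrier G" for f
  proof -
    obtain k where "e k = f" unfolding e_def using from_nat_into_surj[OF countable_carrier f] by auto
    then show ?thesis using T(3)[of k] by (auto simp: P_def)
  qed
  have no1: "\<one> \<notin> P" using witness[of "{\<one>}"] by (auto simp: positive_elements_def)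
  have mult: "f \<otimes> h \<in> P" if fh: "f \<in> P" "h \<in> P" for f h
  proof (rule ccontr)
    assume n: "f \<otimes> h \<notin> P"
    have c: "f \<in> carrier G" "h \<in> carrier G" using P_closed fh by auto
    then have "f \<otimes> h = \<one> \<or> inv (f \<otimes> h) \<in> P" using total[of "f \<otimes> h"] n by simp
    then obtain r where r: "r \<in> left_orders G" "f \<in> positive_elements G r" "h \<in> positive_elements G r"
      "f \<otimes> h = \<one> \<or> inv (f \<otimes> h) \<in> positive_elements G r"
      using witness[of "{f, h}"] witness[of "{f, h, inv (f \<otimes> h)}"] fh by auto
    note o = left_orderD[OF r(1)]
    have "(\<one>, f) \<in> r" "(\<one>, h) \<in> r" "f \<noteq> \<one>" using r by (auto simp: positive_elements_def)
    then have "(f, f \<otimes> h) \<in> r" using o(6)[of f \<one> h] c by simp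
    then have fhr: "(\<one>, f \<otimes> h) \<in> r" using o(3) \<open>(\<one>, f) \<in> r\<close> by blast
    show False
    proof (cases "f \<otimes> h = \<one>")
      case True
      then show False using \<open>(f, f \<otimes> h) \<in> r\<close> \<open>(\<one>, f) \<in> r\<close> o(4)[of f \<one>] \<open>f \<noteq> \<one>\<close> by simp
    next
      case False
      then have "(\<one>, inv (f \<otimes> h)) \<in> r" using r(4) by (auto simp: positive_elements_def)
      then have "(f \<otimes> h \<otimes> \<one>, f \<otimes> h \<otimes> inv (f \<otimes> h)) \<in> r" using o(6)[of "f \<otimes> h" \<one> "inv (f \<otimes> h)"] c by blast
      then have "(f \<otimes> h, \<one>) \<in> r" using c by simp
      then show False using fhr o(4) False by blast
    qed
  qed
  define R where "R f h \<longleftrightarrow> f \<in> carrier G \<and> h \<in> carrier G \<and> (f = h \<or> inv f \<otimes> h \<in> P)" for f h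
  have chain: "(inv f \<otimes> h) \<otimes> (inv h \<otimes> k) = inv f \<otimes> k" if "f \<in> carrier G" "h \<in> carrier G" "k \<in> carrier G" for f h k
  proof -
    have "h \<otimes> (inv h \<otimes> k) = k" using that by (simp add: m_assoc[symmetric])
    then show ?thesis using that by (simp add: m_assoc)
  qed
  have RL: "{(f, h). R f h} \<in> left_orders G"
  proof (rule left_orderI)
    fix f h k
    show "R f h \<Longrightarrow> f \<in> carrier G \<and> h \<in> carrier G" by (simp add: R_def)
    show "f \<in> carrier G \<Longrightarrow> R f f" by (simp add: R_def)
    show "R f k" if "R f h" "R h k"
      using that mult[of "inv f \<otimes> h" "inv h \<otimes> k"] chain[of f h k] by (auto simp: R_def)
    show "f = h" if "R f h" "R h f"
      using that mult[of "inv f \<otimes> h" "inv h \<otimes> f"] chain[of f h f] no1 by (auto simp: R_def)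
    show "R f h \<or> R h f" if c: "f \<in> carrier G" "h \<in> carrier G"
    proof -
      have "inv (inv f \<otimes> h) = inv h \<otimes> f" using c by (simp add: inv_mult_group)
      moreover have "f = h" if "inv f \<otimes> h = \<one>"
      proof -
        have "inv (inv h) = inv (inv f)" using inv_equality[OF that] c by simp
        then show ?thesis using c by simp
      qed
      ultimately show ?thesis using total[of "inv f \<otimes> h"] c by (auto simp: R_def)
    qed
    show "R (g \<otimes> f) (g \<otimes> h)" if g: "g \<in> carrier G" and r: "R f h" for g
    proof -
      have c: "f \<in> carrier G" "h \<in> carrier G" using r by (auto simp: R_def)
      have "inv g \<otimes> (g \<otimes> h) = h" using g c by (simp add: m_assoc[symmetric])
      then have "inv (g \<otimes> f) \<otimes> (g \<otimes> h) = inv f \<otimes> h" using g c by (simp add: inv_mult_group m_assoc)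
      then show ?thesis using r g c by (auto simp: R_def)
    qed
  qed
  let ?r = "{(f, h). R f h}"
  have P_pos: "f \<in> positive_elements G ?r" if "f \<in> P" for f
    using that no1 P_closed[OF that] by (auto simp: positive_elements_def R_def)
  have orbit: "\<exists>g\<in>carrier G. conj_order G ?r g \<in> basic_nbhd G F" if F: "F \<in> \<E>" for F
  proof -
    obtain k where k: "E k = F" unfolding E_def using from_nat_into_surj[OF ec F] by auto
    obtain g where g: "g \<in> carrier G" "\<forall>f\<in>F. g \<otimes> f \<otimes> inv g \<in> T (Suc k)" using T(4)[of k] k by auto
    have "f \<in> positive_elements G (conj_order G ?r g)" if "f \<in> F" for f
    proof -
      have "g \<otimes> f \<otimes> inv g \<in> P" using g(2) that by (auto simp: P_def)
      moreover have "f \<in> carrier G" using F that by (auto simp: \<E>_def)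
      ultimately show ?thesis using positive_conj_order[OF g(1)] P_pos by simp
    qed
    then show ?thesis using conj_order_left_order[OF RL g(1)] g(1) by (auto simp: basic_nbhd_def)
  qed
  have "left_order_topology G closure_of conj_orbit G ?r = left_orders G"
  proof
    show "left_order_topology G closure_of conj_orbit G ?r \<subseteq> left_orders G"
      using closure_of_subset_topspace[of "left_order_topology G"] topspace_left_order_topology by metis
    show "left_orders G \<subseteq> left_order_topology G closure_of conj_orbit G ?r"
    proof
      fix r' assume r': "r' \<in> left_orders G"
      show "r' \<in> left_order_topology G closure_of conj_orbit G ?r"
        unfolding in_closure_of
      proof (intro conjI allI impI)
        show "r' \<in> topspace (left_order_topology G)" using r' topspace_left_order_topology by metis
        fix U assume U: "r' \<in> U \<and> openin (left_order_topology G) U"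
        then obtain F where F: "finite F" "F \<subseteq> positive_elements G r'" "basic_nbhd G F \<subseteq> U"
          unfolding openin_left_order_topology by blast
        have "r' \<in> basic_nbhd G F" using r' F(2) by (simp add: basic_nbhd_def)
        then have "F \<in> \<E>" using F positive_closed[OF F(2)] by (auto simp: \<E>_def)
        then obtain g where "g \<in> carrier G" "conj_order G ?r g \<in> basic_nbhd G F" using orbit by blast
        then show "\<exists>y. y \<in> conj_orbit G ?r \<and> y \<in> U" using F(3) unfolding conj_orbit_def by blast
      qed
    qed
  qed
  then show ?thesis using RL by (intro bexI[of _ ?r]) (simp_all only: topspace_left_order_topology)
qed

end

section \<open>Holonomy of locally constant labels\<close>

lemma continuous_map_nbhd:
  fixes S :: "'b::metric_space set"
  assumes "continuous_map (top_of_set S) X c" "openin X V" "x \<in> S" "c x \<in> V"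
  shows "\<exists>e>0. \<forall>y\<in>S. dist y x < e \<longrightarrow> c y \<in> V"
proof -
  have "openin (top_of_set S) {y \<in> S. c y \<in> V}"
    using openin_continuous_map_preimage[OF assms(1,2)] by simp
  then show ?thesis using assms(3,4) unfolding openin_euclidean_subtopology_iff by auto
qed

lemma Lebesgue_number_cover:
  fixes S :: "'b::euclidean_space set"
  assumes F: "continuous_map (top_of_set S) X F" and S: "compact S"
    and U: "\<And>i. i \<in> I \<Longrightarrow> openin X (U i)" "topspace X \<subseteq> (\<Union>i\<in>I. U i)"
  shows "\<exists>d>0. \<forall>T. T \<subseteq> S \<longrightarrow> diameter T < d \<longrightarrow> T \<noteq> {} \<longrightarrow> (\<exists>i\<in>I. F ` T \<subseteq> U i)"
proof (cases "S = {}")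
  case True then show ?thesis by (intro exI[of _ 1]) auto
next
  case False
  define C where "C = {B :: 'b set. open B \<and> (\<exists>i\<in>I. \<forall>x\<in>B \<inter> S. F x \<in> U i)}"
  have cover: "S \<subseteq> \<Union>C"
  proof
    fix x assume x: "x \<in> S"
    then have "F x \<in> topspace X" using F by (auto simp: continuous_map_def)
    then obtain i where i: "i \<in> I" "F x \<in> U i" using U(2) by blast
    obtain e where "e > 0" "\<forall>y\<in>S. dist y x < e \<longrightarrow> F y \<in> U i"
      using continuous_map_nbhd[OF F U(1)[OF i(1)] x i(2)] by blast
    then have "\<exists>i\<in>I. \<forall>y\<in>ball x e \<inter> S. F y \<in> U i" "x \<in> ball x e"
      using i(1) by (auto simp: dist_commute intro!: bexI[of _ i])
    then have "ball x e \<in> C" "x \<in> ball x e" by (simp_all add: C_def)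
    then show "x \<in> \<Union>C" by blast
  qed
  have ne: "C \<noteq> {}" using cover False by auto
  have op: "\<And>B. B \<in> C \<Longrightarrow> open B" by (simp add: C_def)
  show ?thesis
  proof (rule Lebesgue_number_lemma[OF S ne cover op])
    fix d :: real assume d: "0 < d" "\<And>T. T \<subseteq> S \<Longrightarrow> diameter T < d \<Longrightarrow> \<exists>B\<in>C. T \<subseteq> B"
    show ?thesis
    proof (intro exI[of _ d] conjI allI impI)
      fix T assume T: "T \<subseteq> S" "diameter T < d"
      obtain B where "B \<in> C" "T \<subseteq> B" using d(2)[OF T] by blast
      then show "\<exists>i\<in>I. F ` T \<subseteq> U i" using T(1) unfolding C_def by blast
    qed (rule d(1))
  qed
qed

text \<open>Labels attached to the patches of an open cover, any two of which differ locally by a constant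
  on the left. They are the transition data of a flat connection.\<close>

locale local_system = group H for H (structure) +
  fixes X :: "'x topology" and I :: "'i set" and U :: "'i \<Rightarrow> 'x set" and lab :: "'i \<Rightarrow> 'x \<Rightarrow> 'h"
  assumes U_open: "\<And>i. i \<in> I \<Longrightarrow> openin X (U i)"
    and U_cover: "topspace X \<subseteq> (\<Union>i\<in>I. U i)"
    and lab_closed: "\<And>i x. i \<in> I \<Longrightarrow> x \<in> U i \<Longrightarrow> lab i x \<in> carrier H"
    and lab_local: "\<And>i j x. i \<in> I \<Longrightarrow> j \<in> I \<Longrightarrow> x \<in> U i \<Longrightarrow> x \<in> U j \<Longrightarrow>
       \<exists>V. openin X V \<and> x \<in> V \<and> V \<subseteq> U i \<inter> U j \<and>
         (\<forall>y\<in>V. lab i y \<otimes> inv (lab j y) = lab i x \<otimes> inv (lab j x))"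
begin

text \<open>The label of the patch \<open>i\<close> is a parallel section over that patch, unique up to a
  constant factor on the left.\<close>

definition parallel_near :: "real set \<Rightarrow> (real \<Rightarrow> 'x) \<Rightarrow> (real \<Rightarrow> 'h) \<Rightarrow> 'i \<Rightarrow> real \<Rightarrow> bool" where
  "parallel_near S c \<phi> i t \<longleftrightarrow> (\<exists>e>0. \<forall>s\<in>S. dist s t < e \<longrightarrow>
     c s \<in> U i \<and> \<phi> s \<otimes> inv (lab i (c s)) = \<phi> t \<otimes> inv (lab i (c t)))"

definition transport :: "real set \<Rightarrow> (real \<Rightarrow> 'x) \<Rightarrow> (real \<Rightarrow> 'h) \<Rightarrow> bool" where
  "transport S c \<phi> \<longleftrightarrow> continuous_map (top_of_set S) X c \<and> (\<forall>t\<in>S. \<phi> t \<in> carrier H) \<and>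
     (\<forall>t\<in>S. \<exists>i\<in>I. parallel_near S c \<phi> i t)"

lemma transportD:
  assumes "transport S c \<phi>"
  shows "continuous_map (top_of_set S) X c" "t \<in> S \<Longrightarrow> \<phi> t \<in> carrier H"
    "t \<in> S \<Longrightarrow> \<exists>i\<in>I. parallel_near S c \<phi> i t"
  using assms unfolding transport_def by blast+

lemma change_chart:
  assumes "a \<in> carrier H" "b \<in> carrier H" "c \<in> carrier H"
  shows "(a \<otimes> inv b) \<otimes> (b \<otimes> inv c) = a \<otimes> inv c"
proof -
  have "inv b \<otimes> (b \<otimes> inv c) = inv c" using assms by (simp add: m_assoc[symmetric])
  then show ?thesis using assms by (simp add: m_assoc)
qed

lemma transport_all_charts:
  assumes T: "transport S c \<phi>" and t: "t \<in> S" and j: "j \<in> I" "c t \<in> U j"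
  shows "parallel_near S c \<phi> j t"
proof -
  obtain i e where i: "i \<in> I" and e: "e > 0"
    "\<And>s. s \<in> S \<Longrightarrow> dist s t < e \<Longrightarrow> c s \<in> U i \<and> \<phi> s \<otimes> inv (lab i (c s)) = \<phi> t \<otimes> inv (lab i (c t))"
    using T t unfolding transport_def parallel_near_def by blast
  have ci: "c t \<in> U i" using e(2)[OF t] e(1) by simp
  obtain V where V: "openin X V" "c t \<in> V" "V \<subseteq> U i \<inter> U j"
    "\<And>y. y \<in> V \<Longrightarrow> lab i y \<otimes> inv (lab j y) = lab i (c t) \<otimes> inv (lab j (c t))"
    using lab_local[OF i j(1) ci j(2)] by blast
  have cont: "continuous_map (top_of_set S) X c" and cl: "\<And>s. s \<in> S \<Longrightarrow> \<phi> s \<in> carrier H"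
    using T by (auto simp: transport_def)
  obtain e' where e': "e' > 0" "\<And>s. s \<in> S \<Longrightarrow> dist s t < e' \<Longrightarrow> c s \<in> V"
    using continuous_map_nbhd[OF cont V(1) t V(2)] by blast
  show ?thesis unfolding parallel_near_def
  proof (intro exI[of _ "min e e'"] conjI ballI impI)
    fix s assume s: "s \<in> S" "dist s t < min e e'"
    have sV: "c s \<in> V" using e'(2) s by simp
    then show sj: "c s \<in> U j" using V(3) by blast
    have si: "c s \<in> U i" using sV V(3) by blast
    have "\<phi> s \<otimes> inv (lab j (c s)) = (\<phi> s \<otimes> inv (lab i (c s))) \<otimes> (lab i (c s) \<otimes> inv (lab j (c s)))"
      by (rule change_chart[symmetric]) (use cl s lab_closed i j si sj in auto)
    also have "\<dots> = (\<phi> t \<otimes> inv (lab i (c t))) \<otimes> (lab i (c t) \<otimes> inv (lab j (c t)))"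
      using e(2)[OF s(1)] s(2) V(4)[OF sV] by simp
    also have "\<dots> = \<phi> t \<otimes> inv (lab j (c t))"
      by (rule change_chart) (use cl t lab_closed i j ci in auto)
    finally show "\<phi> s \<otimes> inv (lab j (c s)) = \<phi> t \<otimes> inv (lab j (c t))" .
  qed (use e e' in simp)
qed

lemma transport_unique:
  assumes T: "transport S c \<phi>" and T': "transport S c \<phi>'" and S: "connected S"
    and a: "a \<in> S" "\<phi> a = \<phi>' a" and b: "b \<in> S"
  shows "\<phi> b = \<phi>' b"
proof -
  have cl: "\<And>s. s \<in> S \<Longrightarrow> \<phi> s \<in> carrier H \<and> \<phi>' s \<in> carrier H" using T T' by (auto simp: transport_def)
  have "\<phi> a \<otimes> inv (\<phi>' a) = \<phi> b \<otimes> inv (\<phi>' b)"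
  proof (rule connected_local_const[OF S a(1) b, of "\<lambda>t. \<phi> t \<otimes> inv (\<phi>' t)"], rule ballI)
    fix t assume t: "t \<in> S"
    obtain i where i: "i \<in> I" and n: "parallel_near S c \<phi> i t" using T t by (auto simp: transport_def)
    then obtain e where e: "e > 0"
      "\<And>s. s \<in> S \<Longrightarrow> dist s t < e \<Longrightarrow> c s \<in> U i \<and> \<phi> s \<otimes> inv (lab i (c s)) = \<phi> t \<otimes> inv (lab i (c t))"
      unfolding parallel_near_def by blast
    have ci: "c t \<in> U i" using e(2)[OF t] e(1) by simp
    obtain e' where e': "e' > 0"
      "\<And>s. s \<in> S \<Longrightarrow> dist s t < e' \<Longrightarrow> c s \<in> U i \<and> \<phi>' s \<otimes> inv (lab i (c s)) = \<phi>' t \<otimes> inv (lab i (c t))"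
      using transport_all_charts[OF T' t i ci] unfolding parallel_near_def by blast
    have "\<phi> t \<otimes> inv (\<phi>' t) = \<phi> s \<otimes> inv (\<phi>' s)" if s: "s \<in> S" "dist s t < min e e'" for s
    proof -
      have eq: "(\<phi> r \<otimes> inv (lab i (c r))) \<otimes> inv (\<phi>' r \<otimes> inv (lab i (c r))) = \<phi> r \<otimes> inv (\<phi>' r)"
        if r: "r \<in> S" "c r \<in> U i" for r
      proof -
        have l: "lab i (c r) \<in> carrier H" using lab_closed i r by blast
        have "inv (lab i (c r)) \<otimes> (lab i (c r) \<otimes> inv (\<phi>' r)) = inv (\<phi>' r)"
          using l cl r by (simp add: m_assoc[symmetric])
        then show ?thesis using l cl r by (simp add: inv_mult_group m_assoc)
      qed
      have "c s \<in> U i" "\<phi> s \<otimes> inv (lab i (c s)) = \<phi> t \<otimes> inv (lab i (c t))"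
        "\<phi>' s \<otimes> inv (lab i (c s)) = \<phi>' t \<otimes> inv (lab i (c t))"
        using e(2)[OF s(1)] e'(2)[OF s(1)] s(2) by auto
      then show ?thesis using eq[OF s(1)] eq[OF t ci] by simp
    qed
    then show "\<forall>\<^sub>F s in at t within S. \<phi> t \<otimes> inv (\<phi>' t) = \<phi> s \<otimes> inv (\<phi>' s)"
      unfolding eventually_at using e(1) e'(1) by (intro exI[of _ "min e e'"]) auto
  qed
  then have "\<phi> b \<otimes> inv (\<phi>' b) = \<one>" using a cl by simp
  then have "\<phi> b = inv (inv (\<phi>' b))" using cl[OF b] by (intro inv_equality[symmetric]) simp_all
  then show ?thesis using cl b by simp
qed

lemma transport_left_mult:
  assumes T: "transport S c \<phi>" and g: "g \<in> carrier H"
  shows "transport S c (\<lambda>t. g \<otimes> \<phi> t)"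
proof -
  have cl: "\<And>s. s \<in> S \<Longrightarrow> \<phi> s \<in> carrier H" using T by (auto simp: transport_def)
  have "parallel_near S c (\<lambda>t. g \<otimes> \<phi> t) i t" if t: "t \<in> S" and i: "i \<in> I" and n: "parallel_near S c \<phi> i t" for i t
  proof -
    obtain e where e: "e > 0"
      "\<And>s. s \<in> S \<Longrightarrow> dist s t < e \<Longrightarrow> c s \<in> U i \<and> \<phi> s \<otimes> inv (lab i (c s)) = \<phi> t \<otimes> inv (lab i (c t))"
      using n unfolding parallel_near_def by blast
    have as: "g \<otimes> \<phi> s \<otimes> inv (lab i (c s)) = g \<otimes> (\<phi> s \<otimes> inv (lab i (c s)))" if "s \<in> S" "dist s t < e" for s
      using e(2)[OF that] cl[OF that(1)] g lab_closed[OF i, of "c s"] by (intro m_assoc) auto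
    show ?thesis unfolding parallel_near_def
      using e as as[OF t] by (intro exI[of _ e] conjI ballI impI) simp_all
  qed
  then have "\<exists>i\<in>I. parallel_near S c (\<lambda>t. g \<otimes> \<phi> t) i t" if "t \<in> S" for t
    using transportD(3)[OF T that] that by blast
  then show ?thesis using transportD(1)[OF T] cl g by (simp add: transport_def)
qed

lemma transport_compose:
  assumes T: "transport S c \<phi>" and f: "continuous_on S' f" "f ` S' \<subseteq> S"
  shows "transport S' (\<lambda>t. c (f t)) (\<lambda>t. \<phi> (f t))"
proof -
  have "parallel_near S' (\<lambda>t. c (f t)) (\<lambda>t. \<phi> (f t)) i t" if t: "t \<in> S'" and n: "parallel_near S c \<phi> i (f t)" for i t
  proof -
    obtain e where e: "e > 0"
      "\<And>s. s \<in> S \<Longrightarrow> dist s (f t) < e \<Longrightarrow> c s \<in> U i \<and> \<phi> s \<otimes> inv (lab i (c s)) = \<phi> (f t) \<otimes> inv (lab i (c (f t)))"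
      using n unfolding parallel_near_def by blast
    obtain d where d: "d > 0" "\<And>s. s \<in> S' \<Longrightarrow> dist s t < d \<Longrightarrow> dist (f s) (f t) < e"
      using f(1) t e(1) unfolding continuous_on_iff by metis
    show ?thesis unfolding parallel_near_def
    proof (intro exI[of _ d] conjI ballI impI d(1))
      fix s assume s: "s \<in> S'" "dist s t < d"
      have "f s \<in> S" using s(1) f(2) by blast
      then have "c (f s) \<in> U i \<and> \<phi> (f s) \<otimes> inv (lab i (c (f s))) = \<phi> (f t) \<otimes> inv (lab i (c (f t)))"
        using d(2)[OF s] by (rule e(2))
      then show "c (f s) \<in> U i" "\<phi> (f s) \<otimes> inv (lab i (c (f s))) = \<phi> (f t) \<otimes> inv (lab i (c (f t)))" by simp_all
    qed
  qed
  moreover have "continuous_map (top_of_set S') X (\<lambda>t. c (f t))"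
    by (rule continuous_map_compose_on[OF transportD(1)[OF T] f])
  moreover have "f t \<in> S" if "t \<in> S'" for t using that f(2) by blast
  moreover have "\<exists>i\<in>I. parallel_near S' (\<lambda>t. c (f t)) (\<lambda>t. \<phi> (f t)) i t" if "t \<in> S'" for t
    using transportD(3)[OF T calculation(3)[OF that]] calculation(1)[OF that] by blast
  ultimately show ?thesis using transportD(2)[OF T] by (simp add: transport_def)
qed

lemma parallel_near_subset:
  assumes "parallel_near S c \<phi> i t" "d > 0" "\<And>s. s \<in> S' \<Longrightarrow> dist s t < d \<Longrightarrow> s \<in> S \<and> \<psi> s = \<phi> s" "\<psi> t = \<phi> t"
  shows "parallel_near S' c \<psi> i t"
proof -
  obtain e where e: "e > 0"
    "\<And>s. s \<in> S \<Longrightarrow> dist s t < e \<Longrightarrow> c s \<in> U i \<and> \<phi> s \<otimes> inv (lab i (c s)) = \<phi> t \<otimes> inv (lab i (c t))"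
    using assms(1) unfolding parallel_near_def by blast
  show ?thesis unfolding parallel_near_def
  proof (intro exI[of _ "min d e"] conjI ballI impI)
    fix s assume s: "s \<in> S'" "dist s t < min d e"
    then have "s \<in> S" "\<psi> s = \<phi> s" using assms(3)[of s] by auto
    then show "c s \<in> U i" "\<psi> s \<otimes> inv (lab i (c s)) = \<psi> t \<otimes> inv (lab i (c t))"
      using e(2)[of s] s assms(4) by auto
  qed (use assms(2) e(1) in simp)
qed

lemma transport_glue:
  assumes T1: "transport {l..b} c \<phi>" and T2: "transport {b..r} c \<psi>" and eq: "\<phi> b = \<psi> b" and lr: "l \<le> b" "b \<le> r"
    and c: "continuous_map (top_of_set {l..r}) X c"
  shows "transport {l..r} c (\<lambda>t. if t \<le> b then \<phi> t else \<psi> t)" (is "transport _ c ?\<chi>")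
proof -
  have "\<exists>i\<in>I. parallel_near {l..r} c ?\<chi> i t" if t: "t \<in> {l..r}" for t
  proof -
    consider "t < b" | "t = b" | "b < t" by linarith
    then show ?thesis
    proof cases
      case 1
      then obtain i where "i \<in> I" "parallel_near {l..b} c \<phi> i t"
        using transportD(3)[OF T1, of t] t by auto
      moreover have "parallel_near {l..r} c ?\<chi> i t"
        by (rule parallel_near_subset[OF calculation(2), of "b - t"]) (use 1 in \<open>auto simp: dist_real_def\<close>)
      ultimately show ?thesis by blast
    next
      case 3
      then obtain i where "i \<in> I" "parallel_near {b..r} c \<psi> i t"
        using transportD(3)[OF T2, of t] t by auto
      moreover have "parallel_near {l..r} c ?\<chi> i t"
        by (rule parallel_near_subset[OF calculation(2), of "t - b"]) (use 3 in \<open>auto simp: dist_real_def\<close>)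
      ultimately show ?thesis by blast
    next
      case 2
      have bl: "b \<in> {l..b}" "b \<in> {b..r}" using lr by auto
      obtain i where i: "i \<in> I" "parallel_near {l..b} c \<phi> i b"
        using transportD(3)[OF T1 bl(1)] by auto
      then obtain e where e: "e > 0" "\<And>s. s \<in> {l..b} \<Longrightarrow> dist s b < e \<Longrightarrow>
          c s \<in> U i \<and> \<phi> s \<otimes> inv (lab i (c s)) = \<phi> b \<otimes> inv (lab i (c b))"
        unfolding parallel_near_def by blast
      have "c b \<in> U i" using e(2)[OF bl(1)] e(1) by simp
      then obtain e' where e': "e' > 0" "\<And>s. s \<in> {b..r} \<Longrightarrow> dist s b < e' \<Longrightarrow>
          c s \<in> U i \<and> \<psi> s \<otimes> inv (lab i (c s)) = \<psi> b \<otimes> inv (lab i (c b))"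
        using transport_all_charts[OF T2 bl(2) i(1)] unfolding parallel_near_def by blast
      have "parallel_near {l..r} c ?\<chi> i b" unfolding parallel_near_def
      proof (intro exI[of _ "min e e'"] conjI ballI impI)
        fix s assume s: "s \<in> {l..r}" "dist s b < min e e'"
        show "c s \<in> U i" using e(2)[of s] e'(2)[of s] s by (cases "s \<le> b") auto
        show "?\<chi> s \<otimes> inv (lab i (c s)) = ?\<chi> b \<otimes> inv (lab i (c b))"
          using e(2)[of s] e'(2)[of s] s eq by (cases "s \<le> b") auto
      qed (use e e' in simp)
      then show ?thesis using i 2 by blast
    qed
  qed
  moreover have "?\<chi> t \<in> carrier H" if "t \<in> {l..r}" for t
    using T1 T2 that by (auto simp: transport_def)
  ultimately show ?thesis using c unfolding transport_def by blast
qed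

lemma transport_in_chart:
  assumes c: "continuous_map (top_of_set S) X c" and i: "i \<in> I" "c ` S \<subseteq> U i" and g: "g \<in> carrier H"
  shows "transport S c (\<lambda>t. g \<otimes> lab i (c t))"
proof -
  have l: "lab i (c t) \<in> carrier H" if "t \<in> S" for t using lab_closed[OF i(1)] i(2) that by blast
  have "g \<otimes> lab i (c t) \<otimes> inv (lab i (c t)) = g" if "t \<in> S" for t using l[OF that] g by (simp add: m_assoc)
  then have "parallel_near S c (\<lambda>t. g \<otimes> lab i (c t)) i t" if "t \<in> S" for t
    unfolding parallel_near_def using that i(2) by (intro exI[of _ 1]) auto
  then show ?thesis using c i l g unfolding transport_def by auto
qed

lemma transport_exists:
  assumes c: "continuous_map (top_of_set {0..1}) X c"
  shows "\<exists>\<phi>. transport {0..1} c \<phi> \<and> \<phi> 0 = \<one>"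
proof -
  obtain d where d: "d > 0" "\<And>T. T \<subseteq> {0..1} \<Longrightarrow> diameter T < d \<Longrightarrow> T \<noteq> {} \<Longrightarrow> \<exists>i\<in>I. c ` T \<subseteq> U i"
    using Lebesgue_number_cover[OF c compact_Icc U_open U_cover] by blast
  define u where "u n = min 1 (real n * (d / 2))" for n
  have u: "0 \<le> u n" "u n \<le> 1" "u n \<le> u (Suc n)" "u (Suc n) - u n < d" for n
    using d(1) by (auto simp: u_def min_def algebra_simps)
  have "\<exists>\<phi>. transport {0..u n} c \<phi> \<and> \<phi> 0 = \<one>" for n
  proof (induction n)
    case 0
    have "c 0 \<in> topspace X" using c by (auto simp: continuous_map_def)
    then obtain i where i: "i \<in> I" "c 0 \<in> U i" using U_cover by blast
    have "continuous_map (top_of_set {0..u 0}) X c"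
      by (rule continuous_map_from_subtopology_mono[OF c]) (simp add: u_def)
    then have "transport {0..u 0} c (\<lambda>t. inv (lab i (c 0)) \<otimes> lab i (c t))"
      by (rule transport_in_chart[OF _ i(1)]) (use i lab_closed in \<open>auto simp: u_def\<close>)
    then show ?case using lab_closed[OF i] by (intro exI[of _ "\<lambda>t. inv (lab i (c 0)) \<otimes> lab i (c t)"]) simp
  next
    case (Suc n)
    then obtain \<phi> where \<phi>: "transport {0..u n} c \<phi>" "\<phi> 0 = \<one>" by blast
    have sub: "{u n..u (Suc n)} \<subseteq> {0..1}" "{0..u (Suc n)} \<subseteq> {0..1}" using u[of n] u[of "Suc n"] by auto
    have "diameter {u n..u (Suc n)} < d" using u(3,4)[of n] by simp
    then obtain i where i: "i \<in> I" "c ` {u n..u (Suc n)} \<subseteq> U i" using d(2)[OF sub(1)] u(3)[of n] by auto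
    have ci: "c (u n) \<in> U i" using i(2) u(3)[of n] by auto
    have un: "\<phi> (u n) \<in> carrier H" using \<phi>(1) u(1)[of n] by (auto simp: transport_def)
    let ?g = "\<phi> (u n) \<otimes> inv (lab i (c (u n)))"
    have l: "lab i (c (u n)) \<in> carrier H" using lab_closed[OF i(1) ci] .
    have T: "transport {u n..u (Suc n)} c (\<lambda>t. ?g \<otimes> lab i (c t))"
      by (rule transport_in_chart[OF continuous_map_from_subtopology_mono[OF c sub(1)] i]) (use un l in simp)
    have eq: "\<phi> (u n) = ?g \<otimes> lab i (c (u n))" using un l by (simp add: m_assoc)
    have "transport {0..u (Suc n)} c (\<lambda>t. if t \<le> u n then \<phi> t else ?g \<otimes> lab i (c t))"
      by (rule transport_glue[OF \<phi>(1) T eq u(1) u(3) continuous_map_from_subtopology_mono[OF c sub(2)]])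
    then show ?case using \<phi>(2) u(1)[of n]
      by (intro exI[of _ "\<lambda>t. if t \<le> u n then \<phi> t else ?g \<otimes> lab i (c t)"]) simp
  qed
  moreover obtain n where "1 \<le> real n * (d / 2)"
    using reals_Archimedean3[of "d / 2"] d(1) by (metis half_gt_zero less_imp_le)
  then have "u n = 1" by (simp add: u_def)
  ultimately show ?thesis by metis
qed

definition holonomy :: "(real \<Rightarrow> 'x) \<Rightarrow> 'h" where
  "holonomy c = (SOME g. \<exists>\<phi>. transport {0..1} c \<phi> \<and> \<phi> 0 = \<one> \<and> g = \<phi> 1)"

lemma holonomy_eq:
  assumes T: "transport {0..1} c \<phi>" "\<phi> 0 = \<one>"
  shows "holonomy c = \<phi> 1"
proof -
  have "\<exists>g. \<exists>\<phi>. transport {0..1} c \<phi> \<and> \<phi> 0 = \<one> \<and> g = \<phi> 1" using T by blast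
  then have "\<exists>\<phi>. transport {0..1} c \<phi> \<and> \<phi> 0 = \<one> \<and> holonomy c = \<phi> 1"
    unfolding holonomy_def by (rule someI_ex)
  then obtain \<phi>' where \<phi>': "transport {0..1} c \<phi>'" "\<phi>' 0 = \<one>" "holonomy c = \<phi>' 1" by auto
  have "\<phi>' 1 = \<phi> 1" by (rule transport_unique[OF \<phi>'(1) T(1), of 0]) (use T \<phi>' in auto)
  then show ?thesis using \<phi>'(3) by simp
qed

lemma chart_change_along:
  fixes S :: "real set"
  assumes S: "connected S" and c: "continuous_map (top_of_set S) X c" and ij: "i \<in> I" "j \<in> I" "c ` S \<subseteq> U i" "c ` S \<subseteq> U j"
    and ab: "a \<in> S" "b \<in> S"
  shows "inv (lab i (c a)) \<otimes> lab i (c b) = inv (lab j (c a)) \<otimes> lab j (c b)"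
proof -
  have l: "lab i (c s) \<in> carrier H" "lab j (c s) \<in> carrier H" if "s \<in> S" for s
    using lab_closed ij that by blast+
  have g: "inv (lab i (c a)) \<in> carrier H" "inv (lab j (c a)) \<in> carrier H" using l ab by simp_all
  show ?thesis
    by (rule transport_unique[OF transport_in_chart[OF c ij(1,3) g(1)] transport_in_chart[OF c ij(2,4) g(2)] S, of a])
      (use l ab in simp_all)
qed

text \<open>It suffices that the holonomy of the intermediate paths is locally constant in the homotopy
  parameter. A thin strip of the homotopy is cut into squares mapped into single patches.
  Carrying a transport along one side of the strip across it, by the label of the square at
  hand, gives a transport along the other side; at the ends, which stay fixed, nothing changes.\<close>

lemma holonomy_homotopic:
  assumes "path_homotopic X a b f g"
  shows "holonomy f = holonomy g"
proof -
  obtain F where F: "continuous_map (top_of_set unit_square) X F" "\<And>t. F (0, t) = f t" "\<And>t. F (1, t) = g t"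
    "\<And>s. s \<in> {0..1} \<Longrightarrow> F (s, 0) = a" "\<And>s. s \<in> {0..1} \<Longrightarrow> F (s, 1) = b"
    using path_homotopicE[OF assms] by metis
  have "holonomy (\<lambda>t. F (0, t)) = holonomy (\<lambda>t. F (1, t))"
  proof (rule connected_local_const[of "{0..1::real}" 0 1 "\<lambda>s. holonomy (\<lambda>t. F (s, t))"], simp, simp, simp, rule ballI)
    fix s :: real assume s: "s \<in> {0..1}"
    obtain d where d: "d > 0" "\<And>T. T \<subseteq> unit_square \<Longrightarrow> diameter T < d \<Longrightarrow> T \<noteq> {} \<Longrightarrow> \<exists>i\<in>I. F ` T \<subseteq> U i"
      using Lebesgue_number_cover[OF F(1) compact_Times[OF compact_Icc compact_Icc] U_open U_cover] by blast
    define \<delta> where "\<delta> = d / 5"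
    have \<delta>: "\<delta> > 0" using d(1) by (simp add: \<delta>_def)
    define Q where "Q t = ({s - \<delta>..s + \<delta>} \<inter> {0..1}) \<times> ({t - \<delta>..t + \<delta>} \<inter> {0..1})" for t
    have "\<exists>i\<in>I. F ` Q t \<subseteq> U i" if t: "t \<in> {0..1}" for t
    proof (rule d(2))
      show "Q t \<subseteq> unit_square" by (auto simp: Q_def)
      show "Q t \<noteq> {}" using s t \<delta> by (auto simp: Q_def)
      have "dist z w \<le> 4 * \<delta>" if zw: "z \<in> Q t" "w \<in> Q t" for z w
      proof -
        have "dist z w \<le> dist (fst z) (fst w) + dist (snd z) (snd w)"
          unfolding dist_prod_def by (rule sqrt_sum_squares_le_sum) simp_all
        moreover have "dist (fst z) (fst w) \<le> 2 * \<delta>" "dist (snd z) (snd w) \<le> 2 * \<delta>"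
          using zw by (auto simp: Q_def dist_real_def abs_le_iff)
        ultimately show ?thesis by linarith
      qed
      then have "diameter (Q t) \<le> 4 * \<delta>"
        using \<delta> by (intro diameter_le) (auto simp: dist_norm)
      then show "diameter (Q t) < d" using d(1) by (simp add: \<delta>_def)
    qed
    then have "\<forall>t\<in>{0..1}. \<exists>i. i \<in> I \<and> F ` Q t \<subseteq> U i" by blast
    from bchoice[OF this] obtain k where k: "\<forall>t\<in>{0..1}. k t \<in> I \<and> F ` Q t \<subseteq> U (k t)" ..
    have Fc: "continuous_map (top_of_set {0..1}) X (\<lambda>t. F (r, t))" if "r \<in> {0..1}" for r
      by (rule continuous_map_compose_on[OF F(1)]) (use that in \<open>auto intro!: continuous_intros\<close>)
    obtain \<phi> where \<phi>: "transport {0..1} (\<lambda>t. F (s, t)) \<phi>" "\<phi> 0 = \<one>" using transport_exists[OF Fc[OF s]] by blast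
    have \<phi>c: "\<phi> t \<in> carrier H" if "t \<in> {0..1}" for t using \<phi>(1) that by (simp add: transport_def)
    have "holonomy (\<lambda>t. F (s, t)) = holonomy (\<lambda>t. F (r, t))" if r: "r \<in> {0..1}" "dist r s < \<delta>" for r
    proof -
      have rs: "r \<in> {s - \<delta>..s + \<delta>}" "s \<in> {s - \<delta>..s + \<delta>}" using r(2) \<delta> by (auto simp: dist_real_def abs_less_iff)
      have kU: "F (x, t') \<in> U (k t)" if "t \<in> {0..1}" "t' \<in> {0..1}" "dist t' t < \<delta>" "x \<in> {s - \<delta>..s + \<delta>}" "x \<in> {0..1}" for x t t'
      proof -
        have "(x, t') \<in> Q t" using that by (auto simp: Q_def dist_real_def abs_less_iff)
        then show ?thesis using k that(1) by blast
      qed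
      have lc: "lab (k t) (F (x, t')) \<in> carrier H" if "t \<in> {0..1}" "t' \<in> {0..1}" "dist t' t < \<delta>" "x \<in> {s - \<delta>..s + \<delta>}" "x \<in> {0..1}" for x t t'
        using lab_closed[OF _ kU[OF that]] k that(1) by blast
      define \<psi> where "\<psi> t = \<phi> t \<otimes> (inv (lab (k t) (F (s, t))) \<otimes> lab (k t) (F (r, t)))" for t
      have \<psi>c: "\<psi> t \<in> carrier H" if t: "t \<in> {0..1}" for t
        using lc[OF t t _ rs(1) r(1)] lc[OF t t _ rs(2) s] \<phi>c[OF t] \<delta> by (simp add: \<psi>_def)
      have par: "\<psi> t' \<otimes> inv (lab (k t) (F (r, t'))) = \<phi> t' \<otimes> inv (lab (k t) (F (s, t')))"
        if t: "t \<in> {0..1}" "t' \<in> {0..1}" "dist t' t < \<delta>" for t t'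
      proof -
        have l: "lab (k t) (F (s, t')) \<in> carrier H" "lab (k t) (F (r, t')) \<in> carrier H"
          using lc[OF t rs(2) s] lc[OF t rs(1) r(1)] by simp_all
        have "inv (lab (k t') (F (s, t'))) \<otimes> lab (k t') (F (r, t')) = inv (lab (k t) (F (s, t'))) \<otimes> lab (k t) (F (r, t'))"
        proof (rule chart_change_along[of "{s - \<delta>..s + \<delta>} \<inter> {0..1}" "\<lambda>x. F (x, t')"])
          show "connected ({s - \<delta>..s + \<delta>} \<inter> {0..1})" by (intro convex_connected convex_Int) simp_all
          show "continuous_map (top_of_set ({s - \<delta>..s + \<delta>} \<inter> {0..1})) X (\<lambda>x. F (x, t'))"
            by (rule continuous_map_compose_on[OF F(1)]) (use t in \<open>auto intro!: continuous_intros\<close>)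
          show "k t' \<in> I" "k t \<in> I" using k t by blast+
          show "(\<lambda>x. F (x, t')) ` ({s - \<delta>..s + \<delta>} \<inter> {0..1}) \<subseteq> U (k t')"
            using kU[OF t(2,2)] \<delta> by auto
          show "(\<lambda>x. F (x, t')) ` ({s - \<delta>..s + \<delta>} \<inter> {0..1}) \<subseteq> U (k t)"
            using kU[OF t] by auto
        qed (use rs s r in auto)
        then have "\<psi> t' = (\<phi> t' \<otimes> inv (lab (k t) (F (s, t')))) \<otimes> lab (k t) (F (r, t'))"
          using l \<phi>c[OF t(2)] by (simp add: \<psi>_def m_assoc)
        then show ?thesis using l \<phi>c[OF t(2)] by (simp add: m_assoc)
      qed
      have "parallel_near {0..1} (\<lambda>t. F (r, t)) \<psi> (k t) t" if t: "t \<in> {0..1}" for t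
      proof -
        have "parallel_near {0..1} (\<lambda>t. F (s, t)) \<phi> (k t) t"
          by (rule transport_all_charts[OF \<phi>(1) t]) (use k t kU[OF t t _ rs(2) s] \<delta> in auto)
        then obtain e where e: "e > 0" "\<And>t'. t' \<in> {0..1} \<Longrightarrow> dist t' t < e \<Longrightarrow>
           \<phi> t' \<otimes> inv (lab (k t) (F (s, t'))) = \<phi> t \<otimes> inv (lab (k t) (F (s, t)))"
          unfolding parallel_near_def by blast
        show ?thesis unfolding parallel_near_def
        proof (intro exI[of _ "min e \<delta>"] conjI ballI impI)
          fix t' assume t': "t' \<in> {0..1}" "dist t' t < min e \<delta>"
          show "F (r, t') \<in> U (k t)" using kU[OF t t'(1) _ rs(1) r(1)] t'(2) by simp
          show "\<psi> t' \<otimes> inv (lab (k t) (F (r, t'))) = \<psi> t \<otimes> inv (lab (k t) (F (r, t)))"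
            using par[OF t t'(1)] par[OF t t] e(2)[OF t'(1)] t'(2) \<delta> by simp
        qed (use e(1) \<delta> in simp)
      qed
      then have T: "transport {0..1} (\<lambda>t. F (r, t)) \<psi>"
        unfolding transport_def using Fc[OF r(1)] \<psi>c k by blast
      have ends: "\<psi> t = \<phi> t" if "t \<in> {0..1}" "F (s, t) = F (r, t)" for t
        using lc[OF that(1) that(1) _ rs(1) r(1)] \<phi>c[OF that(1)] \<delta> that(2) by (simp add: \<psi>_def)
      have "holonomy (\<lambda>t. F (r, t)) = \<psi> 1"
        using ends[of 0] F(4)[OF s] F(4)[OF r(1)] \<phi>(2) by (intro holonomy_eq[OF T]) simp
      moreover have "holonomy (\<lambda>t. F (s, t)) = \<phi> 1" by (rule holonomy_eq[OF \<phi>])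
      ultimately show ?thesis using ends[of 1] F(5)[OF s] F(5)[OF r(1)] by simp
    qed
    then show "\<forall>\<^sub>F r in at s within {0..1}. holonomy (\<lambda>t. F (s, t)) = holonomy (\<lambda>t. F (r, t))"
      unfolding eventually_at using \<delta> by (intro exI[of _ \<delta>]) auto
  qed
  moreover have "(\<lambda>t. F (0, t)) = f" "(\<lambda>t. F (1, t)) = g" using F(2,3) by auto
  ultimately show ?thesis by simp
qed

lemma transport_join:
  assumes f: "transport {0..1} f \<phi>" and g: "transport {0..1} g \<psi>" and eq: "f 1 = g 0" and \<psi>: "\<psi> 0 = \<one>"
  shows "transport {0..1} (loop_join f g) (\<lambda>t. if t \<le> 1/2 then \<phi> (2 * t) else \<phi> 1 \<otimes> \<psi> (2 * t - 1))"
proof -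
  have c: "continuous_map (top_of_set {0..1}) X f" "continuous_map (top_of_set {0..1}) X g"
    using f g by (simp_all add: transport_def)
  have p1: "\<phi> 1 \<in> carrier H" using f by (simp add: transport_def)
  have "path_between X (f 0) (f 1) f" "path_between X (f 1) (g 1) g"
    using c eq by (simp_all add: path_between_def pathin_def)
  from path_between_join[OF this] have cj: "continuous_map (top_of_set {0..1}) X (loop_join f g)"
    by (simp add: path_between_def pathin_def)
  have "transport {0..1/2} (\<lambda>t. f (2 * t)) (\<lambda>t. \<phi> (2 * t))"
    by (rule transport_compose[OF f]) (auto intro!: continuous_intros)
  then have 1: "transport {0..1/2} (loop_join f g) (\<lambda>t. \<phi> (2 * t))"
    unfolding transport_def parallel_near_def
    using continuous_map_from_subtopology_mono[OF cj, of "{0..1/2}"] by (simp add: loop_join_def)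
  have j: "loop_join f g t = g (2 * t - 1)" if "t \<in> {1/2..1}" for t
  proof (cases "t = 1/2")
    case True
    show ?thesis unfolding True using eq by (simp add: loop_join_def)
  qed (use that in \<open>auto simp: loop_join_def\<close>)
  have "transport {1/2..1} (\<lambda>t. g (2 * t - 1)) (\<lambda>t. \<phi> 1 \<otimes> \<psi> (2 * t - 1))"
    by (rule transport_compose[OF transport_left_mult[OF g p1]]) (auto intro!: continuous_intros)
  then have 2: "transport {1/2..1} (loop_join f g) (\<lambda>t. \<phi> 1 \<otimes> \<psi> (2 * t - 1))"
    unfolding transport_def parallel_near_def
    using continuous_map_from_subtopology_mono[OF cj, of "{1/2..1}"] by (simp add: j)
  show ?thesis
    by (rule transport_glue[OF 1 2]) (use p1 \<psi> cj in auto)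
qed

lemma holonomy_join:
  assumes f: "path_between X a b f" and g: "path_between X b d g"
  shows "holonomy (loop_join f g) = holonomy f \<otimes> holonomy g"
proof -
  obtain \<phi> where \<phi>: "transport {0..1} f \<phi>" "\<phi> 0 = \<one>"
    using transport_exists[of f] f by (auto simp: path_between_def pathin_def)
  obtain \<psi> where \<psi>: "transport {0..1} g \<psi>" "\<psi> 0 = \<one>"
    using transport_exists[of g] g by (auto simp: path_between_def pathin_def)
  have "f 1 = g 0" using f g by (simp add: path_between_def)
  from holonomy_eq[OF transport_join[OF \<phi>(1) \<psi>(1) this \<psi>(2)]] have "holonomy (loop_join f g) = \<phi> 1 \<otimes> \<psi> 1"
    using \<phi>(2) by simp
  then show ?thesis using holonomy_eq[OF \<phi>] holonomy_eq[OF \<psi>] by simp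
qed

lemma holonomy_closed:
  assumes "path_between X a b f" shows "holonomy f \<in> carrier H"
proof -
  obtain \<phi> where \<phi>: "transport {0..1} f \<phi>" "\<phi> 0 = \<one>"
    using transport_exists[of f] assms by (auto simp: path_between_def pathin_def)
  then show ?thesis using holonomy_eq[OF \<phi>] by (simp add: transport_def)
qed

theorem holonomy_hom:
  obtains h where "h \<in> hom (fundamental_group X p) H" "\<And>f. f \<in> loops_at X p \<Longrightarrow> h (loop_class X p f) = holonomy f"
proof -
  define h where "h C = holonomy (SOME f. f \<in> C)" for C
  have h: "h (loop_class X p f) = holonomy f" if f: "f \<in> loops_at X p" for f
  proof -
    have "f \<in> loop_class X p f"
      using f by (simp add: loop_class_def loop_homotopic_eq path_homotopic_refl loops_at_eq)
    then have "(SOME g. g \<in> loop_class X p f) \<in> loop_class X p f" by (rule someI[of "\<lambda>g. g \<in> loop_class X p f"])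
    then have "path_homotopic X p p f (SOME g. g \<in> loop_class X p f)"
      by (simp add: loop_class_def loop_homotopic_eq)
    from holonomy_homotopic[OF this] show ?thesis by (simp add: h_def)
  qed
  have "h \<in> hom (fundamental_group X p) H"
  proof (rule homI)
    fix x assume "x \<in> carrier (fundamental_group X p)"
    then obtain f where f: "x = loop_class X p f" "f \<in> loops_at X p" by (auto simp: fundamental_group_carrier)
    then show "h x \<in> carrier H" using h holonomy_closed[of p p f] by (simp add: loops_at_eq)
    fix y assume "y \<in> carrier (fundamental_group X p)"
    then obtain g where g: "y = loop_class X p g" "g \<in> loops_at X p" by (auto simp: fundamental_group_carrier)
    have "loop_join f g \<in> loops_at X p" using path_between_join[of X p p f p g] f g by (simp add: loops_at_eq)
    then show "h (x \<otimes>\<^bsub>fundamental_group X p\<^esub> y) = h x \<otimes> h y"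
      using f g holonomy_join[of p p f p g] by (simp add: fundamental_group_mult h) (simp add: loops_at_eq)
  qed
  then show ?thesis using that h by blast
qed

end

section \<open>Loops spelled in a convex domain\<close>

locale convex_cover_map =
  fixes X :: "'a topology" and S :: "'b::real_normed_vector set" and q :: "'b \<Rightarrow> 'a" and x0 :: 'b
  assumes q_cont: "continuous_map (top_of_set S) X q" and S_convex: "convex S" and x0: "x0 \<in> S"
begin

abbreviation base :: 'a where "base \<equiv> q x0"
abbreviation G where "G \<equiv> fundamental_group X base"

text \<open>Every point of the convex domain is joined to the base point by a segment, which turns paths
  between images of points of the domain into loops. The endpoints are given in the domain, as
  their images may have several preimages.\<close>

definition spoke :: "'b \<Rightarrow> real \<Rightarrow> 'a" where
  "spoke x = (\<lambda>t. q (linepath x0 x t))"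

definition tied :: "'b \<Rightarrow> (real \<Rightarrow> 'a) \<Rightarrow> 'b \<Rightarrow> real \<Rightarrow> 'a" where
  "tied x f y = loop_join (spoke x) (loop_join f (path_rev (spoke y)))"

definition tied_class :: "'b \<Rightarrow> (real \<Rightarrow> 'a) \<Rightarrow> 'b \<Rightarrow> (real \<Rightarrow> 'a) set" where
  "tied_class x f y = loop_class X base (tied x f y)"

lemma q_topspace: "x \<in> S \<Longrightarrow> q x \<in> topspace X"
  using q_cont by (auto simp: continuous_map_def)

lemma group_G: "group G"
  by (rule group_fundamental_group[OF q_topspace[OF x0]])

lemma linepath_S: "x \<in> S \<Longrightarrow> linepath x0 x ` {0..1} \<subseteq> S"
  using convexD[OF S_convex x0] by (auto simp: linepath_def)

lemma path_between_inside:
  assumes "continuous_on {0..1} \<delta>" "\<delta> ` {0..1} \<subseteq> S" "\<delta> 0 = x" "\<delta> 1 = y"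
  shows "path_between X (q x) (q y) (\<lambda>t. q (\<delta> t))"
  using path_between_compose[OF q_cont assms(1,2)] assms(3,4) by simp

lemma path_between_spoke: "x \<in> S \<Longrightarrow> path_between X base (q x) (spoke x)"
  unfolding spoke_def by (rule path_between_inside) (auto simp: linepath_S linepath_0' linepath_1' intro: continuous_on_linepath)

lemma tied_loop:
  assumes "x \<in> S" "y \<in> S" "path_between X (q x) (q y) f"
  shows "path_between X base base (tied x f y)"
  unfolding tied_def
  by (rule path_between_join[OF path_between_spoke[OF assms(1)]
     path_between_join[OF assms(3) path_between_rev[OF path_between_spoke[OF assms(2)]]]])

lemma tied_class_closed:
  assumes "x \<in> S" "y \<in> S" "path_between X (q x) (q y) f"
  shows "tied_class x f y \<in> carrier G"
  using tied_loop[OF assms] by (simp add: tied_class_def fundamental_group_carrier loops_at_eq)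

lemma loop_class_cong: "path_homotopic X r r f g \<Longrightarrow> loop_class X r f = loop_class X r g"
  using loop_class_eq_iff[of f X r g] path_homotopic_imp_path_between(1)[of X r r f g] by (simp add: loops_at_eq)

lemma tied_class_cong:
  assumes "x \<in> S" "y \<in> S" "path_homotopic X (q x) (q y) f g"
  shows "tied_class x f y = tied_class x g y"
  unfolding tied_class_def tied_def
  using path_between_spoke[OF assms(1)] path_between_rev[OF path_between_spoke[OF assms(2)]]
  by (intro loop_class_cong path_homotopic_join[OF _ path_homotopic_join[OF assms(3)]]) (simp_all add: path_homotopic_refl)

lemma tied_class_mult:
  assumes x: "x \<in> S" and y: "y \<in> S" and z: "z \<in> S"
    and f: "path_between X (q x) (q y) f" and g: "path_between X (q y) (q z) g"
  shows "tied_class x f y \<otimes>\<^bsub>G\<^esub> tied_class y g z = tied_class x (loop_join f g) z"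
proof -
  note sx = path_between_spoke[OF x] and sy = path_between_spoke[OF y] and sz = path_between_spoke[OF z]
  note rz = path_between_rev[OF sz] and ry = path_between_rev[OF sy]
  note gz = path_between_join[OF g rz]
  have "path_homotopic X base base (loop_join (tied x f y) (tied y g z))
     (loop_join (loop_join (loop_join (spoke x) f) (path_rev (spoke y))) (tied y g z))"
    unfolding tied_def[of x f y]
    by (rule path_homotopic_join[OF path_homotopic_sym[OF path_homotopic_assoc[OF sx f ry]]])
      (simp add: path_homotopic_refl tied_loop[OF y z g])
  also have "path_homotopic X base base
     (loop_join (loop_join (loop_join (spoke x) f) (path_rev (spoke y))) (tied y g z))
     (loop_join (loop_join (spoke x) f) (loop_join g (path_rev (spoke z))))"
    unfolding tied_def by (rule path_homotopic_cancel[OF path_between_join[OF sx f] sy gz])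
  also have "path_homotopic X base base (loop_join (loop_join (spoke x) f) (loop_join g (path_rev (spoke z))))
     (loop_join (spoke x) (loop_join f (loop_join g (path_rev (spoke z)))))"
    by (rule path_homotopic_assoc[OF sx f gz])
  also have "path_homotopic X base base (loop_join (spoke x) (loop_join f (loop_join g (path_rev (spoke z)))))
     (tied x (loop_join f g) z)"
    unfolding tied_def
    by (rule path_homotopic_join[OF _ path_homotopic_sym[OF path_homotopic_assoc[OF f g rz]]])
      (simp add: path_homotopic_refl sx)
  finally have *: "path_homotopic X base base (loop_join (tied x f y) (tied y g z)) (tied x (loop_join f g) z)" .
  have "tied x f y \<in> loops_at X base" "tied y g z \<in> loops_at X base"
    using tied_loop[OF x y f] tied_loop[OF y z g] by (simp_all add: loops_at_eq)
  then show ?thesis unfolding tied_class_def using loop_class_cong[OF *] by (simp only: fundamental_group_mult)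
qed

lemma tied_class_inside:
  assumes d: "continuous_on {0..1} \<delta>" "\<delta> ` {0..1} \<subseteq> S" "\<delta> 0 = x" "\<delta> 1 = y"
  shows "tied_class x (\<lambda>t. q (\<delta> t)) y = \<one>\<^bsub>G\<^esub>"
proof -
  have xy: "x \<in> S" "y \<in> S" using d by auto
  let ?b = "\<lambda>t. if t \<le> 1/2 then \<delta> (2 * t) else linepath x0 y (1 - (2 * t - 1))"
  let ?a = "\<lambda>t. if t \<le> 1/2 then linepath x0 x (2 * t) else ?b (2 * t - 1)"
  have b: "continuous_on {0..1} ?b"
    by (rule continuous_on_unit_cases[OF d(1), of "\<lambda>t. linepath x0 y (1 - t)"])
      (use d in \<open>auto simp: linepath_1' intro!: continuous_on_compose2[OF continuous_on_linepath] continuous_intros\<close>)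
  have a: "continuous_on {0..1} ?a"
    by (rule continuous_on_unit_cases[OF continuous_on_linepath b]) (use d in \<open>simp add: linepath_1'\<close>)
  have bS: "?b t \<in> S" if "t \<in> {0..1}" for t
    using d(2) linepath_S[OF xy(2)] that by (auto simp: image_subset_iff)
  have aS: "?a t \<in> S" if "t \<in> {0..1}" for t
    using linepath_S[OF xy(1)] bS[of "2 * t - 1"] that by (auto simp: image_subset_iff simp del: linepath_def)
  have "path_homotopic X base base (tied x (\<lambda>t. q (\<delta> t)) y) (\<lambda>_. base)"
  proof (rule path_homotopic_convex[OF q_cont S_convex a _ continuous_on_const[of "{0..1}" x0]])
    show "?a ` {0..1} \<subseteq> S" using aS by blast
    show "(\<lambda>t. x0) ` {0..1} \<subseteq> S" using x0 by auto
    show "?a 0 = x0" "?a 1 = x0" by (simp_all add: linepath_0')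
    show "tied x (\<lambda>t. q (\<delta> t)) y t = q (?a t)" for t
      by (simp add: tied_def loop_join_def spoke_def path_rev_def)
    show "tied x (\<lambda>t. q (\<delta> t)) y 0 = base" "tied x (\<lambda>t. q (\<delta> t)) y 1 = base"
      by (simp_all add: tied_def loop_join_def spoke_def path_rev_def linepath_0')
  qed simp
  then show ?thesis unfolding tied_class_def fundamental_group_one by (rule loop_class_cong)
qed

lemma tied_class_loop:
  assumes f: "path_between X base base f"
  shows "tied_class x0 f x0 = loop_class X base f"
proof -
  have s: "spoke x0 = (\<lambda>_. base)" by (simp add: spoke_def linepath_refl)
  have "path_homotopic X base base (tied x0 f x0) (loop_join f (\<lambda>_. base))"
    unfolding tied_def s path_rev_def
    by (rule path_homotopic_const_left[OF path_between_join[OF f path_between_const[OF q_topspace[OF x0]]]])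
  then have "path_homotopic X base base (tied x0 f x0) f"
    by (rule path_homotopic_trans) (rule path_homotopic_const_right[OF f])
  then show ?thesis unfolding tied_class_def by (rule loop_class_cong)
qed

text \<open>Passing from a point of the domain to another one with the same image.\<close>

definition jump :: "'b \<Rightarrow> 'b \<Rightarrow> (real \<Rightarrow> 'a) set" where
  "jump x y = tied_class x (\<lambda>_. q x) y"

lemma const_path: "x \<in> S \<Longrightarrow> q x = q y \<Longrightarrow> path_between X (q x) (q y) (\<lambda>_. q x)"
  using path_between_const[OF q_topspace] by metis

lemma jump_closed: "x \<in> S \<Longrightarrow> y \<in> S \<Longrightarrow> q x = q y \<Longrightarrow> jump x y \<in> carrier G"
  unfolding jump_def by (intro tied_class_closed const_path)

lemma jump_self: "x \<in> S \<Longrightarrow> jump x x = \<one>\<^bsub>G\<^esub>"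
  unfolding jump_def by (rule tied_class_inside[of "\<lambda>_. x" x x]) auto

lemma jump_trans:
  assumes "x \<in> S" "y \<in> S" "z \<in> S" "q x = q y" "q y = q z"
  shows "jump x y \<otimes>\<^bsub>G\<^esub> jump y z = jump x z"
proof -
  have "jump x y \<otimes>\<^bsub>G\<^esub> jump y z = tied_class x (loop_join (\<lambda>_. q x) (\<lambda>_. q y)) z"
    unfolding jump_def by (rule tied_class_mult) (use assms const_path in simp_all)
  also have "loop_join (\<lambda>_. q x) (\<lambda>_. q y) = (\<lambda>_. q x)" using assms(4) by (simp add: loop_join_def fun_eq_iff)
  finally show ?thesis by (simp add: jump_def)
qed

lemma jump_inv:
  assumes "x \<in> S" "y \<in> S" "q x = q y"
  shows "jump y x = inv\<^bsub>G\<^esub> jump x y"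
  by (rule group.inv_equality[OF group_G, symmetric]) (use assms jump_trans[of y x y] jump_self jump_closed in simp_all)

text \<open>Two paths in the domain with the same image may be used to move a jump along them.\<close>

lemma jump_slide:
  fixes \<delta> \<epsilon> :: "real \<Rightarrow> 'b"
  assumes d: "continuous_on {0..1} \<delta>" "\<delta> ` {0..1} \<subseteq> S" and e: "continuous_on {0..1} \<epsilon>" "\<epsilon> ` {0..1} \<subseteq> S"
    and eq: "\<And>t. t \<in> {0..1} \<Longrightarrow> q (\<delta> t) = q (\<epsilon> t)"
  shows "jump (\<delta> 0) (\<epsilon> 0) = jump (\<delta> 1) (\<epsilon> 1)"
proof -
  interpret G: group G by (rule group_G)
  let ?f = "\<lambda>t. q (\<delta> t)" and ?h = "\<lambda>t. q (\<epsilon> t)"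
  have S: "\<delta> 0 \<in> S" "\<delta> 1 \<in> S" "\<epsilon> 0 \<in> S" "\<epsilon> 1 \<in> S" using d e by auto
  have pf: "path_between X (q (\<delta> 0)) (q (\<delta> 1)) ?f" by (rule path_between_inside[OF d]) simp_all
  have ph: "path_between X (q (\<epsilon> 0)) (q (\<epsilon> 1)) ?h" by (rule path_between_inside[OF e]) simp_all
  have q01: "q (\<delta> 0) = q (\<epsilon> 0)" "q (\<delta> 1) = q (\<epsilon> 1)" using eq by simp_all
  have 1: "tied_class (\<delta> 0) ?f (\<delta> 1) = \<one>\<^bsub>G\<^esub>" "tied_class (\<epsilon> 0) ?h (\<epsilon> 1) = \<one>\<^bsub>G\<^esub>"
    by (rule tied_class_inside[OF d]; simp) (rule tied_class_inside[OF e]; simp)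
  have fh: "path_homotopic X (q (\<delta> 0)) (q (\<delta> 1)) ?f ?h" by (rule path_between_eq[OF pf]) (rule eq)
  have "jump (\<delta> 1) (\<epsilon> 1) = tied_class (\<delta> 0) ?f (\<delta> 1) \<otimes>\<^bsub>G\<^esub> jump (\<delta> 1) (\<epsilon> 1)"
    using 1 jump_closed S q01 by simp
  also have "\<dots> = tied_class (\<delta> 0) (loop_join ?f (\<lambda>_. q (\<delta> 1))) (\<epsilon> 1)"
    unfolding jump_def by (rule tied_class_mult[OF S(1,2,4) pf const_path[OF S(2) q01(2)]])
  also have "\<dots> = tied_class (\<delta> 0) ?f (\<epsilon> 1)"
    by (rule tied_class_cong[OF S(1,4)]) (use path_homotopic_const_right[OF pf] q01 in simp)
  also have "\<dots> = tied_class (\<delta> 0) ?h (\<epsilon> 1)"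
    by (rule tied_class_cong[OF S(1,4)]) (use fh q01 in simp)
  also have "\<dots> = tied_class (\<delta> 0) (loop_join (\<lambda>_. q (\<delta> 0)) ?h) (\<epsilon> 1)"
    by (rule tied_class_cong[OF S(1,4)]) (use path_homotopic_sym[OF path_homotopic_const_left[OF ph]] q01 in simp)
  also have "\<dots> = jump (\<delta> 0) (\<epsilon> 0) \<otimes>\<^bsub>G\<^esub> tied_class (\<epsilon> 0) ?h (\<epsilon> 1)"
    unfolding jump_def by (rule tied_class_mult[OF S(1,3,4) const_path[OF S(1) q01(1)] ph, symmetric])
  also have "\<dots> = jump (\<delta> 0) (\<epsilon> 0)" using 1 jump_closed S q01 by simp
  finally show ?thesis by simp
qed

text \<open>A path that can be contracted in \<open>X\<close>, with the tracks of its end points lifting to the domain,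
  represents the jump between the two ends of those tracks.\<close>

lemma tied_class_contract:
  fixes \<delta> \<epsilon> :: "real \<Rightarrow> 'b"
  assumes x: "x \<in> S" and y: "y \<in> S"
    and h: "continuous_map (top_of_set unit_square) X h"
    and f: "\<And>t. t \<in> {0..1} \<Longrightarrow> h (0, t) = f t"
    and c: "\<And>t. t \<in> {0..1} \<Longrightarrow> h (1, t) = q x'"
    and d: "continuous_on {0..1} \<delta>" "\<delta> ` {0..1} \<subseteq> S" "\<delta> 0 = x" "\<delta> 1 = x'" "\<And>s. s \<in> {0..1} \<Longrightarrow> h (s, 0) = q (\<delta> s)"
    and e: "continuous_on {0..1} \<epsilon>" "\<epsilon> ` {0..1} \<subseteq> S" "\<epsilon> 0 = y" "\<epsilon> 1 = y'" "\<And>s. s \<in> {0..1} \<Longrightarrow> h (s, 1) = q (\<epsilon> s)"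
  shows "tied_class x f y = jump x' y'"
proof -
  interpret G: group G by (rule group_G)
  have S: "x' \<in> S" "y' \<in> S" using d(2,4) e(2,4) by auto
  have qq: "q x' = q y'" using c[of 1] e(4) e(5)[of 1] by simp
  have ends: "f 0 = q x" "f 1 = q y" using f[of 0] f[of 1] d(3) d(5)[of 0] e(3) e(5)[of 0] by simp_all
  let ?d = "\<lambda>t. q (\<delta> t)" and ?e = "\<lambda>t. q (\<epsilon> (1 - t))"
  let ?b2 = "\<lambda>t::real. if t \<le> 1/2 then (1::real, 2 * t) else (1 - (2 * t - 1), 1)"
  let ?b = "\<lambda>t::real. if t \<le> 1/2 then (2 * t, 0) else ?b2 (2 * t - 1)"
  let ?g = "loop_join ?d (loop_join (\<lambda>_. q x') ?e)"
  have b2: "continuous_on {0..1} ?b2"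
    by (rule continuous_on_unit_cases[of "\<lambda>t. (1, t)" "\<lambda>t. (1 - t, 1)"]) (auto intro!: continuous_intros)
  have b: "continuous_on {0..1} ?b"
    by (rule continuous_on_unit_cases[of "\<lambda>t. (t, 0)", OF _ b2]) (auto intro!: continuous_intros)
  have "path_homotopic X (q x) (q y) f ?g"
  proof (rule path_homotopic_convex[OF h _ _ _ b, of "\<lambda>t. (0, t)"])
    show "convex unit_square" by (intro convex_Times) simp_all
    show "continuous_on {0..1} (\<lambda>t::real. (0::real, t))" by (intro continuous_intros)
    show "?b ` {0..1} \<subseteq> unit_square" by auto
    show "?g t = h (?b t)" if t: "t \<in> {0..1}" for t
    proof -
      consider "t \<le> 1/2" | "1/2 < t" "2 * t - 1 \<le> 1/2" | "1/2 < t" "1/2 < 2 * t - 1" by linarith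
      then show ?thesis
      proof cases
        case 1 then show ?thesis using d(5)[of "2 * t"] t by (simp add: loop_join_def)
      next
        case 2 then show ?thesis using c[of "2 * (2 * t - 1)"] t by (simp add: loop_join_def)
      next
        case 3
        have "1 - (2 * (2 * t - 1) - 1) \<in> {0..1}" using 3 t by auto
        from e(5)[OF this] show ?thesis using 3 by (simp add: loop_join_def)
      qed
    qed
  qed (use f ends in auto)
  from tied_class_cong[OF x y this] have "tied_class x f y = tied_class x ?g y" .
  also have "\<dots> = tied_class x ?d x' \<otimes>\<^bsub>G\<^esub> tied_class x' (loop_join (\<lambda>_. q x') ?e) y"
  proof (rule tied_class_mult[OF x S(1) y, symmetric])
    show "path_between X (q x) (q x') ?d" by (rule path_between_inside[OF d(1-4)])
    have "path_between X (q y') (q y) ?e"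
      by (rule path_between_inside[of "\<lambda>t. \<epsilon> (1 - t)"])
        (use e in \<open>auto intro!: continuous_on_compose2[OF e(1)] continuous_intros\<close>)
    then show "path_between X (q x') (q y) (loop_join (\<lambda>_. q x') ?e)"
      using path_between_join[OF const_path[OF S(1) qq]] by simp
  qed
  also have "tied_class x ?d x' = \<one>\<^bsub>G\<^esub>" by (rule tied_class_inside[OF d(1-4)])
  also have "tied_class x' (loop_join (\<lambda>_. q x') ?e) y = jump x' y' \<otimes>\<^bsub>G\<^esub> tied_class y' ?e y"
    unfolding jump_def
  proof (rule tied_class_mult[OF S y const_path[OF S(1) qq], symmetric])
    show "path_between X (q y') (q y) ?e"
      by (rule path_between_inside[of "\<lambda>t. \<epsilon> (1 - t)"])
        (use e in \<open>auto intro!: continuous_on_compose2[OF e(1)] continuous_intros\<close>)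
  qed
  also have "tied_class y' ?e y = \<one>\<^bsub>G\<^esub>"
    by (rule tied_class_inside[of "\<lambda>t. \<epsilon> (1 - t)"])
      (use e in \<open>auto intro!: continuous_on_compose2[OF e(1)] continuous_intros\<close>)
  finally show ?thesis using jump_closed[OF S qq] by simp
qed

end

section \<open>The polygon and its patches\<close>

locale polygon_surface =
  fixes n :: nat and X :: "'a topology" and q :: "complex \<Rightarrow> 'a" and x0 :: complex
  assumes n_pos: "1 \<le> n"
    and quotient: "quotient_map (top_of_set (cball 0 1)) X q"
    and fibres: "\<And>x y. x \<in> cball 0 1 \<Longrightarrow> y \<in> cball 0 1 \<Longrightarrow> q x = q y \<longleftrightarrow> equivclp (side_pairing n) x y"
    and x0_disc: "x0 \<in> cball 0 1"
begin

abbreviation D :: "complex set" where "D \<equiv> cball 0 1"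
abbreviation per :: real where "per \<equiv> 4 * real n"

sublocale convex_cover_map X D q x0
  using quotient_imp_continuous_map[OF quotient] x0_disc by unfold_locales simp_all

text \<open>Polar coordinates in which a side of the polygon has length 1, so that vertices sit at integers
  and side midpoints at half-integers.\<close>

definition pnt :: "real \<Rightarrow> real \<Rightarrow> complex" where
  "pnt r u = of_real r * cis (2 * pi * u / per)"

lemma per_pos: "4 \<le> per" "0 < per"
  using n_pos by linarith+

lemma norm_pnt [simp]: "norm (pnt r u) = \<bar>r\<bar>"
  by (simp add: pnt_def norm_mult)

lemma pnt_periodic: "pnt r (u + of_int j * per) = pnt r u"
proof -
  have "2 * pi * (u + of_int j * per) / per = 2 * pi * u / per + 2 * pi * of_int j"
    using per_pos by (simp add: field_simps)
  then have "cis (2 * pi * (u + of_int j * per) / per) = cis (2 * pi * u / per) * cis (2 * pi * of_int j)"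
    by (simp only: cis_mult)
  also have "cis (2 * pi * of_int j) = 1" by (rule cis_multiple_2pi) simp
  finally show ?thesis by (simp add: pnt_def)
qed

lemma pnt_unique:
  assumes "0 < r" "0 < r'" "pnt r u = pnt r' u'"
  shows "r = r'" "\<exists>j::int. u' = u + of_int j * per"
proof -
  have "norm (pnt r u) = norm (pnt r' u')" using assms(3) by simp
  then show r: "r = r'" using assms(1,2) by simp
  have "cis (2 * pi * u' / per) = cis (2 * pi * u / per)" using assms r by (simp add: pnt_def)
  then have "sin (2 * pi * u' / per) = sin (2 * pi * u / per) \<and> cos (2 * pi * u' / per) = cos (2 * pi * u / per)"
    by (simp add: complex_eq_iff)
  then obtain j :: int where "2 * pi * u' / per = 2 * pi * u / per + 2 * pi * of_int j"
    unfolding sin_cos_eq_iff by blast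
  then have "2 * pi * u' = 2 * pi * (u + of_int j * per)" using per_pos by (simp add: field_simps)
  then show "\<exists>j::int. u' = u + of_int j * per" by (intro exI[of _ j]) simp
qed

text \<open>The open sector of the points whose angular coordinate differs from \<open>c\<close> by less
  than 1/2, written without choosing an argument.\<close>

definition sector :: "real \<Rightarrow> complex set" where
  "sector c = {z. norm z * cos (pi / per) < Re (z * cis (- (2 * pi * c / per)))}"

definition angle :: "real \<Rightarrow> complex \<Rightarrow> real" where
  "angle c z = c + per / (2 * pi) * Arg (z * cis (- (2 * pi * c / per)))"

lemma open_sector: "open (sector c)"
  unfolding sector_def by (intro open_Collect_less continuous_intros)

lemma per_angle: "0 < pi / per" "pi / per \<le> pi / 4" "0 \<le> cos (pi / per)"
proof -
  show 1: "0 < pi / per" using per_pos by simp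
  show 2: "pi / per \<le> pi / 4" using per_pos by (intro divide_left_mono) simp_all
  show "0 \<le> cos (pi / per)" using 1 2 by (intro cos_ge_zero) simp_all
qed

lemma sector_coords:
  assumes z: "z \<in> sector c"
  shows "z \<noteq> 0" "\<bar>angle c z - c\<bar> < 1/2" "z = pnt (norm z) (angle c z)"
    "z * cis (- (2 * pi * c / per)) \<notin> \<real>\<^sub>\<le>\<^sub>0"
proof -
  let ?w = "z * cis (- (2 * pi * c / per))"
  have less: "norm ?w * cos (pi / per) < Re ?w" using z by (simp add: sector_def norm_mult)
  show z0: "z \<noteq> 0" using less by auto
  then have w0: "?w \<noteq> 0" "0 < norm ?w" by simp_all
  have "0 < Re ?w" using less per_angle(3) w0 mult_nonneg_nonneg[of "norm ?w" "cos (pi / per)"] by linarith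
  then show "?w \<notin> \<real>\<^sub>\<le>\<^sub>0" by (auto simp: complex_nonpos_Reals_iff)
  have w: "?w = of_real (norm ?w) * cis (Arg ?w)" using rcis_cmod_Arg[of ?w] by (simp add: rcis_def)
  have "Re (of_real (norm ?w) * cis (Arg ?w)) = norm ?w * cos (Arg ?w)" by simp
  then have "Re ?w = norm ?w * cos (Arg ?w)" by (simp only: w[symmetric])
  then have "norm ?w * cos (pi / per) < norm ?w * cos (Arg ?w)" using less by simp
  then have cos: "cos (pi / per) < cos (Arg ?w)" using w0 by simp
  have "\<bar>Arg ?w\<bar> < pi / per"
  proof (rule ccontr)
    assume "\<not> \<bar>Arg ?w\<bar> < pi / per"
    then have "cos \<bar>Arg ?w\<bar> \<le> cos (pi / per)"
      using per_angle Arg_bounded[of ?w] by (intro cos_monotone_0_pi_le) auto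
    then show False using cos by simp
  qed
  then have "per / (2 * pi) * \<bar>Arg ?w\<bar> < per / (2 * pi) * (pi / per)"
    using per_pos by (intro mult_strict_left_mono) simp_all
  also have "\<dots> = 1/2" using per_pos by simp
  finally show "\<bar>angle c z - c\<bar> < 1/2" using per_pos by (simp add: angle_def abs_mult)
  have "2 * pi * angle c z / per = 2 * pi * c / per + Arg ?w"
    using per_pos by (simp add: angle_def field_simps)
  then have "cis (2 * pi * angle c z / per) = cis (2 * pi * c / per) * cis (Arg ?w)" by (simp only: cis_mult)
  then have "pnt (norm z) (angle c z) = of_real (norm z) * cis (Arg ?w) * cis (2 * pi * c / per)"
    by (simp only: pnt_def mult_ac)
  also have "of_real (norm z) * cis (Arg ?w) = ?w" using w by (simp add: norm_mult)
  also have "?w * cis (2 * pi * c / per) = z" by (simp add: mult.assoc cis_mult)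
  finally show "z = pnt (norm z) (angle c z)" by simp
qed

lemma pnt_sector:
  assumes r: "0 < r" and u: "\<bar>u - c\<bar> < 1/2"
  shows "pnt r u \<in> sector c" "angle c (pnt r u) = u"
proof -
  let ?a = "2 * pi * (u - c) / per"
  have w: "pnt r u * cis (- (2 * pi * c / per)) = of_real r * cis ?a"
    by (simp add: pnt_def mult.assoc cis_mult diff_divide_distrib right_diff_distrib)
  have "\<bar>?a\<bar> = 2 * pi / per * \<bar>u - c\<bar>" using per_pos by (simp add: abs_mult)
  also have "\<dots> < 2 * pi / per * (1/2)" using u per_pos by (intro mult_strict_left_mono) simp_all
  finally have a: "\<bar>?a\<bar> < pi / per" by simp
  have "cos (pi / per) < cos \<bar>?a\<bar>"
    using a per_angle pi_gt_zero by (intro cos_monotone_0_pi) linarith+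
  then have "cos (pi / per) < cos ?a" by (simp only: cos_abs_real)
  then have "r * cos (pi / per) < r * cos ?a" using r by simp
  then show "pnt r u \<in> sector c" unfolding sector_def mem_Collect_eq w using r by simp
  have "Arg (of_real r * cis ?a) = ?a"
  proof -
    have "Arg (cis ?a) = ?a" by (rule Arg_cis, unfold greaterThanAtMost_iff) (use a per_angle(2) pi_gt_zero in linarith)
    then show ?thesis using r by simp
  qed
  then show "angle c (pnt r u) = u" unfolding angle_def w using per_pos by simp
qed

text \<open>Sets of centres for a patch: half-integers, closed under full turns, with disjoint sectors, and
  invariant under the reflection \<open>u \<mapsto> 2 k + 3 - u\<close> which describes how the
  side from \<open>k\<close> to \<open>k + 1\<close> is glued to its partner. The invariance
  makes the union of the sectors saturated.\<close>

definition chart :: "real set \<Rightarrow> bool" where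
  "chart C \<longleftrightarrow> (\<forall>c\<in>C. \<exists>z::int. c = of_int z / 2) \<and> (\<forall>c\<in>C. \<forall>j::int. c + of_int j * per \<in> C) \<and>
     (\<forall>c\<in>C. \<forall>c'\<in>C. c \<noteq> c' \<longrightarrow> 1 \<le> \<bar>c - c'\<bar>) \<and>
     (\<forall>k<4 * n. k mod 4 < 2 \<longrightarrow> (\<forall>c. \<bar>c - (real k + 1/2)\<bar> \<le> 1/2 \<longrightarrow> c \<in> C \<longleftrightarrow> 2 * real k + 3 - c \<in> C))"

lemma chartD:
  assumes "chart C"
  shows "c \<in> C \<Longrightarrow> \<exists>z::int. c = of_int z / 2" "c \<in> C \<Longrightarrow> c + of_int j * per \<in> C"
    "c \<in> C \<Longrightarrow> c' \<in> C \<Longrightarrow> c \<noteq> c' \<Longrightarrow> 1 \<le> \<bar>c - c'\<bar>"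
    "k < 4 * n \<Longrightarrow> k mod 4 < 2 \<Longrightarrow> \<bar>c - (real k + 1/2)\<bar> \<le> 1/2 \<Longrightarrow> c \<in> C \<longleftrightarrow> 2 * real k + 3 - c \<in> C"
  using assms unfolding chart_def by blast+

definition region :: "real set \<Rightarrow> complex set" where
  "region C = (\<Union>c\<in>C. sector c)"

lemma same_centre:
  assumes C: "chart C" and c: "c \<in> C" "z \<in> sector c" and c': "c' \<in> C" "z \<in> sector c'"
  shows "\<exists>j::int. c' = c + of_int j * per \<and> angle c' z = angle c z + of_int j * per"
proof -
  note a = sector_coords[OF c(2)] and a' = sector_coords[OF c'(2)]
  have "0 < norm z" using a(1) by simp
  moreover have "pnt (norm z) (angle c z) = pnt (norm z) (angle c' z)" using a(3) a'(3) by simp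
  ultimately obtain j :: int where j: "angle c' z = angle c z + of_int j * per" using pnt_unique(2) by blast
  have "c + of_int j * per = c'"
  proof (rule ccontr)
    assume "c + of_int j * per \<noteq> c'"
    then have "1 \<le> \<bar>c + of_int j * per - c'\<bar>" using chartD(3)[OF C chartD(2)[OF C c(1)] c'(1)] by blast
    then show False using a(2) a'(2) j by linarith
  qed
  then show ?thesis using j by auto
qed

text \<open>In polar coordinates, the straight-line motion towards the boundary point at angle
  \<open>c\<close>.\<close>

definition shrink :: "real \<Rightarrow> real \<Rightarrow> complex \<Rightarrow> complex" where
  "shrink c s z = pnt (norm z + s * (1 - norm z)) (angle c z + s * (c - angle c z))"

definition centre :: "real set \<Rightarrow> complex \<Rightarrow> real" where
  "centre C z = (SOME c. c \<in> C \<and> z \<in> sector c)"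

lemma centre: "z \<in> region C \<Longrightarrow> centre C z \<in> C \<and> z \<in> sector (centre C z)"
  unfolding centre_def by (rule someI_ex) (auto simp: region_def)

lemma shrink_centre:
  assumes C: "chart C" and c: "c \<in> C" "z \<in> sector c"
  shows "shrink (centre C z) s z = shrink c s z"
proof -
  have "z \<in> region C" using c by (auto simp: region_def)
  from centre[OF this] obtain j :: int where "centre C z = c + of_int j * per"
    "angle (centre C z) z = angle c z + of_int j * per"
    using same_centre[OF C c] by blast
  then have "angle (centre C z) z + s * (centre C z - angle (centre C z) z)
      = angle c z + s * (c - angle c z) + of_int j * per" by simp
  then show ?thesis unfolding shrink_def using pnt_periodic by metis
qed

lemma continuous_on_angle: "continuous_on (sector c) (angle c)"
proof -
  have "continuous_on (- \<real>\<^sub>\<le>\<^sub>0) Arg" by (rule continuous_on_Arg)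
  then have "continuous_on (sector c) (\<lambda>z. Arg (z * cis (- (2 * pi * c / per))))"
  proof (rule continuous_on_compose2)
    show "continuous_on (sector c) (\<lambda>z. z * cis (- (2 * pi * c / per)))" by (intro continuous_intros)
    show "(\<lambda>z. z * cis (- (2 * pi * c / per))) ` sector c \<subseteq> - \<real>\<^sub>\<le>\<^sub>0"
      using sector_coords(4)[of _ c] by blast
  qed
  then show ?thesis unfolding angle_def by (intro continuous_on_add continuous_on_mult continuous_on_const)
qed

lemma continuous_on_shrink: "continuous_on (UNIV \<times> sector c) (\<lambda>x. shrink c (fst x) (snd x))"
proof -
  have "continuous_on (UNIV \<times> sector c) (\<lambda>x. angle c (snd x))"
    by (rule continuous_on_compose2[OF continuous_on_angle[of c] continuous_on_snd[OF continuous_on_id]]) auto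
  then show ?thesis unfolding shrink_def pnt_def
    using per_pos by (intro continuous_intros continuous_on_cis) simp_all
qed

lemma continuous_on_shrink_region:
  assumes C: "chart C"
  shows "continuous_on (UNIV \<times> region C) (\<lambda>x. shrink (centre C (snd x)) (fst x) (snd x))"
proof -
  have eq: "UNIV \<times> region C = (\<Union>c\<in>C. UNIV \<times> sector c)" by (auto simp: region_def)
  show ?thesis unfolding eq
  proof (rule continuous_on_open_UN)
    fix c assume c: "c \<in> C"
    show "open (UNIV \<times> sector c)" by (intro open_Times open_UNIV open_sector)
    show "continuous_on (UNIV \<times> sector c) (\<lambda>x. shrink (centre C (snd x)) (fst x) (snd x))"
      by (rule continuous_on_eq[OF continuous_on_shrink[of c]]) (use shrink_centre[OF C c] in auto)
  qed
qed

lemma side_pairingE: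
  assumes "side_pairing n x y"
  obtains k u where "k < 4 * n" "k mod 4 < 2" "real k \<le> u" "u \<le> real k + 1" "x = pnt 1 u" "y = pnt 1 (2 * real k + 3 - u)"
proof -
  obtain k t where kt: "k < 4 * n" "k mod 4 < 2" "0 \<le> t" "t \<le> 1" "x = polygon_side n k t" "y = polygon_side n (k + 2) (1 - t)"
    using assms unfolding side_pairing_def by blast
  have "y = pnt 1 (2 * real k + 3 - (real k + t))" using kt(6) by (simp add: polygon_side_def pnt_def algebra_simps)
  moreover have "x = pnt 1 (real k + t)" using kt(5) by (simp add: polygon_side_def pnt_def)
  ultimately show ?thesis using that[of k "real k + t"] kt by simp
qed

lemma side_pairingI:
  assumes "k < 4 * n" "k mod 4 < 2" "real k \<le> u" "u \<le> real k + 1"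
  shows "side_pairing n (pnt 1 u) (pnt 1 (2 * real k + 3 - u))"
  unfolding side_pairing_def
  by (rule exI[of _ k], rule exI[of _ "u - real k"])
    (use assms in \<open>simp add: polygon_side_def pnt_def algebra_simps\<close>)

lemma q_glue:
  assumes "k < 4 * n" "k mod 4 < 2" "real k \<le> u" "u \<le> real k + 1"
  shows "q (pnt 1 u) = q (pnt 1 (2 * real k + 3 - u))"
  using fibres[of "pnt 1 u" "pnt 1 (2 * real k + 3 - u)"] side_pairingI[OF assms] by (simp add: r_into_equivclp)

lemma half_integer_near:
  fixes u c :: real
  assumes "c = of_int z / 2" "of_int k \<le> u" "u \<le> of_int k + 1" "\<bar>u - c\<bar> < 1/2"
  shows "\<bar>c - (of_int k + 1/2)\<bar> \<le> 1/2"
proof -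
  have "2 * of_int k - 1 < (of_int z :: real)" "(of_int z :: real) < 2 * of_int k + 3"
    using assms by linarith+
  then have "of_int (2 * k - 1) < (of_int z :: real)" "(of_int z :: real) < of_int (2 * k + 3)" by simp_all
  then have "2 * k \<le> z" "z \<le> 2 * k + 2" unfolding of_int_less_iff by linarith+
  then have "(of_int (2 * k) :: real) \<le> of_int z" "(of_int z :: real) \<le> of_int (2 * k + 2)" by (simp_all only: of_int_le_iff)
  then have "2 * of_int k \<le> (of_int z :: real)" "(of_int z :: real) \<le> 2 * of_int k + 2" by simp_all
  then show ?thesis unfolding assms(1) by linarith
qed

lemma boundary_centre:
  assumes C: "chart C" and u: "of_int k \<le> u" "u \<le> of_int k + 1" and x: "pnt 1 u \<in> region C"
  obtains c where "c \<in> C" "\<bar>u - c\<bar> < 1/2" "\<bar>c - (of_int k + 1/2)\<bar> \<le> 1/2"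
proof -
  obtain c0 where c0: "c0 \<in> C" "pnt 1 u \<in> sector c0" using x by (auto simp: region_def)
  have "pnt 1 u = pnt (norm (pnt 1 u)) (angle c0 (pnt 1 u))" by (rule sector_coords(3)[OF c0(2)])
  then have "pnt 1 u = pnt 1 (angle c0 (pnt 1 u))" by simp
  then obtain j :: int where j: "angle c0 (pnt 1 u) = u + of_int j * per" using pnt_unique(2)[of 1 1] by auto
  define c where "c = c0 + of_int (- j) * per"
  have c: "c \<in> C" unfolding c_def by (rule chartD(2)[OF C c0(1)])
  have uc: "\<bar>u - c\<bar> < 1/2" using sector_coords(2)[OF c0(2)] j unfolding c_def of_int_minus by linarith
  obtain z :: int where "c = of_int z / 2" using chartD(1)[OF C c] by blast
  from half_integer_near[OF this u uc] show ?thesis using that c uc by blast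
qed

lemma pair_centre:
  assumes C: "chart C" and k: "k < 4 * n" "k mod 4 < 2" "real k \<le> u" "u \<le> real k + 1"
    and or: "pnt 1 u \<in> region C \<or> pnt 1 (2 * real k + 3 - u) \<in> region C"
  obtains c where "c \<in> C" "\<bar>u - c\<bar> < 1/2" "\<bar>c - (real k + 1/2)\<bar> \<le> 1/2" "2 * real k + 3 - c \<in> C"
    "pnt 1 u \<in> sector c" "pnt 1 (2 * real k + 3 - u) \<in> sector (2 * real k + 3 - c)"
proof -
  have "\<exists>c. c \<in> C \<and> \<bar>u - c\<bar> < 1/2 \<and> \<bar>c - (real k + 1/2)\<bar> \<le> 1/2"
    using or
  proof
    assume "pnt 1 u \<in> region C"
    from boundary_centre[OF C, of "int k" u] this k show ?thesis by auto
  next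
    assume v: "pnt 1 (2 * real k + 3 - u) \<in> region C"
    obtain c where c: "c \<in> C" "\<bar>2 * real k + 3 - u - c\<bar> < 1/2" "\<bar>c - (of_int (int k + 2) + 1/2)\<bar> \<le> 1/2"
      using boundary_centre[OF C, of "int k + 2" "2 * real k + 3 - u"] v k by auto
    have near: "\<bar>(2 * real k + 3 - c) - (real k + 1/2)\<bar> \<le> 1/2" using c(3) unfolding of_int_add of_int_of_nat_eq of_int_numeral by linarith
    have "2 * real k + 3 - c \<in> C" using chartD(4)[OF C k(1,2) near] c(1) by simp
    moreover have "\<bar>u - (2 * real k + 3 - c)\<bar> < 1/2" using c(2) by linarith
    ultimately show ?thesis using near by blast
  qed
  then obtain c where c: "c \<in> C" "\<bar>u - c\<bar> < 1/2" "\<bar>c - (real k + 1/2)\<bar> \<le> 1/2" by blast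
  have "\<bar>(2 * real k + 3 - u) - (2 * real k + 3 - c)\<bar> < 1/2" using c(2) by linarith
  then show ?thesis
    using that[OF c] chartD(4)[OF C k(1,2) c(3)] c(1) pnt_sector(1)[of 1 u c] c(2)
      pnt_sector(1)[of 1 "2 * real k + 3 - u" "2 * real k + 3 - c"] by simp
qed

text \<open>The patch with index 1 surrounds the vertices, that with index \<open>k + 2\<close> the side
  starting at \<open>k\<close> and its partner, which starts at \<open>k + 2\<close>. Index 0 is
  reserved for the interior of the polygon.\<close>

definition centres :: "nat \<Rightarrow> real set" where
  "centres i = (if i = 1 then \<int> else
     {real (i - 2) + 1/2 + of_int j * per |j. True} \<union> {real (i - 2) + 5/2 + of_int j * per |j. True})"

definition charts :: "nat set" where
  "charts = {0, 1} \<union> {k + 2 |k. k < 4 * n \<and> k mod 4 < 2}"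

lemma chart_vertex: "chart \<int>"
  unfolding chart_def
proof (intro conjI ballI allI impI)
  fix c c' :: real and j :: int and k :: nat
  { assume "c \<in> \<int>"
    then obtain z :: int where z: "c = of_int z" by (rule Ints_cases)
    show "\<exists>z::int. c = of_int z / 2" using z by (intro exI[of _ "2 * z"]) simp
    show "c + of_int j * per \<in> \<int>" using \<open>c \<in> \<int>\<close> by (intro Ints_add Ints_mult) simp_all
    assume "c' \<in> \<int>" "c \<noteq> c'"
    then obtain z' :: int where z': "c' = of_int z'" by (auto elim: Ints_cases)
    have "1 \<le> \<bar>z - z'\<bar>" using \<open>c \<noteq> c'\<close> z z' by auto
    then have "(1::real) \<le> of_int \<bar>z - z'\<bar>" by linarith
    then show "1 \<le> \<bar>c - c'\<bar>" using z z' by simp }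
  show "c \<in> \<int> \<longleftrightarrow> 2 * real k + 3 - c \<in> \<int>"
  proof
    show "2 * real k + 3 - c \<in> \<int>" if "c \<in> \<int>" using that by (intro Ints_diff Ints_add Ints_mult) simp_all
    assume "2 * real k + 3 - c \<in> \<int>"
    then have "2 * real k + 3 - (2 * real k + 3 - c) \<in> \<int>" by (intro Ints_diff Ints_add Ints_mult) simp_all
    then show "c \<in> \<int>" by simp
  qed
qed

lemma edge_centreE:
  assumes "c \<in> centres (k + 2)"
  obtains (fst) j :: int where "c = of_int (2 * int k + 1 + 8 * j * int n) / 2"
  | (snd) j :: int where "c = of_int (2 * int k + 5 + 8 * j * int n) / 2"
proof -
  have e: "real k + 1/2 + of_int j * per = of_int (2 * int k + 1 + 8 * j * int n) / 2"
    "real k + 5/2 + of_int j * per = of_int (2 * int k + 5 + 8 * j * int n) / 2" for j :: int by simp_all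
  have "centres (k + 2) = {real k + 1/2 + of_int j * per |j. True} \<union> {real k + 5/2 + of_int j * per |j. True}"
    by (simp add: centres_def)
  then have "c \<in> {real k + 1/2 + of_int j * per |j. True} \<union> {real k + 5/2 + of_int j * per |j. True}" using assms by simp
  then have "(\<exists>j::int. c = of_int (2 * int k + 1 + 8 * j * int n) / 2) \<or> (\<exists>j::int. c = of_int (2 * int k + 5 + 8 * j * int n) / 2)"
    unfolding Un_iff mem_Collect_eq e by blast
  then show ?thesis using fst snd by blast
qed

lemma edge_centreI: "real k + 1/2 + of_int j * per \<in> centres (k + 2)" "real k + 5/2 + of_int j * per \<in> centres (k + 2)"
  unfolding centres_def by auto

lemma edge_centre_near:
  assumes k: "k < 4 * n" "k mod 4 < 2" and k': "k' < 4 * n" "k' mod 4 < 2"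
    and c: "c \<in> centres (k + 2)" and near: "\<bar>c - (real k' + 1/2)\<bar> \<le> 1/2"
  shows "k' = k" "c = real k + 1/2"
proof -
  have "k' = k \<and> c = real k + 1/2" using c
  proof (cases rule: edge_centreE)
    case (fst j)
    define z m where "z = 2 * int k + 1 + 8 * j * int n" and "m = j * int n"
    have z: "c = of_int z / 2" "z = 2 * int k + 1 + 8 * m" using fst by (simp_all add: z_def m_def)
    have "2 * real k' \<le> of_int z" "of_int z \<le> 2 * real k' + 2" using near z(1) by linarith+
    then have "of_int (2 * int k') \<le> (of_int z :: real)" "(of_int z :: real) \<le> of_int (2 * int k' + 2)" by simp_all
    then have "2 * int k' \<le> z" "z \<le> 2 * int k' + 2" by (simp_all only: of_int_le_iff)
    then have e: "int k' = int k + 4 * m" using z(2) by linarith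
    have "4 * m < 4 * int n" "- (4 * int n) < 4 * m" using k(1) k'(1) e by linarith+
    then have "int n * j < int n * 1" "int n * (- 1) < int n * j" by (simp_all add: m_def mult_ac)
    then have "j < 1" "- 1 < j" using n_pos by (simp_all only: mult_less_cancel_left_pos)
    then have "j = 0" by simp
    then show ?thesis using e fst by (simp add: m_def)
  next
    case (snd j)
    define z m where "z = 2 * int k + 5 + 8 * j * int n" and "m = j * int n"
    have z: "c = of_int z / 2" "z = 2 * int k + 5 + 8 * m" using snd by (simp_all add: z_def m_def)
    have "2 * real k' \<le> of_int z" "of_int z \<le> 2 * real k' + 2" using near z(1) by linarith+
    then have "of_int (2 * int k') \<le> (of_int z :: real)" "(of_int z :: real) \<le> of_int (2 * int k' + 2)" by simp_all
    then have "2 * int k' \<le> z" "z \<le> 2 * int k' + 2" by (simp_all only: of_int_le_iff)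
    then have "int k' = int k + 2 + 4 * m" using z(2) by linarith
    then show ?thesis using k(2) k'(2) by presburger
  qed
  then show "k' = k" "c = real k + 1/2" by blast+
qed

lemma chart_edge:
  assumes k: "k < 4 * n" "k mod 4 < 2"
  shows "chart (centres (k + 2))"
proof -
  have odd: "\<exists>z. x = of_int (2 * z + 1) / (2::real)" if x: "x \<in> centres (k + 2)" for x using x
  proof (cases rule: edge_centreE)
    case (fst i) then show ?thesis by (intro exI[of _ "int k + 4 * i * int n"]) simp
  next
    case (snd i) then show ?thesis by (intro exI[of _ "int k + 2 + 4 * i * int n"]) simp
  qed
  have shift: "c + of_int j * per \<in> centres (k + 2)" if c: "c \<in> centres (k + 2)" for c j using c
  proof (cases rule: edge_centreE)
    case (fst i)
    then have "c + of_int j * per = real k + 1/2 + of_int (i + j) * per" by (simp add: field_simps)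
    then show ?thesis by (simp only: edge_centreI)
  next
    case (snd i)
    then have "c + of_int j * per = real k + 5/2 + of_int (i + j) * per" by (simp add: field_simps)
    then show ?thesis by (simp only: edge_centreI)
  qed
  have apart: "1 \<le> \<bar>c - c'\<bar>" if c: "c \<in> centres (k + 2)" "c' \<in> centres (k + 2)" "c \<noteq> c'" for c c'
  proof -
    obtain v v' :: int where v: "c = of_int (2 * v + 1) / 2" "c' = of_int (2 * v' + 1) / 2"
      using odd[OF c(1)] odd[OF c(2)] by blast
    have "v \<noteq> v'" using v c(3) by auto
    then have "1 \<le> \<bar>v - v'\<bar>" by linarith
    then have "(1::real) \<le> \<bar>of_int v - of_int v'\<bar>" by linarith
    then show ?thesis using v by simp
  qed
  have pair: "c \<in> centres (k + 2) \<longleftrightarrow> 2 * real k' + 3 - c \<in> centres (k + 2)"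
    if k': "k' < 4 * n" "k' mod 4 < 2" and near: "\<bar>c - (real k' + 1/2)\<bar> \<le> 1/2" for c k'
  proof
    assume "c \<in> centres (k + 2)"
    from edge_centre_near[OF k k' this near] have "2 * real k' + 3 - c = real k + 5/2 + of_int 0 * per" by simp
    then show "2 * real k' + 3 - c \<in> centres (k + 2)" by (simp only: edge_centreI)
  next
    define d where "d = 2 * real k' + 3 - c"
    assume "2 * real k' + 3 - c \<in> centres (k + 2)"
    then have "d \<in> centres (k + 2)" by (simp add: d_def)
    then show "c \<in> centres (k + 2)"
    proof (cases rule: edge_centreE)
      case (fst j)
      define z m where "z = 2 * int k + 1 + 8 * j * int n" and "m = j * int n"
      have z: "d = of_int z / 2" "z = 2 * int k + 1 + 8 * m" using fst by (simp_all add: z_def m_def)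
      have "2 * real k' + 4 \<le> of_int z" "of_int z \<le> 2 * real k' + 6" using near z(1) unfolding d_def by linarith+
      then have "of_int (2 * int k' + 4) \<le> (of_int z :: real)" "(of_int z :: real) \<le> of_int (2 * int k' + 6)" by simp_all
      then have "2 * int k' + 4 \<le> z" "z \<le> 2 * int k' + 6" by (simp_all only: of_int_le_iff)
      then have "int k' + 2 = int k + 4 * m" using z(2) by linarith
      then show ?thesis using k(2) k'(2) by presburger
    next
      case (snd j)
      then have "d - 2 = real k + 1/2 + of_int j * per" by simp
      then have "d - 2 \<in> centres (k + 2)" by (simp only: edge_centreI)
      moreover have "\<bar>d - 2 - (real k' + 1/2)\<bar> \<le> 1/2" using near unfolding d_def by linarith
      ultimately have "k' = k" "d - 2 = real k + 1/2" by (rule edge_centre_near[OF k k'])+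
      then have "c = real k + 1/2 + of_int 0 * per" unfolding d_def by simp
      then show ?thesis by (simp only: edge_centreI)
    qed
  qed
  have half: "\<exists>z::int. c = of_int z / 2" if "c \<in> centres (k + 2)" for c using odd[OF that] by blast
  let ?C = "centres (k + 2)"
  have 1: "\<forall>c\<in>?C. \<exists>z::int. c = of_int z / 2" using half by (rule ballI)
  have 2: "\<forall>c\<in>?C. \<forall>j::int. c + of_int j * per \<in> ?C" using shift by (intro ballI allI)
  have 3: "\<forall>c\<in>?C. \<forall>c'\<in>?C. c \<noteq> c' \<longrightarrow> 1 \<le> \<bar>c - c'\<bar>"
  proof (intro ballI impI)
    fix c c' assume "c \<in> ?C" "c' \<in> ?C" "c \<noteq> c'"
    then show "1 \<le> \<bar>c - c'\<bar>" by (rule apart)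
  qed
  have 4: "\<forall>k<4 * n. k mod 4 < 2 \<longrightarrow> (\<forall>c. \<bar>c - (real k + 1/2)\<bar> \<le> 1/2 \<longrightarrow> c \<in> ?C \<longleftrightarrow> 2 * real k + 3 - c \<in> ?C)"
  proof (rule allI, rule impI, rule impI, rule allI, rule impI)
    fix k' c assume "k' < 4 * n" "k' mod 4 < 2" "\<bar>c - (real k' + 1/2)\<bar> \<le> 1/2"
    then show "c \<in> ?C \<longleftrightarrow> 2 * real k' + 3 - c \<in> ?C" by (rule pair)
  qed
  show ?thesis unfolding chart_def by (rule conjI[OF 1 conjI[OF 2 conjI[OF 3 4]]])
qed

lemma chart_centres: "i \<in> charts \<Longrightarrow> i \<noteq> 0 \<Longrightarrow> chart (centres i)"
proof -
  assume i: "i \<in> charts" "i \<noteq> 0"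
  show ?thesis
  proof (cases "i = 1")
    case False
    then obtain k where "i = k + 2" "k < 4 * n" "k mod 4 < 2" using i by (auto simp: charts_def)
    then show ?thesis using chart_edge by simp
  qed (use chart_vertex in \<open>simp add: centres_def\<close>)
qed

definition patch :: "nat \<Rightarrow> complex set" where
  "patch i = (if i = 0 then ball 0 1 else region (centres i))"

definition contraction :: "nat \<Rightarrow> real \<Rightarrow> complex \<Rightarrow> complex" where
  "contraction i s z = (if i = 0 then of_real (1 - s) * z else shrink (centre (centres i) z) s z)"

lemma open_patch: "open (patch i)"
  unfolding patch_def region_def using open_sector by auto

lemma continuous_on_contraction:
  assumes "i \<in> charts"
  shows "continuous_on (UNIV \<times> patch i) (\<lambda>x. contraction i (fst x) (snd x))"
proof (cases "i = 0")
  case True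
  then show ?thesis unfolding contraction_def by (simp add: continuous_intros)
next
  case False
  then show ?thesis using continuous_on_shrink_region[OF chart_centres[OF assms]]
    by (simp add: contraction_def patch_def)
qed

lemma contraction_0:
  assumes i: "i \<in> charts" and z: "z \<in> patch i" shows "contraction i 0 z = z"
proof (cases "i = 0")
  case False
  then have "z \<in> region (centres i)" using z by (simp add: patch_def)
  from sector_coords(3)[OF conjunct2[OF centre[OF this]]] show ?thesis using False
    by (simp add: contraction_def shrink_def)
qed (simp add: contraction_def)

lemma contraction_1:
  assumes i: "i \<in> charts" and z: "z \<in> patch i"
  shows "i = 0 \<and> contraction i 1 z = 0 \<or> i \<noteq> 0 \<and> (\<exists>c\<in>centres i. contraction i 1 z = pnt 1 c)"
proof (cases "i = 0")
  case False
  then have "z \<in> region (centres i)" using z by (simp add: patch_def)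
  from centre[OF this] show ?thesis using False by (auto simp: contraction_def shrink_def)
qed (simp add: contraction_def)

lemma contraction_D:
  assumes s: "s \<in> {0..1}" and z: "z \<in> D"
  shows "contraction i s z \<in> D"
proof (cases "i = 0")
  case True
  have "\<bar>1 - s\<bar> * norm z \<le> 1 * 1" using s z by (intro mult_mono) auto
  then have "norm (of_real (1 - s) * z) \<le> 1" by (simp only: norm_mult norm_of_real)
  then show ?thesis using True by (simp add: contraction_def)
next
  case False
  have "0 \<le> s * (1 - norm z)" "s * (1 - norm z) \<le> 1 * (1 - norm z)"
    using s z by (intro mult_nonneg_nonneg mult_right_mono; simp)+
  then have "\<bar>norm z + s * (1 - norm z)\<bar> \<le> 1" by simp
  then show ?thesis using False by (simp add: contraction_def shrink_def)
qed

text \<open>The gluing map is a reflection of the angular coordinate, and carries the motion towards a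
  centre to the motion towards the reflected centre.\<close>

lemma patch_pairing:
  assumes i: "i \<in> charts" and xy: "side_pairing n x y"
  shows "x \<in> patch i \<longleftrightarrow> y \<in> patch i"
    and "s \<in> {0..1} \<Longrightarrow> x \<in> patch i \<Longrightarrow> q (contraction i s x) = q (contraction i s y)"
proof -
  obtain k u where k: "k < 4 * n" "k mod 4 < 2" "real k \<le> u" "u \<le> real k + 1" and x: "x = pnt 1 u" and y: "y = pnt 1 (2 * real k + 3 - u)"
    using side_pairingE[OF xy] by metis
  have "(x \<in> patch i \<longleftrightarrow> y \<in> patch i) \<and> (s \<in> {0..1} \<longrightarrow> x \<in> patch i \<longrightarrow> q (contraction i s x) = q (contraction i s y))"
  proof (cases "i = 0")
    case True
    then show ?thesis using x y by (simp add: patch_def)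
  next
    case False
    have C: "chart (centres i)" by (rule chart_centres[OF i False])
    show ?thesis
    proof (cases "x \<in> region (centres i) \<or> y \<in> region (centres i)")
      case True
      then obtain c where c: "c \<in> centres i" "\<bar>u - c\<bar> < 1/2" "\<bar>c - (real k + 1/2)\<bar> \<le> 1/2" "2 * real k + 3 - c \<in> centres i"
        "x \<in> sector c" "y \<in> sector (2 * real k + 3 - c)"
        using pair_centre[OF C k] x y by metis
      have xy': "x \<in> region (centres i)" "y \<in> region (centres i)" using c unfolding region_def by blast+
      have "q (contraction i s x) = q (contraction i s y)" if s: "s \<in> {0..1}"
      proof -
        let ?w = "u + s * (c - u)"
        have w: "real k \<le> ?w" "?w \<le> real k + 1"
        proof -
          have ck: "real k \<le> c" "c \<le> real k + 1" using c(3) by linarith+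
          have eq: "?w = (1 - s) * u + s * c" by (simp add: algebra_simps)
          have "(1 - s) * real k + s * real k \<le> ?w" unfolding eq using s ck k by (intro add_mono mult_left_mono) auto
          then show "real k \<le> ?w" by (simp add: algebra_simps)
          have "?w \<le> (1 - s) * (real k + 1) + s * (real k + 1)" unfolding eq using s ck k by (intro add_mono mult_left_mono) auto
          then show "?w \<le> real k + 1" by (simp add: algebra_simps)
        qed
        have "contraction i s x = pnt 1 ?w"
          using shrink_centre[OF C c(1,5)] pnt_sector(2)[of 1 u c] c(2) False x
          by (simp add: contraction_def shrink_def)
        moreover have "contraction i s y = pnt 1 (2 * real k + 3 - ?w)"
        proof -
          have "angle (2 * real k + 3 - c) y = 2 * real k + 3 - u" unfolding y
            by (rule pnt_sector(2)) (use c(2) in linarith)+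
          then have "contraction i s y = pnt (norm y + s * (1 - norm y)) (2 * real k + 3 - u + s * (2 * real k + 3 - c - (2 * real k + 3 - u)))"
            using shrink_centre[OF C c(4,6), of s] False by (simp add: contraction_def shrink_def)
          also have "\<dots> = pnt 1 (2 * real k + 3 - ?w)" unfolding y by (simp add: algebra_simps)
          finally show ?thesis .
        qed
        ultimately show ?thesis using q_glue[OF k(1,2) w] by simp
      qed
      then show ?thesis using xy' False by (simp add: patch_def)
    qed (use False in \<open>simp add: patch_def\<close>)
  qed
  then show "x \<in> patch i \<longleftrightarrow> y \<in> patch i"
    "s \<in> {0..1} \<Longrightarrow> x \<in> patch i \<Longrightarrow> q (contraction i s x) = q (contraction i s y)" by blast+
qed

lemma q_invariant:
  assumes f: "\<And>x y. side_pairing n x y \<Longrightarrow> f x = f y" and xy: "x \<in> D" "y \<in> D" "q x = q y"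
  shows "f x = f y"
proof -
  have "equivclp (side_pairing n) x y" using fibres xy by blast
  then show ?thesis
  proof (induction rule: equivclp_induct)
    case base show ?case ..
  next
    case (step y z) then show ?case using f by metis
  qed
qed

lemma patch_saturated:
  assumes "i \<in> charts" "x \<in> D" "y \<in> D" "q x = q y" shows "x \<in> patch i \<longleftrightarrow> y \<in> patch i"
  using q_invariant[of "\<lambda>x. x \<in> patch i", OF patch_pairing(1)[OF assms(1)] assms(2-4)] .

lemma contraction_saturated:
  assumes i: "i \<in> charts" and xy: "x \<in> D" "y \<in> D" "q x = q y" and s: "s \<in> {0..1}" and x: "x \<in> patch i"
  shows "q (contraction i s x) = q (contraction i s y)"
proof -
  have "(if x \<in> patch i then Some (q (contraction i s x)) else None) = (if y \<in> patch i then Some (q (contraction i s y)) else None)"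
    by (rule q_invariant[OF _ xy]) (use patch_pairing[OF i] s in auto)
  then show ?thesis using x by (auto split: if_splits)
qed

lemma patch_sectorI: "i \<noteq> 0 \<Longrightarrow> c \<in> centres i \<Longrightarrow> z \<in> sector c \<Longrightarrow> z \<in> patch i"
  unfolding patch_def region_def by auto

lemma patches_cover:
  assumes "z \<in> D" shows "\<exists>i\<in>charts. z \<in> patch i"
proof (cases "norm z < 1")
  case True
  then show ?thesis by (intro bexI[of _ 0]) (simp_all add: patch_def charts_def)
next
  case False
  then have nz: "norm z = 1" using assms by simp
  define u where "u = Arg z * per / (2 * pi)"
  have "2 * pi * u / per = Arg z" using per_pos by (simp add: u_def)
  then have z: "z = pnt 1 u" using rcis_cmod_Arg[of z] nz by (simp add: pnt_def rcis_def)
  show ?thesis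
  proof (cases "u \<in> \<int>")
    case True
    then have "z \<in> sector u" using pnt_sector(1)[of 1 u u] z by simp
    then have "z \<in> patch 1" using True by (auto simp: patch_def region_def centres_def)
    then show ?thesis by (intro bexI[of _ 1]) (simp_all add: charts_def)
  next
    case False
    define l where "l = \<lfloor>u\<rfloor>"
    have "of_int l \<noteq> u" using False Ints_of_int by (metis l_def)
    then have l: "of_int l < u" "u < of_int l + 1" unfolding l_def by linarith+
    then have "\<bar>u - (of_int l + 1/2)\<bar> < 1/2" by linarith
    then have s: "z \<in> sector (of_int l + 1/2)" unfolding z by (rule pnt_sector(1)[OF zero_less_one])
    define k0 where "k0 = nat (l mod (4 * int n))"
    have n4: "0 < 4 * int n" using n_pos by simp
    have k0: "int k0 = l mod (4 * int n)" "k0 < 4 * n"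
      using pos_mod_bound[OF n4, of l] pos_mod_sign[OF n4, of l] by (auto simp: k0_def nat_less_iff)
    define j where "j = l div (4 * int n)"
    have lj: "l = int k0 + j * (4 * int n)" unfolding k0 j_def by (simp add: mult.commute)
    then have "of_int l = (of_int (int k0 + j * (4 * int n)) :: real)" by simp
    then have ll: "(of_int l :: real) = real k0 + of_int j * per" by simp
    show ?thesis
    proof (cases "k0 mod 4 < 2")
      case True
      have "of_int l + 1/2 = real k0 + 1/2 + of_int j * per" using ll by simp
      then have "of_int l + 1/2 \<in> centres (k0 + 2)" by (simp only: edge_centreI)
      from patch_sectorI[OF _ this s] have "z \<in> patch (k0 + 2)" by simp
      moreover have "k0 + 2 \<in> charts" using True k0(2) unfolding charts_def by blast
      ultimately show ?thesis by (rule rev_bexI[rotated])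
    next
      case False
      then obtain k where k: "k0 = k + 2" using le_Suc_ex[of 2 k0] by (cases "2 \<le> k0") auto
      have m: "k mod 4 < 2" "k < 4 * n" using False k0(2) unfolding k by presburger+
      have "of_int l + 1/2 = real k + 5/2 + of_int j * per" using ll k by simp
      then have "of_int l + 1/2 \<in> centres (k + 2)" by (simp only: edge_centreI)
      from patch_sectorI[OF _ this s] have "z \<in> patch (k + 2)" by simp
      moreover have "k + 2 \<in> charts" using m unfolding charts_def by blast
      ultimately show ?thesis by (rule rev_bexI[rotated])
    qed
  qed
qed

lemma openin_image:
  assumes O: "open Q" and sat: "\<And>x y. x \<in> D \<Longrightarrow> y \<in> D \<Longrightarrow> q x = q y \<Longrightarrow> x \<in> Q \<Longrightarrow> y \<in> Q"
  shows "openin X (q ` (Q \<inter> D))"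
proof -
  have "{x \<in> D. q x \<in> q ` (Q \<inter> D)} = D \<inter> Q"
  proof (intro subset_antisym subsetI)
    fix y assume "y \<in> {x \<in> D. q x \<in> q ` (Q \<inter> D)}"
    then obtain x where "y \<in> D" "x \<in> Q" "x \<in> D" "q y = q x" by blast
    then show "y \<in> D \<inter> Q" using sat[of x y] by simp
  qed simp
  then have 1: "openin (top_of_set D) {x \<in> topspace (top_of_set D). q x \<in> q ` (Q \<inter> D)}"
    using openin_open_Int[OF O, of D] by simp
  have 2: "q ` (Q \<inter> D) \<subseteq> topspace X"
  proof
    fix \<xi> assume "\<xi> \<in> q ` (Q \<inter> D)"
    then show "\<xi> \<in> topspace X" using q_topspace by auto
  qed
  have "\<forall>U. U \<subseteq> topspace X \<longrightarrow> openin (top_of_set D) {x \<in> topspace (top_of_set D). q x \<in> U} = openin X U"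
    using quotient unfolding quotient_map_def by (rule conjunct2)
  from mp[OF spec[OF this] 2] 1 show ?thesis by simp
qed

definition U :: "nat \<Rightarrow> 'a set" where
  "U i = q ` (patch i \<inter> D)"

lemma openin_U:
  assumes i: "i \<in> charts" shows "openin X (U i)"
  unfolding U_def
proof (rule openin_image[OF open_patch])
  fix x y assume "x \<in> D" "y \<in> D" "q x = q y" "x \<in> patch i"
  then show "y \<in> patch i" using patch_saturated[OF i] by metis
qed

lemma topspace_q: "topspace X = q ` D"
  using quotient_imp_surjective_map[OF quotient] by simp

lemma U_cover: "topspace X \<subseteq> (\<Union>i\<in>charts. U i)"
proof
  fix \<xi> assume "\<xi> \<in> topspace X"
  then obtain x where x: "x \<in> D" "\<xi> = q x" unfolding topspace_q by blast
  obtain i where "i \<in> charts" "x \<in> patch i" using patches_cover[OF x(1)] by blast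
  then show "\<xi> \<in> (\<Union>i\<in>charts. U i)" unfolding U_def x(2) by (intro UN_I imageI IntI x(1))
qed

text \<open>The canonical lift: an arbitrary choice of preimages, normalised at the base point.\<close>

definition lift :: "'a \<Rightarrow> complex" where
  "lift \<xi> = (if \<xi> = q x0 then x0 else (SOME x. x \<in> D \<and> q x = \<xi>))"

lemma lift:
  assumes \<xi>: "\<xi> \<in> topspace X" shows "lift \<xi> \<in> D" "q (lift \<xi>) = \<xi>"
proof -
  have "lift \<xi> \<in> D \<and> q (lift \<xi>) = \<xi>"
  proof (cases "\<xi> = q x0")
    case True
    then have "lift \<xi> = x0" by (simp only: lift_def if_True simp_thms)
    then show ?thesis using x0_disc True by (simp only: simp_thms)
  next
    case False
    then have l: "lift \<xi> = (SOME x. x \<in> D \<and> q x = \<xi>)" by (simp only: lift_def if_False)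
    obtain x where "x \<in> D" "\<xi> = q x" using \<xi> unfolding topspace_q by (rule imageE)
    then have "\<exists>x. x \<in> D \<and> q x = \<xi>" by (intro exI[of _ x]) (simp only: simp_thms)
    then show ?thesis unfolding l by (rule someI_ex)
  qed
  note * = this
  show "lift \<xi> \<in> D" by (rule conjunct1[OF *])
  show "q (lift \<xi>) = \<xi>" by (rule conjunct2[OF *])
qed

lemma U_topspace: "U i \<subseteq> topspace X"
  unfolding U_def topspace_q by blast

lemma lift_patch:
  assumes i: "i \<in> charts" and \<xi>: "\<xi> \<in> U i" shows "lift \<xi> \<in> patch i"
proof -
  obtain x where x: "x \<in> patch i" "x \<in> D" "\<xi> = q x" using \<xi> unfolding U_def by blast
  note l = lift[OF subsetD[OF U_topspace \<xi>]]
  have "q x = q (lift \<xi>)" using l(2) x(3) by (simp only:)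
  from patch_saturated[OF i x(2) l(1) this] show ?thesis using x(1) by (simp only: simp_thms)
qed

text \<open>The product of a quotient map with a compact interval is again a quotient map, so that it
  suffices to know the contraction on the polygon to be continuous and compatible with the
  gluing.\<close>

lemma contraction_continuous:
  assumes i: "i \<in> charts"
  shows "continuous_map (prod_topology (top_of_set {0..1}) (subtopology X (U i))) X
    (\<lambda>x. q (contraction i (fst x) (lift (snd x))))"
proof -
  have "{x \<in> topspace (top_of_set D). q x \<in> U i} = D \<inter> patch i"
    unfolding topspace_euclidean_subtopology
  proof (intro subset_antisym subsetI)
    fix y assume "y \<in> {x \<in> D. q x \<in> U i}"
    then obtain x where x: "y \<in> D" "x \<in> D" "q x = q y" "x \<in> patch i" unfolding U_def by force
    then show "y \<in> D \<inter> patch i" using patch_saturated[OF i x(2,1,3)] by simp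
  next
    fix y assume "y \<in> D \<inter> patch i"
    then show "y \<in> {x \<in> D. q x \<in> U i}" unfolding U_def by simp
  qed
  from quotient_map_restriction[OF quotient this disjI1[OF openin_U[OF i]]]
  have "quotient_map (subtopology (top_of_set D) (D \<inter> patch i)) (subtopology X (U i)) q" .
  then have qm: "quotient_map (top_of_set (D \<inter> patch i)) (subtopology X (U i)) q"
    unfolding subtopology_subtopology Int_assoc[symmetric] Int_absorb .
  have "quotient_map (prod_topology (top_of_set {0..1::real}) (top_of_set (D \<inter> patch i)))
     (prod_topology (top_of_set {0..1}) (subtopology X (U i))) (\<lambda>(x, y). (x, q y))"
  proof (rule quotient_map_prod_right[OF _ _ qm])
    have "compact_space (top_of_set {0..1::real})" by (rule compact_space_subtopology) simp
    then show "locally_compact_space (top_of_set {0..1::real})" by (rule compact_imp_locally_compact_space)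
  qed (simp add: Hausdorff_space_subtopology)
  moreover
  have "continuous_map (top_of_set ({0..1} \<times> (D \<inter> patch i))) X (\<lambda>x. q (contraction i (fst x) (snd x)))"
  proof (rule continuous_map_compose_on[OF q_cont])
    show "continuous_on ({0..1} \<times> (D \<inter> patch i)) (\<lambda>x. contraction i (fst x) (snd x))"
      by (rule continuous_on_subset[OF continuous_on_contraction[OF i]]) auto
    show "(\<lambda>x. contraction i (fst x) (snd x)) ` ({0..1} \<times> (D \<inter> patch i)) \<subseteq> D"
      using contraction_D by auto
  qed
  then have c: "continuous_map (prod_topology (top_of_set {0..1::real}) (top_of_set (D \<inter> patch i))) X
     (\<lambda>x. q (contraction i (fst x) (snd x)))"
    by (simp only: prod_topology_subtopology_eu)
  have "continuous_map (prod_topology (top_of_set {0..1::real}) (top_of_set (D \<inter> patch i))) X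
     ((\<lambda>x. q (contraction i (fst x) (lift (snd x)))) \<circ> (\<lambda>(x, y). (x, q y)))"
  proof (rule continuous_map_eq[OF c])
    fix x :: "real \<times> complex"
    assume "x \<in> topspace (prod_topology (top_of_set {0..1}) (top_of_set (D \<inter> patch i)))"
    then have x: "fst x \<in> {0..1}" "snd x \<in> D" "snd x \<in> patch i" by (auto simp: mem_Times_iff)
    note l = lift[OF q_topspace[OF x(2)]]
    show "q (contraction i (fst x) (snd x)) = ((\<lambda>x. q (contraction i (fst x) (lift (snd x)))) \<circ> (\<lambda>(x, y). (x, q y))) x"
      using contraction_saturated[OF i x(2) l(1) l(2)[symmetric] x(1,3)] by (simp only: case_prod_unfold o_def fst_conv snd_conv)
  qed
  ultimately show ?thesis by (rule continuous_compose_quotient_map)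
qed

end

section \<open>The sides generate the fundamental group\<close>

context polygon_surface begin

interpretation G: group G by (rule group_G)

lemma pnt_circle [simp]: "pnt 1 u \<in> D"
  by simp

lemma continuous_on_pnt: "continuous_on S f \<Longrightarrow> continuous_on S (\<lambda>t. pnt 1 (f t))"
  unfolding pnt_def using per_pos by (intro continuous_intros continuous_on_cis) simp_all

text \<open>Both points may slide along their sides, keeping the same image.\<close>

lemma side_jump:
  assumes k: "k < 4 * n" "k mod 4 < 2" and u: "real k \<le> u" "u \<le> real k + 1" and v: "real k \<le> v" "v \<le> real k + 1"
  shows "jump (pnt 1 u) (pnt 1 (2 * real k + 3 - u)) = jump (pnt 1 v) (pnt 1 (2 * real k + 3 - v))"
proof -
  let ?w = "\<lambda>t. linepath u v t"
  have "closed_segment u v \<subseteq> {real k..real k + 1}" using u v by (intro closed_segment_subset) auto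
  then have "?w t \<in> {real k..real k + 1}" if "t \<in> {0..1}" for t
    using linepath_in_path[OF that, of u v] by (rule subsetD)
  then have w: "real k \<le> ?w t \<and> ?w t \<le> real k + 1" if "t \<in> {0..1}" for t using that by simp
  have "jump (pnt 1 (?w 0)) (pnt 1 (2 * real k + 3 - ?w 0)) = jump (pnt 1 (?w 1)) (pnt 1 (2 * real k + 3 - ?w 1))"
  proof (rule jump_slide[of "\<lambda>t. pnt 1 (?w t)" "\<lambda>t. pnt 1 (2 * real k + 3 - ?w t)"])
    show "continuous_on {0..1} (\<lambda>t. pnt 1 (?w t))" "continuous_on {0..1} (\<lambda>t. pnt 1 (2 * real k + 3 - ?w t))"
      by (intro continuous_on_pnt continuous_intros)+
    show "q (pnt 1 (?w t)) = q (pnt 1 (2 * real k + 3 - ?w t))" if "t \<in> {0..1}" for t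
      using q_glue[OF k] w[OF that] by blast
  qed auto
  then show ?thesis by (simp only: linepath_0' linepath_1')
qed

abbreviation corner :: "nat \<Rightarrow> complex" where "corner i \<equiv> pnt 1 (real i)"

text \<open>The first side of the \<open>j\<close>-th handle is glued to the third one, and the second to
  the fourth. The inverse in the definition of \<open>B\<close> makes the product over one
  handle come out as the commutator of \<open>A j\<close> and \<open>B j\<close>.\<close>

definition A :: "nat \<Rightarrow> (real \<Rightarrow> 'a) set" where "A j = jump (corner (4 * j)) (corner (4 * j + 3))"

definition B :: "nat \<Rightarrow> (real \<Rightarrow> 'a) set" where "B j = inv\<^bsub>G\<^esub> jump (corner (4 * j + 1)) (corner (4 * j + 4))"

lemma glue_corners:
  assumes j: "j < n"
  shows "q (corner (4 * j)) = q (corner (4 * j + 3))" "q (corner (4 * j + 1)) = q (corner (4 * j + 2))"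
    "q (corner (4 * j + 1)) = q (corner (4 * j + 4))" "q (corner (4 * j + 2)) = q (corner (4 * j + 3))"
proof -
  have k: "4 * j < 4 * n" "4 * j mod 4 < 2" "4 * j + 1 < 4 * n" "(4 * j + 1) mod 4 < 2" using j by presburger+
  show "q (corner (4 * j)) = q (corner (4 * j + 3))" using q_glue[OF k(1,2), of "real (4 * j)"] by (simp add: algebra_simps)
  show "q (corner (4 * j + 1)) = q (corner (4 * j + 2))" using q_glue[OF k(1,2), of "real (4 * j + 1)"] by (simp add: algebra_simps)
  show "q (corner (4 * j + 1)) = q (corner (4 * j + 4))" using q_glue[OF k(3,4), of "real (4 * j + 1)"] by (simp add: algebra_simps)
  show "q (corner (4 * j + 2)) = q (corner (4 * j + 3))" using q_glue[OF k(3,4), of "real (4 * j + 2)"] by (simp add: algebra_simps)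
qed

lemma side_jumps:
  assumes j: "j < n"
  shows "jump (corner (4 * j + 1)) (corner (4 * j + 2)) = A j"
    "jump (corner (4 * j + 1)) (corner (4 * j + 4)) = inv\<^bsub>G\<^esub> B j" "jump (corner (4 * j + 2)) (corner (4 * j + 3)) = inv\<^bsub>G\<^esub> B j"
    "A j \<in> carrier G" "B j \<in> carrier G"
proof -
  have k: "4 * j < 4 * n" "4 * j mod 4 < 2" "4 * j + 1 < 4 * n" "(4 * j + 1) mod 4 < 2" using j by presburger+
  show "jump (corner (4 * j + 1)) (corner (4 * j + 2)) = A j"
    using side_jump[OF k(1,2), of "real (4 * j + 1)" "real (4 * j)"] by (simp add: A_def algebra_simps)
  have c: "jump (corner (4 * j + 1)) (corner (4 * j + 4)) \<in> carrier G"
    by (rule jump_closed[OF pnt_circle pnt_circle glue_corners(3)[OF j]])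
  show 1: "jump (corner (4 * j + 1)) (corner (4 * j + 4)) = inv\<^bsub>G\<^esub> B j"
    unfolding B_def by (rule G.inv_inv[OF c, symmetric])
  have "jump (corner (4 * j + 2)) (corner (4 * j + 3)) = jump (corner (4 * j + 1)) (corner (4 * j + 4))"
    using side_jump[OF k(3,4), of "real (4 * j + 2)" "real (4 * j + 1)"] by (simp add: algebra_simps)
  then show "jump (corner (4 * j + 2)) (corner (4 * j + 3)) = inv\<^bsub>G\<^esub> B j" using 1 by simp
  show "A j \<in> carrier G" unfolding A_def by (rule jump_closed[OF pnt_circle pnt_circle glue_corners(1)[OF j]])
  show "B j \<in> carrier G" unfolding B_def by (rule G.inv_closed[OF c])
qed

lemma one_vertex: "j \<le> n \<Longrightarrow> q (corner (4 * j)) = q (corner 0)"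
proof (induction j)
  case (Suc j)
  then have j: "j < n" by simp
  have "q (corner (4 * j + 4)) = q (corner (4 * j))" using glue_corners[OF j] by simp
  then show ?case using Suc by (simp add: add.commute)
qed simp

lemma one_vertex_block:
  assumes "j < n" shows "r \<le> 4 \<Longrightarrow> q (corner (4 * j + r)) = q (corner 0)"
proof -
  assume "r \<le> 4"
  then consider "r = 0" | "r = 1" | "r = 2" | "r = 3" | "r = 4" by linarith
  then show ?thesis using glue_corners[OF assms] one_vertex[of j] assms by cases simp_all
qed

lemma one_vertex_all: "i \<le> 4 * n \<Longrightarrow> q (corner i) = q (corner 0)"
proof (cases "i < 4 * n")
  case True
  then have "i div 4 < n" "i mod 4 \<le> 4" by presburger+
  from one_vertex_block[OF this] show ?thesis by simp
next
  case False
  assume "i \<le> 4 * n"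
  then have "i = 4 * n" using False by simp
  then show ?thesis using one_vertex[of n] by simp
qed

lemma jump_corner_step:
  assumes i: "i \<le> 4 * n" "i' \<le> 4 * n"
  shows "jump (corner 0) (corner i') = jump (corner 0) (corner i) \<otimes>\<^bsub>G\<^esub> jump (corner i) (corner i')"
  by (rule jump_trans[symmetric]) (use one_vertex_all[OF i(1)] one_vertex_all[OF i(2)] in simp_all)

lemma G_cancel: "\<lbrakk>x \<in> carrier G; y \<in> carrier G; z = x \<otimes>\<^bsub>G\<^esub> inv\<^bsub>G\<^esub> y\<rbrakk> \<Longrightarrow> x = z \<otimes>\<^bsub>G\<^esub> y"
  by (simp add: G.m_assoc)

text \<open>Starting at the first corner of a handle, the corners are met in the order 0, 3, 2, 1, 4: each
  is glued to the next by one of the two side pairings.\<close>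

lemma jump_corners:
  assumes j: "j < n" and w: "jump (corner 0) (corner (4 * j)) = surface_word G A B j" "surface_word G A B j \<in> carrier G"
  shows "jump (corner 0) (corner (4 * j + 3)) = surface_word G A B j \<otimes>\<^bsub>G\<^esub> A j"
    "jump (corner 0) (corner (4 * j + 2)) = surface_word G A B j \<otimes>\<^bsub>G\<^esub> A j \<otimes>\<^bsub>G\<^esub> B j"
    "jump (corner 0) (corner (4 * j + 1)) = surface_word G A B j \<otimes>\<^bsub>G\<^esub> A j \<otimes>\<^bsub>G\<^esub> B j \<otimes>\<^bsub>G\<^esub> inv\<^bsub>G\<^esub> A j"
    "jump (corner 0) (corner (4 * j + 4)) = surface_word G A B (Suc j)"
proof -
  note s = side_jumps[OF j]
  have le: "4 * j + r \<le> 4 * n" if "r \<le> 4" for r using j that by simp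
  have cl: "jump (corner 0) (corner (4 * j + r)) \<in> carrier G" if "r \<le> 4" for r
    by (rule jump_closed) (use one_vertex_all[OF le[OF that]] in simp_all)
  show 3: "jump (corner 0) (corner (4 * j + 3)) = surface_word G A B j \<otimes>\<^bsub>G\<^esub> A j"
    using jump_corner_step[of "4 * j" "4 * j + 3"] le[of 0] le[of 3] w by (simp add: A_def)
  have "jump (corner 0) (corner (4 * j + 3)) = jump (corner 0) (corner (4 * j + 2)) \<otimes>\<^bsub>G\<^esub> inv\<^bsub>G\<^esub> B j"
    using jump_corner_step[of "4 * j + 2" "4 * j + 3"] le[of 2] le[of 3] s(3) by simp
  from G_cancel[OF cl s(5) this] show 2: "jump (corner 0) (corner (4 * j + 2)) = surface_word G A B j \<otimes>\<^bsub>G\<^esub> A j \<otimes>\<^bsub>G\<^esub> B j"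
    using 3 by simp
  have "jump (corner 0) (corner (4 * j + 2)) = jump (corner 0) (corner (4 * j + 1)) \<otimes>\<^bsub>G\<^esub> inv\<^bsub>G\<^esub> (inv\<^bsub>G\<^esub> A j)"
    using jump_corner_step[of "4 * j + 1" "4 * j + 2"] le[of 1] le[of 2] s(1,4) by simp
  from G_cancel[OF cl G.inv_closed[OF s(4)] this]
  show 1: "jump (corner 0) (corner (4 * j + 1)) = surface_word G A B j \<otimes>\<^bsub>G\<^esub> A j \<otimes>\<^bsub>G\<^esub> B j \<otimes>\<^bsub>G\<^esub> inv\<^bsub>G\<^esub> A j"
    using 2 by simp
  have "jump (corner 0) (corner (4 * j + 4)) = jump (corner 0) (corner (4 * j + 1)) \<otimes>\<^bsub>G\<^esub> inv\<^bsub>G\<^esub> B j"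
    using jump_corner_step[of "4 * j + 1" "4 * j + 4"] le[of 1] le[of 4] s(2) by simp
  then show "jump (corner 0) (corner (4 * j + 4)) = surface_word G A B (Suc j)"
    using 1 w(2) s(4,5) by (simp add: G.m_assoc)
qed

lemma jump_surface_word:
  "j \<le> n \<Longrightarrow> jump (corner 0) (corner (4 * j)) = surface_word G A B j \<and> surface_word G A B j \<in> carrier G"
proof (induction j)
  case 0 show ?case using jump_self[of "corner 0"] by simp
next
  case (Suc j)
  then have j: "j < n" and w: "jump (corner 0) (corner (4 * j)) = surface_word G A B j" "surface_word G A B j \<in> carrier G" by simp_all
  have "jump (corner 0) (corner (4 * Suc j)) = surface_word G A B (Suc j)"
    using jump_corners(4)[OF j w] by (simp add: add.commute)
  moreover have "surface_word G A B (Suc j) \<in> carrier G" using w(2) side_jumps(4,5)[OF j] by simp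
  ultimately show ?case by blast
qed

text \<open>Once around the polygon, the corners are back at the first one.\<close>

lemma surface_relation: "surface_word G A B n = \<one>\<^bsub>G\<^esub>"
proof -
  have "corner (4 * n) = corner 0" using pnt_periodic[of 1 0 1] by simp
  then show ?thesis using jump_surface_word[of n] jump_self[of "corner 0"] by simp
qed

definition K :: "(real \<Rightarrow> 'a) set set" where
  "K = generate G (A ` {..<n} \<union> B ` {..<n})"

lemma subgroup_K: "subgroup K G"
  unfolding K_def by (rule G.generate_is_subgroup) (use side_jumps(4,5) in auto)

lemma K_gen: "j < n \<Longrightarrow> A j \<in> K" "j < n \<Longrightarrow> B j \<in> K"
  unfolding K_def by (intro generate.incl; simp)+

lemmas K_mult = subgroup.m_closed[OF subgroup_K]
lemmas K_inv = subgroup.m_inv_closed[OF subgroup_K]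
lemmas K_one = subgroup.one_closed[OF subgroup_K]

lemma surface_word_K: "j \<le> n \<Longrightarrow> surface_word G A B j \<in> K"
  by (induction j) (simp_all add: K_one K_mult K_inv K_gen)

lemma jump_corner_K: "i < 4 * n \<Longrightarrow> jump (corner 0) (corner i) \<in> K"
proof -
  assume i: "i < 4 * n"
  define j where "j = i div 4"
  have j: "j < n" using i unfolding j_def by presburger
  have w: "jump (corner 0) (corner (4 * j)) = surface_word G A B j" "surface_word G A B j \<in> carrier G" "surface_word G A B j \<in> K"
    using jump_surface_word[of j] surface_word_K[of j] j by simp_all
  have i4: "i = 4 * j + i mod 4" unfolding j_def by simp
  consider "i mod 4 = 0" | "i mod 4 = 1" | "i mod 4 = 2" | "i mod 4 = 3" by linarith
  then consider "i = 4 * j" | "i = 4 * j + 1" | "i = 4 * j + 2" | "i = 4 * j + 3" using i4 by cases simp_all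
  then show ?thesis
  proof cases
    case 1 then show ?thesis using w by (simp only:)
  next
    case 2 then show ?thesis using jump_corners(3)[OF j w(1,2)] w(3) K_gen[OF j] by (simp only: K_mult K_inv)
  next
    case 3 then show ?thesis using jump_corners(2)[OF j w(1,2)] w(3) K_gen[OF j] by (simp only: K_mult K_inv)
  next
    case 4 then show ?thesis using jump_corners(1)[OF j w(1,2)] w(3) K_gen[OF j] by (simp only: K_mult K_inv)
  qed
qed

lemma jump_corners_K:
  assumes i: "i < 4 * n" "i' < 4 * n"
  shows "jump (corner i) (corner i') \<in> K"
proof -
  have q: "q (corner i) = q (corner 0)" "q (corner i') = q (corner 0)" using one_vertex_all i by simp_all
  have "jump (corner i) (corner i') = jump (corner i) (corner 0) \<otimes>\<^bsub>G\<^esub> jump (corner 0) (corner i')"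
    by (rule jump_trans[symmetric]) (use q in simp_all)
  also have "jump (corner i) (corner 0) = inv\<^bsub>G\<^esub> jump (corner 0) (corner i)" by (rule jump_inv) (use q in simp_all)
  finally show ?thesis using jump_corner_K[OF i(1)] jump_corner_K[OF i(2)] by (simp only: K_mult K_inv)
qed

lemma integer_corner: "\<exists>i<4 * n. pnt 1 (of_int l) = corner i \<and> int i = l mod (4 * int n)"
proof -
  have n4: "0 < 4 * int n" using n_pos by simp
  define i where "i = nat (l mod (4 * int n))"
  have i: "int i = l mod (4 * int n)" "i < 4 * n"
    using pos_mod_bound[OF n4, of l] pos_mod_sign[OF n4, of l] by (auto simp: i_def nat_less_iff)
  have "l = int i + (l div (4 * int n)) * (4 * int n)" unfolding i(1) by (simp add: mult.commute)
  then have "(of_int l :: real) = of_int (int i + (l div (4 * int n)) * (4 * int n))" by simp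
  then have "(of_int l :: real) = real i + of_int (l div (4 * int n)) * per" by simp
  then have "pnt 1 (of_int l) = corner i" by (simp only: pnt_periodic)
  then show ?thesis using i by blast
qed

lemma jump_centres:
  assumes i: "i \<in> charts" "i \<noteq> 0" and c: "c \<in> centres i" "c' \<in> centres i"
  shows "q (pnt 1 c) = q (pnt 1 c')" "jump (pnt 1 c) (pnt 1 c') \<in> K"
proof -
  have "q (pnt 1 c) = q (pnt 1 c') \<and> jump (pnt 1 c) (pnt 1 c') \<in> K"
  proof (cases "i = 1")
    case True
    then obtain l l' :: int where l: "c = of_int l" "c' = of_int l'" using c by (auto simp: centres_def elim!: Ints_cases)
    obtain r where r: "r < 4 * n" "pnt 1 c = corner r" using integer_corner[of l] l(1) by auto
    obtain r' where r': "r' < 4 * n" "pnt 1 c' = corner r'" using integer_corner[of l'] l(2) by auto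
    show ?thesis unfolding r(2) r'(2)
      using one_vertex_all[of r] one_vertex_all[of r'] jump_corners_K[OF r(1) r'(1)] r(1) r'(1) by simp
  next
    case False
    then obtain k where k: "i = k + 2" "k < 4 * n" "k mod 4 < 2" using i by (auto simp: charts_def)
    let ?x = "pnt 1 (real k + 1/2)" and ?y = "pnt 1 (real k + 5/2)"
    have xy: "pnt 1 d = ?x \<or> pnt 1 d = ?y" if d: "d \<in> centres i" for d
    proof -
      obtain j :: int where "d = real k + 1/2 + of_int j * per \<or> d = real k + 5/2 + of_int j * per"
        using d unfolding k(1) centres_def by auto
      then show ?thesis by (elim disjE) (simp_all only: pnt_periodic simp_thms)
    qed
    have e: "2 * real k + 3 - (real k + 1/2) = real k + 5/2" "2 * real k + 3 - real (k + 1) = real (k + 2)" by simp_all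
    have q: "q ?x = q ?y" using q_glue[OF k(2,3), of "real k + 1/2"] unfolding e by simp
    have k4: "k + 1 < 4 * n" "k + 2 < 4 * n" using k(2,3) by presburger+
    have "jump ?x ?y = jump (corner (k + 1)) (corner (k + 2))"
      using side_jump[OF k(2,3), of "real k + 1/2" "real (k + 1)"] unfolding e by simp
    then have 1: "jump ?x ?y \<in> K" using jump_corners_K[OF k4] by simp
    have 2: "jump ?y ?x \<in> K" using jump_inv[of ?x ?y] q K_inv[OF 1] by simp
    have 3: "jump ?x ?x \<in> K" "jump ?y ?y \<in> K" by (simp_all only: jump_self[OF pnt_circle] K_one)
    from xy[OF c(1)] xy[OF c(2)] show ?thesis using q 1 2 3 by (elim disjE) simp_all
  qed
  then show "q (pnt 1 c) = q (pnt 1 c')" "jump (pnt 1 c) (pnt 1 c') \<in> K" by blast+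
qed

lemma contraction_end:
  assumes i: "i \<in> charts" and z: "z \<in> patch i" "z' \<in> patch i"
  shows "q (contraction i 1 z) = q (contraction i 1 z')" "jump (contraction i 1 z) (contraction i 1 z') \<in> K"
proof -
  have "q (contraction i 1 z) = q (contraction i 1 z') \<and> jump (contraction i 1 z) (contraction i 1 z') \<in> K"
  proof (cases "i = 0")
    case True
    then have "contraction i 1 z = 0" "contraction i 1 z' = 0" by (simp_all add: contraction_def)
    then show ?thesis using jump_self[of 0] K_one by simp
  next
    case False
    obtain c where c: "c \<in> centres i" "contraction i 1 z = pnt 1 c" using contraction_1[OF i z(1)] False by auto
    obtain c' where c': "c' \<in> centres i" "contraction i 1 z' = pnt 1 c'" using contraction_1[OF i z(2)] False by auto
    show ?thesis unfolding c(2) c'(2) using jump_centres[OF i False c(1) c'(1)] by (intro conjI)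
  qed
  then show "q (contraction i 1 z) = q (contraction i 1 z')" "jump (contraction i 1 z) (contraction i 1 z') \<in> K" by blast+
qed

text \<open>A path inside a patch contracts to the image of the centres. The tracks of its ends lift to the
  polygon, and what is left is the jump between two centres.\<close>

lemma tied_class_patch:
  assumes f: "pathin X f" and i: "i \<in> charts" and sub: "f ` {0..1} \<subseteq> U i"
  shows "tied_class (lift (f 0)) f (lift (f 1)) \<in> K"
proof -
  let ?c = "\<lambda>s t. contraction i s (lift (f t))"
  have fU: "f t \<in> U i" if "t \<in> {0..1}" for t using sub that by blast
  have l: "lift (f t) \<in> D" "q (lift (f t)) = f t" "lift (f t) \<in> patch i" if "t \<in> {0..1}" for t
    by (rule lift[OF subsetD[OF U_topspace fU[OF that]]] lift_patch[OF i fU[OF that]])+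
  have track: "continuous_on {0..1} (\<lambda>s. ?c s t)" "(\<lambda>s. ?c s t) ` {0..1} \<subseteq> D" "?c 0 t = lift (f t)" if t: "t \<in> {0..1}" for t
  proof -
    show "continuous_on {0..1} (\<lambda>s. ?c s t)"
      by (rule continuous_on_compose2[OF continuous_on_contraction[OF i], of _ "\<lambda>s. (s, lift (f t))", unfolded fst_conv snd_conv])
        (use l(3)[OF t] in \<open>auto intro!: continuous_intros\<close>)
    show "(\<lambda>s. ?c s t) ` {0..1} \<subseteq> D" using contraction_D[OF _ l(1)[OF t]] by blast
    show "?c 0 t = lift (f t)" by (rule contraction_0[OF i l(3)[OF t]])
  qed
  have 01: "(0::real) \<in> {0..1}" "(1::real) \<in> {0..1}" by simp_all
  have "continuous_map (top_of_set unit_square) (prod_topology (top_of_set {0..1}) (subtopology X (U i))) (\<lambda>x. (fst x, f (snd x)))"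
  proof (rule continuous_map_pairedI)
    show "continuous_map (top_of_set unit_square) (top_of_set {0..1}) (fst :: real \<times> real \<Rightarrow> real)"
      by (auto intro!: continuous_intros)
    have s: "continuous_map (top_of_set unit_square) (top_of_set {0..1}) (snd :: real \<times> real \<Rightarrow> real)"
      by (auto intro!: continuous_intros)
    have "continuous_map (top_of_set {0..1}) (subtopology X (U i)) f"
      using f sub by (simp add: pathin_def continuous_map_in_subtopology Pi_iff image_subset_iff)
    from continuous_map_compose[OF s this] show "continuous_map (top_of_set unit_square) (subtopology X (U i)) (\<lambda>x. f (snd x))"
      by (simp add: o_def)
  qed
  from continuous_map_compose[OF this contraction_continuous[OF i]]
  have h: "continuous_map (top_of_set unit_square) X (\<lambda>x. q (?c (fst x) (snd x)))" by (simp add: o_def)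
  have "tied_class (lift (f 0)) f (lift (f 1)) = jump (?c 1 0) (?c 1 1)"
  proof (rule tied_class_contract[OF l(1)[OF 01(1)] l(1)[OF 01(2)] h,
      where \<delta> = "\<lambda>s. ?c s 0" and \<epsilon> = "\<lambda>s. ?c s 1"])
    show "q (?c (fst (0, t)) (snd (0, t))) = f t" if "t \<in> {0..1}" for t using track(3)[OF that] l(2)[OF that] by simp
    show "q (?c (fst (1, t)) (snd (1, t))) = q (?c 1 0)" if "t \<in> {0..1}" for t
      using contraction_end(1)[OF i l(3)[OF that] l(3)[OF 01(1)]] by simp
  qed (use track[OF 01(1)] track[OF 01(2)] in simp_all)
  then show ?thesis using contraction_end(2)[OF i l(3)[OF 01(1)] l(3)[OF 01(2)]] by simp
qed

text \<open>Each point of the interval has a neighbourhood in which all subpaths stay in one patch; by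
  Bolzano's argument the statement for subpaths extends from short ones to the whole loop.\<close>

theorem generated_by_sides: "carrier G = K"
proof
  show "K \<subseteq> carrier G" by (rule subgroup.subset[OF subgroup_K])
  show "carrier G \<subseteq> K"
  proof
    fix g assume "g \<in> carrier G"
    then obtain f where f: "path_between X base base f" and g: "g = loop_class X base f"
      by (auto simp: fundamental_group_carrier loops_at_eq)
    have cf: "continuous_map (top_of_set {0..1}) X f" using f by (simp add: path_between_def pathin_def)
    define piece where "piece a b = (\<lambda>s. f (a + s * (b - a)))" for a b
    define \<rho> where "\<rho> t = lift (f t)" for t
    have \<rho>: "\<rho> t \<in> D" "q (\<rho> t) = f t" if "t \<in> {0..1}" for t
    proof -
      have "f t \<in> topspace X" using cf that by (auto simp: continuous_map_def)
      from lift[OF this] show "\<rho> t \<in> D" "q (\<rho> t) = f t" unfolding \<rho>_def .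
    qed
    have seg: "a + s * (b - a) \<in> {a..b}" if "a \<le> b" "s \<in> {0..1}" for a b s :: real
    proof -
      have "0 \<le> s * (b - a)" "s * (b - a) \<le> 1 * (b - a)"
        using that by (intro mult_nonneg_nonneg mult_right_mono; simp)+
      then show ?thesis by simp
    qed
    have piece: "path_between X (f a) (f b) (piece a b)" if "0 \<le> a" "a \<le> b" "b \<le> 1" for a b
    proof -
      have "continuous_map (top_of_set {0..1}) X (\<lambda>s. f (a + s * (b - a)))"
      proof (rule continuous_map_compose_on[OF cf])
        show "continuous_on {0..1} (\<lambda>s. a + s * (b - a))" by (intro continuous_intros)
        show "(\<lambda>s. a + s * (b - a)) ` {0..1} \<subseteq> {0..1}" 
        proof (rule image_subsetI)
          fix s :: real assume "s \<in> {0..1}"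
          from seg[OF that(2) this] show "a + s * (b - a) \<in> {0..1}" using that(1,3) by simp
        qed
      qed
      then show ?thesis by (simp add: piece_def path_between_def pathin_def)
    qed
    have "0 \<le> (0::real) \<longrightarrow> (1::real) \<le> 1 \<longrightarrow> (0::real) \<le> 1 \<longrightarrow> tied_class (\<rho> 0) (piece 0 1) (\<rho> 1) \<in> K"
    proof (rule Bolzano[of 0 1 "\<lambda>a b. 0 \<le> a \<longrightarrow> b \<le> 1 \<longrightarrow> a \<le> b \<longrightarrow> tied_class (\<rho> a) (piece a b) (\<rho> b) \<in> K"])
      fix a b c :: real
      assume ab: "0 \<le> a \<longrightarrow> b \<le> 1 \<longrightarrow> a \<le> b \<longrightarrow> tied_class (\<rho> a) (piece a b) (\<rho> b) \<in> K"
        and bc: "0 \<le> b \<longrightarrow> c \<le> 1 \<longrightarrow> b \<le> c \<longrightarrow> tied_class (\<rho> b) (piece b c) (\<rho> c) \<in> K" and le: "a \<le> b" "b \<le> c"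
      show "0 \<le> a \<longrightarrow> c \<le> 1 \<longrightarrow> a \<le> c \<longrightarrow> tied_class (\<rho> a) (piece a c) (\<rho> c) \<in> K"
      proof (intro impI)
        assume ac: "0 \<le> a" "c \<le> 1" "a \<le> c"
        have D: "\<rho> a \<in> D" "\<rho> b \<in> D" "\<rho> c \<in> D" and qf: "q (\<rho> a) = f a" "q (\<rho> b) = f b" "q (\<rho> c) = f c" using \<rho> ac le by simp_all
        have pab: "path_between X (f a) (f b) (piece a b)" and pbc: "path_between X (f b) (f c) (piece b c)"
          using piece ac le by simp_all
        let ?\<alpha> = "\<lambda>t. if t \<le> 1/2 then a + 2 * t * (b - a) else b + (2 * t - 1) * (c - b)"
        have "path_homotopic X (f a) (f c) (loop_join (piece a b) (piece b c)) (piece a c)"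
        proof (rule path_homotopic_convex[OF cf, of ?\<alpha> "\<lambda>t. a + t * (c - a)"])
          show "continuous_on {0..1} ?\<alpha>"
            by (rule continuous_on_unit_cases[of "\<lambda>t. a + t * (b - a)" "\<lambda>t. b + t * (c - b)"]) (auto intro!: continuous_intros)
          show "continuous_on {0..1} (\<lambda>t. a + t * (c - a))" by (intro continuous_intros)
          have "?\<alpha> t \<in> {0..1}" if t: "t \<in> {0..1}" for t
          proof (cases "t \<le> 1/2")
            case True
            then show ?thesis using seg[OF le(1), of "2 * t"] t ac le by simp
          next
            case False
            then show ?thesis using seg[OF le(2), of "2 * t - 1"] t ac le by simp
          qed
          then show "?\<alpha> ` {0..1} \<subseteq> {0..1}" by blast
          show "(\<lambda>t. a + t * (c - a)) ` {0..1} \<subseteq> {0..1}" 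
          proof (rule image_subsetI)
            fix s :: real assume "s \<in> {0..1}"
            from seg[OF ac(3) this] show "a + s * (c - a) \<in> {0..1}" using ac(1,2) by simp
          qed
        qed (simp_all add: loop_join_def piece_def)
        from tied_class_cong[OF D(1,3), unfolded qf, OF this]
        have "tied_class (\<rho> a) (piece a c) (\<rho> c) = tied_class (\<rho> a) (loop_join (piece a b) (piece b c)) (\<rho> c)" by (rule sym)
        also have "\<dots> = tied_class (\<rho> a) (piece a b) (\<rho> b) \<otimes>\<^bsub>G\<^esub> tied_class (\<rho> b) (piece b c) (\<rho> c)"
          by (rule tied_class_mult[OF D, unfolded qf, OF pab pbc, symmetric])
        finally show "tied_class (\<rho> a) (piece a c) (\<rho> c) \<in> K" using K_mult ab bc ac le by simp
      qed
    next
      fix x :: real assume x: "0 \<le> x" "x \<le> 1"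
      then have "f x \<in> topspace X" using cf by (auto simp: continuous_map_def)
      then obtain i where i: "i \<in> charts" "f x \<in> U i" using U_cover by blast
      obtain d where d: "d > 0" "\<And>y. y \<in> {0..1} \<Longrightarrow> dist y x < d \<Longrightarrow> f y \<in> U i"
        using continuous_map_nbhd[OF cf openin_U[OF i(1)] _ i(2)] x by auto
      show "\<exists>d>0. \<forall>a b. a \<le> x \<and> x \<le> b \<and> b - a < d \<longrightarrow>
        (0 \<le> a \<longrightarrow> b \<le> 1 \<longrightarrow> a \<le> b \<longrightarrow> tied_class (\<rho> a) (piece a b) (\<rho> b) \<in> K)"
      proof (intro exI[of _ d] conjI allI impI)
        fix a b assume x: "a \<le> x \<and> x \<le> b \<and> b - a < d" and ab: "0 \<le> a" "b \<le> 1" "a \<le> b"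
        have "piece a b s \<in> U i" if s: "s \<in> {0..1}" for s
        proof -
          have m: "a + s * (b - a) \<in> {a..b}" by (rule seg[OF ab(3) s])
          have "dist (a + s * (b - a)) x < d" using m x unfolding dist_real_def atLeastAtMost_iff by linarith
          then show ?thesis unfolding piece_def by (intro d(2)) (use m ab in auto)
        qed
        then have sub: "piece a b ` {0..1} \<subseteq> U i" by blast
        have "piece a b 0 = f a" "piece a b 1 = f b" by (simp_all add: piece_def)
        then show "tied_class (\<rho> a) (piece a b) (\<rho> b) \<in> K"
          using tied_class_patch[OF _ i(1) sub] piece[OF ab(1,3,2)] by (simp add: \<rho>_def path_between_def)
      qed (rule d(1))
    qed simp
    moreover have "piece 0 1 = f" by (simp add: piece_def)
    moreover have "\<rho> 0 = x0" "\<rho> 1 = x0" using f by (simp_all add: \<rho>_def path_between_def lift_def)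
    ultimately show "g \<in> K" using tied_class_loop[OF f] g by simp
  qed
qed

end

section \<open>Homomorphisms out of the fundamental group\<close>

text \<open>Given elements satisfying the surface relation, the patches receive locally constant labels on
  the polygon that change by the element \<open>side k\<close> when one passes from side
  \<open>k\<close> to its partner. Ratios of two labels are then well defined on the surface.\<close>

locale polygon_labelling = polygon_surface n X q x0 + group H
  for n :: nat and X :: "'a topology" and q x0 and H :: "('h, 'm) monoid_scheme" (structure) +
  fixes a b :: "nat \<Rightarrow> 'h"
  assumes ab_closed: "\<And>j. j < n \<Longrightarrow> a j \<in> carrier H" "\<And>j. j < n \<Longrightarrow> b j \<in> carrier H"
    and word: "surface_word H a b n = \<one>"
begin

abbreviation w where "w \<equiv> surface_word H a b"

definition side :: "nat \<Rightarrow> 'h" where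
  "side k = (if k mod 4 = 0 then a (k div 4) else inv (b (k div 4)))"

text \<open>The values follow the passage through the corners of a handle in the order 0, 3, 2, 1; that they
  close up after the last handle is the surface relation.\<close>

definition corner_label :: "nat \<Rightarrow> 'h" where
  "corner_label i = (let j = i div 4 in
     if i mod 4 = 0 then w j else if i mod 4 = 1 then w j \<otimes> a j \<otimes> b j \<otimes> inv (a j)
     else if i mod 4 = 2 then w j \<otimes> a j \<otimes> b j else w j \<otimes> a j)"

text \<open>In the patch of a pair of sides, the centre on the first side is labelled by 1 and hence that on
  its partner by the element of the pair.\<close>

definition mark :: "nat \<Rightarrow> real \<Rightarrow> 'h" where
  "mark i c = (if i = 1 then corner_label (nat (\<lfloor>c\<rfloor> mod (4 * int n)))
     else if \<exists>j::int. c = real (i - 2) + 1/2 + of_int j * per then \<one> else side (i - 2))"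

definition lam :: "nat \<Rightarrow> complex \<Rightarrow> 'h" where
  "lam i z = (if i = 0 then \<one> else mark i (centre (centres i) z))"

definition lab :: "nat \<Rightarrow> 'a \<Rightarrow> 'h" where
  "lab i \<xi> = lam i (lift \<xi>)"

lemma w_closed: "j \<le> n \<Longrightarrow> w j \<in> carrier H"
  by (induction j) (simp_all add: ab_closed)

lemma side_closed: "k < 4 * n \<Longrightarrow> side k \<in> carrier H"
proof -
  assume "k < 4 * n"
  then have "k div 4 < n" by presburger
  then show ?thesis unfolding side_def using ab_closed by simp
qed

lemma corner_label_closed: "i < 4 * n \<Longrightarrow> corner_label i \<in> carrier H"
proof -
  assume "i < 4 * n"
  then have "i div 4 < n" by presburger
  then show ?thesis unfolding corner_label_def Let_def using ab_closed w_closed by simp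
qed

lemma nat_mod_less: "nat (l mod (4 * int n)) < 4 * n"
proof -
  have n4: "0 < 4 * int n" using n_pos by simp
  show ?thesis using pos_mod_bound[OF n4, of l] pos_mod_sign[OF n4, of l] by (simp add: nat_less_iff)
qed

lemma mark_closed:
  assumes "i \<in> charts" "i \<noteq> 0" shows "mark i c \<in> carrier H"
proof (cases "i = 1")
  case True then show ?thesis using corner_label_closed[OF nat_mod_less] by (simp add: mark_def)
next
  case False
  then obtain k where "i = k + 2" "k < 4 * n" using assms by (auto simp: charts_def)
  then show ?thesis using side_closed by (simp add: mark_def)
qed

lemma mark_periodic: "mark i (c + of_int j * per) = mark i c"
proof -
  have "c + of_int j * per = c + of_int (j * (4 * int n))" by simp
  then have "\<lfloor>c + of_int j * per\<rfloor> = \<lfloor>c\<rfloor> + j * (4 * int n)" by (simp only: floor_add_int)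
  then have 1: "\<lfloor>c + of_int j * per\<rfloor> mod (4 * int n) = \<lfloor>c\<rfloor> mod (4 * int n)" by (simp only: mod_mult_self1)
  have "(\<exists>i. c + of_int j * per = e + of_int i * per) \<longleftrightarrow> (\<exists>i. c = e + of_int i * per)" for e
  proof
    assume "\<exists>i. c + of_int j * per = e + of_int i * per"
    then obtain i where "c + of_int j * per = e + of_int i * per" by blast
    then have "c = e + of_int (i - j) * per" by (simp add: algebra_simps)
    then show "\<exists>i. c = e + of_int i * per" by blast
  next
    assume "\<exists>i. c = e + of_int i * per"
    then obtain i where "c = e + of_int i * per" by blast
    then have "c + of_int j * per = e + of_int (i + j) * per" by (simp add: algebra_simps)
    then show "\<exists>i. c + of_int j * per = e + of_int i * per" by blast
  qed
  then show ?thesis unfolding mark_def 1 by (simp only:)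
qed

lemma lam_sector:
  assumes i: "i \<in> charts" "i \<noteq> 0" and c: "c \<in> centres i" "z \<in> sector c"
  shows "lam i z = mark i c"
proof -
  have "z \<in> region (centres i)" using c unfolding region_def by (rule UN_I)
  from centre[OF this] obtain j :: int where "centre (centres i) z = c + of_int j * per"
    using same_centre[OF chart_centres[OF i] c] by blast
  then show ?thesis using i(2) by (simp only: lam_def if_False mark_periodic)
qed

lemma lam_closed: "i \<in> charts \<Longrightarrow> lam i z \<in> carrier H"
  using mark_closed by (simp add: lam_def)

lemma cancel: "x \<in> carrier H \<Longrightarrow> y \<in> carrier H \<Longrightarrow> x \<otimes> y \<otimes> inv y = x"
  "x \<in> carrier H \<Longrightarrow> y \<in> carrier H \<Longrightarrow> x \<otimes> inv y \<otimes> y = x"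
  by (simp_all add: m_assoc)

lemma cancel_left: "x \<in> carrier H \<Longrightarrow> y \<in> carrier H \<Longrightarrow> x \<otimes> (inv x \<otimes> y) = y"
  by (simp add: m_assoc[symmetric])

lemma corner_label_pair:
  assumes k: "k < 4 * n" "k mod 4 < 2"
  shows "corner_label ((k + 3) mod (4 * n)) = corner_label k \<otimes> side k"
    "corner_label (k + 2) = corner_label (k + 1) \<otimes> side k"
proof -
  define j where "j = k div 4"
  have j: "j < n" using k unfolding j_def by presburger
  have cl: "w j \<in> carrier H" "a j \<in> carrier H" "b j \<in> carrier H" using w_closed ab_closed j by simp_all
  have k01: "k = 4 * j \<or> k = 4 * j + 1" using k(2) unfolding j_def by presburger
  have l: "corner_label (4 * j) = w j" "corner_label (4 * j + 1) = w j \<otimes> a j \<otimes> b j \<otimes> inv (a j)"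
     "corner_label (4 * j + 2) = w j \<otimes> a j \<otimes> b j" "corner_label (4 * j + 3) = w j \<otimes> a j"
  proof -
    have d: "4 * j div 4 = j" "4 * j mod 4 = 0" "(4 * j + 1) div 4 = j" "(4 * j + 1) mod 4 = 1"
      "(4 * j + 2) div 4 = j" "(4 * j + 2) mod 4 = 2" "(4 * j + 3) div 4 = j" "(4 * j + 3) mod 4 = 3" by presburger+
    show "corner_label (4 * j) = w j" "corner_label (4 * j + 1) = w j \<otimes> a j \<otimes> b j \<otimes> inv (a j)"
     "corner_label (4 * j + 2) = w j \<otimes> a j \<otimes> b j" "corner_label (4 * j + 3) = w j \<otimes> a j"
      unfolding corner_label_def Let_def d by simp_all
  qed
  have s: "side (4 * j) = a j" "side (4 * j + 1) = inv (b j)"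
  proof -
    have d: "4 * j div 4 = j" "4 * j mod 4 = 0" "(4 * j + 1) div 4 = j" "(4 * j + 1) mod 4 = 1" by presburger+
    show "side (4 * j) = a j" "side (4 * j + 1) = inv (b j)" unfolding side_def d by simp_all
  qed
  show "corner_label (k + 2) = corner_label (k + 1) \<otimes> side k"
    using k01
  proof
    assume k: "k = 4 * j"
    show ?thesis unfolding k s l using cl by (simp add: cancel)
  next
    assume k: "k = 4 * j + 1"
    have e: "4 * j + 1 + 2 = 4 * j + 3" "4 * j + 1 + 1 = 4 * j + 2" by simp_all
    show ?thesis unfolding k e s l using cl by (simp add: cancel)
  qed
  show "corner_label ((k + 3) mod (4 * n)) = corner_label k \<otimes> side k"
    using k01
  proof
    assume k: "k = 4 * j"
    have e: "(4 * j + 3) mod (4 * n) = 4 * j + 3" using j by (intro mod_less) simp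
    show ?thesis unfolding k e s l ..
  next
    assume k: "k = 4 * j + 1"
    have "corner_label ((4 * j + 1 + 3) mod (4 * n)) = w (Suc j)"
    proof (cases "Suc j = n")
      case True
      then have "(4 * j + 1 + 3) mod (4 * n) = 0" by (simp add: True[symmetric])
      moreover have "corner_label 0 = \<one>" by (simp add: corner_label_def)
      ultimately show ?thesis using word True by simp
    next
      case False
      then have "(4 * j + 1 + 3) mod (4 * n) = 4 * Suc j" using j by (subst mod_less) simp_all
      moreover have "corner_label (4 * Suc j) = w (Suc j)"
      proof -
        have d: "4 * Suc j div 4 = Suc j" "4 * Suc j mod 4 = 0" by presburger+
        show ?thesis unfolding corner_label_def Let_def d by simp
      qed
      ultimately show ?thesis by (simp only:)
    qed
    also have "w (Suc j) = w j \<otimes> a j \<otimes> b j \<otimes> inv (a j) \<otimes> inv (b j)" using cl by (simp add: m_assoc)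
    finally show ?thesis unfolding k s l .
  qed
qed

lemma mark_pair:
  assumes i: "i \<in> charts" "i \<noteq> 0" and k: "k < 4 * n" "k mod 4 < 2"
    and c: "c \<in> centres i" "\<bar>c - (real k + 1/2)\<bar> \<le> 1/2"
  shows "mark i (2 * real k + 3 - c) = mark i c \<otimes> side k"
proof (cases "i = 1")
  case True
  then obtain z :: int where z: "c = of_int z" using c(1) by (auto simp: centres_def elim!: Ints_cases)
  have "real k \<le> of_int z" "of_int z \<le> real k + 1" using c(2) unfolding z by linarith+
  then have "of_int (int k) \<le> (of_int z :: real)" "(of_int z :: real) \<le> of_int (int k + 1)" by simp_all
  then have "int k \<le> z" "z \<le> int k + 1" by (simp_all only: of_int_le_iff)
  then consider "z = int k" | "z = int k + 1" by linarith
  then show ?thesis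
  proof cases
    case 1
    have e: "2 * real k + 3 - c = of_int (int (k + 3))" using 1 z by simp
    have m: "nat (int (k + 3) mod (4 * int n)) = (k + 3) mod (4 * n)"
      by (metis nat_int of_nat_mult of_nat_numeral zmod_int)
    have "nat (int k mod (4 * int n)) = k" using k(1) by simp
    then show ?thesis unfolding e unfolding mark_def True z 1
      using m corner_label_pair(1)[OF k] by (simp only: floor_of_int if_True simp_thms)
  next
    case 2
    have k2: "k + 2 < 4 * n" using k by presburger
    have e: "2 * real k + 3 - c = of_int (int (k + 2))" "c = of_int (int (k + 1))" using 2 z by simp_all
    have "nat (int (k + 2) mod (4 * int n)) = k + 2" "nat (int (k + 1) mod (4 * int n)) = k + 1" using k2 by simp_all
    then show ?thesis unfolding e(1) unfolding mark_def True e(2)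
      using corner_label_pair(2)[OF k] by (simp only: floor_of_int if_True simp_thms)
  qed
next
  case False
  then obtain k' where k': "i = k' + 2" "k' < 4 * n" "k' mod 4 < 2" using i by (auto simp: charts_def)
  have "c \<in> centres (k' + 2)" using c(1) k'(1) by simp
  from edge_centre_near[OF k'(2,3) k this c(2)] have ck: "k' = k" "c = real k + 1/2" by simp_all
  have "2 * real k + 3 - c \<noteq> real k + 1/2 + of_int j * per" for j :: int
  proof
    assume "2 * real k + 3 - c = real k + 1/2 + of_int j * per"
    then have "2 = of_int j * per" unfolding ck(2) by simp
    then have "(of_int 2 :: real) = of_int (4 * (j * int n))" by simp
    then have "2 = 4 * (j * int n)" by (simp only: of_int_eq_iff)
    then show False by presburger
  qed
  then have 1: "mark i (2 * real k + 3 - c) = side k" using k'(1) ck(1) False by (simp add: mark_def)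
  have "c = real k + 1/2 + of_int 0 * per" using ck by simp
  then have "\<exists>j::int. c = real k + 1/2 + of_int j * per" by blast
  then have 2: "mark i c = \<one>" using k'(1) ck(1) False by (simp add: mark_def)
  show ?thesis unfolding 1 2 using side_closed[OF k(1)] by simp
qed

lemma lam_side:
  assumes i: "i \<in> charts" and k: "k < 4 * n" "k mod 4 < 2" "real k \<le> u" "u \<le> real k + 1"
    and x: "pnt 1 u \<in> patch i"
  shows "lam i (pnt 1 (2 * real k + 3 - u)) = lam i (pnt 1 u) \<otimes> side k"
proof (cases "i = 0")
  case True
  then show ?thesis using x by (simp add: patch_def)
next
  case False
  then have "pnt 1 u \<in> region (centres i) \<or> pnt 1 (2 * real k + 3 - u) \<in> region (centres i)" using x by (simp add: patch_def)
  then show ?thesis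
  proof (rule pair_centre[OF chart_centres[OF i False] k])
    fix c assume c: "c \<in> centres i" "\<bar>u - c\<bar> < 1/2" "\<bar>c - (real k + 1/2)\<bar> \<le> 1/2" "2 * real k + 3 - c \<in> centres i"
      "pnt 1 u \<in> sector c" "pnt 1 (2 * real k + 3 - u) \<in> sector (2 * real k + 3 - c)"
    show ?thesis unfolding lam_sector[OF i False c(1,5)] lam_sector[OF i False c(4,6)]
      by (rule mark_pair[OF i False k(1,2) c(1,3)])
  qed
qed

text \<open>Both labels are multiplied by the same element on the right when a point is replaced by one that
  it is glued to.\<close>

lemma lam_ratio:
  assumes ij: "i \<in> charts" "j \<in> charts" and xy: "x \<in> D" "y \<in> D" "q x = q y" and x: "x \<in> patch i" "x \<in> patch j"
  shows "lam i x \<otimes> inv (lam j x) = lam i y \<otimes> inv (lam j y)"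
proof -
  define f where "f x = (if x \<in> patch i \<and> x \<in> patch j then Some (lam i x \<otimes> inv (lam j x)) else None)" for x
  have "f x = f y"
  proof (rule q_invariant[OF _ xy])
    fix x y assume p: "side_pairing n x y"
    show "f x = f y"
    proof (rule side_pairingE[OF p])
      fix k u assume k: "k < 4 * n" "k mod 4 < 2" "real k \<le> u" "u \<le> real k + 1" and x: "x = pnt 1 u" and y: "y = pnt 1 (2 * real k + 3 - u)"
      show "f x = f y"
      proof (cases "x \<in> patch i \<and> x \<in> patch j")
        case True
        then have s: "lam i y = lam i x \<otimes> side k" "lam j y = lam j x \<otimes> side k"
          using lam_side[OF ij(1) k] lam_side[OF ij(2) k] unfolding x y by blast+
        have cl: "lam i x \<in> carrier H" "lam j x \<in> carrier H" "side k \<in> carrier H" using lam_closed ij side_closed k(1) by simp_all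
        have "lam i y \<otimes> inv (lam j y) = lam i x \<otimes> side k \<otimes> inv (side k) \<otimes> inv (lam j x)"
          unfolding s using cl by (simp add: inv_mult_group m_assoc cancel_left)
        then have "lam i y \<otimes> inv (lam j y) = lam i x \<otimes> inv (lam j x)" using cl by (simp add: cancel)
        then show ?thesis using True patch_pairing(1)[OF ij(1) p] patch_pairing(1)[OF ij(2) p] by (simp add: f_def)
      next
        case False
        then show ?thesis using patch_pairing(1)[OF ij(1) p] patch_pairing(1)[OF ij(2) p] unfolding f_def by argo
      qed
    qed
  qed
  moreover have "y \<in> patch i" "y \<in> patch j" using patch_saturated[OF ij(1) xy] patch_saturated[OF ij(2) xy] x by simp_all
  ultimately show ?thesis using x by (simp add: f_def)
qed

lemma open_lam:
  assumes i: "i \<in> charts" shows "open {z \<in> patch i. lam i z = g}"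
proof (cases "i = 0")
  case True
  then show ?thesis by (cases "g = \<one>") (simp_all add: lam_def open_patch)
next
  case False
  have "{z \<in> patch i. lam i z = g} = (\<Union>c\<in>{c \<in> centres i. mark i c = g}. sector c)"
  proof (intro subset_antisym subsetI)
    fix z assume "z \<in> {z \<in> patch i. lam i z = g}"
    then obtain c where c: "c \<in> centres i" "z \<in> sector c" "lam i z = g" using False unfolding patch_def region_def by auto
    then show "z \<in> (\<Union>c\<in>{c \<in> centres i. mark i c = g}. sector c)" using lam_sector[OF i False c(1,2)] by auto
  next
    fix z assume "z \<in> (\<Union>c\<in>{c \<in> centres i. mark i c = g}. sector c)"
    then obtain c where c: "c \<in> centres i" "mark i c = g" "z \<in> sector c" by blast
    then show "z \<in> {z \<in> patch i. lam i z = g}" using lam_sector[OF i False c(1,3)] patch_sectorI[OF False c(1,3)] by simp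
  qed
  then show ?thesis using open_sector by auto
qed

sublocale labels: local_system H X charts U lab
proof
  show "openin X (U i)" if "i \<in> charts" for i by (rule openin_U[OF that])
  show "topspace X \<subseteq> (\<Union>i\<in>charts. U i)" by (rule U_cover)
  show "lab i \<xi> \<in> carrier H" if "i \<in> charts" for i \<xi> unfolding lab_def by (rule lam_closed[OF that])
  fix i j \<xi> assume ij: "i \<in> charts" "j \<in> charts" and \<xi>: "\<xi> \<in> U i" "\<xi> \<in> U j"
  define s where "s = lab i \<xi> \<otimes> inv (lab j \<xi>)"
  define Q where "Q = (\<Union>p\<in>{p. fst p \<otimes> inv (snd p) = s}. {z \<in> patch i. lam i z = fst p} \<inter> {z \<in> patch j. lam j z = snd p})"
  have Q: "z \<in> Q \<longleftrightarrow> z \<in> patch i \<and> z \<in> patch j \<and> lam i z \<otimes> inv (lam j z) = s" for z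
    unfolding Q_def by auto
  have oQ: "open Q" unfolding Q_def by (intro open_UN ballI open_Int open_lam ij)
  have op: "openin X (q ` (Q \<inter> D))"
  proof (rule openin_image[OF oQ])
    fix x y assume xy: "x \<in> D" "y \<in> D" "q x = q y" and x: "x \<in> Q"
    then have xi: "x \<in> patch i" "x \<in> patch j" "lam i x \<otimes> inv (lam j x) = s" using Q[of x] by simp_all
    have "y \<in> patch i" "y \<in> patch j" using patch_saturated[OF ij(1) xy] patch_saturated[OF ij(2) xy] xi by simp_all
    then show "y \<in> Q" using lam_ratio[OF ij xy xi(1,2)] xi(3) Q[of y] by simp
  qed
  have top: "\<xi> \<in> topspace X" using \<xi>(1) U_topspace by (rule rev_subsetD)
  have in_V: "\<xi> \<in> q ` (Q \<inter> D)"
  proof (rule image_eqI[of _ _ "lift \<xi>"])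
    show "\<xi> = q (lift \<xi>)" using lift(2)[OF top] by simp
    have "lift \<xi> \<in> Q" using Q[of "lift \<xi>"] lift_patch[OF ij(1) \<xi>(1)] lift_patch[OF ij(2) \<xi>(2)] by (simp add: s_def lab_def)
    then show "lift \<xi> \<in> Q \<inter> D" using lift(1)[OF top] by simp
  qed
  have V: "\<eta> \<in> U i \<and> \<eta> \<in> U j \<and> lab i \<eta> \<otimes> inv (lab j \<eta>) = s" if \<eta>: "\<eta> \<in> q ` (Q \<inter> D)" for \<eta>
  proof -
    obtain x where x: "x \<in> Q" "x \<in> D" "\<eta> = q x" using \<eta> by auto
    then have xi: "x \<in> patch i" "x \<in> patch j" "lam i x \<otimes> inv (lam j x) = s" using Q[of x] by simp_all
    have U: "\<eta> \<in> U i" "\<eta> \<in> U j" unfolding U_def x(3) using xi x(2) by simp_all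
    note l = lift[OF subsetD[OF U_topspace U(1)]]
    have "q x = q (lift \<eta>)" using l(2) x(3) by simp
    from lam_ratio[OF ij x(2) l(1) this xi(1,2)] show ?thesis using xi(3) U by (simp add: lab_def)
  qed
  show "\<exists>V. openin X V \<and> \<xi> \<in> V \<and> V \<subseteq> U i \<inter> U j \<and> (\<forall>y\<in>V. lab i y \<otimes> inv (lab j y) = lab i \<xi> \<otimes> inv (lab j \<xi>))"
  proof (intro exI conjI)
    show "openin X (q ` (Q \<inter> D))" by (rule op)
    show "\<xi> \<in> q ` (Q \<inter> D)" by (rule in_V)
    show "q ` (Q \<inter> D) \<subseteq> U i \<inter> U j" using V by (intro subsetI IntI) simp_all
    show "\<forall>y\<in>q ` (Q \<inter> D). lab i y \<otimes> inv (lab j y) = lab i \<xi> \<otimes> inv (lab j \<xi>)"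
      unfolding s_def[symmetric] using V by (intro ballI) simp
  qed
qed

text \<open>Along the image of a path in the polygon that starts at the base point, parallel transport has
  this value. It would be trivial if the preimages chosen by \<open>lift\<close> were the points
  of the path itself; in general it records the change of label from a point to the chosen
  preimage of its image.\<close>

definition defect :: "complex \<Rightarrow> 'h" where
  "defect z = (let i = (SOME i. i \<in> charts \<and> z \<in> patch i) in inv (lam i z) \<otimes> lam i (lift (q z)))"

lemma defect:
  assumes z: "z \<in> D" and i: "i \<in> charts" "z \<in> patch i"
  shows "defect z = inv (lam i z) \<otimes> lam i (lift (q z))"
proof -
  define j where "j = (SOME i. i \<in> charts \<and> z \<in> patch i)"
  have j: "j \<in> charts" "z \<in> patch j" using someI[of "\<lambda>i. i \<in> charts \<and> z \<in> patch i" i] i unfolding j_def by simp_all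
  note l = lift[OF q_topspace[OF z]]
  let ?y = "lift (q z)"
  have r: "lam i z \<otimes> inv (lam j z) = lam i ?y \<otimes> inv (lam j ?y)"
    by (rule lam_ratio[OF i(1) j(1) z l(1) l(2)[symmetric] i(2) j(2)])
  have cl: "lam i z \<in> carrier H" "lam j z \<in> carrier H" "lam i ?y \<in> carrier H" "lam j ?y \<in> carrier H"
    using lam_closed i(1) j(1) by simp_all
  have "inv (lam i z) \<otimes> lam i ?y = inv (lam i z) \<otimes> (lam i ?y \<otimes> inv (lam j ?y)) \<otimes> lam j ?y"
    using cl by (simp add: m_assoc)
  also have "\<dots> = inv (lam i z) \<otimes> (lam i z \<otimes> inv (lam j z)) \<otimes> lam j ?y" by (simp only: r)
  also have "\<dots> = inv (lam j z) \<otimes> lam j ?y" using cl by (simp add: m_assoc[symmetric])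
  finally show ?thesis unfolding defect_def j_def[symmetric] Let_def ..
qed

lemma transport_defect:
  assumes d: "continuous_on {0..1} \<delta>" "\<delta> ` {0..1} \<subseteq> D"
  shows "labels.transport {0..1} (\<lambda>t. q (\<delta> t)) (\<lambda>t. defect (\<delta> t))"
proof -
  have dD: "\<delta> t \<in> D" if "t \<in> {0..1}" for t using d(2) that by blast
  have cont: "continuous_map (top_of_set {0..1}) X (\<lambda>t. q (\<delta> t))"
    by (rule continuous_map_compose_on[OF q_cont d])
  have closed: "defect (\<delta> t) \<in> carrier H" if t: "t \<in> {0..1}" for t
  proof -
    obtain i where i: "i \<in> charts" "\<delta> t \<in> patch i" using patches_cover[OF dD[OF t]] by blast
    show ?thesis unfolding defect[OF dD[OF t] i] using lam_closed[OF i(1)] by simp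
  qed
  have par: "\<exists>i\<in>charts. labels.parallel_near {0..1} (\<lambda>t. q (\<delta> t)) (\<lambda>t. defect (\<delta> t)) i t" if t: "t \<in> {0..1}" for t
  proof -
    obtain i where i: "i \<in> charts" "\<delta> t \<in> patch i" using patches_cover[OF dD[OF t]] by blast
    define V where "V = {z \<in> patch i. lam i z = lam i (\<delta> t)}"
    have "open V" unfolding V_def by (rule open_lam[OF i(1)])
    then have oV: "openin euclidean V" by (simp only: open_openin)
    have cm: "continuous_map (top_of_set {0..1}) euclidean \<delta>" using d(1) by simp
    have tV: "\<delta> t \<in> V" using i(2) by (simp add: V_def)
    obtain e where e: "e > 0" "\<And>s. s \<in> {0..1} \<Longrightarrow> dist s t < e \<Longrightarrow> \<delta> s \<in> V"
      using continuous_map_nbhd[OF cm oV t tV] by blast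
    have key: "q (\<delta> s) \<in> U i \<and> defect (\<delta> s) \<otimes> inv (lab i (q (\<delta> s))) = inv (lam i (\<delta> t))"
      if s: "s \<in> {0..1}" "dist s t < e" for s
    proof -
      have p: "\<delta> s \<in> patch i" "lam i (\<delta> s) = lam i (\<delta> t)" using e(2)[OF s] by (simp_all add: V_def)
      have "q (\<delta> s) \<in> U i" unfolding U_def using p(1) dD[OF s(1)] by simp
      moreover have "defect (\<delta> s) \<otimes> inv (lab i (q (\<delta> s))) = inv (lam i (\<delta> t))"
        unfolding defect[OF dD[OF s(1)] i(1) p(1)] lab_def p(2) using lam_closed[OF i(1)] by (simp add: cancel)
      ultimately show ?thesis by blast
    qed
    have "dist t t < e" using e(1) by simp
    note kt = key[OF t this]
    have "labels.parallel_near {0..1} (\<lambda>t. q (\<delta> t)) (\<lambda>t. defect (\<delta> t)) i t"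
      unfolding labels.parallel_near_def
    proof (intro exI[of _ e] conjI ballI impI)
      fix s :: real assume "s \<in> {0..1}" "dist s t < e"
      note ks = key[OF this]
      show "q (\<delta> s) \<in> U i" using ks by (rule conjunct1)
      show "defect (\<delta> s) \<otimes> inv (lab i (q (\<delta> s))) = defect (\<delta> t) \<otimes> inv (lab i (q (\<delta> t)))"
        using ks kt by (simp only:)
    qed (rule e(1))
    then show ?thesis using i(1) by (rule rev_bexI[rotated])
  qed
  show ?thesis unfolding labels.transport_def using cont closed par by (intro conjI ballI)
qed

lemma defect_closed: "z \<in> D \<Longrightarrow> defect z \<in> carrier H"
proof -
  assume z: "z \<in> D"
  obtain i where i: "i \<in> charts" "z \<in> patch i" using patches_cover[OF z] by blast
  show ?thesis unfolding defect[OF z i] using lam_closed[OF i(1)] by simp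
qed

lemma holonomy_inside:
  assumes d: "continuous_on {0..1} \<delta>" "\<delta> ` {0..1} \<subseteq> D"
  shows "labels.holonomy (\<lambda>t. q (\<delta> t)) = inv (defect (\<delta> 0)) \<otimes> defect (\<delta> 1)"
proof (rule labels.holonomy_eq)
  have D0: "\<delta> 0 \<in> D" using d(2) by (rule subsetD) simp
  show "labels.transport {0..1} (\<lambda>t. q (\<delta> t)) (\<lambda>t. inv (defect (\<delta> 0)) \<otimes> defect (\<delta> t))"
    by (rule labels.transport_left_mult[OF transport_defect[OF d] inv_closed[OF defect_closed[OF D0]]])
  show "inv (defect (\<delta> 0)) \<otimes> defect (\<delta> 0) = \<one>" by (rule l_inv[OF defect_closed[OF D0]])
qed

lemma defect_x0: "defect x0 = \<one>"
proof -
  have x: "x0 \<in> D" by (rule x0_disc)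
  obtain i where i: "i \<in> charts" "x0 \<in> patch i" using patches_cover[OF x] by blast
  have "lift (q x0) = x0" by (simp add: lift_def)
  then show ?thesis unfolding defect[OF x i] using lam_closed[OF i(1)] by simp
qed

lemma holonomy_tied:
  assumes xy: "x \<in> D" "y \<in> D" "q x = q y"
  shows "labels.holonomy (tied x (\<lambda>_. q x) y) = defect x \<otimes> inv (defect y)"
proof -
  have cl: "defect x \<in> carrier H" "defect y \<in> carrier H" using defect_closed xy by simp_all
  have "labels.holonomy (\<lambda>t. q (linepath x0 x t)) = inv (defect (linepath x0 x 0)) \<otimes> defect (linepath x0 x 1)"
    by (rule holonomy_inside[OF continuous_on_linepath linepath_S[OF xy(1)]])
  then have 1: "labels.holonomy (spoke x) = defect x"
    unfolding spoke_def linepath_0' linepath_1' defect_x0 using cl by simp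
  have "labels.holonomy (\<lambda>t. q ((\<lambda>_::real. x) t)) = inv (defect x) \<otimes> defect x"
    by (rule holonomy_inside) (use xy(1) in auto)
  then have 2: "labels.holonomy (\<lambda>_. q x) = \<one>" using cl by simp
  have "labels.holonomy (\<lambda>t. q (linepath y x0 t)) = inv (defect (linepath y x0 0)) \<otimes> defect (linepath y x0 1)"
    by (rule holonomy_inside[OF continuous_on_linepath])
      (use closed_segment_subset[OF xy(2) x0_disc S_convex] in \<open>simp add: linepath_image_01\<close>)
  moreover have "path_rev (spoke y) = (\<lambda>t. q (linepath y x0 t))"
    by (simp add: path_rev_def spoke_def linepath_def fun_eq_iff add.commute)
  ultimately have 3: "labels.holonomy (path_rev (spoke y)) = inv (defect y)"
    unfolding linepath_0' linepath_1' defect_x0 using cl by simp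
  note px = path_between_spoke[OF xy(1)] and py = path_between_rev[OF path_between_spoke[OF xy(2)]]
  note pc = const_path[OF xy(1,3)]
  have "labels.holonomy (tied x (\<lambda>_. q x) y) = labels.holonomy (spoke x) \<otimes> (labels.holonomy (\<lambda>_. q x) \<otimes> labels.holonomy (path_rev (spoke y)))"
    unfolding tied_def
    by (simp only: labels.holonomy_join[OF px path_between_join[OF pc py]] labels.holonomy_join[OF pc py])
  then show ?thesis unfolding 1 2 3 using cl by simp
qed

lemma defect_side:
  assumes k: "k < 4 * n" "k mod 4 < 2" and u: "real k \<le> u" "u \<le> real k + 1"
  shows "defect (pnt 1 u) \<otimes> inv (defect (pnt 1 (2 * real k + 3 - u))) = side k"
proof -
  let ?x = "pnt 1 u" and ?y = "pnt 1 (2 * real k + 3 - u)"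
  have x: "?x \<in> D" and y: "?y \<in> D" and qq: "q ?x = q ?y" using q_glue[OF k u] by simp_all
  obtain i where i: "i \<in> charts" "?x \<in> patch i" using patches_cover[OF x] by blast
  have iy: "?y \<in> patch i" using patch_saturated[OF i(1) x y qq] i(2) by simp
  have s: "lam i ?y = lam i ?x \<otimes> side k" by (rule lam_side[OF i(1) k u i(2)])
  have cl: "lam i z \<in> carrier H" "side k \<in> carrier H" for z using lam_closed[OF i(1)] side_closed[OF k(1)] by simp_all
  have "defect ?x \<otimes> inv (defect ?y) = inv (lam i ?x) \<otimes> (lam i (lift (q ?y)) \<otimes> inv (lam i (lift (q ?y)))) \<otimes> (lam i ?x \<otimes> side k)"
    unfolding defect[OF x i] defect[OF y i(1) iy] qq s using cl by (simp add: inv_mult_group m_assoc cancel_left)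
  also have "\<dots> = side k" using cl by (simp add: m_assoc[symmetric])
  finally show ?thesis .
qed

theorem labelling_hom: "\<exists>h\<in>hom G H. \<forall>j<n. h (A j) = a j \<and> h (B j) = b j"
proof (rule labels.holonomy_hom[of base])
  fix h assume h: "h \<in> hom G H" and hol: "\<And>f. f \<in> loops_at X base \<Longrightarrow> h (loop_class X base f) = labels.holonomy f"
  interpret hh: group_hom G H h
    using h group_G group_axioms by (intro group_hom.intro group_hom_axioms.intro)
  have jump: "h (jump (pnt 1 u) (pnt 1 (2 * real k + 3 - u))) = side k"
    if k: "k < 4 * n" "k mod 4 < 2" and u: "real k \<le> u" "u \<le> real k + 1" for k u
  proof -
    have D: "pnt 1 u \<in> D" "pnt 1 (2 * real k + 3 - u) \<in> D" by simp_all
    note qq = q_glue[OF k u]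
    have "tied (pnt 1 u) (\<lambda>_. q (pnt 1 u)) (pnt 1 (2 * real k + 3 - u)) \<in> loops_at X base"
      using tied_loop[OF D const_path[OF D(1) qq]] by (simp only: loops_at_eq mem_Collect_eq)
    from hol[OF this] show ?thesis
      unfolding jump_def tied_class_def holonomy_tied[OF D qq] defect_side[OF k u] .
  qed
  have "h (A j) = a j \<and> h (B j) = b j" if j: "j < n" for j
  proof -
    have k: "4 * j < 4 * n" "4 * j mod 4 < 2" "4 * j + 1 < 4 * n" "(4 * j + 1) mod 4 < 2" using j by presburger+
    have s: "side (4 * j) = a j" "side (4 * j + 1) = inv (b j)"
    proof -
      have d: "4 * j div 4 = j" "4 * j mod 4 = 0" "(4 * j + 1) div 4 = j" "(4 * j + 1) mod 4 = 1" by presburger+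
      show "side (4 * j) = a j" "side (4 * j + 1) = inv (b j)" unfolding side_def d by simp_all
    qed
    have e: "2 * real (4 * j) + 3 - real (4 * j) = real (4 * j + 3)"
      "2 * real (4 * j + 1) + 3 - real (4 * j + 1) = real (4 * j + 4)" by simp_all
    have "h (A j) = a j" using jump[OF k(1,2), of "real (4 * j)"] unfolding A_def e s by simp
    moreover have "h (B j) = b j"
    proof -
      have c: "jump (corner (4 * j + 1)) (corner (4 * j + 4)) \<in> carrier G"
        by (rule jump_closed[OF pnt_circle pnt_circle glue_corners(3)[OF j]])
      have "h (jump (corner (4 * j + 1)) (corner (4 * j + 4))) = inv (b j)"
        using jump[OF k(3,4), of "real (4 * j + 1)"] unfolding e s by simp
      then show ?thesis unfolding B_def hh.hom_inv[OF c] using ab_closed(2)[OF j] by simp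
    qed
    ultimately show ?thesis by blast
  qed
  then show ?thesis using h by blast
qed

end

lemma (in polygon_surface) surface_presentation_fundamental_group:
  assumes n: "n = Suc m" and m: "0 < m"
  shows "surface_presentation G A B m"
proof (intro surface_presentation.intro surface_presentation_axioms.intro)
  show "group G" by (rule group_G)
  show "0 < m" by (rule m)
  show "A j \<in> carrier G" "B j \<in> carrier G" if "j < Suc m" for j using side_jumps(4,5)[of j] that n by simp_all
  show "carrier G = generate G (A ` {..<Suc m} \<union> B ` {..<Suc m})"
    using generated_by_sides[unfolded K_def] unfolding n .
  show "surface_word G A B (Suc m) = \<one>\<^bsub>G\<^esub>" using surface_relation unfolding n .
  fix a b :: "nat \<Rightarrow> rat \<Rightarrow> rat"
  assume ab: "\<And>j. j < Suc m \<Longrightarrow> a j \<in> order_aut \<and> b j \<in> order_aut" and word: "cword a b (Suc m) = id"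
  have "polygon_labelling n X q x0 Aut_rat a b"
  proof (intro polygon_labelling.intro polygon_labelling_axioms.intro)
    show "polygon_surface n X q x0" by (rule polygon_surface_axioms)
    show "group Aut_rat" by (rule group_Aut_rat)
    show "a j \<in> carrier Aut_rat" "b j \<in> carrier Aut_rat" if "j < n" for j
      using ab[of j] that n by (simp_all add: Aut_rat_def)
    show "surface_word Aut_rat a b n = \<one>\<^bsub>Aut_rat\<^esub>"
      using surface_word_Aut_rat[of n a b] ab word n by (simp add: Aut_rat_def)
  qed
  from polygon_labelling.labelling_hom[OF this]
  show "\<exists>h\<in>hom G Aut_rat. \<forall>j<Suc m. h (A j) = a j \<and> h (B j) = b j" unfolding n .
qed

section \<open>Dense orbits for surface groups\<close>

theorem theorem1p6:
  fixes \<Sigma> :: "'a topology" and n :: nat and p :: 'a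
  assumes "closed_orientable_surface n \<Sigma>" and "n \<ge> 2" and "p \<in> topspace \<Sigma>"
  shows "\<exists>r \<in> left_orders (fundamental_group \<Sigma> p).
           left_order_topology (fundamental_group \<Sigma> p) closure_of
             conj_orbit (fundamental_group \<Sigma> p) r
           = topspace (left_order_topology (fundamental_group \<Sigma> p))"
proof -
  obtain q where q: "quotient_map (top_of_set (cball (0::complex) 1)) \<Sigma> q"
    and fib: "\<And>x y. x \<in> cball 0 1 \<Longrightarrow> y \<in> cball 0 1 \<Longrightarrow> q x = q y \<longleftrightarrow> equivclp (side_pairing n) x y"
    using assms(1) unfolding closed_orientable_surface_def by blast
  have "topspace \<Sigma> = q ` cball 0 1" using quotient_imp_surjective_map[OF q] by simp
  then obtain x0 where x0: "x0 \<in> cball 0 1" "q x0 = p" using assms(3) by auto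
  have surface: "polygon_surface n \<Sigma> q x0"
    by (rule polygon_surface.intro[OF _ q fib x0(1)]) (use assms(2) in simp_all)
  have m: "n = Suc (n - 1)" "0 < n - 1" using assms(2) by simp_all
  from polygon_surface.surface_presentation_fundamental_group[OF surface m]
  show ?thesis unfolding x0(2) by (rule surface_presentation.dense_orbit_exists)
qed

end
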